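(* Let $(\Omega,\mathcal{A},P)$ be a probability space with a filtration $\mathcal{G}=(\mathcal{G}_n)_{n\ge0}$ and let $(X_n)_{n\ge1}$ be a $\mathcal{G}$-c.i.d. sequence of real random variables. For $n\ge1$ and $t\in\mathbb{R}$ let $$C_{n,t}=\frac{1}{\sqrt n}\Bigl(\sum_{k=1}^nI_{\{X_k\le t\}}-nE[I_{\{X_{n+1}\le t\}}\mid\mathcal{G}_n]\Bigr),$$ and regard $C_n=\{C_{n,t}:t\in\mathbb{R}\}$ as a process with paths in $\mathcal{X}$. Suppose that $\sup_nE[C_{n,t}^2]<\infty$ for all $t\in\mathbb{R}$ and that for all $\varepsilon,\eta>0$ there is a finite partition $I_1,\dots,I_m$ of $\mathbb{R}$ by right-open intervals such that $$\limsup_nP\Bigl(\max_k\sup_{s,t\in I_k}|C_{n,s}-C_{n,t}|>\varepsilon\Bigr)<\eta .$$ (a) If $$\frac1n\sum_{k=1}^nk^2\bigl(E[I_{\{X_{k+1}\le t\}}\mid\mathcal{G}_k]-E[I_{\{X_k\le t\}}\mid\mathcal{G}_{k-1}]\bigr)^2\to0\quad\text{in probability, for all }t\in\mathbb{R},$$ then $C_n\to\mathbb{G}^F$ in distribution (in $\mathcal{X}$ under uniform distance) and $\mathbb{G}^F$ is tight. (b) Moreover, let $q_k(t)=I_{\{X_k\le t\}}-kE[I_{\{X_{k+1}\le t\}}\mid\mathcal{G}_k]+(k-1)E[I_{\{X_k\le t\}}\mid\mathcal{G}_{k-1}]$ for $t\in\mathbb{R}$. If $$\frac1n\sum_{k=1}^nq_k(s)q_k(t)\to\sigma(s,t)\quad\text{a.s.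 for all }s,t\in\mathbb{R}$$ (for some real random variables $\sigma(s,t)$), then $C_n\to C$ in distribution, where $C$ is a tight process whose distribution $\nu$ is given by $$\nu\{x\in\mathcal{X}:(x(t_1),\dots,x(t_r))\in A\}=\int\mathcal{N}(0,\Sigma(t_1,\dots,t_r))(A)\,dP$$ for all $t_1,\dots,t_r\in\mathbb{R}$ and $A\in\mathcal{B}(\mathbb{R}^r)$, with $\Sigma(t_1,\dots,t_r)=(\sigma(t_i,t_j))_{1\le i,j\le r}$.
   Context: $(X_n)_{n\ge1}$ is $\mathcal{G}$-c.i.d. if it is adapted to $\mathcal{G}$ and, for all $k>n\ge0$ and all bounded Borel $f:\mathbb{R}\to\mathbb{R}$, $E[f(X_k)\mid\mathcal{G}_n]=E[f(X_{n+1})\mid\mathcal{G}_n]$ a.s. Its directing measure is the (a.s. unique, always existing) random probability measure $\alpha$ on $\mathbb{R}$ such that, for each bounded continuous $f:\mathbb{R}\to\mathbb{R}$, $E[f(X_{n+1})\mid\mathcal{G}_n]\to\int f\,d\alpha$ a.s. $\mathcal{X}$ is the set of real cadlag functions $x$ on $\mathbb{R}$ with $\lim_{|t|\to\infty}x(t)=0$, equipped with uniform distance. Versions of the conditional probabilities are chosen (regular conditional distributions) so that, up to modification on $P$-null sets, the paths of $C_n$ lie in $\mathcal{X}$. Weak convergence is in the Hoffmann-Jørgensen sense. A random element $Z$ of $\mathcal{X}$ (a map from a probability space into $\mathcal{X}$) is measurable if $\{Z\in B\}$ is measurable for all Borel $B\subset\mathcal{X}$; it is tight if it is indistinguishable from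 a measurable random element with a tight probability distribution. If $Z$ is measurable and $Z_n$ are arbitrary random elements of $\mathcal{X}$, $Z_n\to Z$ in distribution means $E^*[f(Z_n)]\to E[f(Z)]$ for all bounded continuous $f:\mathcal{X}\to\mathbb{R}$, with $E^*$ the outer expectation. If $Z$ is not measurable but indistinguishable from a measurable random element $Z'$, then $Z_n\to Z$ in distribution means $Z_n\to Z'$ in distribution. $\mathbb{G}^F$ denotes a process, on some probability space, of the form $\mathbb{G}^F_t=\mathbb{G}^0_{F(t)}$, $t\in\mathbb{R}$, where $\mathbb{G}^0$ is a standard Brownian bridge on $[0,1]$ and $F$ is a random distribution function, independent of $\mathbb{G}^0$, such that $(F(t_1),\dots,F(t_r))$ has the same distribution as $(\alpha(-\infty,t_1],\dots,\alpha(-\infty,t_r])$ for all $t_1,\dots,t_r\in\mathbb{R}$. $\mathcal{N}(0,\Sigma)$ is the (possibly degenerate) centered Gaussian law with covariance matrix $\Sigma$. *)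

theory Defs
  imports "HOL-Probability.Probability"
begin

section \<open>The space of cadlag functions vanishing at infinity\<close>

definition cadlag :: "(real \<Rightarrow> real) \<Rightarrow> bool" where
  "cadlag x \<longleftrightarrow> (\<forall>t. continuous (at_right t) x \<and> (\<exists>l. (x \<longlongrightarrow> l) (at_left t)))"

typedef cadlag0 = "{x. cadlag x \<and> (x \<longlongrightarrow> 0) at_infinity}"
  morphisms path_of Cadlag0
  by (rule exI[of _ "\<lambda>_. 0"]) (auto simp: cadlag_def)

lemma cadlag_locally_bounded:
  assumes "cadlag x"
  shows "\<exists>B U. open U \<and> t \<in> U \<and> (\<forall>s\<in>U. \<bar>x s\<bar> \<le> (B::real))"
proof -
  obtain l where l: "(x \<longlongrightarrow> l) (at_left t)"
    using assms by (auto simp: cadlag_def)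
  have r: "(x \<longlongrightarrow> x t) (at_right t)"
    using assms by (auto simp: cadlag_def continuous_within)
  define B where "B = max (\<bar>l\<bar> + 1) (\<bar>x t\<bar> + 1)"
  have "\<forall>\<^sub>F s in at_left t. \<bar>x s\<bar> < \<bar>l\<bar> + 1"
    by (rule order_tendstoD(2)[OF tendsto_rabs[OF l]]) simp
  then have L: "\<forall>\<^sub>F s in at_left t. \<bar>x s\<bar> \<le> B"
    by (rule eventually_mono) (auto simp: B_def)
  have "\<forall>\<^sub>F s in at_right t. \<bar>x s\<bar> < \<bar>x t\<bar> + 1"
    by (rule order_tendstoD(2)[OF tendsto_rabs[OF r]]) simp
  then have R: "\<forall>\<^sub>F s in at_right t. \<bar>x s\<bar> \<le> B"
    by (rule eventually_mono) (auto simp: B_def)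
  from L R have "\<forall>\<^sub>F s in at t. \<bar>x s\<bar> \<le> B"
    by (simp add: eventually_at_split)
  moreover have "\<bar>x t\<bar> \<le> B" by (auto simp: B_def)
  ultimately have "\<forall>\<^sub>F s in nhds t. \<bar>x s\<bar> \<le> B"
    by (simp add: eventually_nhds_conv_at)
  then show ?thesis unfolding eventually_nhds by blast
qed

lemma bounded_range_path_of: "bounded (range (path_of x))"
proof -
  have cad: "cadlag (path_of x)" and lim: "(path_of x \<longlongrightarrow> 0) at_infinity"
    using path_of[of x] by auto
  have "\<forall>\<^sub>F s in at_infinity. \<bar>path_of x s\<bar> < 1"
    by (rule order_tendstoD(2)[OF tendsto_rabs[OF lim]]) simp
  then obtain b where b: "\<And>s. b \<le> \<bar>s\<bar> \<Longrightarrow> \<bar>path_of x s\<bar> < 1"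
    unfolding eventually_at_infinity by auto
  obtain B U where U: "\<And>t. open (U t)" "\<And>t. t \<in> U t" "\<And>t s. s \<in> U t \<Longrightarrow> \<bar>path_of x s\<bar> \<le> (B t::real)"
    using cadlag_locally_bounded[OF cad] by metis
  have "compact {-b..b}" "{-b..b} \<subseteq> (\<Union>t\<in>{-b..b}. U t)"
    using U(2) by auto
  then obtain T where T: "T \<subseteq> {-b..b}" "finite T" "{-b..b} \<subseteq> (\<Union>t\<in>T. U t)"
    using compactE_image[of "{-b..b}" "{-b..b}" U] U(1) by metis
  have "\<bar>path_of x s\<bar> \<le> 1 + (\<Sum>t\<in>T. \<bar>B t\<bar>)" for s
  proof (cases "s \<in> {-b..b}")
    case True
    then obtain t where t: "t \<in> T" "s \<in> U t" using T(3) by auto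
    have "\<bar>path_of x s\<bar> \<le> \<bar>B t\<bar>" using U(3)[OF t(2)] by linarith
    also have "\<dots> \<le> (\<Sum>t\<in>T. \<bar>B t\<bar>)"
      using t(1) T(2) by (intro member_le_sum) auto
    finally show ?thesis by simp
  next
    case False
    then have "\<bar>path_of x s\<bar> < 1" by (intro b) auto
    moreover have "0 \<le> (\<Sum>t\<in>T. \<bar>B t\<bar>)" by (simp add: sum_nonneg)
    ultimately show ?thesis by linarith
  qed
  then show ?thesis unfolding bounded_iff by auto
qed

instantiation cadlag0 :: metric_space
begin

definition dist_cadlag0 :: "cadlag0 \<Rightarrow> cadlag0 \<Rightarrow> real" where
  "dist_cadlag0 x y = (SUP t. \<bar>path_of x t - path_of y t\<bar>)"

definition uniformity_cadlag0 :: "(cadlag0 \<times> cadlag0) filter" where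
  "uniformity_cadlag0 = (INF e\<in>{0<..}. principal {(x, y). dist x y < e})"

definition open_cadlag0 :: "cadlag0 set \<Rightarrow> bool" where
  "open_cadlag0 S = (\<forall>x\<in>S. \<forall>\<^sub>F (x', y) in uniformity. x' = x \<longrightarrow> y \<in> S)"

lemma abs_path_diff_le_dist: "\<bar>path_of x t - path_of y t\<bar> \<le> dist x y"
proof -
  obtain A where A: "\<And>t. \<bar>path_of x t\<bar> \<le> A" 
    using bounded_range_path_of[of x] by (auto simp: bounded_iff)
  obtain B where B: "\<And>t. \<bar>path_of y t\<bar> \<le> B" 
    using bounded_range_path_of[of y] by (auto simp: bounded_iff)
  have "\<bar>path_of x s - path_of y s\<bar> \<le> A + B" for s
    using A[of s] B[of s] by linarith
  then have "bdd_above (range (\<lambda>t. \<bar>path_of x t - path_of y t\<bar>))" by (intro bdd_aboveI2)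
  then show ?thesis unfolding dist_cadlag0_def by (intro cSUP_upper) auto
qed

lemma dist_cadlag0_le: "(\<And>t. \<bar>path_of x t - path_of y t\<bar> \<le> c) \<Longrightarrow> dist x y \<le> c"
  unfolding dist_cadlag0_def by (intro cSUP_least) auto

instance
proof
  fix x y z :: cadlag0
  show "dist x y = 0 \<longleftrightarrow> x = y"
  proof
    assume "dist x y = 0"
    then have "path_of x t = path_of y t" for t
      using abs_path_diff_le_dist[of x t y] by simp
    then show "x = y" by (simp add: path_of_inject[symmetric] ext)
  qed (simp add: dist_cadlag0_def)
  show "dist x y \<le> dist x z + dist y z"
  proof (rule dist_cadlag0_le)
    fix t show "\<bar>path_of x t - path_of y t\<bar> \<le> dist x z + dist y z"
      using abs_path_diff_le_dist[of x t z] abs_path_diff_le_dist[of y t z] by linarith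
  qed
qed (simp_all add: uniformity_cadlag0_def open_cadlag0_def)

end


section \<open>Weak convergence in the Hoffmann-Joergensen sense\<close>

text \<open>
  A random element of the space \<^typ>\<open>cadlag0\<close> is an arbitrary, possibly non-measurable, map
  into it.
\<close>

definition indistinguishable :: "'w measure \<Rightarrow> ('w \<Rightarrow> cadlag0) \<Rightarrow> ('w \<Rightarrow> cadlag0) \<Rightarrow> bool" where
  "indistinguishable N Z Z' \<longleftrightarrow> (AE \<omega> in N. Z \<omega> = Z' \<omega>)"

definition tight_law :: "'b::metric_space measure \<Rightarrow> bool" where
  "tight_law \<mu> \<longleftrightarrow> (\<forall>\<epsilon>>0. \<exists>K. compact K \<and> measure \<mu> K \<ge> 1 - \<epsilon>)"

definition tight_element :: "'w measure \<Rightarrow> ('w \<Rightarrow> cadlag0) \<Rightarrow> bool" where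
  "tight_element N Z \<longleftrightarrow>
     (\<exists>Z'. Z' \<in> N \<rightarrow>\<^sub>M borel \<and> indistinguishable N Z Z' \<and> tight_law (distr N borel Z'))"

text \<open>
  For bounded \<open>h\<close>, the only case in which it is used, restricting to integrable real majorants does
  not change the outer expectation.
\<close>

definition outer_expectation :: "'w measure \<Rightarrow> ('w \<Rightarrow> real) \<Rightarrow> real" where
  "outer_expectation M h =
     Inf {integral\<^sup>L M U |U. integrable M U \<and> (\<forall>\<omega>\<in>space M. h \<omega> \<le> U \<omega>)}"

definition converges_in_dist ::
    "'w measure \<Rightarrow> (nat \<Rightarrow> 'w \<Rightarrow> cadlag0) \<Rightarrow> 'v measure \<Rightarrow> ('v \<Rightarrow> cadlag0) \<Rightarrow> bool" where
  "converges_in_dist M Zn N Z \<longleftrightarrow>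
     (\<exists>Z'. Z' \<in> N \<rightarrow>\<^sub>M borel \<and> indistinguishable N Z Z' \<and>
        (\<forall>f :: cadlag0 \<Rightarrow> real. continuous_on UNIV f \<and> bounded (range f) \<longrightarrow>
           (\<lambda>n. outer_expectation M (\<lambda>\<omega>. f (Zn n \<omega>))) \<longlonglongrightarrow> (\<integral>\<omega>. f (Z' \<omega>) \<partial>N)))"

definition converges_in_prob_to_0 :: "'w measure \<Rightarrow> (nat \<Rightarrow> 'w \<Rightarrow> real) \<Rightarrow> bool" where
  "converges_in_prob_to_0 M Y \<longleftrightarrow>
     (\<forall>\<epsilon>>0. (\<lambda>n. measure M {\<omega> \<in> space M. \<bar>Y n \<omega>\<bar> > \<epsilon>}) \<longlonglongrightarrow> 0)"


section \<open>Conditionally identically distributed sequences\<close>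

text \<open>The sequence is indexed from 1; \<open>X 0\<close> is never used.\<close>

definition cid :: "'a measure \<Rightarrow> (nat \<Rightarrow> 'a measure) \<Rightarrow> (nat \<Rightarrow> 'a \<Rightarrow> real) \<Rightarrow> bool" where
  "cid M G X \<longleftrightarrow>
     (\<forall>n\<ge>1. X n \<in> borel_measurable (G n)) \<and>
     (\<forall>n k (f :: real \<Rightarrow> real). n < k \<and> f \<in> borel_measurable borel \<and> bounded (range f) \<longrightarrow>
        (AE \<omega> in M. real_cond_exp M (G n) (\<lambda>\<omega>. f (X k \<omega>)) \<omega>
                   = real_cond_exp M (G n) (\<lambda>\<omega>. f (X (n + 1) \<omega>)) \<omega>))"

definition directing_measure ::
    "'a measure \<Rightarrow> (nat \<Rightarrow> 'a measure) \<Rightarrow> (nat \<Rightarrow> 'a \<Rightarrow> real) \<Rightarrow> ('a \<Rightarrow> real measure) \<Rightarrow> bool" where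
  "directing_measure M G X \<alpha> \<longleftrightarrow>
     \<alpha> \<in> M \<rightarrow>\<^sub>M prob_algebra borel \<and>
     (\<forall>f :: real \<Rightarrow> real. continuous_on UNIV f \<and> bounded (range f) \<longrightarrow>
        (AE \<omega> in M. (\<lambda>n. real_cond_exp M (G n) (\<lambda>\<omega>. f (X (n + 1) \<omega>)) \<omega>)
                       \<longlonglongrightarrow> (\<integral>x. f x \<partial>\<alpha> \<omega>)))"

definition regular_cond_distr ::
    "'a measure \<Rightarrow> 'a measure \<Rightarrow> ('a \<Rightarrow> real) \<Rightarrow> ('a \<Rightarrow> real measure) \<Rightarrow> bool" where
  "regular_cond_distr M G Y \<kappa> \<longleftrightarrow>
     \<kappa> \<in> G \<rightarrow>\<^sub>M prob_algebra borel \<and>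
     (\<forall>A\<in>sets borel. AE \<omega> in M.
        measure (\<kappa> \<omega>) A = real_cond_exp M G (\<lambda>\<omega>. indicator A (Y \<omega>)) \<omega>)"

definition cond_cdf ::
    "'a measure \<Rightarrow> (nat \<Rightarrow> 'a measure) \<Rightarrow> (nat \<Rightarrow> 'a \<Rightarrow> real) \<Rightarrow> nat \<Rightarrow> real \<Rightarrow> 'a \<Rightarrow> real" where
  "cond_cdf M G X n t = real_cond_exp M (G n) (\<lambda>\<omega>. indicator {..t} (X (n + 1) \<omega>))"

text \<open>
  \<open>\<kappa> n\<close> is a regular version of the conditional distribution of \<open>X (n + 1)\<close> given \<open>G n\<close>; it
  makes every path of the empirical process an element of \<^typ>\<open>cadlag0\<close>
  (lemma \<open>path_empirical_process\<close> below).
\<close>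

definition empirical_process ::
    "(nat \<Rightarrow> 'a \<Rightarrow> real) \<Rightarrow> (nat \<Rightarrow> 'a \<Rightarrow> real measure) \<Rightarrow> nat \<Rightarrow> 'a \<Rightarrow> cadlag0" where
  "empirical_process X \<kappa> n \<omega> =
     Cadlag0 (\<lambda>t. 1 / sqrt (real n) *
       ((\<Sum>k=1..n. indicator {..t} (X k \<omega>)) - real n * measure (\<kappa> n \<omega>) {..t}))"

lemma right_cont_indicator_atMost:
  fixes a t :: real
  shows "continuous (at_right t) (\<lambda>s. indicator {..s} a :: real)"
proof (cases "a \<le> t")
  case True
  have "\<forall>\<^sub>F s in at_right t. indicator {..s} a = (1::real)"
    using eventually_at_right_less[of t]
    by (rule eventually_mono) (use True in \<open>auto simp: indicator_def\<close>)
  then show ?thesis using True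
    by (auto simp: continuous_within intro!: tendsto_eventually)
next
  case False
  then have "\<forall>\<^sub>F s in at_right t. s < a"
    using eventually_at_right_field by force
  then have "\<forall>\<^sub>F s in at_right t. indicator {..s} a = (0::real)"
    by (rule eventually_mono) (auto simp: indicator_def)
  then show ?thesis using False
    by (auto simp: continuous_within intro!: tendsto_eventually)
qed

lemma mono_left_limit:
  fixes g :: "real \<Rightarrow> real"
  assumes m: "mono g" and b: "\<And>s. g s \<le> c"
  shows "\<exists>l. (g \<longlongrightarrow> l) (at_left t)"
proof
  have bdd: "bdd_above (g ` {..<t})" using b by (intro bdd_aboveI2) auto
  show "(g \<longlongrightarrow> Sup (g ` {..<t})) (at_left t)"
  proof (rule order_tendstoI)
    fix a assume "a < Sup (g ` {..<t})"
    then obtain s where s: "s < t" "a < g s"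
      using less_cSup_iff[of "g ` {..<t}" a] bdd by auto
    have "\<forall>\<^sub>F u in at_left t. u \<in> {s<..<t}"
      using s(1) by (rule eventually_at_left_real)
    then show "\<forall>\<^sub>F u in at_left t. a < g u"
      by eventually_elim (use s m in \<open>auto intro: less_le_trans[OF _ monoD[of g s]]\<close>)
  next
    fix a assume a: "Sup (g ` {..<t}) < a"
    have "\<forall>\<^sub>F u in at_left t. u \<in> {t - 1<..<t}"
      by (rule eventually_at_left_real) simp
    then show "\<forall>\<^sub>F u in at_left t. g u < a"
      by eventually_elim (use a bdd in \<open>auto intro: le_less_trans[OF cSup_upper]\<close>)
  qed
qed

lemma indicator_atMost_tendsto:
  fixes a :: real
  shows "((\<lambda>s. indicator {..s} a :: real) \<longlongrightarrow> 1) at_top"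
    and "((\<lambda>s. indicator {..s} a :: real) \<longlongrightarrow> 0) at_bot"
proof -
  have "\<forall>\<^sub>F s in at_top. indicator {..s} a = (1::real)"
    using eventually_ge_at_top[of a] by eventually_elim (auto simp: indicator_def)
  then show "((\<lambda>s. indicator {..s} a :: real) \<longlongrightarrow> 1) at_top" by (rule tendsto_eventually)
  have "\<forall>\<^sub>F s in at_bot. indicator {..s} a = (0::real)"
    using eventually_le_at_bot[of "a - 1"]
    by (rule eventually_mono) (auto simp: indicator_def)
  then show "((\<lambda>s. indicator {..s} a :: real) \<longlongrightarrow> 0) at_bot" by (rule tendsto_eventually)
qed

lemma path_empirical_process:
  assumes "\<kappa> n \<omega> \<in> space (prob_algebra borel)"
  shows "path_of (empirical_process X \<kappa> n \<omega>) t = 1 / sqrt (real n) *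
           ((\<Sum>k=1..n. indicator {..t} (X k \<omega>)) - real n * measure (\<kappa> n \<omega>) {..t})"
proof -
  interpret real_distribution "\<kappa> n \<omega>"
    using assms by (auto simp: space_prob_algebra real_distribution_def real_distribution_axioms_def)
  define H where "H = cdf (\<kappa> n \<omega>)"
  define g where "g = (\<lambda>t. \<Sum>k=1..n. indicator {..t} (X k \<omega>) :: real)"
  define p where "p = (\<lambda>t. 1 / sqrt (real n) * (g t - real n * H t))"
  have H_rc: "continuous (at_right t) H" for t
    unfolding H_def by (rule cdf_is_right_cont)
  have g_rc: "continuous (at_right t) g" for t
    unfolding g_def by (intro continuous_sum right_cont_indicator_atMost)
  have H_ll: "\<exists>l. (H \<longlongrightarrow> l) (at_left t)" for t
    by (rule mono_left_limit[where c=1]) (auto simp: H_def mono_def cdf_nondecreasing cdf_bounded_prob)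
  have g_ll: "\<exists>l. (g \<longlongrightarrow> l) (at_left t)" for t
  proof (rule mono_left_limit[where c="real n"])
    show "mono g" unfolding g_def mono_def
      by (intro allI impI sum_mono) (auto simp: indicator_def)
    fix s
    have "g s \<le> (\<Sum>k=1..n. 1)" unfolding g_def by (intro sum_mono) (auto simp: indicator_def)
    then show "g s \<le> real n" by simp
  qed
  have "cadlag p" unfolding cadlag_def
  proof (intro allI conjI)
    fix t
    show "continuous (at_right t) p" unfolding p_def
      by (intro continuous_intros g_rc H_rc)
    obtain l1 l2 where "(g \<longlongrightarrow> l1) (at_left t)" "(H \<longlongrightarrow> l2) (at_left t)"
      using g_ll H_ll by blast
    then have "(p \<longlongrightarrow> 1 / sqrt (real n) * (l1 - real n * l2)) (at_left t)"
      unfolding p_def by (intro tendsto_intros)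
    then show "\<exists>l. (p \<longlongrightarrow> l) (at_left t)" by blast
  qed
  moreover have "(p \<longlongrightarrow> 0) at_infinity"
  proof -
    have "(g \<longlongrightarrow> (\<Sum>k=1..n. 1)) at_top" "(g \<longlongrightarrow> (\<Sum>k=1..n. 0)) at_bot"
      unfolding g_def by (intro tendsto_sum indicator_atMost_tendsto)+
    moreover have "(H \<longlongrightarrow> 1) at_top" "(H \<longlongrightarrow> 0) at_bot"
      unfolding H_def using cdf_lim_at_top_prob cdf_lim_at_bot by auto
    ultimately have lims: "(p \<longlongrightarrow> 1 / sqrt (real n) * ((\<Sum>k=1..n. 1) - real n * 1)) at_top"
        "(p \<longlongrightarrow> 1 / sqrt (real n) * ((\<Sum>k=1..n. 0) - real n * 0)) at_bot"
      unfolding p_def by - (intro tendsto_intros; assumption)+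
    from lims show ?thesis by (simp add: at_infinity_eq_at_top_bot filterlim_sup)
  qed
  ultimately have "path_of (Cadlag0 p) = p" by (intro Cadlag0_inverse) auto
  moreover have "empirical_process X \<kappa> n \<omega> = Cadlag0 p"
    unfolding empirical_process_def p_def g_def H_def cdf_def ..
  ultimately show ?thesis unfolding p_def g_def H_def cdf_def by simp
qed

definition q_incr ::
    "'a measure \<Rightarrow> (nat \<Rightarrow> 'a measure) \<Rightarrow> (nat \<Rightarrow> 'a \<Rightarrow> real) \<Rightarrow> nat \<Rightarrow> real \<Rightarrow> 'a \<Rightarrow> real" where
  "q_incr M G X k t \<omega> =
     indicator {..t} (X k \<omega>) - real k * cond_cdf M G X k t \<omega>
       + (real k - 1) * cond_cdf M G X (k - 1) t \<omega>"

text \<open>\<open>[a, b)\<close> with possibly infinite endpoints; nonempty because \<open>a < b\<close>.\<close>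

definition right_open_interval :: "real set \<Rightarrow> bool" where
  "right_open_interval I \<longleftrightarrow> (\<exists>a b :: ereal. a < b \<and> I = {t. a \<le> ereal t \<and> ereal t < b})"


section \<open>Gaussian laws and the limit process\<close>

text \<open>
  The law on \<open>\<real>\<^sup>r\<close> (functions on \<open>{..<r}\<close>) of \<open>L z\<close>, where \<open>z\<close> is standard Gaussian and
  \<open>L L\<^sup>T = S\<close>. It does not depend on the choice of \<open>L\<close>, which exists iff \<open>S\<close> is symmetric positive
  semidefinite; for other \<open>S\<close> the value is meaningless.
\<close>

definition centered_gaussian :: "nat \<Rightarrow> (nat \<Rightarrow> nat \<Rightarrow> real) \<Rightarrow> (nat \<Rightarrow> real) measure" where
  "centered_gaussian r S =
     (let L = (SOME L :: nat \<Rightarrow> nat \<Rightarrow> real. \<forall>i<r. \<forall>j<r. (\<Sum>k<r. L i k * L j k) = S i j) in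
      distr (\<Pi>\<^sub>M i\<in>{..<r}. density lborel std_normal_density) (\<Pi>\<^sub>M i\<in>{..<r}. borel)
        (\<lambda>z. \<lambda>i\<in>{..<r}. \<Sum>k<r. L i k * z k))"

definition standard_brownian_bridge :: "'w measure \<Rightarrow> (real \<Rightarrow> 'w \<Rightarrow> real) \<Rightarrow> bool" where
  "standard_brownian_bridge N W \<longleftrightarrow>
     (\<forall>u\<in>{0..1}. W u \<in> borel_measurable N) \<and>
     (\<forall>\<omega>\<in>space N. continuous_on {0..1} (\<lambda>u. W u \<omega>) \<and> W 0 \<omega> = 0 \<and> W 1 \<omega> = 0) \<and>
     (\<forall>(r :: nat) u. (\<forall>i<r. u i \<in> {0..1}) \<longrightarrow>
        distr N (\<Pi>\<^sub>M i\<in>{..<r}. borel) (\<lambda>\<omega>. \<lambda>i\<in>{..<r}. W (u i) \<omega>)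
          = centered_gaussian r (\<lambda>i j. min (u i) (u j) - u i * u j))"

definition distribution_function :: "(real \<Rightarrow> real) \<Rightarrow> bool" where
  "distribution_function H \<longleftrightarrow>
     mono H \<and> (\<forall>t. continuous (at_right t) H) \<and> (H \<longlongrightarrow> 0) at_bot \<and> (H \<longlongrightarrow> 1) at_top"

text \<open>
  \<open>W\<close> is the bridge and \<open>F\<close> the independent random distribution function, both on \<open>N\<close>;
  independence refers to the sigma-fields generated by all coordinates.
\<close>

definition bridge_setting ::
    "'a measure \<Rightarrow> ('a \<Rightarrow> real measure) \<Rightarrow> 'w measure \<Rightarrow> (real \<Rightarrow> 'w \<Rightarrow> real)
       \<Rightarrow> ('w \<Rightarrow> real \<Rightarrow> real) \<Rightarrow> bool" where
  "bridge_setting M \<alpha> N W F \<longleftrightarrow>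
     prob_space N \<and>
     standard_brownian_bridge N W \<and>
     (\<forall>\<omega>\<in>space N. distribution_function (F \<omega>)) \<and>
     (\<forall>t. (\<lambda>\<omega>. F \<omega> t) \<in> borel_measurable N) \<and>
     prob_space.indep_var N (\<Pi>\<^sub>M u\<in>{0..1}. borel) (\<lambda>\<omega>. \<lambda>u\<in>{0..1}. W u \<omega>)
                            (\<Pi>\<^sub>M t\<in>UNIV. borel) F \<and>
     (\<forall>(r :: nat) t. distr N (\<Pi>\<^sub>M i\<in>{..<r}. borel) (\<lambda>\<omega>. \<lambda>i\<in>{..<r}. F \<omega> (t i))
          = distr M (\<Pi>\<^sub>M i\<in>{..<r}. borel) (\<lambda>\<omega>. \<lambda>i\<in>{..<r}. measure (\<alpha> \<omega>) {..t i}))"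

definition bridge_process ::
    "(real \<Rightarrow> 'w \<Rightarrow> real) \<Rightarrow> ('w \<Rightarrow> real \<Rightarrow> real) \<Rightarrow> 'w \<Rightarrow> cadlag0" where
  "bridge_process W F \<omega> = Cadlag0 (\<lambda>t. W (F \<omega> t) \<omega>)"

lemma path_bridge_process:
  assumes S: "bridge_setting M \<alpha> N W F" and w: "\<omega> \<in> space N"
  shows "path_of (bridge_process W F \<omega>) t = W (F \<omega> t) \<omega>"
proof -
  define H where "H = F \<omega>"
  define b where "b = (\<lambda>u. W u \<omega>)"
  have H: "mono H" "\<And>t. continuous (at_right t) H" "(H \<longlongrightarrow> 0) at_bot" "(H \<longlongrightarrow> 1) at_top"
    using S w by (auto simp: bridge_setting_def distribution_function_def H_def)
  have b: "continuous_on {0..1} b" "b 0 = 0" "b 1 = 0"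
    using S w by (auto simp: bridge_setting_def standard_brownian_bridge_def b_def)
  have H0: "0 \<le> H s" for s
  proof (rule tendsto_upperbound[OF H(3)])
    show "\<forall>\<^sub>F i in at_bot. H i \<le> H s"
      using eventually_le_at_bot[of s] by eventually_elim (rule monoD[OF H(1)])
  qed simp
  have H1: "H s \<le> 1" for s
  proof (rule tendsto_lowerbound[OF H(4)])
    show "\<forall>\<^sub>F i in at_top. H s \<le> H i"
      using eventually_ge_at_top[of s] by eventually_elim (rule monoD[OF H(1)])
  qed simp
  have lim: "((\<lambda>s. b (H s)) \<longlongrightarrow> b l) A" if "(H \<longlongrightarrow> l) A" "l \<in> {0..1}" for l A
    using continuous_on_tendsto_compose[OF b(1) that] H0 H1 by simp
  have "cadlag (\<lambda>s. b (H s))" unfolding cadlag_def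
  proof (intro allI conjI)
    fix t
    show "continuous (at_right t) (\<lambda>s. b (H s))"
      unfolding continuous_within
      by (rule lim) (use H(2) H0 H1 in \<open>auto simp: continuous_within\<close>)
    obtain l where l: "(H \<longlongrightarrow> l) (at_left t)"
      using mono_left_limit[OF H(1) H1] by blast
    have "l \<in> {0..1}"
      using tendsto_lowerbound[OF l, of 0] tendsto_upperbound[OF l, of 1] H0 H1 by simp
    with lim[OF l] show "\<exists>l. ((\<lambda>s. b (H s)) \<longlongrightarrow> l) (at_left t)" by blast
  qed
  moreover have "((\<lambda>s. b (H s)) \<longlongrightarrow> 0) at_infinity"
    using lim[OF H(3)] lim[OF H(4)] b by (simp add: at_infinity_eq_at_top_bot filterlim_sup)
  ultimately have "path_of (Cadlag0 (\<lambda>s. b (H s))) = (\<lambda>s. b (H s))" by (intro Cadlag0_inverse) auto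
  then show ?thesis by (simp add: bridge_process_def b_def H_def)
qed

end

theory Submission
  imports Defs
begin

text \<open>
  The increments \<open>q\<^sub>k(t)\<close> are martingale differences with \<open>\<Sum>k\<le>n. q\<^sub>k(t) = \<surd>n C\<^sub>n(t)\<close>. McLeish's
  argument, applied to linear combinations of the \<open>q\<^sub>k(t\<^sub>j)\<close>, gives the limit of the characteristic
  functions of the finite-dimensional distributions as soon as the averages of \<open>q\<^sub>k(s) q\<^sub>k(t)\<close>
  converge; in (a) their limit is \<open>F(s \<and> t) - F(s) F(t)\<close>.

  A process on a countable dense set with these finite-dimensional distributions inherits the
  oscillation bounds of \<open>C\<^sub>n\<close>, so it extends to a random element of the path space that is tight,
  because paths of uniformly small oscillation over finite partitions form compact sets. On such a
  compact set, trigonometric polynomials in finitely many coordinates approximate any continuous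
  function (Stone--Weierstrass), and for these the convergence of expectations is known.
\<close>

text \<open>The path space is not separable in the uniform distance, so \<open>C_n\<close> may fail
  to be Borel measurable; only its coordinates are random variables. Hence tightness of
  \<open>C_n\<close> is asymptotic: for large \<open>n\<close> and outside a small measurable event,
  \<open>C_n\<close> is within any \<delta> of one compact set. The limit has to be Borel
  measurable, and is so as a limit of continuous functions of countably many coordinates.

  The limiting variance is random and known at no finite time, yet McLeish's products must be tested
  against a function of it. It is replaced by averages over an initial segment, which are measurable
  at a finite time; from then on the products form a martingale.

  In (a) the averages converge in probability only, so the limit theorem is stated along an index
  sequence and applied to almost surely convergent subsequences. The bound on
  \<open>E[C_n(t)^2]\<close> enters through orthogonality: it bounds the mean of the averages of
  \<open>q_k(t)^2\<close>, although \<open>q_k\<close> itself is only bounded by a multiple of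
  \<open>k\<close>.\<close>

lemma (in prob_space) integrable_boundedI:
  fixes g :: "'a \<Rightarrow> 'c::{banach, second_countable_topology}"
  assumes "g \<in> borel_measurable M" "\<And>\<omega>. \<omega> \<in> space M \<Longrightarrow> norm (g \<omega>) \<le> B"
  shows "integrable M g"
  using assms by (intro integrable_const_bound[of _ B]) auto

section \<open>Weak convergence from trigonometric test functions\<close>

text \<open>\<open>U\<close> makes the set under \<open>Inf\<close> nonempty and \<open>L\<close>
  bounds it below. A non-measurable \<open>h\<close> caught between integrable functions of nearly
  equal mean thus has its outer expectation pinned down.\<close>

lemma outer_expectation_bounds:
  fixes h :: "'w \<Rightarrow> real"
  assumes M: "prob_space M" and hb: "\<And>\<omega>. \<bar>h \<omega>\<bar> \<le> B"
    and L: "integrable M L" "\<And>\<omega>. \<omega> \<in> space M \<Longrightarrow> L \<omega> \<le> h \<omega>"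
    and U: "integrable M U" "\<And>\<omega>. \<omega> \<in> space M \<Longrightarrow> h \<omega> \<le> U \<omega>"
  shows "integral\<^sup>L M L \<le> outer_expectation M h" "outer_expectation M h \<le> integral\<^sup>L M U"
proof -
  let ?S = "{integral\<^sup>L M U |U. integrable M U \<and> (\<forall>\<omega>\<in>space M. h \<omega> \<le> U \<omega>)}"
  have lower: "integral\<^sup>L M L \<le> x" if "x \<in> ?S" for x
    using that L by (auto intro!: integral_mono) (meson order_trans)
  have mem: "integral\<^sup>L M U \<in> ?S" using U by auto
  show "integral\<^sup>L M L \<le> outer_expectation M h"
    unfolding outer_expectation_def by (rule cInf_greatest) (use mem in blast, erule lower)
  show "outer_expectation M h \<le> integral\<^sup>L M U"
    unfolding outer_expectation_def
    by (rule cInf_lower[OF mem]) (rule bdd_belowI[of _ "integral\<^sup>L M L"], erule lower)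
qed

lemma outer_expectation_integrable:
  assumes "prob_space M" "h \<in> borel_measurable M" "\<And>\<omega>. \<bar>h \<omega>\<bar> \<le> (B::real)"
  shows "outer_expectation M h = integral\<^sup>L M h"
proof -
  interpret prob_space M by fact
  have "integrable M h"
    using assms by (intro integrable_const_bound[of _ B]) auto
  then show ?thesis
    using outer_expectation_bounds[of M h B h h] assms by force
qed

section \<open>Trigonometric polynomials in a sequence of functions\<close>

inductive_set trig_span :: "(nat \<Rightarrow> 'a \<Rightarrow> real) \<Rightarrow> ('a \<Rightarrow> real) set" for \<phi> where
  cos: "(\<lambda>x. a * cos ((\<Sum>i<r. b i * \<phi> i x) + c)) \<in> trig_span \<phi>"
| add: "f \<in> trig_span \<phi> \<Longrightarrow> g \<in> trig_span \<phi> \<Longrightarrow> (\<lambda>x. f x + g x) \<in> trig_span \<phi>"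

text \<open>2 cos x cos y = cos (x - y) + cos (x + y), after padding both frequency vectors with
  zeros to the common length \<open>R\<close>. The phase \<open>c\<close> makes sines and constants
  members, so the span is a ring, as Stone--Weierstrass requires.\<close>

lemma trig_span_mult_cos:
  assumes "g \<in> trig_span \<phi>"
  shows "(\<lambda>x. a * cos ((\<Sum>i<r. b i * \<phi> i x) + c) * g x) \<in> trig_span \<phi>"
  using assms
proof induction
  case (cos a' b' r' c')
  define R where "R = max r r'"
  define b1 where "b1 = (\<lambda>i. if i < r then b i else 0)"
  define b2 where "b2 = (\<lambda>i. if i < r' then b' i else 0)"
  have s1: "(\<Sum>i<R. b1 i * \<phi> i x) = (\<Sum>i<r. b i * \<phi> i x)" for x
    by (rule sum.mono_neutral_cong_right) (auto simp: R_def b1_def)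
  have s2: "(\<Sum>i<R. b2 i * \<phi> i x) = (\<Sum>i<r'. b' i * \<phi> i x)" for x
    by (rule sum.mono_neutral_cong_right) (auto simp: R_def b2_def)
  have "(\<lambda>x. (a * a' / 2) * cos ((\<Sum>i<R. (b1 i - b2 i) * \<phi> i x) + (c - c')) +
       (a * a' / 2) * cos ((\<Sum>i<R. (b1 i + b2 i) * \<phi> i x) + (c + c'))) \<in> trig_span \<phi>"
    by (intro trig_span.intros)
  also have "(\<lambda>x. (a * a' / 2) * cos ((\<Sum>i<R. (b1 i - b2 i) * \<phi> i x) + (c - c')) +
       (a * a' / 2) * cos ((\<Sum>i<R. (b1 i + b2 i) * \<phi> i x) + (c + c'))) =
     (\<lambda>x. a * cos ((\<Sum>i<r. b i * \<phi> i x) + c) * (a' * cos ((\<Sum>i<r'. b' i * \<phi> i x) + c')))"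
  proof
    fix x
    let ?s = "\<Sum>i<r. b i * \<phi> i x" and ?t = "\<Sum>i<r'. b' i * \<phi> i x"
    have 1: "(\<Sum>i<R. (b1 i - b2 i) * \<phi> i x) + (c - c') = (?s + c) - (?t + c')"
      using s1[of x] s2[of x] by (simp add: left_diff_distrib sum_subtractf)
    have 2: "(\<Sum>i<R. (b1 i + b2 i) * \<phi> i x) + (c + c') = (?s + c) + (?t + c')"
      using s1[of x] s2[of x] by (simp add: distrib_right sum.distrib)
    show "(a * a' / 2) * cos ((\<Sum>i<R. (b1 i - b2 i) * \<phi> i x) + (c - c')) +
       (a * a' / 2) * cos ((\<Sum>i<R. (b1 i + b2 i) * \<phi> i x) + (c + c')) =
       a * cos (?s + c) * (a' * cos (?t + c'))"
      unfolding 1 2 cos_add[of "?s + c"] cos_diff[of "?s + c"] by (simp add: field_simps)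
  qed
  finally show ?case .
next
  case (add f g)
  then show ?case by (auto simp: distrib_left dest: trig_span.add)
qed

lemma trig_span_mult:
  assumes "f \<in> trig_span \<phi>" "g \<in> trig_span \<phi>"
  shows "(\<lambda>x. f x * g x) \<in> trig_span \<phi>"
  using assms(1)
proof induction
  case (cos a b r c)
  then show ?case by (rule trig_span_mult_cos[OF assms(2)])
next
  case (add f g)
  then show ?case by (auto simp: distrib_right dest: trig_span.add)
qed

lemma trig_span_const: "(\<lambda>_. c) \<in> trig_span \<phi>"
  using trig_span.cos[of c "\<lambda>_. 0" \<phi> 0 0] by simp

lemma trig_span_bounded:
  assumes "f \<in> trig_span \<phi>"
  obtains H where "\<And>x. \<bar>f x\<bar> \<le> H"
proof -
  have "\<exists>H. \<forall>x. \<bar>f x\<bar> \<le> H"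
    using assms
  proof induction
    case (cos a b r c)
    show ?case
      by (rule exI[of _ "\<bar>a\<bar>"]) (auto simp: abs_mult mult_left_le)
  next
    case (add f g)
    then obtain H1 H2 where "\<forall>x. \<bar>f x\<bar> \<le> H1" "\<forall>x. \<bar>g x\<bar> \<le> H2" by blast
    then show ?case
      by (intro exI[of _ "H1 + H2"]) (meson abs_triangle_ineq add_mono order_trans)
  qed
  then show ?thesis using that by blast
qed

lemma trig_span_continuous:
  fixes \<phi> :: "nat \<Rightarrow> 'a::t2_space \<Rightarrow> real"
  assumes "f \<in> trig_span \<phi>" "\<And>i. continuous_on UNIV (\<phi> i)"
  shows "continuous_on S f"
  using assms(1)
proof induction
  case (cos a b r c)
  have "continuous_on S (\<phi> i)" for i using assms(2) continuous_on_subset by blast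
  then have "continuous_on S (\<lambda>x. (\<Sum>i<r. b i * \<phi> i x) + c)" by (intro continuous_intros)
  then show ?case by (intro continuous_on_mult continuous_on_const continuous_on_cos)
next
  case (add f g)
  then show ?case by (intro continuous_intros)
qed

lemma trig_span_measurable:
  assumes "f \<in> trig_span \<phi>" "\<And>i. (\<lambda>\<omega>. \<phi> i (Y \<omega>)) \<in> borel_measurable M"
  shows "(\<lambda>\<omega>. f (Y \<omega>)) \<in> borel_measurable M"
  using assms(1)
proof induction
  case (cos a b r c)
  note [measurable] = assms(2)
  show ?case by measurable
next
  case (add f g)
  then show ?case by simp
qed

lemma trig_span_expectation_tendsto:
  assumes M: "prob_space M" and N: "prob_space N"
    and f: "f \<in> trig_span \<phi>"
    and Y: "\<And>n i. (\<lambda>\<omega>. \<phi> i (Y n \<omega>)) \<in> borel_measurable M"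
    and Z: "\<And>i. (\<lambda>\<omega>. \<phi> i (Z \<omega>)) \<in> borel_measurable N"
    and conv: "\<And>(r::nat) b c. (\<lambda>n. \<integral>\<omega>. cos ((\<Sum>i<r. b i * \<phi> i (Y n \<omega>)) + c) \<partial>M)
                 \<longlonglongrightarrow> (\<integral>\<omega>. cos ((\<Sum>i<r. b i * \<phi> i (Z \<omega>)) + c) \<partial>N)"
  shows "(\<lambda>n. \<integral>\<omega>. f (Y n \<omega>) \<partial>M) \<longlonglongrightarrow> (\<integral>\<omega>. f (Z \<omega>) \<partial>N)"
  using f
proof induction
  case (cos a b r c)
  show ?case by (simp add: tendsto_mult_left conv)
next
  case (add f g)
  interpret M: prob_space M by fact
  interpret N: prob_space N by fact
  obtain H1 H2 where H: "\<And>x. \<bar>f x\<bar> \<le> H1" "\<And>x. \<bar>g x\<bar> \<le> H2"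
    using trig_span_bounded add.hyps by metis
  have I: "integrable M (\<lambda>\<omega>. f (Y n \<omega>))" "integrable M (\<lambda>\<omega>. g (Y n \<omega>))" for n
    using M.integrable_boundedI[OF trig_span_measurable[OF add.hyps(1) Y], where B=H1]
      M.integrable_boundedI[OF trig_span_measurable[OF add.hyps(2) Y], where B=H2] H by auto
  have J: "integrable N (\<lambda>\<omega>. f (Z \<omega>))" "integrable N (\<lambda>\<omega>. g (Z \<omega>))"
    using N.integrable_boundedI[OF trig_span_measurable[OF add.hyps(1) Z], where B=H1]
      N.integrable_boundedI[OF trig_span_measurable[OF add.hyps(2) Z], where B=H2] H by auto
  show ?case
    using add.IH by (simp add: I J tendsto_add)
qed

text \<open>Clamping the Stone--Weierstrass approximant by a polynomial keeps it bounded off \<open>K\<close>.\<close>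

lemma trig_span_approx:
  fixes \<phi> :: "nat \<Rightarrow> 'a::metric_space \<Rightarrow> real"
  assumes cont: "\<And>i. continuous_on UNIV (\<phi> i)"
    and sep: "\<And>x y. x \<noteq> y \<Longrightarrow> \<exists>i. \<phi> i x \<noteq> \<phi> i y"
    and K: "compact K" and f: "continuous_on UNIV f" "\<And>x. \<bar>f x\<bar> \<le> B" and e: "0 < (e::real)"
  obtains h where "h \<in> trig_span \<phi>" "\<And>x. \<bar>h x\<bar> \<le> B + e" "\<And>x. x \<in> K \<Longrightarrow> \<bar>f x - h x\<bar> < e"
proof -
  have *: "\<exists>h\<in>trig_span \<phi>. h x \<noteq> h y" if xy: "x \<noteq> y" for x y
  proof -
    obtain i where i: "\<phi> i x \<noteq> \<phi> i y" using sep[OF xy] by blast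
    \<comment> \<open>The phase makes the cosine equal to 1 at \<open>y\<close>; the frequency
      \<open>b\<close> makes it cos (pi / 2) = 0 at \<open>x\<close>.\<close>
    define d where "d = \<phi> i x - \<phi> i y"
    define b where "b = pi / (2 * d)"
    have "d \<noteq> 0" using i by (simp add: d_def)
    have "(\<lambda>z. 1 * cos ((\<Sum>j<Suc i. (if j = i then b else 0) * \<phi> j z) + (- b * \<phi> i y))) \<in> trig_span \<phi>"
      by (rule trig_span.cos)
    also have "(\<lambda>z. (\<Sum>j<Suc i. (if j = i then b else 0) * \<phi> j z)) = (\<lambda>z. b * \<phi> i z)"
      by (simp add: if_distrib[of "\<lambda>x. x * _"] cong: if_cong)
    finally have "(\<lambda>z. cos (b * \<phi> i z + (- b * \<phi> i y))) \<in> trig_span \<phi>"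
      by (simp add: if_distrib[of "\<lambda>x. x * _"] cong: if_cong)
    moreover have arg: "b * \<phi> i x + (- b * \<phi> i y) = pi / 2"
    proof -
      have "b * \<phi> i x + (- b * \<phi> i y) = b * d" by (simp add: d_def algebra_simps)
      then show ?thesis using \<open>d \<noteq> 0\<close> by (simp add: b_def)
    qed
    moreover have "cos (b * \<phi> i x + (- b * \<phi> i y)) \<noteq> cos (b * \<phi> i y + (- b * \<phi> i y))"
      unfolding arg by simp
    ultimately show ?thesis
      by (intro bexI[of _ "\<lambda>z. cos (b * \<phi> i z + (- b * \<phi> i y))"])
  qed
  interpret A: function_ring_on "trig_span \<phi>" K
    by unfold_locales
      (auto intro: K trig_span_continuous[OF _ cont] trig_span.add trig_span_mult trig_span_const *)
  obtain h0 where h0: "h0 \<in> trig_span \<phi>" "\<And>x. x \<in> K \<Longrightarrow> \<bar>f x - h0 x\<bar> < e / 2"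
    using A.Stone_Weierstrass_basic[OF continuous_on_subset[OF f(1)], of "e/2"] e by auto
  obtain H where H: "\<And>x. \<bar>h0 x\<bar> \<le> H" using trig_span_bounded[OF h0(1)] by blast
  \<comment> \<open>Since |f| \<le> B, clamping to [-B, B] never moves a value away from that of
    \<open>f\<close>.\<close>
  define cl where "cl = (\<lambda>u. max (-B) (min B (u::real)))"
  have B0: "0 \<le> B" using f(2)[of undefined] by linarith
  \<comment> \<open>The functions \<open>p\<close> whose composition with \<open>h0\<close> stays in
    the span form a ring containing the identity. A second application of Stone--Weierstrass, now on
    an interval containing the range of \<open>h0\<close>, therefore approximates \<open>cl\<close>
    inside this ring.\<close>
  interpret P: function_ring_on "{p. continuous_on {-H..H} p \<and> (\<lambda>x. p (h0 x)) \<in> trig_span \<phi>}" "{-H..H}"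
  proof
    fix x y :: real assume "x \<noteq> y"
    then show "\<exists>f\<in>{p. continuous_on {-H..H} p \<and> (\<lambda>x. p (h0 x)) \<in> trig_span \<phi>}. f x \<noteq> f y"
      using h0(1) by (intro bexI[of _ "\<lambda>x. x"]) auto
  qed (auto intro: trig_span.add trig_span_mult trig_span_const continuous_intros)
  have "continuous_on {-H..H} cl" unfolding cl_def by (intro continuous_intros)
  from P.Stone_Weierstrass_basic[OF this, of "e/2"] e
  obtain p where p: "(\<lambda>x. p (h0 x)) \<in> trig_span \<phi>" "\<And>u. u \<in> {-H..H} \<Longrightarrow> \<bar>cl u - p u\<bar> < e / 2"
    by auto
  have pc: "\<bar>cl (h0 x) - p (h0 x)\<bar> < e / 2" for x
    using p(2)[of "h0 x"] H[of x] by (auto simp: abs_le_iff)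
  show thesis
  proof (rule that[of "\<lambda>x. p (h0 x)"])
    show "\<bar>p (h0 x)\<bar> \<le> B + e" for x
    proof -
      have "\<bar>cl (h0 x)\<bar> \<le> B" using B0 by (auto simp: cl_def)
      then show ?thesis using pc[of x] e by linarith
    qed
    show "\<bar>f x - p (h0 x)\<bar> < e" if "x \<in> K" for x
      using pc[of x] h0(2)[OF that] f(2)[of x] B0 unfolding cl_def
      by (auto simp: max_def min_def abs_if split: if_splits)
  qed (rule p)
qed

text \<open>The order of quantifiers in \<open>tight\<close> follows the proof: \<eta> fixes
  \<open>K\<close>, then the approximant \<open>h\<close> of \<open>f\<close> is built on
  \<open>K\<close>, and only then \<delta> is read off from \<open>h\<close>. Off the exceptional
  sets \<open>f\<close> and \<open>h\<close> are close; on them the global bounds of both functions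
  are multiplied by \<eta>.\<close>

theorem weak_convergence_from_trig:
  fixes \<phi> :: "nat \<Rightarrow> 'a::metric_space \<Rightarrow> real" and Y :: "nat \<Rightarrow> 'm \<Rightarrow> 'a" and Z :: "'n \<Rightarrow> 'a"
  assumes M: "prob_space M" and N: "prob_space N"
    and cont: "\<And>i. continuous_on UNIV (\<phi> i)"
    and sep: "\<And>x y. x \<noteq> y \<Longrightarrow> \<exists>i. \<phi> i x \<noteq> \<phi> i y"
    and Y: "\<And>n i. (\<lambda>\<omega>. \<phi> i (Y n \<omega>)) \<in> borel_measurable M"
    and Z: "Z \<in> N \<rightarrow>\<^sub>M borel"
    and conv: "\<And>(r::nat) b c. (\<lambda>n. \<integral>\<omega>. cos ((\<Sum>i<r. b i * \<phi> i (Y n \<omega>)) + c) \<partial>M)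
                 \<longlonglongrightarrow> (\<integral>\<omega>. cos ((\<Sum>i<r. b i * \<phi> i (Z \<omega>)) + c) \<partial>N)"
    and tight: "\<And>\<eta>. \<eta> > 0 \<Longrightarrow> \<exists>K. compact K \<and> measure N {\<omega> \<in> space N. Z \<omega> \<notin> K} \<le> \<eta> \<and>
      (\<forall>\<delta>>0. \<forall>\<^sub>F n in sequentially. \<exists>E\<in>sets M. measure M E \<le> \<eta> \<and>
         (\<forall>\<omega>\<in>space M - E. \<exists>z\<in>K. dist (Y n \<omega>) z < \<delta>))"
    and f: "continuous_on UNIV f" "\<And>x. \<bar>f x\<bar> \<le> B"
  shows "(\<lambda>n. outer_expectation M (\<lambda>\<omega>. f (Y n \<omega>))) \<longlonglongrightarrow> (\<integral>\<omega>. f (Z \<omega>) \<partial>N)"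
proof (rule tendstoI)
  fix e0 :: real assume e0: "0 < e0"
  interpret M: prob_space M by fact
  interpret N: prob_space N by fact
  have B0: "0 \<le> B" using f(2)[of undefined] by linarith
  \<comment> \<open>\<open>e \<le> 1\<close> yields |f - h| \<le> 2 B + 1 everywhere. The total
    error stays below 5 e: 2 e for replacing \<open>f\<close> by \<open>h\<close> under
    \<open>Z\<close>, e for the convergence of the means of \<open>h\<close>, and 2 e for replacing
    \<open>h\<close> by \<open>f\<close> under \<open>Y n\<close>.\<close>
  define e where "e = min 1 (e0 / 8)"
  have e: "0 < e" "e \<le> 1" "8 * e \<le> e0" using e0 by (auto simp: e_def)
  define \<eta> where "\<eta> = e / (2 * B + 2)"
  have \<eta>: "0 < \<eta>" "\<eta> * (2 * B + 1) \<le> e"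
    using e B0 by (auto simp: \<eta>_def field_simps)
  obtain K where K: "compact K" "measure N {\<omega> \<in> space N. Z \<omega> \<notin> K} \<le> \<eta>"
      "\<And>\<delta>. \<delta> > 0 \<Longrightarrow> \<forall>\<^sub>F n in sequentially. \<exists>E\<in>sets M. measure M E \<le> \<eta> \<and>
         (\<forall>\<omega>\<in>space M - E. \<exists>z\<in>K. dist (Y n \<omega>) z < \<delta>)"
    using tight[OF \<eta>(1)] by blast
  obtain h where h: "h \<in> trig_span \<phi>" "\<And>x. \<bar>h x\<bar> \<le> B + e" "\<And>x. x \<in> K \<Longrightarrow> \<bar>f x - h x\<bar> < e"
    using trig_span_approx[OF cont sep K(1) f e(1)] by blast
  have hc: "continuous_on UNIV h" by (rule trig_span_continuous[OF h(1) cont])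
  \<comment> \<open>The estimate |f - h| < e is an open condition that holds on the compact set
    \<open>K\<close>, so it persists on a \<delta>-neighbourhood. This is why it suffices that
    \<open>Y n\<close> comes close to \<open>K\<close>.\<close>
  have "open {x. \<bar>f x - h x\<bar> < e}"
    using f(1) hc by (intro open_Collect_less continuous_intros)
  then obtain \<delta> where \<delta>: "\<delta> > 0" "(\<Union>x\<in>K. ball x \<delta>) \<subseteq> {x. \<bar>f x - h x\<bar> < e}"
    using compact_subset_open_imp_ball_epsilon_subset[OF K(1)] h(3) by (metis (mono_tags) mem_Collect_eq subsetI)
  have gb: "\<bar>f x - h x\<bar> \<le> 2 * B + 1" for x using f(2)[of x] h(2)[of x] e by linarith
  have Kc: "K \<in> sets borel" using K(1) by (simp add: borel_compact)
  have mZ: "(\<lambda>\<omega>. f (Z \<omega>)) \<in> borel_measurable N" "(\<lambda>\<omega>. h (Z \<omega>)) \<in> borel_measurable N"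
    using measurable_compose[OF Z borel_measurable_continuous_onI[OF f(1)]]
      measurable_compose[OF Z borel_measurable_continuous_onI[OF hc]] by auto
  have iZ: "integrable N (\<lambda>\<omega>. f (Z \<omega>))" "integrable N (\<lambda>\<omega>. h (Z \<omega>))"
    using N.integrable_boundedI[OF mZ(1), of B] N.integrable_boundedI[OF mZ(2), of "B + e"] f(2) h(2)
    by auto
  have "\<bar>(\<integral>\<omega>. h (Z \<omega>) \<partial>N) - (\<integral>\<omega>. f (Z \<omega>) \<partial>N)\<bar> \<le> 2 * e"
  proof -
    let ?A = "{\<omega> \<in> space N. Z \<omega> \<notin> K}"
    have A: "?A \<in> sets N" using Z Kc by measurable
    have "\<bar>(\<integral>\<omega>. h (Z \<omega>) \<partial>N) - (\<integral>\<omega>. f (Z \<omega>) \<partial>N)\<bar> = \<bar>\<integral>\<omega>. h (Z \<omega>) - f (Z \<omega>) \<partial>N\<bar>"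
      using iZ by simp
    also have "\<dots> \<le> (\<integral>\<omega>. \<bar>h (Z \<omega>) - f (Z \<omega>)\<bar> \<partial>N)"
      by (rule integral_abs_bound)
    also have "\<dots> \<le> (\<integral>\<omega>. e + (2 * B + 1) * indicator ?A \<omega> \<partial>N)"
    proof (rule integral_mono)
      show "integrable N (\<lambda>\<omega>. \<bar>h (Z \<omega>) - f (Z \<omega>)\<bar>)" using iZ by auto
      show "integrable N (\<lambda>\<omega>. e + (2 * B + 1) * indicator ?A \<omega>)"
        using A by (auto simp: N.emeasure_eq_measure)
      fix \<omega> assume "\<omega> \<in> space N"
      then show "\<bar>h (Z \<omega>) - f (Z \<omega>)\<bar> \<le> e + (2 * B + 1) * indicator ?A \<omega>"
        using gb[of "Z \<omega>"] h(3)[of "Z \<omega>"] e by (auto simp: indicator_def)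
    qed
    also have "\<dots> = e + (2 * B + 1) * measure N ?A"
      using A by (simp add: N.emeasure_eq_measure N.prob_space)
    also have "\<dots> \<le> e + (2 * B + 1) * \<eta>"
      using K(2) B0 by (intro add_left_mono mult_left_mono) auto
    finally show ?thesis using \<eta>(2) by (simp add: mult.commute)
  qed
  note limit = this
  have "\<forall>\<^sub>F n in sequentially. dist (\<integral>\<omega>. h (Y n \<omega>) \<partial>M) (\<integral>\<omega>. h (Z \<omega>) \<partial>N) < e"
  proof (rule tendstoD[OF _ e(1)], rule trig_span_expectation_tendsto[OF M N h(1) Y _ conv])
    show "(\<lambda>\<omega>. \<phi> i (Z \<omega>)) \<in> borel_measurable N" for i
      by (rule measurable_compose[OF Z borel_measurable_continuous_onI[OF cont]])
  qed
  then show "\<forall>\<^sub>F n in sequentially.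
      dist (outer_expectation M (\<lambda>\<omega>. f (Y n \<omega>))) (\<integral>\<omega>. f (Z \<omega>) \<partial>N) < e0"
    using K(3)[OF \<delta>(1)]
  proof eventually_elim
    case (elim n)
    then obtain E where E: "E \<in> sets M" "measure M E \<le> \<eta>"
      "\<And>\<omega>. \<omega> \<in> space M - E \<Longrightarrow> \<exists>z\<in>K. dist (Y n \<omega>) z < \<delta>" by blast
    have mY: "(\<lambda>\<omega>. h (Y n \<omega>)) \<in> borel_measurable M" by (rule trig_span_measurable[OF h(1) Y])
    have iY: "integrable M (\<lambda>\<omega>. h (Y n \<omega>))"
      by (rule M.integrable_boundedI[OF mY]) (use h(2) in simp)
    have iE: "integrable M (indicator E :: _ \<Rightarrow> real)"
      using E by (auto simp: M.emeasure_eq_measure)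
    have close: "\<bar>f (Y n \<omega>) - h (Y n \<omega>)\<bar> \<le> e + (2 * B + 1) * indicator E \<omega>" if "\<omega> \<in> space M" for \<omega>
    proof (cases "\<omega> \<in> E")
      case True then show ?thesis using gb[of "Y n \<omega>"] e by simp
    next
      case False
      then obtain z where "z \<in> K" "dist (Y n \<omega>) z < \<delta>" using E(3) \<open>\<omega> \<in> space M\<close> by blast
      then have "Y n \<omega> \<in> (\<Union>x\<in>K. ball x \<delta>)" by (auto simp: dist_commute)
      then show ?thesis using \<delta>(2) False by fastforce
    qed
    let ?e = "\<lambda>\<omega>. e + (2 * B + 1) * indicator E \<omega> :: real"
    have ie: "integrable M ?e" using iE by auto
    have Ie: "integral\<^sup>L M ?e \<le> 2 * e"
    proof -
      have "integral\<^sup>L M ?e = e + (2 * B + 1) * measure M E"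
        using iE E(1) by (simp add: M.prob_space)
      also have "\<dots> \<le> e + (2 * B + 1) * \<eta>"
        using E(2) B0 by (intro add_left_mono mult_left_mono) auto
      finally show ?thesis using \<eta>(2) by (simp add: mult.commute)
    qed
    have "(\<integral>\<omega>. h (Y n \<omega>) - ?e \<omega> \<partial>M) \<le> outer_expectation M (\<lambda>\<omega>. f (Y n \<omega>))"
         "outer_expectation M (\<lambda>\<omega>. f (Y n \<omega>)) \<le> (\<integral>\<omega>. h (Y n \<omega>) + ?e \<omega> \<partial>M)"
      by (rule outer_expectation_bounds[OF M, of _ B "\<lambda>\<omega>. h (Y n \<omega>) - ?e \<omega>" "\<lambda>\<omega>. h (Y n \<omega>) + ?e \<omega>"];
          use f(2) iY ie close in \<open>force simp: abs_le_iff\<close>)+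
    then have "(\<integral>\<omega>. h (Y n \<omega>) \<partial>M) - 2 * e \<le> outer_expectation M (\<lambda>\<omega>. f (Y n \<omega>))"
         "outer_expectation M (\<lambda>\<omega>. f (Y n \<omega>)) \<le> (\<integral>\<omega>. h (Y n \<omega>) \<partial>M) + 2 * e"
      using iY ie Ie by simp_all
    with elim(1) limit e show ?case
      unfolding dist_real_def by (smt (verit))
  qed
qed

section \<open>A martingale central limit theorem\<close>

text \<open>1 + x^2 \<le> exp (x^2). As \<open>iexp x\<close> has modulus 1 too,
  \<open>norm_prod_diff\<close> can compare the two products factor by factor.\<close>

lemma cmod_gauss_factor_le_1:
  fixes x :: real
  shows "cmod ((1 + \<i> * x) * exp (- x\<^sup>2 / 2)) \<le> 1"
proof -
  have "(cmod ((1 + \<i> * x) * exp (- x\<^sup>2 / 2)))\<^sup>2 = (1 + x\<^sup>2) * exp (- x\<^sup>2)"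
    by (simp add: norm_mult power_mult_distrib cmod_power2 flip: exp_double of_real_exp)
  also have "\<dots> \<le> exp (x\<^sup>2) * exp (- x\<^sup>2)"
    by (intro mult_right_mono exp_ge_add_one_self) auto
  also have "\<dots> = 1" by (simp flip: exp_add)
  finally show ?thesis by (simp add: power2_le_imp_le abs_square_le_1)
qed

text \<open>Both sides have the Taylor polynomial 1 + i x - x^2 / 2, because the factor exp (- x^2 /
  2) supplies the missing quadratic term. For |x| > 1 both have modulus at most 1, and 2 |x|^3
  exceeds 2.\<close>

lemma cmod_iexp_approx_quadratic:
  fixes x :: real
  shows "cmod (iexp x - (1 + \<i> * x) * exp (- x\<^sup>2 / 2)) \<le> 2 * \<bar>x\<bar> ^ 3"
proof (cases "\<bar>x\<bar> \<le> 1")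
  case True
  have 1: "cmod (iexp x - (1 + \<i> * x - x\<^sup>2 / 2)) \<le> \<bar>x\<bar> ^ 3 / 6"
    using iexp_approx1[of x 2] by (simp add: numeral_eq_Suc power2_eq_square algebra_simps fact_numeral)
  have e1: "1 - x\<^sup>2 / 2 \<le> exp (- x\<^sup>2 / 2)" using exp_ge_add_one_self[of "- x\<^sup>2 / 2"] by simp
  have e2: "exp (- x\<^sup>2 / 2) \<le> 1 - x\<^sup>2 / 2 + x ^ 4 / 4"
  proof -
    define y where "y = x\<^sup>2 / 2"
    have y: "0 \<le> y" "y \<le> 1" by (simp add: y_def) (use True abs_square_le_1[of x] in \<open>simp add: y_def\<close>)
    have "exp (- y) = 1 / exp y" by (simp add: exp_minus field_simps)
    also have "\<dots> \<le> 1 / (1 + y)" using y exp_ge_add_one_self[of y] by (intro divide_left_mono) auto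
    also have "\<dots> \<le> 1 - y + y\<^sup>2" using y by (simp add: divide_simps power2_eq_square algebra_simps)
    finally show ?thesis by (simp add: y_def power_divide flip: power_mult)
  qed
  have 2: "\<bar>exp (- x\<^sup>2 / 2) - (1 - x\<^sup>2 / 2)\<bar> \<le> x ^ 4 / 4" using e1 e2 by linarith
  have x4: "x ^ 4 \<le> \<bar>x\<bar> ^ 3"
  proof -
    have "x ^ 4 = \<bar>x\<bar> ^ 4" by simp
    also have "\<dots> = \<bar>x\<bar> ^ 3 * \<bar>x\<bar>" by (simp add: power4_eq_xxxx power3_eq_cube mult.assoc)
    finally have "x ^ 4 = \<bar>x\<bar> ^ 3 * \<bar>x\<bar>" .
    then show ?thesis using True by (simp add: mult_left_le)
  qed
  have "iexp x - (1 + \<i> * x) * exp (- x\<^sup>2 / 2) =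
      (iexp x - (1 + \<i> * x - x\<^sup>2 / 2)) - \<i> * of_real (x * (- x\<^sup>2 / 2))
       - (1 + \<i> * x) * of_real (exp (- x\<^sup>2 / 2) - (1 - x\<^sup>2 / 2))"
    by (simp add: algebra_simps)
  also have "cmod \<dots> \<le> cmod (iexp x - (1 + \<i> * x - x\<^sup>2 / 2)) + cmod (\<i> * of_real (x * (- x\<^sup>2 / 2)))
       + cmod ((1 + \<i> * x) * of_real (exp (- x\<^sup>2 / 2) - (1 - x\<^sup>2 / 2)))"
    by (meson norm_triangle_ineq4 add_right_mono order_trans)
  also have "\<dots> \<le> \<bar>x\<bar> ^ 3 / 6 + \<bar>x\<bar> ^ 3 / 2 + 2 * (x ^ 4 / 4)"
  proof (intro add_mono 1)
    show "cmod (\<i> * of_real (x * (- x\<^sup>2 / 2))) \<le> \<bar>x\<bar> ^ 3 / 2"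
      by (simp add: norm_mult abs_mult power2_eq_square power3_eq_cube del: of_real_mult)
    have "cmod (1 + \<i> * x) \<le> 1 + \<bar>x\<bar>"
      using norm_triangle_ineq[of 1 "\<i> * of_real x"] by (simp add: norm_mult)
    then show "cmod ((1 + \<i> * x) * of_real (exp (- x\<^sup>2 / 2) - (1 - x\<^sup>2 / 2))) \<le> 2 * (x ^ 4 / 4)"
      unfolding norm_mult norm_of_real using True 2 by (intro mult_mono) auto
  qed
  also have "\<dots> \<le> 2 * \<bar>x\<bar> ^ 3"
  proof -
    have "0 \<le> \<bar>x\<bar> ^ 3" by simp
    with x4 show ?thesis by linarith
  qed
  finally show ?thesis .
next
  case False
  have "cmod (iexp x - (1 + \<i> * x) * exp (- x\<^sup>2 / 2)) \<le> 1 + cmod ((1 + \<i> * x) * exp (- x\<^sup>2 / 2))"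
    by (rule norm_triangle_le_diff) (simp add: norm_mult)
  also have "cmod ((1 + \<i> * x) * exp (- x\<^sup>2 / 2)) \<le> 1" by (rule cmod_gauss_factor_le_1)
  also have "1 + 1 \<le> 2 * \<bar>x\<bar> ^ 3" using False one_le_power[of "\<bar>x\<bar>" 3] by simp
  finally show ?thesis by simp
qed

text \<open>Truncating once the sum of squares exceeds \<open>c\<close> makes the products \<open>\<Prod>(1 + \<i> x\<^sub>k)\<close> in McLeish's
  argument bounded in \<open>L\<^sup>2\<close>, given only a bound on the mean of the sum of squares.\<close>

definition stopped :: "real \<Rightarrow> (nat \<Rightarrow> real) \<Rightarrow> nat \<Rightarrow> real" where
  "stopped c a k = (if (\<Sum>j<k. (a j)\<^sup>2) \<le> c then a k else 0)"

text \<open>The factors before the sum of squares passes \<open>c\<close> multiply to at most exp c.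
  The summand that carries the sum past \<open>c\<close> is still kept and contributes 1 + (a k)^2;
  all later factors equal 1.\<close>

lemma stopped_prod_le:
  "(\<Prod>k<n. 1 + (stopped c a k)\<^sup>2) \<le> exp c * (1 + (\<Sum>k<n. (a k)\<^sup>2))" if "0 \<le> c"
proof (induction n)
  case 0
  then show ?case using that by simp
next
  case (Suc n)
  show ?case
  proof (cases "(\<Sum>j<n. (a j)\<^sup>2) \<le> c")
    case True
    have "(\<Prod>k<n. 1 + (stopped c a k)\<^sup>2) \<le> (\<Prod>k<n. exp ((a k)\<^sup>2))"
      by (intro prod_mono conjI) (auto simp: stopped_def intro: exp_ge_add_one_self order_trans[OF _ exp_ge_add_one_self] add_nonneg_nonneg)
    also have "\<dots> = exp (\<Sum>k<n. (a k)\<^sup>2)" by (simp add: exp_sum)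
    also have "\<dots> \<le> exp c" using True by simp
    finally have "(\<Prod>k<Suc n. 1 + (stopped c a k)\<^sup>2) \<le> exp c * (1 + (stopped c a n)\<^sup>2)"
      by (simp add: mult_right_mono)
    also have "\<dots> \<le> exp c * (1 + (\<Sum>k<Suc n. (a k)\<^sup>2))"
      by (auto simp: stopped_def sum_nonneg)
    finally show ?thesis .
  next
    case False
    then have "stopped c a n = 0" by (simp add: stopped_def)
    then have "(\<Prod>k<Suc n. 1 + (stopped c a k)\<^sup>2) \<le> exp c * (1 + (\<Sum>k<n. (a k)\<^sup>2))"
      using Suc by simp
    also have "\<dots> \<le> exp c * (1 + (\<Sum>k<Suc n. (a k)\<^sup>2))" by simp
    finally show ?thesis .
  qed
qed

lemma stopped_eq:
  assumes "(\<Sum>j<n. (a j)\<^sup>2) \<le> c" "k < n"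
  shows "stopped c a k = a k"
proof -
  have "(\<Sum>j<k. (a j)\<^sup>2) \<le> (\<Sum>j<n. (a j)\<^sup>2)" using assms(2) by (intro sum_mono2) auto
  then show ?thesis using assms(1) by (simp add: stopped_def)
qed

lemma stopped_sum_ge: "min (\<Sum>k<n. (a k)\<^sup>2) c \<le> (\<Sum>k<n. (stopped c a k)\<^sup>2)"
proof (induction n)
  case (Suc n)
  show ?case
  proof (cases "(\<Sum>j<n. (a j)\<^sup>2) \<le> c")
    case True
    then have "(\<Sum>k<n. (stopped c a k)\<^sup>2) = (\<Sum>k<n. (a k)\<^sup>2)"
      by (intro sum.cong) (auto simp: stopped_eq)
    then show ?thesis using True by (simp add: stopped_def)
  next
    case False
    then have "c \<le> (\<Sum>k<n. (stopped c a k)\<^sup>2)" using Suc by simp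
    then show ?thesis by (simp add: add_increasing2 min.coboundedI2)
  qed
qed simp

text \<open>The truncated sum overshoots \<open>c\<close> by its last nonzero summand at most, which
  \<open>m\<close> bounds. With \<open>stopped_sum_ge\<close> this squeezes it towards the minimum
  of \<open>c\<close> and the full sum once the largest summand is negligible.\<close>

lemma stopped_sum_le:
  assumes "0 \<le> c" "0 \<le> m" "\<And>k. k < n \<Longrightarrow> (a k)\<^sup>2 \<le> m"
  shows "(\<Sum>k<n. (stopped c a k)\<^sup>2) \<le> min (\<Sum>k<n. (a k)\<^sup>2) c + m"
proof -
  have 1: "(\<Sum>k<n. (stopped c a k)\<^sup>2) \<le> (\<Sum>k<n. (a k)\<^sup>2)"
    by (intro sum_mono) (auto simp: stopped_def)
  have 2: "(\<Sum>k<n. (stopped c a k)\<^sup>2) \<le> c + m"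
    using assms(3)
  proof (induction n)
    case (Suc n)
    show ?case
    proof (cases "(\<Sum>j<n. (a j)\<^sup>2) \<le> c")
      case True
      then have "(\<Sum>k<n. (stopped c a k)\<^sup>2) \<le> c"
        by (simp add: stopped_eq[OF True] cong: sum.cong_simp)
      then show ?thesis using Suc(2)[of n] True by (simp add: stopped_def add_mono)
    next
      case False
      then show ?thesis using Suc by (simp add: stopped_def)
    qed
  qed (use assms in simp)
  from 1 2 assms(2) show ?thesis by (auto simp: min_def)
qed

text \<open>\<open>mart\<close> is the martingale difference property in weak form:
  \<open>u k\<close> integrates to 0 against bounded \<open>G k\<close>-measurable weights. The
  indices are shifted, \<open>u k\<close> being known at time \<open>Suc k\<close>. The bounds
  \<open>b k\<close> may grow with \<open>k\<close>; they secure integrability, while estimates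
  uniform in \<open>n\<close> come from second moments.\<close>

locale bounded_mart_diff = prob_space M for M :: "'a measure" +
  fixes G :: "nat \<Rightarrow> 'a measure" and u :: "nat \<Rightarrow> 'a \<Rightarrow> real" and b :: "nat \<Rightarrow> real"
  assumes sub: "\<And>n. subalgebra M (G n)"
    and mono: "\<And>m n. m \<le> n \<Longrightarrow> sets (G m) \<subseteq> sets (G n)"
    and adapted: "\<And>k. u k \<in> borel_measurable (G (Suc k))"
    and bdd: "\<And>k \<omega>. \<omega> \<in> space M \<Longrightarrow> \<bar>u k \<omega>\<bar> \<le> b k"
    and mart: "\<And>k w B. w \<in> borel_measurable (G k) \<Longrightarrow> (\<And>\<omega>. \<omega> \<in> space M \<Longrightarrow> \<bar>w \<omega>\<bar> \<le> (B::real)) \<Longrightarrow>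
        (\<integral>\<omega>. u k \<omega> * w \<omega> \<partial>M) = 0"
begin

lemma space_G: "space (G n) = space M" using sub[of n] by (simp add: subalgebra_def)

lemma meas_G_mono:
  assumes "f \<in> borel_measurable (G m)" "m \<le> n" shows "f \<in> borel_measurable (G n)"
  by (rule measurable_from_subalg[OF _ assms(1)]) (use mono[OF assms(2)] in \<open>auto simp: subalgebra_def space_G\<close>)

lemma meas_G_M: assumes "f \<in> borel_measurable (G m)" shows "f \<in> borel_measurable M"
  by (rule measurable_from_subalg[OF sub assms])

lemma adapted_le: "k < n \<Longrightarrow> u k \<in> borel_measurable (G n)"
  using meas_G_mono[OF adapted, of k n] by simp

lemma u_M [measurable]: "u k \<in> borel_measurable M"
  by (rule meas_G_M[OF adapted])

lemma b_nonneg: "0 \<le> b k"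
proof -
  obtain \<omega> where "\<omega> \<in> space M" using not_empty by auto
  with bdd[of \<omega> k] show ?thesis by linarith
qed

lemma sum_bdd: "\<omega> \<in> space M \<Longrightarrow> \<bar>\<Sum>k<n. u k \<omega>\<bar> \<le> (\<Sum>k<n. b k)"
  by (rule order_trans[OF sum_abs]) (intro sum_mono bdd)

lemma expectation_sum_squared: "(\<integral>\<omega>. (\<Sum>k<n. u k \<omega>)\<^sup>2 \<partial>M) = (\<integral>\<omega>. (\<Sum>k<n. (u k \<omega>)\<^sup>2) \<partial>M)"
proof (induction n)
  case (Suc n)
  let ?S = "\<lambda>\<omega>. \<Sum>k<n. u k \<omega>"
  have I1: "integrable M (\<lambda>\<omega>. (?S \<omega>)\<^sup>2)"
    by (rule integrable_boundedI[where B="(\<Sum>k<n. b k)\<^sup>2"])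
      (use sum_bdd in \<open>auto simp: power2_le_iff_abs_le sum_nonneg b_nonneg\<close>)
  have I2: "integrable M (\<lambda>\<omega>. (u k \<omega>)\<^sup>2)" for k
    by (rule integrable_boundedI[where B="(b k)\<^sup>2"])
      (use bdd in \<open>auto simp: power2_le_iff_abs_le b_nonneg\<close>)
  have I3: "integrable M (\<lambda>\<omega>. u n \<omega> * ?S \<omega>)"
    by (rule integrable_boundedI[where B="b n * (\<Sum>k<n. b k)"])
      (use bdd sum_bdd in \<open>auto simp: abs_mult b_nonneg intro!: mult_mono\<close>)
  have 0: "(\<integral>\<omega>. u n \<omega> * ?S \<omega> \<partial>M) = 0"
    by (rule mart[of _ _ "\<Sum>k<n. b k"]) (auto intro!: borel_measurable_sum adapted_le sum_bdd)
  have "(\<integral>\<omega>. (\<Sum>k<Suc n. u k \<omega>)\<^sup>2 \<partial>M) = (\<integral>\<omega>. (?S \<omega>)\<^sup>2 + 2 * (u n \<omega> * ?S \<omega>) + (u n \<omega>)\<^sup>2 \<partial>M)"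
    by (simp add: power2_sum algebra_simps)
  also have "\<dots> = (\<integral>\<omega>. (?S \<omega>)\<^sup>2 \<partial>M) + (\<integral>\<omega>. (u n \<omega>)\<^sup>2 \<partial>M)"
    using I1 I2 I3 0 by simp
  also have "\<dots> = (\<integral>\<omega>. (\<Sum>k<Suc n. (u k \<omega>)\<^sup>2) \<partial>M)"
    using I2 Suc by simp
  finally show ?case .
qed simp

section \<open>Truncated increments and the martingale of their products\<close>

definition xs :: "real \<Rightarrow> real \<Rightarrow> nat \<Rightarrow> 'a \<Rightarrow> real" where
  "xs N c k \<omega> = stopped c (\<lambda>j. u j \<omega> / sqrt N) k"

definition tprod :: "real \<Rightarrow> real \<Rightarrow> nat \<Rightarrow> 'a \<Rightarrow> complex" where
  "tprod N c n \<omega> = (\<Prod>k<n. 1 + \<i> * xs N c k \<omega>)"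

lemma xs_meas: assumes "k < n" shows "xs N c k \<in> borel_measurable (G n)"
proof -
  have [measurable]: "u j \<in> borel_measurable (G n)" if "j < k \<or> j = k" for j
    using adapted_le that assms by force
  have [measurable]: "(\<lambda>\<omega>. \<Sum>j<k. (u j \<omega> / sqrt N)\<^sup>2) \<in> borel_measurable (G n)"
    by (rule borel_measurable_sum) simp
  show ?thesis unfolding xs_def stopped_def by measurable
qed

text \<open>Whether the \<open>k\<close>-th increment is truncated depends on earlier increments
  only. The weight \<open>w\<close> is therefore predictable, and truncation preserves the
  martingale difference property.\<close>

lemma xs_eq: "\<exists>w\<in>borel_measurable (G k). (\<forall>\<omega>. \<bar>w \<omega>\<bar> \<le> 1 / \<bar>sqrt N\<bar>) \<and> xs N c k = (\<lambda>\<omega>. u k \<omega> * w \<omega>)"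
proof (intro bexI conjI)
  let ?w = "\<lambda>\<omega>. (if (\<Sum>j<k. (u j \<omega> / sqrt N)\<^sup>2) \<le> c then 1 / sqrt N else 0)"
  show "xs N c k = (\<lambda>\<omega>. u k \<omega> * ?w \<omega>)" by (auto simp: xs_def stopped_def)
  show "\<forall>\<omega>. \<bar>?w \<omega>\<bar> \<le> 1 / \<bar>sqrt N\<bar>" by auto
  have [measurable]: "(\<lambda>\<omega>. \<Sum>j<k. (u j \<omega> / sqrt N)\<^sup>2) \<in> borel_measurable (G k)"
    by (intro borel_measurable_sum borel_measurable_power borel_measurable_divide borel_measurable_const) (auto intro: adapted_le)
  show "?w \<in> borel_measurable (G k)" by measurable
qed

lemma xs_M [measurable]: "xs N c k \<in> borel_measurable M"
  by (rule meas_G_M[OF xs_meas[of k "Suc k"]]) simp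

lemma xs_bdd: assumes "\<omega> \<in> space M" "1 \<le> N" shows "\<bar>xs N c k \<omega>\<bar> \<le> b k"
proof -
  have "\<bar>u k \<omega> / sqrt N\<bar> = \<bar>u k \<omega>\<bar> / sqrt N" using assms(2) by simp
  also have "\<dots> \<le> \<bar>u k \<omega>\<bar> / 1" using assms(2) by (intro divide_left_mono) auto
  finally have "\<bar>u k \<omega> / sqrt N\<bar> \<le> \<bar>u k \<omega>\<bar>" by simp
  then show ?thesis using bdd[OF assms(1), of k] b_nonneg[of k] by (auto simp: xs_def stopped_def)
qed

lemma tprod_meas: "tprod N c n \<in> borel_measurable (G n)"
  unfolding tprod_def
  by (intro borel_measurable_prod borel_measurable_add borel_measurable_times borel_measurable_const
      measurable_compose[OF xs_meas borel_measurable_of_real]) auto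

lemma tprod_M [measurable]: "tprod N c n \<in> borel_measurable M"
  by (rule measurable_from_subalg[OF sub tprod_meas])

lemma tprod_bdd:
  assumes "\<omega> \<in> space M" "1 \<le> N" shows "cmod (tprod N c n \<omega>) \<le> (\<Prod>k<n. 1 + b k)"
  unfolding tprod_def prod_norm[symmetric]
proof (intro prod_mono conjI)
  fix k
  have "cmod (1 + \<i> * xs N c k \<omega>) \<le> 1 + \<bar>xs N c k \<omega>\<bar>"
    using norm_triangle_ineq[of 1 "\<i> * of_real (xs N c k \<omega>)"] by (simp add: norm_mult)
  then show "cmod (1 + \<i> * xs N c k \<omega>) \<le> 1 + b k" using xs_bdd[OF assms, of c k] by linarith
qed simp

lemma cmod_tprod_sq: "(cmod (tprod N c n \<omega>))\<^sup>2 = (\<Prod>k<n. 1 + (xs N c k \<omega>)\<^sup>2)"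
  unfolding tprod_def prod_norm[symmetric] prod_power_distrib by (simp add: cmod_power2)

lemma expectation_cmod_tprod_sq:
  assumes N: "1 \<le> N" and c: "0 \<le> c" and C: "(\<integral>\<omega>. (\<Sum>k<n. (u k \<omega>)\<^sup>2) / N \<partial>M) \<le> C"
  shows "(\<integral>\<omega>. (cmod (tprod N c n \<omega>))\<^sup>2 \<partial>M) \<le> exp c * (1 + C)"
proof -
  have i: "integrable M (\<lambda>\<omega>. (\<Sum>k<n. (u k \<omega>)\<^sup>2) / N)"
    by (rule integrable_boundedI[where B="(\<Sum>k<n. (b k)\<^sup>2) / N"])
      (use N bdd in \<open>auto simp: sum_nonneg power2_le_iff_abs_le b_nonneg intro!: divide_right_mono sum_mono\<close>)
  have "(\<integral>\<omega>. (cmod (tprod N c n \<omega>))\<^sup>2 \<partial>M) \<le> (\<integral>\<omega>. exp c * (1 + (\<Sum>k<n. (u k \<omega>)\<^sup>2) / N) \<partial>M)"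
  proof (rule integral_mono)
    show "integrable M (\<lambda>\<omega>. (cmod (tprod N c n \<omega>))\<^sup>2)"
      by (rule integrable_boundedI[where B="(\<Prod>k<n. 1 + b k)\<^sup>2"])
        (use tprod_bdd[OF _ N] in \<open>auto intro!: power_mono\<close>)
    show "integrable M (\<lambda>\<omega>. exp c * (1 + (\<Sum>k<n. (u k \<omega>)\<^sup>2) / N))" using i by simp
    fix \<omega>
    show "(cmod (tprod N c n \<omega>))\<^sup>2 \<le> exp c * (1 + (\<Sum>k<n. (u k \<omega>)\<^sup>2) / N)"
      unfolding cmod_tprod_sq xs_def
      using stopped_prod_le[OF c, of "\<lambda>j. u j \<omega> / sqrt N" n] N
      by (simp add: power_divide sum_divide_distrib)
  qed
  also have "\<dots> = exp c * (1 + (\<integral>\<omega>. (\<Sum>k<n. (u k \<omega>)\<^sup>2) / N \<partial>M))" using i by (simp add: prob_space)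
  also have "\<dots> \<le> exp c * (1 + C)" using C by simp
  finally show ?thesis .
qed

text \<open>Passing from \<open>n\<close> to \<open>Suc n\<close> adds \<i> times the product of
  \<open>tprod\<close> and the truncated increment. Against the \<open>G n\<close>-measurable
  \<open>tprod * Y\<close> that increment integrates to 0. Since \<open>mart\<close> speaks of real
  weights, the function \<open>g\<close> below is taken to be \<open>Re\<close> and
  \<open>Im\<close> in turn.\<close>

lemma expectation_tprod_mult:
  fixes Y :: "'a \<Rightarrow> real"
  assumes N: "1 \<le> N" and Y: "Y \<in> borel_measurable (G m)" "\<And>\<omega>. \<omega> \<in> space M \<Longrightarrow> \<bar>Y \<omega>\<bar> \<le> B" and "m \<le> n"
  shows "(\<integral>\<omega>. tprod N c n \<omega> * Y \<omega> \<partial>M) = (\<integral>\<omega>. tprod N c m \<omega> * Y \<omega> \<partial>M)"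
  using \<open>m \<le> n\<close>
proof (induction n rule: dec_induct)
  case (step n)
  have [measurable]: "Y \<in> borel_measurable M" by (rule meas_G_M[OF Y(1)])
  have B: "0 \<le> B" using Y(2) not_empty by force
  let ?P = "\<Prod>k<n. 1 + b k"
  have P: "0 \<le> ?P" by (auto intro!: prod_nonneg simp: b_nonneg add_nonneg_nonneg)
  obtain w where w: "w \<in> borel_measurable (G n)" "\<And>\<omega>. \<bar>w \<omega>\<bar> \<le> 1 / \<bar>sqrt N\<bar>" "xs N c n = (\<lambda>\<omega>. u n \<omega> * w \<omega>)"
    using xs_eq[of n N c] by blast
  have Yn: "Y \<in> borel_measurable (G n)" using meas_G_mono[OF Y(1)] step by simp
  have tY: "cmod (tprod N c n \<omega> * Y \<omega>) \<le> ?P * B" if "\<omega> \<in> space M" for \<omega>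
    unfolding norm_mult using tprod_bdd[OF that N] Y(2)[OF that] P by (intro mult_mono) auto
  have z: "(\<integral>\<omega>. u n \<omega> * (w \<omega> * g (tprod N c n \<omega> * Y \<omega>)) \<partial>M) = 0"
    if g: "g \<in> borel_measurable borel" "\<And>z. \<bar>g z\<bar> \<le> cmod z" for g :: "complex \<Rightarrow> real"
  proof (rule mart[of _ _ "1 / \<bar>sqrt N\<bar> * (?P * B)"])
    note [measurable] = w(1) g(1) Yn tprod_meas[of N c n]
    show "(\<lambda>\<omega>. w \<omega> * g (tprod N c n \<omega> * Y \<omega>)) \<in> borel_measurable (G n)" by measurable
    fix \<omega> assume "\<omega> \<in> space M"
    then show "\<bar>w \<omega> * g (tprod N c n \<omega> * Y \<omega>)\<bar> \<le> 1 / \<bar>sqrt N\<bar> * (?P * B)"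
      unfolding abs_mult using w(2) order_trans[OF g(2) tY] by (intro mult_mono) auto
  qed
  define f where "f = (\<lambda>\<omega>. tprod N c n \<omega> * Y \<omega> * of_real (xs N c n \<omega>))"
  have fi: "integrable M f"
  proof (rule integrable_boundedI)
    fix \<omega> assume \<omega>: "\<omega> \<in> space M"
    have "norm (f \<omega>) = cmod (tprod N c n \<omega> * Y \<omega>) * \<bar>xs N c n \<omega>\<bar>" by (simp add: f_def norm_mult)
    also have "\<dots> \<le> (?P * B) * b n"
      using tY[OF \<omega>] xs_bdd[OF \<omega> N] P B by (intro mult_mono) auto
    finally show "norm (f \<omega>) \<le> (?P * B) * b n" .
  qed (simp add: f_def)
  have "(\<integral>\<omega>. f \<omega> \<partial>M) = 0"
  proof (rule complex_eqI)
    have "Re (\<integral>\<omega>. f \<omega> \<partial>M) = (\<integral>\<omega>. Re (f \<omega>) \<partial>M)" using fi by simp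
    also have "\<dots> = (\<integral>\<omega>. u n \<omega> * (w \<omega> * Re (tprod N c n \<omega> * Y \<omega>)) \<partial>M)"
      by (intro Bochner_Integration.integral_cong) (auto simp: f_def w(3) algebra_simps)
    also have "\<dots> = 0" by (rule z) (auto simp: abs_Re_le_cmod)
    finally show "Re (\<integral>\<omega>. f \<omega> \<partial>M) = Re 0" by simp
    have "Im (\<integral>\<omega>. f \<omega> \<partial>M) = (\<integral>\<omega>. Im (f \<omega>) \<partial>M)" using fi by simp
    also have "\<dots> = (\<integral>\<omega>. u n \<omega> * (w \<omega> * Im (tprod N c n \<omega> * Y \<omega>)) \<partial>M)"
      by (intro Bochner_Integration.integral_cong) (auto simp: f_def w(3) algebra_simps)
    also have "\<dots> = 0" by (rule z) (auto simp: abs_Im_le_cmod)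
    finally show "Im (\<integral>\<omega>. f \<omega> \<partial>M) = Im 0" by simp
  qed
  moreover have "integrable M (\<lambda>\<omega>. tprod N c n \<omega> * Y \<omega>)"
    by (rule integrable_boundedI[where B="?P * B"]) (use tY in auto)
  moreover have "tprod N c (Suc n) \<omega> * Y \<omega> = tprod N c n \<omega> * Y \<omega> + \<i> * f \<omega>" for \<omega>
    by (simp add: tprod_def f_def algebra_simps)
  ultimately show ?case using step fi by simp
qed simp

end

context bounded_mart_diff begin

text \<open>A weighted form of Cauchy--Schwarz: |t d| \<le> \<epsilon> |t|^2 + d^2 / \<epsilon>. The
  second moment of \<open>tprod\<close> is bounded independently of \<open>n\<close>, so that of
  \<open>d\<close> decides.\<close>

lemma tprod_mult_small:
  fixes d :: "'a \<Rightarrow> real"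
  assumes N: "1 \<le> N" and c: "0 \<le> c" and C: "(\<integral>\<omega>. (\<Sum>k<n. (u k \<omega>)\<^sup>2) / N \<partial>M) \<le> C"
    and d: "d \<in> borel_measurable M" "\<And>\<omega>. \<bar>d \<omega>\<bar> \<le> B" and e: "0 < \<epsilon>" "(\<integral>\<omega>. (d \<omega>)\<^sup>2 \<partial>M) \<le> \<epsilon>\<^sup>2"
  shows "cmod (\<integral>\<omega>. tprod N c n \<omega> * d \<omega> \<partial>M) \<le> \<epsilon> * (exp c * (1 + C) + 1)"
proof -
  have B: "0 \<le> B" using d(2)[of undefined] by linarith
  note [measurable] = d(1)
  have i1: "integrable M (\<lambda>\<omega>. (cmod (tprod N c n \<omega>))\<^sup>2)"
    by (rule integrable_boundedI[where B="(\<Prod>k<n. 1 + b k)\<^sup>2"])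
      (use tprod_bdd[OF _ N] in \<open>auto intro!: power_mono\<close>)
  have i2: "integrable M (\<lambda>\<omega>. (d \<omega>)\<^sup>2)"
    by (rule integrable_boundedI[where B="B\<^sup>2"]) (use d B in \<open>auto simp: power2_le_iff_abs_le\<close>)
  have i3: "integrable M (\<lambda>\<omega>. cmod (tprod N c n \<omega> * d \<omega>))"
  proof (rule integrable_boundedI)
    fix \<omega> assume "\<omega> \<in> space M"
    then show "norm (cmod (tprod N c n \<omega> * d \<omega>)) \<le> (\<Prod>k<n. 1 + b k) * B"
      using tprod_bdd[OF _ N, of \<omega> c n] d(2)[of \<omega>] b_nonneg
      by (auto simp: norm_mult intro!: mult_mono prod_nonneg add_nonneg_nonneg)
  qed simp
  have "cmod (\<integral>\<omega>. tprod N c n \<omega> * d \<omega> \<partial>M) \<le> (\<integral>\<omega>. cmod (tprod N c n \<omega> * d \<omega>) \<partial>M)"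
    by (rule integral_norm_bound)
  also have "\<dots> \<le> (\<integral>\<omega>. \<epsilon> * (cmod (tprod N c n \<omega>))\<^sup>2 + (d \<omega>)\<^sup>2 / \<epsilon> \<partial>M)"
  proof (rule integral_mono[OF i3])
    fix \<omega>
    let ?t = "cmod (tprod N c n \<omega>)"
    have "?t * \<bar>d \<omega>\<bar> * \<epsilon> \<le> (\<epsilon> * ?t\<^sup>2 + (d \<omega>)\<^sup>2 / \<epsilon>) * \<epsilon>"
    proof -
      have "2 * ((\<epsilon> * ?t) * \<bar>d \<omega>\<bar>) \<le> (\<epsilon> * ?t)\<^sup>2 + (d \<omega>)\<^sup>2"
        using sum_squares_bound[of "\<epsilon> * ?t" "\<bar>d \<omega>\<bar>"] by (simp add: mult.assoc)
      moreover have "0 \<le> (\<epsilon> * ?t) * \<bar>d \<omega>\<bar>" using e by auto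
      ultimately have "(\<epsilon> * ?t) * \<bar>d \<omega>\<bar> \<le> (\<epsilon> * ?t)\<^sup>2 + (d \<omega>)\<^sup>2" by linarith
      also have "\<dots> = (\<epsilon> * ?t\<^sup>2 + (d \<omega>)\<^sup>2 / \<epsilon>) * \<epsilon>"
        using e(1) by (simp add: power_mult_distrib distrib_right power2_eq_square)
      finally show ?thesis by (simp add: mult.commute mult.left_commute)
    qed
    then have "?t * \<bar>d \<omega>\<bar> \<le> \<epsilon> * ?t\<^sup>2 + (d \<omega>)\<^sup>2 / \<epsilon>" using e(1) by (rule mult_right_le_imp_le)
    then show "cmod (tprod N c n \<omega> * d \<omega>) \<le> \<epsilon> * ?t\<^sup>2 + (d \<omega>)\<^sup>2 / \<epsilon>" by (simp add: norm_mult)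
  qed (use i1 i2 in auto)
  also have "\<dots> = \<epsilon> * (\<integral>\<omega>. (cmod (tprod N c n \<omega>))\<^sup>2 \<partial>M) + (\<integral>\<omega>. (d \<omega>)\<^sup>2 \<partial>M) / \<epsilon>"
    using i1 i2 by simp
  also have "\<dots> \<le> \<epsilon> * (exp c * (1 + C)) + \<epsilon>\<^sup>2 / \<epsilon>"
    using expectation_cmod_tprod_sq[OF N c C] e by (intro add_mono mult_left_mono divide_right_mono) auto
  also have "\<dots> = \<epsilon> * (exp c * (1 + C) + 1)"
    using e by (simp add: power2_eq_square algebra_simps)
  finally show ?thesis .
qed

text \<open>Along a fixed initial segment the products \<open>tprod\<close> tend to 1, which is what makes the
  limit mixing: it may be tested against any variable measurable at a finite time.\<close>

lemma tprod_initial_tendsto: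
  fixes Y :: "'a \<Rightarrow> real" and N :: "nat \<Rightarrow> real"
  assumes N: "filterlim N at_top sequentially"
    and Y: "Y \<in> borel_measurable (G m)" "\<And>\<omega>. \<omega> \<in> space M \<Longrightarrow> \<bar>Y \<omega>\<bar> \<le> B"
  shows "(\<lambda>n. \<integral>\<omega>. tprod (N n) c m \<omega> * Y \<omega> \<partial>M) \<longlonglongrightarrow> (\<integral>\<omega>. Y \<omega> \<partial>M)"
proof -
  have [measurable]: "Y \<in> borel_measurable M" by (rule meas_G_M[OF Y(1)])
  have B: "0 \<le> B" using Y(2) not_empty by force
  \<comment> \<open>The bound on \<open>tprod\<close> that dominates the integrands requires
    \<open>1 \<le> N n\<close>, which holds eventually; hence the shift of the sequence by
    \<open>n0\<close>.\<close>
  have N1: "\<forall>\<^sub>F n in sequentially. 1 \<le> N n" using N by (simp add: filterlim_at_top)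
  then obtain n0 where n0: "\<And>n. n0 \<le> n \<Longrightarrow> 1 \<le> N n" by (auto simp: eventually_sequentially)
  have "(\<lambda>n. \<integral>\<omega>. tprod (N (n + n0)) c m \<omega> * Y \<omega> \<partial>M) \<longlonglongrightarrow> (\<integral>\<omega>. complex_of_real (Y \<omega>) \<partial>M)"
  proof (rule integral_dominated_convergence[where w="\<lambda>_. (\<Prod>k<m. 1 + b k) * B"])
    show "AE \<omega> in M. (\<lambda>n. tprod (N (n + n0)) c m \<omega> * Y \<omega>) \<longlonglongrightarrow> complex_of_real (Y \<omega>)"
    proof (rule AE_I2)
      fix \<omega> assume "\<omega> \<in> space M"
      have x0: "(\<lambda>n. xs (N n) c k \<omega>) \<longlonglongrightarrow> 0" for k
      proof (rule tendsto_rabs_zero_cancel, rule tendsto_sandwich[where f="\<lambda>_. 0"])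
        have "(\<lambda>n. inverse (sqrt (N n))) \<longlonglongrightarrow> 0"
          by (rule tendsto_inverse_0_at_top[OF filterlim_compose[OF sqrt_at_top N]])
        then show "(\<lambda>n. \<bar>u k \<omega>\<bar> * \<bar>inverse (sqrt (N n))\<bar>) \<longlonglongrightarrow> 0"
          by (intro tendsto_mult_right_zero tendsto_rabs_zero)
        show "\<forall>\<^sub>F n in sequentially. \<bar>xs (N n) c k \<omega>\<bar> \<le> \<bar>u k \<omega>\<bar> * \<bar>inverse (sqrt (N n))\<bar>"
          by (auto simp: xs_def stopped_def divide_inverse abs_mult)
      qed auto
      have "(\<lambda>n. tprod (N n) c m \<omega> * Y \<omega>) \<longlonglongrightarrow> (\<Prod>k<m. 1 + \<i> * of_real 0) * of_real (Y \<omega>)"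
        unfolding tprod_def by (intro tendsto_intros x0)
      then have "(\<lambda>n. tprod (N n) c m \<omega> * Y \<omega>) \<longlonglongrightarrow> complex_of_real (Y \<omega>)" by simp
      then show "(\<lambda>n. tprod (N (n + n0)) c m \<omega> * Y \<omega>) \<longlonglongrightarrow> complex_of_real (Y \<omega>)"
        by (rule LIMSEQ_ignore_initial_segment)
    qed
    fix n
    show "AE \<omega> in M. cmod (tprod (N (n + n0)) c m \<omega> * Y \<omega>) \<le> (\<Prod>k<m. 1 + b k) * B"
      using tprod_bdd[OF _ n0, of _ "n + n0" c m] Y(2) b_nonneg
      by (auto simp: norm_mult intro!: mult_mono prod_nonneg add_nonneg_nonneg)
  qed auto
  then show ?thesis
    using LIMSEQ_offset[of "\<lambda>n. \<integral>\<omega>. tprod (N n) c m \<omega> * Y \<omega> \<partial>M" n0] by simp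
qed

text \<open>\<open>iexp\<close> of the truncated sum equals \<open>tprod\<close> times exp (- R / 2)
  up to the error \<open>D\<close>, which a cubic sum bounds, and \<open>R\<close> tends to min s2
  c. In the main term exp (- R / 2) is exchanged for its limit \<open>Y\<close> and \<open>Y\<close>
  for the finite-time variable \<open>Ym\<close>; then the martingale property shortens the product
  to its first \<open>r m\<close> factors, which tend to 1.\<close>

lemma stopped_char_tendsto:
  fixes r :: "nat \<Rightarrow> nat" and s2 :: "'a \<Rightarrow> real"
  assumes r: "filterlim r at_top sequentially" and c: "0 \<le> c"
    and C: "\<And>n. 1 \<le> n \<Longrightarrow> (\<integral>\<omega>. (\<Sum>k<n. (u k \<omega>)\<^sup>2) / real n \<partial>M) \<le> C"
    and s2 [measurable]: "s2 \<in> borel_measurable M"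
    and lim: "AE \<omega> in M. (\<lambda>n. (\<Sum>k<r n. (u k \<omega>)\<^sup>2) / real (r n)) \<longlonglongrightarrow> s2 \<omega>"
    and mx: "AE \<omega> in M. \<forall>\<epsilon>>0. \<forall>\<^sub>F n in sequentially. \<forall>k<r n. (u k \<omega>)\<^sup>2 \<le> \<epsilon> * real (r n)"
  shows "(\<lambda>n. \<integral>\<omega>. iexp (\<Sum>k<r n. xs (real (r n)) c k \<omega>) \<partial>M)
           \<longlonglongrightarrow> (\<integral>\<omega>. exp (- min (s2 \<omega>) c / 2) \<partial>M)"
proof -
  let ?N = "\<lambda>n. real (r n)"
  let ?Q = "\<lambda>n \<omega>. (\<Sum>k<r n. (u k \<omega>)\<^sup>2) / real (r n)"
  define R where "R = (\<lambda>n \<omega>. \<Sum>k<r n. (xs (?N n) c k \<omega>)\<^sup>2)"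
  \<comment> \<open>\<open>s2\<close> is nonnegative almost everywhere only; \<open>max 0\<close>
    makes the bound \<open>Y \<le> 1\<close> hold at every point.\<close>
  define Y where "Y = (\<lambda>\<omega>. exp (- min (max 0 (s2 \<omega>)) c / 2))"
  define Ym where "Ym = (\<lambda>m \<omega>. exp (- min (?Q m \<omega>) c / 2))"
  have Nlim: "filterlim ?N at_top sequentially"
    by (rule filterlim_compose[OF filterlim_real_sequentially r])
  have r1: "\<forall>\<^sub>F n in sequentially. 1 \<le> r n" using r by (simp add: filterlim_at_top)
  have C0: "0 \<le> C"
    using order_trans[OF _ C[of 1]] by (auto intro!: integral_nonneg_AE)
  have Q0: "0 \<le> ?Q n \<omega>" for n \<omega> by (simp add: sum_nonneg)
  have Rm [measurable]: "R n \<in> borel_measurable M" for n unfolding R_def by measurable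
  have R0: "0 \<le> R n \<omega>" for n \<omega> by (simp add: R_def sum_nonneg)
  have Y01: "0 \<le> Y \<omega>" "Y \<omega> \<le> 1" for \<omega> using c by (auto simp: Y_def)
  have Ym01: "0 \<le> Ym m \<omega>" "Ym m \<omega> \<le> 1" for m \<omega> using c Q0[of \<omega> m] by (auto simp: Ym_def)
  have [measurable]: "Y \<in> borel_measurable M" "Ym m \<in> borel_measurable M" for m
    unfolding Y_def Ym_def by measurable
  have scale: "(\<Sum>k<n. (u k \<omega> / sqrt (real N))\<^sup>2) = (\<Sum>k<n. (u k \<omega>)\<^sup>2) / real N" for N n \<omega>
    by (simp add: power_divide sum_divide_distrib)
  have s20: "AE \<omega> in M. 0 \<le> s2 \<omega>"
    using lim by eventually_elim (rule tendsto_lowerbound, assumption, use Q0 in auto)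
  have YE: "AE \<omega> in M. Y \<omega> = exp (- min (s2 \<omega>) c / 2)"
    using s20 by eventually_elim (simp add: Y_def)
  have Ymlim: "AE \<omega> in M. (\<lambda>m. Ym m \<omega>) \<longlonglongrightarrow> Y \<omega>"
    using lim YE by eventually_elim (auto simp: Ym_def intro!: tendsto_intros)
  have sqz: "AE \<omega> in M. (\<lambda>n. R n \<omega>) \<longlonglongrightarrow> min (s2 \<omega>) c \<and>
      (\<forall>\<epsilon>>0. \<forall>\<^sub>F n in sequentially. \<forall>k<r n. \<bar>xs (?N n) c k \<omega>\<bar> \<le> \<epsilon>)"
    using lim mx
  proof eventually_elim
    case (elim \<omega>)
    have ev: "\<forall>\<^sub>F n in sequentially. \<forall>k<r n. (u k \<omega> / sqrt (?N n))\<^sup>2 \<le> \<epsilon>" if "\<epsilon> > 0" for \<epsilon>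
      using elim(2)[rule_format, OF that] r1
      by eventually_elim (auto simp: power_divide divide_le_eq)
    have "(\<lambda>n. R n \<omega>) \<longlonglongrightarrow> min (s2 \<omega>) c"
    proof (rule tendstoI)
      fix e :: real assume e: "0 < e"
      have "(\<lambda>n. min (?Q n \<omega>) c) \<longlonglongrightarrow> min (s2 \<omega>) c" by (intro tendsto_min elim tendsto_const)
      then have "\<forall>\<^sub>F n in sequentially. dist (min (?Q n \<omega>) c) (min (s2 \<omega>) c) < e / 2"
        using e by (intro tendstoD) auto
      moreover have "\<forall>\<^sub>F n in sequentially. \<forall>k<r n. (u k \<omega> / sqrt (?N n))\<^sup>2 \<le> e / 2"
        using e by (intro ev) auto
      ultimately show "\<forall>\<^sub>F n in sequentially. dist (R n \<omega>) (min (s2 \<omega>) c) < e"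
      proof eventually_elim
        case (elim n)
        have "min (?Q n \<omega>) c \<le> R n \<omega>" "R n \<omega> \<le> min (?Q n \<omega>) c + e / 2"
          using stopped_sum_ge[of "\<lambda>j. u j \<omega> / sqrt (?N n)" "r n" c]
            stopped_sum_le[OF c, of "e/2" "r n" "\<lambda>j. u j \<omega> / sqrt (?N n)"] elim(2) e
          by (auto simp: R_def xs_def scale)
        with elim(1) show ?case by (auto simp: dist_real_def abs_if split: if_splits)
      qed
    qed
    moreover have "\<forall>\<^sub>F n in sequentially. \<forall>k<r n. \<bar>xs (?N n) c k \<omega>\<bar> \<le> \<epsilon>" if "\<epsilon> > 0" for \<epsilon>
      using ev[of "\<epsilon>\<^sup>2"] that by (auto elim!: eventually_mono simp: xs_def stopped_def power2_le_iff_abs_le)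
    ultimately show ?case by blast
  qed
  define D where "D = (\<lambda>n \<omega>. iexp (\<Sum>k<r n. xs (?N n) c k \<omega>) - tprod (?N n) c (r n) \<omega> * exp (- R n \<omega> / 2))"
  have [measurable]: "D n \<in> borel_measurable M" for n unfolding D_def by measurable
  have prod1: "iexp (\<Sum>k<r n. xs (?N n) c k \<omega>) = (\<Prod>k<r n. iexp (xs (?N n) c k \<omega>))" for n \<omega>
    by (simp add: exp_sum sum_distrib_left)
  have prod2: "tprod (?N n) c (r n) \<omega> * exp (- R n \<omega> / 2)
      = (\<Prod>k<r n. (1 + \<i> * xs (?N n) c k \<omega>) * exp (- (xs (?N n) c k \<omega>)\<^sup>2 / 2))" for n \<omega>
  proof -
    have "exp (- R n \<omega> / 2) = (\<Prod>k<r n. exp (- (xs (?N n) c k \<omega>)\<^sup>2 / 2))"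
      unfolding R_def by (simp add: sum_divide_distrib sum_negf[symmetric] exp_sum flip: sum_negf)
    then show ?thesis by (simp add: tprod_def prod.distrib of_real_prod)
  qed
  have Dbd: "cmod (D n \<omega>) \<le> (\<Sum>k<r n. 2 * \<bar>xs (?N n) c k \<omega>\<bar> ^ 3)" for n \<omega>
    unfolding D_def prod1 prod2
    by (rule order_trans[OF norm_prod_diff];
        (rule cmod_gauss_factor_le_1 | (intro sum_mono, rule cmod_iexp_approx_quadratic) | simp))
  have Dbd2: "cmod (D n \<omega>) \<le> 2" for n \<omega>
  proof -
    have "cmod (tprod (?N n) c (r n) \<omega> * exp (- R n \<omega> / 2)) \<le> 1"
      unfolding prod2 prod_norm[symmetric] by (intro prod_le_1 conjI cmod_gauss_factor_le_1) auto
    moreover have "cmod (iexp (\<Sum>k<r n. xs (?N n) c k \<omega>)) = 1" by simp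
    ultimately show ?thesis unfolding D_def
      using norm_triangle_ineq4[of "iexp (\<Sum>k<r n. xs (?N n) c k \<omega>)" "tprod (?N n) c (r n) \<omega> * exp (- R n \<omega> / 2)"]
      by linarith
  qed
  have Dlim: "(\<lambda>n. \<integral>\<omega>. D n \<omega> \<partial>M) \<longlonglongrightarrow> (\<integral>\<omega>. 0 \<partial>M)"
  proof (rule integral_dominated_convergence[where w="\<lambda>_. 2"])
    show "AE \<omega> in M. (\<lambda>n. D n \<omega>) \<longlonglongrightarrow> 0"
      using sqz
    proof eventually_elim
      case (elim \<omega>)
      then have Rl: "(\<lambda>n. R n \<omega>) \<longlonglongrightarrow> min (s2 \<omega>) c" by blast
      obtain \<rho> where \<rho>: "\<And>n. R n \<omega> \<le> \<rho>" "0 < \<rho>"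
        using convergent_imp_Bseq[OF convergentI[OF Rl]] by (auto simp: Bseq_def abs_le_iff)
      show ?case
      proof (rule tendsto_norm_zero_cancel, rule tendstoI)
        fix e :: real assume e: "0 < e"
        \<comment> \<open>The cubic sum is at most the largest |xs| times \<open>R\<close>, and
          \<open>R\<close> stays below \<rho> along the path. With the factor 2 from
          \<open>Dbd\<close> the constant 4 leaves a bound of e / 2.\<close>
        have "\<forall>\<^sub>F n in sequentially. \<forall>k<r n. \<bar>xs (?N n) c k \<omega>\<bar> \<le> e / (4 * \<rho>)"
          using elim e \<rho>(2) by (simp add: zero_less_divide_iff)
        then show "\<forall>\<^sub>F n in sequentially. dist (norm (D n \<omega>)) 0 < e"
        proof eventually_elim
          case (elim n)
          have "cmod (D n \<omega>) \<le> (\<Sum>k<r n. 2 * \<bar>xs (?N n) c k \<omega>\<bar> ^ 3)" by (rule Dbd)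
          also have "\<dots> \<le> (\<Sum>k<r n. (e / (2 * \<rho>)) * (xs (?N n) c k \<omega>)\<^sup>2)"
          proof (rule sum_mono)
            fix k assume "k \<in> {..<r n}"
            then have "\<bar>xs (?N n) c k \<omega>\<bar> * (xs (?N n) c k \<omega>)\<^sup>2 \<le> e / (4 * \<rho>) * (xs (?N n) c k \<omega>)\<^sup>2"
              using elim by (intro mult_right_mono) auto
            then show "2 * \<bar>xs (?N n) c k \<omega>\<bar> ^ 3 \<le> (e / (2 * \<rho>)) * (xs (?N n) c k \<omega>)\<^sup>2"
              by (simp add: power3_eq_cube power2_eq_square mult.assoc)
          qed
          also have "\<dots> = (e / (2 * \<rho>)) * R n \<omega>" by (simp add: R_def sum_distrib_left)
          also have "\<dots> \<le> (e / (2 * \<rho>)) * \<rho>" using \<rho> e by (intro mult_left_mono) auto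
          also have "\<dots> < e" using e \<rho>(2) by simp
          finally show ?case by simp
        qed
      qed
    qed
  qed (use Dbd2 in auto)
  have tY: "(\<lambda>n. \<integral>\<omega>. tprod (?N n) c (r n) \<omega> * exp (- R n \<omega> / 2) \<partial>M) \<longlonglongrightarrow> (\<integral>\<omega>. Y \<omega> \<partial>M)"
  proof (rule tendstoI)
    fix e :: real assume e: "0 < e"
    \<comment> \<open>Each of the two applications of \<open>tprod_mult_small\<close> then costs e /
      8. The initial segment and the distance of the means of \<open>Ym m\<close> and
      \<open>Y\<close> cost e / 8 each as well, which leaves room below e.\<close>
    define \<epsilon> where "\<epsilon> = e / (8 * (exp c * (1 + C) + 1))"
    have A: "0 < exp c * (1 + C) + 1" using C0 by (auto intro: add_nonneg_pos)
    have \<epsilon>: "0 < \<epsilon>" "\<epsilon> * (exp c * (1 + C) + 1) = e / 8" proof -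
      have "e / (8 * A) * A = e / 8" if "0 < A" for A :: real using that by simp
      from this[OF A] show "\<epsilon> * (exp c * (1 + C) + 1) = e / 8" by (simp only: \<epsilon>_def)
    qed (use e A in \<open>simp add: \<epsilon>_def\<close>)
    have "(\<lambda>m. \<integral>\<omega>. (Y \<omega> - Ym m \<omega>)\<^sup>2 \<partial>M) \<longlonglongrightarrow> (\<integral>\<omega>. 0 \<partial>M)"
    proof (rule integral_dominated_convergence[where w="\<lambda>_. 1"])
      show "AE \<omega> in M. (\<lambda>m. (Y \<omega> - Ym m \<omega>)\<^sup>2) \<longlonglongrightarrow> 0"
        using Ymlim
      proof eventually_elim
        case (elim \<omega>)
        have "(\<lambda>m. (Y \<omega> - Ym m \<omega>)\<^sup>2) \<longlonglongrightarrow> (Y \<omega> - Y \<omega>)\<^sup>2" by (intro tendsto_intros elim)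
        then show ?case by simp
      qed
      show "AE \<omega> in M. norm ((Y \<omega> - Ym m \<omega>)\<^sup>2) \<le> 1" for m
        using Y01 Ym01[of m] by (auto simp: abs_square_le_1 abs_le_iff intro!: AE_I2) (smt (verit))+
    qed auto
    then have 1: "\<forall>\<^sub>F m in sequentially. (\<integral>\<omega>. (Y \<omega> - Ym m \<omega>)\<^sup>2 \<partial>M) < \<epsilon>\<^sup>2"
      using \<epsilon>(1) by (intro order_tendstoD(2)) auto
    have "(\<lambda>m. \<integral>\<omega>. Ym m \<omega> \<partial>M) \<longlonglongrightarrow> (\<integral>\<omega>. Y \<omega> \<partial>M)"
      by (rule integral_dominated_convergence[where w="\<lambda>_. 1"]) (use Ymlim Ym01 in auto)
    then have "\<forall>\<^sub>F m in sequentially. dist (\<integral>\<omega>. Ym m \<omega> \<partial>M) (\<integral>\<omega>. Y \<omega> \<partial>M) < e / 8"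
      using e by (intro tendstoD) auto
    with 1 have "\<forall>\<^sub>F m in sequentially. (\<integral>\<omega>. (Y \<omega> - Ym m \<omega>)\<^sup>2 \<partial>M) < \<epsilon>\<^sup>2 \<and>
        dist (\<integral>\<omega>. Ym m \<omega> \<partial>M) (\<integral>\<omega>. Y \<omega> \<partial>M) < e / 8" by eventually_elim auto
    \<comment> \<open>\<open>m\<close> is fixed before \<open>n\<close> grows, so that the test
      variable \<open>Ym m\<close> belongs to the fixed time \<open>r m\<close>.\<close>
    then obtain m where m: "(\<integral>\<omega>. (Y \<omega> - Ym m \<omega>)\<^sup>2 \<partial>M) < \<epsilon>\<^sup>2"
        "dist (\<integral>\<omega>. Ym m \<omega> \<partial>M) (\<integral>\<omega>. Y \<omega> \<partial>M) < e / 8"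
      by (auto simp: eventually_sequentially)
    have YmG: "Ym m \<in> borel_measurable (G (r m))"
    proof -
      have "(\<lambda>\<omega>. \<Sum>k<r m. (u k \<omega>)\<^sup>2) \<in> borel_measurable (G (r m))"
        by (intro borel_measurable_sum borel_measurable_power adapted_le) auto
      then show ?thesis unfolding Ym_def by measurable
    qed
    have "(\<lambda>n. \<integral>\<omega>. tprod (?N n) c (r m) \<omega> * Ym m \<omega> \<partial>M) \<longlonglongrightarrow> (\<integral>\<omega>. Ym m \<omega> \<partial>M)"
      by (rule tprod_initial_tendsto[OF Nlim YmG, of 1]) (use Ym01 in auto)
    then have 2: "\<forall>\<^sub>F n in sequentially. dist (\<integral>\<omega>. tprod (?N n) c (r m) \<omega> * Ym m \<omega> \<partial>M) (\<integral>\<omega>. Ym m \<omega> \<partial>M) < e / 8"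
      using e by (intro tendstoD) auto
    have "(\<lambda>n. \<integral>\<omega>. (exp (- R n \<omega> / 2) - Y \<omega>)\<^sup>2 \<partial>M) \<longlonglongrightarrow> (\<integral>\<omega>. 0 \<partial>M)"
    proof (rule integral_dominated_convergence[where w="\<lambda>_. 1"])
      show "AE \<omega> in M. (\<lambda>n. (exp (- R n \<omega> / 2) - Y \<omega>)\<^sup>2) \<longlonglongrightarrow> 0"
        using sqz YE
      proof eventually_elim
        case (elim \<omega>)
        then have "(\<lambda>n. (exp (- R n \<omega> / 2) - Y \<omega>)\<^sup>2) \<longlonglongrightarrow> (exp (- min (s2 \<omega>) c / 2) - Y \<omega>)\<^sup>2"
          by (intro tendsto_intros) auto
        then show ?case using elim by simp
      qed
      have "\<bar>exp (- R n \<omega> / 2) - Y \<omega>\<bar> \<le> 1" for n \<omega>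
      proof -
        have "exp (- R n \<omega> / 2) \<le> 1" using R0[of n \<omega>] by simp
        then show ?thesis using Y01[of \<omega>] exp_gt_zero[of "- R n \<omega> / 2"] by linarith
      qed
      then show "AE \<omega> in M. norm ((exp (- R n \<omega> / 2) - Y \<omega>)\<^sup>2) \<le> 1" for n
        by (simp add: abs_square_le_1)
    qed auto
    then have 3: "\<forall>\<^sub>F n in sequentially. (\<integral>\<omega>. (exp (- R n \<omega> / 2) - Y \<omega>)\<^sup>2 \<partial>M) < \<epsilon>\<^sup>2"
      using \<epsilon>(1) by (intro order_tendstoD(2)) auto
    have 4: "\<forall>\<^sub>F n in sequentially. r m \<le> r n" using r by (simp add: filterlim_at_top)
    show "\<forall>\<^sub>F n in sequentially. dist (\<integral>\<omega>. tprod (?N n) c (r n) \<omega> * exp (- R n \<omega> / 2) \<partial>M)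
        (complex_of_real (\<integral>\<omega>. Y \<omega> \<partial>M)) < e"
      using 2 3 4 r1
    proof eventually_elim
      case (elim n)
      let ?T = "tprod (?N n) c (r n)"
      have N1: "1 \<le> ?N n" using elim by simp
      have CN: "(\<integral>\<omega>. (\<Sum>k<r n. (u k \<omega>)\<^sup>2) / ?N n \<partial>M) \<le> C" by (rule C) (use elim in simp)
      have iT: "integrable M (\<lambda>\<omega>. ?T \<omega> * complex_of_real (d \<omega>))"
        if [measurable]: "d \<in> borel_measurable M" and d: "\<And>\<omega>. \<bar>d \<omega>\<bar> \<le> 1" for d
      proof (rule integrable_boundedI)
        fix \<omega> assume "\<omega> \<in> space M"
        then show "cmod (?T \<omega> * complex_of_real (d \<omega>)) \<le> (\<Prod>k<r n. 1 + b k) * 1"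
          unfolding norm_mult using tprod_bdd[OF _ N1, of \<omega> c "r n"] d[of \<omega>] b_nonneg
          by (intro mult_mono) (auto intro!: prod_nonneg add_nonneg_nonneg)
      qed simp
      have eR: "\<bar>exp (- R n \<omega> / 2)\<bar> \<le> 1" for \<omega> using R0[of n \<omega>] by simp
      have aY: "\<bar>Y \<omega>\<bar> \<le> 1" "\<bar>Ym m \<omega>\<bar> \<le> 1" for \<omega> using Y01[of \<omega>] Ym01[of m \<omega>] by auto
      have "cmod (\<integral>\<omega>. ?T \<omega> * of_real (exp (- R n \<omega> / 2) - Y \<omega>) \<partial>M) \<le> \<epsilon> * (exp c * (1 + C) + 1)"
      proof (rule tprod_mult_small[OF N1 c CN _ _ \<epsilon>(1), where B=2])
        show "\<bar>exp (- R n \<omega> / 2) - Y \<omega>\<bar> \<le> 2" for \<omega> using eR[of \<omega>] aY[of \<omega>] by linarith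
      qed (use elim in auto)
      then have a: "dist (\<integral>\<omega>. ?T \<omega> * exp (- R n \<omega> / 2) \<partial>M) (\<integral>\<omega>. ?T \<omega> * Y \<omega> \<partial>M) \<le> e / 8"
        using iT[of "\<lambda>\<omega>. exp (- R n \<omega> / 2)"] iT[of Y] eR aY
        by (simp add: dist_norm right_diff_distrib \<epsilon>(2) del: of_real_exp)
      have "cmod (\<integral>\<omega>. ?T \<omega> * of_real (Y \<omega> - Ym m \<omega>) \<partial>M) \<le> \<epsilon> * (exp c * (1 + C) + 1)"
      proof (rule tprod_mult_small[OF N1 c CN _ _ \<epsilon>(1), where B=2])
        show "\<bar>Y \<omega> - Ym m \<omega>\<bar> \<le> 2" for \<omega> using aY[of \<omega>] by linarith
      qed (use m in auto)
      then have b: "dist (\<integral>\<omega>. ?T \<omega> * Y \<omega> \<partial>M) (\<integral>\<omega>. ?T \<omega> * Ym m \<omega> \<partial>M) \<le> e / 8"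
        using iT[of Y] iT[of "Ym m"] aY by (simp add: dist_norm right_diff_distrib \<epsilon>(2))
      have c: "(\<integral>\<omega>. ?T \<omega> * Ym m \<omega> \<partial>M) = (\<integral>\<omega>. tprod (?N n) c (r m) \<omega> * Ym m \<omega> \<partial>M)"
        by (rule expectation_tprod_mult[OF N1 YmG, of 1]) (use aY elim in auto)
      have d: "dist (complex_of_real (\<integral>\<omega>. Ym m \<omega> \<partial>M)) (complex_of_real (\<integral>\<omega>. Y \<omega> \<partial>M)) < e / 8"
        using m(2) by (simp add: dist_norm flip: of_real_diff)
      have "dist (\<integral>\<omega>. ?T \<omega> * exp (- R n \<omega> / 2) \<partial>M) (complex_of_real (\<integral>\<omega>. Y \<omega> \<partial>M)) < e / 8 + e / 8 + (e / 8 + e / 8)"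
        using a b elim(1) d unfolding c
        by (smt (verit, best) dist_triangle)
      then show ?case using e by simp
    qed
  qed
  have "(\<lambda>n. (\<integral>\<omega>. D n \<omega> \<partial>M) + (\<integral>\<omega>. tprod (?N n) c (r n) \<omega> * exp (- R n \<omega> / 2) \<partial>M))
      \<longlonglongrightarrow> 0 + complex_of_real (\<integral>\<omega>. Y \<omega> \<partial>M)"
    using Dlim by (intro tendsto_add tY) simp
  moreover have "(\<integral>\<omega>. D n \<omega> \<partial>M) + (\<integral>\<omega>. tprod (?N n) c (r n) \<omega> * exp (- R n \<omega> / 2) \<partial>M)
      = (\<integral>\<omega>. iexp (\<Sum>k<r n. xs (?N n) c k \<omega>) \<partial>M)" for n
  proof -
    have 1: "integrable M (\<lambda>\<omega>. iexp (\<Sum>k<r n. xs (?N n) c k \<omega>))"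
      by (rule integrable_boundedI[of _ 1]) auto
    have 2: "integrable M (D n)" by (rule integrable_boundedI[of _ 2]) (use Dbd2 in auto)
    have eq: "tprod (?N n) c (r n) \<omega> * exp (- R n \<omega> / 2) = iexp (\<Sum>k<r n. xs (?N n) c k \<omega>) - D n \<omega>" for \<omega>
      by (simp add: D_def)
    show ?thesis unfolding eq using 1 2 by (subst Bochner_Integration.integral_diff) auto
  qed
  moreover have "(\<integral>\<omega>. Y \<omega> \<partial>M) = (\<integral>\<omega>. exp (- min (s2 \<omega>) c / 2) \<partial>M)"
    by (rule integral_cong_AE) (use YE in auto)
  ultimately show ?thesis by simp
qed

text \<open>By Markov's inequality the average of the squares exceeds \<open>c\<close> with
  probability at most C / c, uniformly in \<open>n\<close>. Off this event nothing is truncated, and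
  on it the two exponentials differ by at most 2. So \<open>c\<close> is chosen large before
  \<open>n\<close>.\<close>

theorem martingale_char_tendsto:
  fixes r :: "nat \<Rightarrow> nat" and s2 :: "'a \<Rightarrow> real"
  assumes r: "filterlim r at_top sequentially"
    and C: "\<And>n. 1 \<le> n \<Longrightarrow> (\<integral>\<omega>. (\<Sum>k<n. (u k \<omega>)\<^sup>2) / real n \<partial>M) \<le> C"
    and s2 [measurable]: "s2 \<in> borel_measurable M"
    and lim: "AE \<omega> in M. (\<lambda>n. (\<Sum>k<r n. (u k \<omega>)\<^sup>2) / real (r n)) \<longlonglongrightarrow> s2 \<omega>"
    and mx: "AE \<omega> in M. \<forall>\<epsilon>>0. \<forall>\<^sub>F n in sequentially. \<forall>k<r n. (u k \<omega>)\<^sup>2 \<le> \<epsilon> * real (r n)"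
  shows "(\<lambda>n. \<integral>\<omega>. iexp ((\<Sum>k<r n. u k \<omega>) / sqrt (real (r n))) \<partial>M)
           \<longlonglongrightarrow> (\<integral>\<omega>. exp (- s2 \<omega> / 2) \<partial>M)"
proof (rule tendstoI)
  fix e :: real assume e: "0 < e"
  have C0: "0 \<le> C" using order_trans[OF _ C[of 1]] by (auto intro!: integral_nonneg_AE)
  have s20: "AE \<omega> in M. 0 \<le> s2 \<omega>"
    using lim by eventually_elim (rule tendsto_lowerbound, assumption, auto simp: sum_nonneg)
  have "(\<lambda>c. \<integral>\<omega>. exp (- min (s2 \<omega>) (real c) / 2) \<partial>M) \<longlonglongrightarrow> (\<integral>\<omega>. exp (- s2 \<omega> / 2) \<partial>M)"
  proof (rule integral_dominated_convergence[where w="\<lambda>_. 1"])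
    show "AE \<omega> in M. (\<lambda>c. exp (- min (s2 \<omega>) (real c) / 2)) \<longlonglongrightarrow> exp (- s2 \<omega> / 2)"
    proof (intro AE_I2 tendsto_eventually)
      fix \<omega>
      have "\<forall>\<^sub>F c in sequentially. s2 \<omega> \<le> real c"
        using filterlim_real_sequentially by (simp add: filterlim_at_top)
      then show "\<forall>\<^sub>F c in sequentially. exp (- min (s2 \<omega>) (real c) / 2) = exp (- s2 \<omega> / 2)"
        by eventually_elim simp
    qed
    show "AE \<omega> in M. norm (exp (- min (s2 \<omega>) (real c) / 2)) \<le> 1" for c
      using s20 by eventually_elim simp
  qed auto
  then have "\<forall>\<^sub>F c in sequentially. dist (\<integral>\<omega>. exp (- min (s2 \<omega>) (real c) / 2) \<partial>M) (\<integral>\<omega>. exp (- s2 \<omega> / 2) \<partial>M) < e / 3"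
    using e by (intro tendstoD) auto
  \<comment> \<open>6 C / e makes the truncation error 2 C / c at most e / 3; the summand 1 keeps
    \<open>c\<close> positive when C = 0.\<close>
  moreover have "\<forall>\<^sub>F c in sequentially. 6 * C / e + 1 \<le> real c"
    using filterlim_real_sequentially by (simp add: filterlim_at_top)
  ultimately have "\<forall>\<^sub>F c in sequentially. dist (\<integral>\<omega>. exp (- min (s2 \<omega>) (real c) / 2) \<partial>M) (\<integral>\<omega>. exp (- s2 \<omega> / 2) \<partial>M) < e / 3
      \<and> 6 * C / e + 1 \<le> real c" by eventually_elim simp
  then obtain c :: nat where c: "dist (\<integral>\<omega>. exp (- min (s2 \<omega>) (real c) / 2) \<partial>M) (\<integral>\<omega>. exp (- s2 \<omega> / 2) \<partial>M) < e / 3"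
      "6 * C / e + 1 \<le> real c" by (auto simp: eventually_sequentially)
  have cpos: "0 < real c" using c(2) C0 e by (smt (verit) divide_nonneg_pos)
  have cC: "2 * (C / real c) \<le> e / 3" using c(2) e cpos by (simp add: field_simps)
  have "\<forall>\<^sub>F n in sequentially. 1 \<le> r n" using r by (simp add: filterlim_at_top)
  moreover have "\<forall>\<^sub>F n in sequentially. dist (\<integral>\<omega>. iexp (\<Sum>k<r n. xs (real (r n)) (real c) k \<omega>) \<partial>M)
           (complex_of_real (\<integral>\<omega>. exp (- min (s2 \<omega>) (real c) / 2) \<partial>M)) < e / 3"
    by (rule tendstoD[OF stopped_char_tendsto[OF r _ C s2 lim mx]]) (use e in auto)
  ultimately show "\<forall>\<^sub>F n in sequentially. dist (\<integral>\<omega>. iexp ((\<Sum>k<r n. u k \<omega>) / sqrt (real (r n))) \<partial>M)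
      (complex_of_real (\<integral>\<omega>. exp (- s2 \<omega> / 2) \<partial>M)) < e"
  proof eventually_elim
    case (elim n)
    let ?N = "real (r n)"
    let ?Q = "\<lambda>\<omega>. (\<Sum>k<r n. (u k \<omega>)\<^sup>2) / ?N"
    let ?A = "{\<omega> \<in> space M. real c \<le> ?Q \<omega>}"
    let ?f = "\<lambda>\<omega>. iexp ((\<Sum>k<r n. u k \<omega>) / sqrt ?N)" and ?g = "\<lambda>\<omega>. iexp (\<Sum>k<r n. xs ?N (real c) k \<omega>)"
    have iQ: "integrable M ?Q"
      by (rule integrable_boundedI[where B="(\<Sum>k<r n. (b k)\<^sup>2) / ?N"])
        (use elim bdd in \<open>auto simp: sum_nonneg power2_le_iff_abs_le b_nonneg intro!: divide_right_mono sum_mono\<close>)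
    have "measure M ?A \<le> (\<integral>\<omega>. ?Q \<omega> \<partial>M) / real c"
      using integral_Markov_inequality_measure[OF iQ, of "space M" "real c"] cpos by (simp add: sum_nonneg)
    also have "\<dots> \<le> C / real c" using C[of "r n"] elim cpos by (intro divide_right_mono) auto
    finally have PA: "measure M ?A \<le> C / real c" .
    have if': "integrable M ?f" "integrable M ?g" by (rule integrable_boundedI[of _ 1]; simp)+
    have "dist (\<integral>\<omega>. ?f \<omega> \<partial>M) (\<integral>\<omega>. ?g \<omega> \<partial>M) \<le> (\<integral>\<omega>. cmod (?f \<omega> - ?g \<omega>) \<partial>M)"
      unfolding dist_norm using if' integral_norm_bound[of M "\<lambda>\<omega>. ?f \<omega> - ?g \<omega>"] by simp
    also have "\<dots> \<le> (\<integral>\<omega>. 2 * indicator ?A \<omega> \<partial>M)"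
    proof (rule integral_mono)
      fix \<omega> assume \<omega>: "\<omega> \<in> space M"
      show "cmod (?f \<omega> - ?g \<omega>) \<le> 2 * indicator ?A \<omega>"
      proof (cases "\<omega> \<in> ?A")
        case True
        then show ?thesis using norm_triangle_ineq4[of "?f \<omega>" "?g \<omega>"] by simp
      next
        case False
        have "(\<Sum>k<r n. (u k \<omega> / sqrt ?N)\<^sup>2) \<le> real c"
          using False \<omega> by (simp add: power_divide sum_divide_distrib)
        then have "xs ?N (real c) k \<omega> = u k \<omega> / sqrt ?N" if "k < r n" for k
          unfolding xs_def using that by (rule stopped_eq)
        then have "(\<Sum>k<r n. xs ?N (real c) k \<omega>) = (\<Sum>k<r n. u k \<omega>) / sqrt ?N"
          by (simp add: sum_divide_distrib)
        then show ?thesis by simp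
      qed
    qed (use if' in \<open>auto simp: emeasure_eq_measure\<close>)
    also have "\<dots> = 2 * measure M ?A" by simp
    also have "\<dots> \<le> e / 3" using PA cC by linarith
    finally have 1: "dist (\<integral>\<omega>. ?f \<omega> \<partial>M) (\<integral>\<omega>. ?g \<omega> \<partial>M) \<le> e / 3" .
    have "dist (complex_of_real (\<integral>\<omega>. exp (- min (s2 \<omega>) (real c) / 2) \<partial>M)) (complex_of_real (\<integral>\<omega>. exp (- s2 \<omega> / 2) \<partial>M)) < e / 3"
      using c(1) by (simp add: dist_norm flip: of_real_diff)
    then show ?case
      using 1 elim(2)
        dist_triangle[of "\<integral>\<omega>. ?f \<omega> \<partial>M" "complex_of_real (\<integral>\<omega>. exp (- s2 \<omega> / 2) \<partial>M)" "\<integral>\<omega>. ?g \<omega> \<partial>M"]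
        dist_triangle[of "\<integral>\<omega>. ?g \<omega> \<partial>M" "complex_of_real (\<integral>\<omega>. exp (- s2 \<omega> / 2) \<partial>M)"
          "complex_of_real (\<integral>\<omega>. exp (- min (s2 \<omega>) (real c) / 2) \<partial>M)"]
      by linarith
  qed
qed

end

section \<open>Paths of small oscillation\<close>

text \<open>A finite set \<open>A\<close> of cut points encodes the partition of the line into the right-open
  intervals on which \<open>cell A\<close> is constant; the two unbounded ones have cells \<open>{}\<close> and \<open>A\<close>.\<close>

definition cell :: "real set \<Rightarrow> real \<Rightarrow> real set" where
  "cell A t = {a \<in> A. a \<le> t}"

lemma cell_subset: "A \<subseteq> B \<Longrightarrow> cell A s = A \<inter> cell B s"
  unfolding cell_def by blast

lemma cell_mono: "A \<subseteq> B \<Longrightarrow> cell B s = cell B t \<Longrightarrow> cell A s = cell A t"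
  by (simp add: cell_subset)

lemma cell_mono_extreme:
  "A \<subseteq> B \<Longrightarrow> cell B s = {} \<or> cell B s = B \<Longrightarrow> cell A s = {} \<or> cell A s = A"
  by (metis cell_subset inf.absorb1 inf_bot_right)

lemma cell_at_right:
  assumes "finite A"
  shows "\<forall>\<^sub>F s in at_right t. cell A s = cell A t"
proof -
  have "\<forall>\<^sub>F s in at_right t. \<forall>a\<in>A. a \<le> s \<longleftrightarrow> a \<le> t"
  proof (intro eventually_ball_finite assms ballI)
    fix a
    show "\<forall>\<^sub>F s in at_right t. a \<le> s \<longleftrightarrow> a \<le> t"
    proof (cases "a \<le> t")
      case True
      show ?thesis using eventually_at_right_less[of t] by (rule eventually_mono) (use True in auto)
    next
      case False
      then have "\<forall>\<^sub>F s in at_right t. s < a" using eventually_at_right_field by force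
      then show ?thesis by (rule eventually_mono) (use False in auto)
    qed
  qed
  then show ?thesis by (rule eventually_mono) (auto simp: cell_def)
qed

lemma cell_at_left:
  assumes "finite A"
  shows "\<forall>\<^sub>F s in at_left t. cell A s = {a \<in> A. a < t}"
proof -
  have "\<forall>\<^sub>F s in at_left t. \<forall>a\<in>A. a \<le> s \<longleftrightarrow> a < t"
  proof (intro eventually_ball_finite assms ballI)
    fix a
    have lt: "\<forall>\<^sub>F s in at_left t. s < t" by (simp add: eventually_at_filter)
    show "\<forall>\<^sub>F s in at_left t. a \<le> s \<longleftrightarrow> a < t"
    proof (cases "a < t")
      case True
      show ?thesis using eventually_at_left_real[OF True] by (rule eventually_mono) auto
    next
      case False
      show ?thesis using lt by (rule eventually_mono) (use False in auto)
    qed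
  qed
  then show ?thesis by (rule eventually_mono) (auto simp: cell_def)
qed

lemma cell_at_top:
  assumes "finite A" shows "\<forall>\<^sub>F s in at_top. cell A s = A"
proof -
  have "\<forall>\<^sub>F s in at_top. \<forall>a\<in>A. a \<le> s"
    by (intro eventually_ball_finite assms ballI eventually_ge_at_top)
  then show ?thesis by (rule eventually_mono) (auto simp: cell_def)
qed

lemma cell_at_bot:
  assumes "finite A" shows "\<forall>\<^sub>F s in at_bot. cell A s = {}"
proof -
  have "\<forall>\<^sub>F s in at_bot. \<forall>a\<in>A. s < a"
    by (intro eventually_ball_finite assms ballI eventually_gt_at_bot)
  then show ?thesis by (rule eventually_mono) (auto simp: cell_def)
qed

text \<open>On the two unbounded intervals the value must be 0, since paths vanish at infinity. For
  \<open>A = {}\<close> the whole line is such an interval and the path is 0.\<close>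

definition step :: "real set \<Rightarrow> (real set \<Rightarrow> real) \<Rightarrow> cadlag0" where
  "step A \<phi> = Cadlag0 (\<lambda>t. if cell A t = {} \<or> cell A t = A then 0 else \<phi> (cell A t))"

lemma path_step:
  assumes "finite A"
  shows "path_of (step A \<phi>) t = (if cell A t = {} \<or> cell A t = A then 0 else \<phi> (cell A t))"
proof -
  define p where "p = (\<lambda>t. if cell A t = {} \<or> cell A t = A then 0 else \<phi> (cell A t))"
  define \<psi> where "\<psi> = (\<lambda>c. if c = {} \<or> c = A then 0 else \<phi> c)"
  have p: "p = (\<lambda>t. \<psi> (cell A t))" by (auto simp: p_def \<psi>_def)
  have "cadlag p" unfolding cadlag_def
  proof (intro allI conjI)
    fix t
    show "continuous (at_right t) p" unfolding continuous_within p
      by (rule tendsto_eventually) (use cell_at_right[OF assms, of t] in \<open>auto elim: eventually_mono\<close>)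
    have "(p \<longlongrightarrow> \<psi> {a \<in> A. a < t}) (at_left t)" unfolding p
      by (rule tendsto_eventually) (use cell_at_left[OF assms, of t] in \<open>auto elim: eventually_mono\<close>)
    then show "\<exists>l. (p \<longlongrightarrow> l) (at_left t)" by blast
  qed
  moreover have "(p \<longlongrightarrow> 0) at_top" "(p \<longlongrightarrow> 0) at_bot" unfolding p_def
    by (rule tendsto_eventually, use cell_at_top[OF assms] in \<open>auto elim: eventually_mono\<close>)
       (rule tendsto_eventually, use cell_at_bot[OF assms] in \<open>auto elim: eventually_mono\<close>)
  then have "(p \<longlongrightarrow> 0) at_infinity" by (simp add: at_infinity_eq_at_top_bot filterlim_sup)
  ultimately have "path_of (Cadlag0 p) = p" by (intro Cadlag0_inverse) auto
  then show ?thesis by (simp add: step_def p_def)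
qed

text \<open>Uniform convergence permits the interchange with one-sided limits and with the limit at
  infinity. The left limits of the approximants are not given in advance; they form a Cauchy
  sequence because their differences are bounded by the uniform distance.\<close>

lemma cadlag0_convergent:
  fixes X :: "nat \<Rightarrow> cadlag0"
  assumes "Cauchy X" shows "convergent X"
proof -
  have "uniformly_Cauchy_on UNIV (\<lambda>n. path_of (X n))"
    using assms unfolding uniformly_Cauchy_on_def Cauchy_def dist_real_def
    by (meson abs_path_diff_le_dist le_less_trans)
  then obtain x where x: "uniform_limit UNIV (\<lambda>n. path_of (X n)) x sequentially"
    using Cauchy_uniformly_convergent unfolding uniformly_convergent_on_def by blast
  have path: "cadlag (path_of (X n))" "(path_of (X n) \<longlongrightarrow> 0) at_infinity" for n
    using path_of[of "X n"] by auto
  have "cadlag x" unfolding cadlag_def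
  proof (intro allI conjI)
    fix t
    show "continuous (at_right t) x" unfolding continuous_within
      by (rule swap_uniform_limit'[where g="\<lambda>n. path_of (X n) t", OF _ _ x])
        (use path tendsto_uniform_limitI[OF x, of t] in \<open>auto simp: cadlag_def continuous_within\<close>)
    have "\<forall>n. \<exists>l. (path_of (X n) \<longlongrightarrow> l) (at_left t)"
      using path unfolding cadlag_def by blast
    then obtain l where l: "\<And>n. (path_of (X n) \<longlongrightarrow> l n) (at_left t)" by metis
    have ll: "dist (l m) (l n) \<le> dist (X m) (X n)" for m n
    proof -
      have "((\<lambda>s. \<bar>path_of (X m) s - path_of (X n) s\<bar>) \<longlongrightarrow> \<bar>l m - l n\<bar>) (at_left t)"
        by (intro tendsto_intros l)
      then show ?thesis unfolding dist_real_def
        by (rule tendsto_upperbound) (auto simp: abs_path_diff_le_dist)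
    qed
    have "Cauchy l" using assms unfolding Cauchy_def by (meson ll le_less_trans)
    then obtain l0 where l0: "l \<longlonglongrightarrow> l0" using Cauchy_convergent convergent_def by blast
    have "(x \<longlongrightarrow> l0) (at_left t)"
      by (rule swap_uniform_limit'[OF _ l0 x]) (use l in auto)
    then show "\<exists>l. (x \<longlongrightarrow> l) (at_left t)" by blast
  qed
  moreover have "(x \<longlongrightarrow> 0) at_infinity"
    by (rule swap_uniform_limit'[where g="\<lambda>n. 0", OF _ _ x]) (use path in auto)
  ultimately have px: "path_of (Cadlag0 x) = x" by (intro Cadlag0_inverse) auto
  have "X \<longlonglongrightarrow> Cadlag0 x"
  proof (rule tendstoI)
    fix e :: real assume e: "0 < e"
    have "\<forall>\<^sub>F n in sequentially. \<forall>t\<in>UNIV. dist (path_of (X n) t) (x t) < e / 2"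
      using uniform_limitD[OF x, of "e/2"] e by simp
    then show "\<forall>\<^sub>F n in sequentially. dist (X n) (Cadlag0 x) < e"
    proof eventually_elim
      case (elim n)
      have "dist (X n) (Cadlag0 x) \<le> e / 2"
        by (rule dist_cadlag0_le) (use elim in \<open>auto simp: px dist_real_def less_imp_le\<close>)
      with e show ?case by simp
    qed
  qed
  then show ?thesis by (auto simp: convergent_def)
qed

lemma complete_cadlag0: "Topological_Spaces.complete (UNIV :: cadlag0 set)"
  unfolding Real_Vector_Spaces.complete_def using cadlag0_convergent by (auto simp: convergent_def)

lemma continuous_on_eval: "continuous_on S (\<lambda>x. path_of x t)"
proof -
  have "\<bar>path_of y t - path_of x t\<bar> < e" if "dist y x < e" for x y e
    using abs_path_diff_le_dist[of y t x] that by simp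
  then show ?thesis unfolding continuous_on_iff dist_real_def by blast
qed

lemma measurable_eval [measurable]: "(\<lambda>x. path_of x t) \<in> borel_measurable borel"
  by (rule borel_measurable_continuous_onI[OF continuous_on_eval])

text \<open>With \<open>d = id\<close> this bounds the oscillation of a path on every interval of the partition;
  with \<open>d\<close> an enumeration of a dense set, that of a function known only on its range. A path
  vanishes at infinity, whence the bound on the unbounded intervals.\<close>

definition osc_le :: "('i \<Rightarrow> real) \<Rightarrow> real set \<Rightarrow> real \<Rightarrow> ('i \<Rightarrow> real) \<Rightarrow> bool" where
  "osc_le d A \<epsilon> x \<longleftrightarrow>
     (\<forall>i j. cell A (d i) = cell A (d j) \<longrightarrow> \<bar>x i - x j\<bar> \<le> \<epsilon>) \<and>
     (\<forall>i. cell A (d i) = {} \<or> cell A (d i) = A \<longrightarrow> \<bar>x i\<bar> \<le> \<epsilon>)"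

text \<open>The \<open>SOME\<close> is unspecified on a cell that contains no \<open>d i\<close>; with \<open>d\<close> dense there is none.\<close>

definition proj :: "('i \<Rightarrow> real) \<Rightarrow> real set \<Rightarrow> ('i \<Rightarrow> real) \<Rightarrow> cadlag0" where
  "proj d A x = step A (\<lambda>c. x (SOME i. cell A (d i) = c))"

lemma proj_cases:
  assumes "finite A"
  obtains "cell A (d i) = {} \<or> cell A (d i) = A" "path_of (proj d A x) (d i) = 0"
  | k where "cell A (d k) = cell A (d i)" "path_of (proj d A x) (d i) = x k"
proof (cases "cell A (d i) = {} \<or> cell A (d i) = A")
  case True
  then show ?thesis using that(1) assms by (simp add: proj_def path_step)
next
  case False
  have "cell A (d (SOME k. cell A (d k) = cell A (d i))) = cell A (d i)" by (rule someI) simp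
  then show ?thesis using that(2) False assms by (simp add: proj_def path_step)
qed

lemma proj_close:
  assumes "finite A" "osc_le d A \<epsilon> x"
  shows "\<bar>path_of (proj d A x) (d i) - x i\<bar> \<le> \<epsilon>"
proof -
  have a: "\<bar>x k - x i\<bar> \<le> \<epsilon>" if "cell A (d k) = cell A (d i)" for k
    using assms(2) that unfolding osc_le_def by blast
  have b: "\<bar>x i\<bar> \<le> \<epsilon>" if "cell A (d i) = {} \<or> cell A (d i) = A"
    using assms(2) that unfolding osc_le_def by blast
  show ?thesis
  proof (cases rule: proj_cases[OF assms(1), of d i x])
    case 1
    show ?thesis using b[OF 1(1)] 1(2) by simp
  next
    case (2 k)
    show ?thesis using a[OF 2(1)] 2(2) by simp
  qed
qed

text \<open>The bound on the unbounded intervals comes for free: comparison with points of the same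
  interval tending to infinity, where the path tends to 0.\<close>

lemma osc_le_path:
  assumes "finite A" "\<And>s t. cell A s = cell A t \<Longrightarrow> \<bar>path_of x s - path_of x t\<bar> \<le> \<epsilon>"
  shows "osc_le (\<lambda>t. t) A \<epsilon> (path_of x)"
  unfolding osc_le_def
proof (intro conjI allI impI assms(2); assumption?)
  fix s assume s: "cell A s = {} \<or> cell A s = A"
  have "(path_of x \<longlongrightarrow> 0) at_infinity" using path_of[of x] by auto
  then have lim: "(path_of x \<longlongrightarrow> 0) at_top" "(path_of x \<longlongrightarrow> 0) at_bot"
    by (simp_all add: at_infinity_eq_at_top_bot filterlim_sup)
       (auto simp: filterlim_def le_sup_iff filtermap_sup)
  obtain F :: "real filter" where F: "F \<noteq> bot" "(path_of x \<longlongrightarrow> 0) F" "\<forall>\<^sub>F t in F. cell A t = cell A s"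
    using s cell_at_top[OF assms(1)] cell_at_bot[OF assms(1)] lim trivial_limit_at_top_linorder trivial_limit_at_bot_linorder
    by metis
  have "((\<lambda>t. \<bar>path_of x s - path_of x t\<bar>) \<longlongrightarrow> \<bar>path_of x s - 0\<bar>) F" by (intro tendsto_intros F)
  then have "\<bar>path_of x s - 0\<bar> \<le> \<epsilon>"
    by (rule tendsto_upperbound[OF _ _ F(1)]) (use F(3) in eventually_elim, use assms(2) in auto)
  then show "\<bar>path_of x s\<bar> \<le> \<epsilon>" by simp
qed

section \<open>Paths observed along a dense sequence of times\<close>

locale dense_seq =
  fixes d :: "nat \<Rightarrow> real"
  assumes dense: "\<And>a b. a < b \<Longrightarrow> \<exists>i. a < d i \<and> d i < b"
begin

text \<open>The approximating times lie strictly to the right of \<open>t\<close>, so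
  right-continuity carries every closed condition from the dense times to all times.\<close>

lemma seq_to_right: obtains f where "filterlim (\<lambda>n. d (f n)) (at_right t) sequentially"
proof -
  have "\<exists>i. t < d i \<and> d i < t + inverse (real (Suc n))" for n by (rule dense) simp
  then obtain f where f: "\<And>n. t < d (f n)" "\<And>n. d (f n) < t + inverse (real (Suc n))" by metis
  have "(\<lambda>n. d (f n)) \<longlonglongrightarrow> t"
  proof (rule tendsto_sandwich[OF _ _ tendsto_const LIMSEQ_inverse_real_of_nat_add])
    show "\<forall>\<^sub>F n in sequentially. t \<le> d (f n)"
      by (intro always_eventually allI less_imp_le f)
    show "\<forall>\<^sub>F n in sequentially. d (f n) \<le> t + inverse (real (Suc n))"
      by (intro always_eventually allI less_imp_le f)
  qed
  moreover have "\<forall>\<^sub>F n in sequentially. d (f n) \<in> {t<..} \<and> d (f n) \<noteq> t"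
    using f(1) by (intro always_eventually allI) (metis greaterThan_iff less_irrefl)
  ultimately have "filterlim (\<lambda>n. d (f n)) (at_right t) sequentially"
    unfolding filterlim_at by blast
  then show thesis by (rule that)
qed

lemma path_seq_to_right:
  assumes "filterlim (\<lambda>n. d (f n)) (at_right t) sequentially"
  shows "(\<lambda>n. path_of x (d (f n))) \<longlonglongrightarrow> path_of x t"
proof -
  have "(path_of x \<longlongrightarrow> path_of x t) (at_right t)"
    using path_of[of x] by (auto simp: cadlag_def continuous_within)
  then show ?thesis using assms by (rule filterlim_compose)
qed

lemma dist_le_dense:
  assumes "\<And>i. \<bar>path_of x (d i) - path_of y (d i)\<bar> \<le> c" shows "dist x y \<le> c"
proof (rule dist_cadlag0_le)
  fix t
  obtain f where f: "filterlim (\<lambda>n. d (f n)) (at_right t) sequentially" by (rule seq_to_right)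
  have "(\<lambda>n. \<bar>path_of x (d (f n)) - path_of y (d (f n))\<bar>) \<longlonglongrightarrow> \<bar>path_of x t - path_of y t\<bar>"
    by (rule tendsto_rabs[OF tendsto_diff[OF path_seq_to_right[OF f] path_seq_to_right[OF f]]])
  then show "\<bar>path_of x t - path_of y t\<bar> \<le> c"
    by (rule tendsto_upperbound) (use assms in auto)
qed

lemma eq_if_dense:
  assumes "\<And>i. path_of x (d i) = path_of y (d i)" shows "x = y"
proof -
  have "dist x y \<le> 0" by (rule dist_le_dense) (use assms in auto)
  then show ?thesis by simp
qed

lemma osc_le_dense:
  assumes A: "finite A" and x: "osc_le d A \<epsilon> (\<lambda>i. path_of x (d i))"
  shows "osc_le (\<lambda>t. t) A \<epsilon> (path_of x)"
proof (rule osc_le_path[OF A])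
  fix s t assume st: "cell A s = cell A t"
  obtain f where f: "filterlim (\<lambda>n. d (f n)) (at_right s) sequentially" by (rule seq_to_right)
  obtain g where g: "filterlim (\<lambda>n. d (g n)) (at_right t) sequentially" by (rule seq_to_right)
  have "(\<lambda>n. \<bar>path_of x (d (f n)) - path_of x (d (g n))\<bar>) \<longlonglongrightarrow> \<bar>path_of x s - path_of x t\<bar>"
    by (rule tendsto_rabs[OF tendsto_diff[OF path_seq_to_right[OF f] path_seq_to_right[OF g]]])
  moreover have "\<forall>\<^sub>F n in sequentially. \<bar>path_of x (d (f n)) - path_of x (d (g n))\<bar> \<le> \<epsilon>"
    using eventually_compose_filterlim[OF cell_at_right[OF A] f]
      eventually_compose_filterlim[OF cell_at_right[OF A] g]
    by eventually_elim (use x st in \<open>auto simp: osc_le_def\<close>)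
  ultimately show "\<bar>path_of x s - path_of x t\<bar> \<le> \<epsilon>" by (rule tendsto_upperbound) simp
qed

lemma sup_le_dense:
  assumes "\<And>i. \<bar>path_of x (d i)\<bar> \<le> R" shows "\<bar>path_of x t\<bar> \<le> R"
proof -
  obtain f where f: "filterlim (\<lambda>n. d (f n)) (at_right t) sequentially" by (rule seq_to_right)
  have "(\<lambda>n. \<bar>path_of x (d (f n))\<bar>) \<longlonglongrightarrow> \<bar>path_of x t\<bar>"
    by (rule tendsto_rabs[OF path_seq_to_right[OF f]])
  then show ?thesis by (rule tendsto_upperbound) (use assms in auto)
qed

text \<open>\<open>proj\<close> reads one coordinate for each of finitely many cells, so it is
  continuous from the product topology into the uniform distance. This is the source of Borel
  measurability in the non-separable path space.\<close>

lemma continuous_proj: assumes "finite A" shows "continuous_on UNIV (proj d A)"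
proof -
  define ix where "ix = (\<lambda>c. SOME i. cell A (d i) = c)"
  have le: "dist (proj d A y) (proj d A z) \<le> (\<Sum>c\<in>Pow A. \<bar>y (ix c) - z (ix c)\<bar>)" for y z
  proof (rule dist_cadlag0_le)
    fix t
    have c: "cell A t \<in> Pow A" by (auto simp: cell_def)
    have "\<bar>path_of (proj d A y) t - path_of (proj d A z) t\<bar> \<le> \<bar>y (ix (cell A t)) - z (ix (cell A t))\<bar>"
      using assms by (auto simp: proj_def path_step ix_def)
    also have "\<dots> \<le> (\<Sum>c\<in>Pow A. \<bar>y (ix c) - z (ix c)\<bar>)"
      using assms c by (intro member_le_sum) auto
    finally show "\<bar>path_of (proj d A y) t - path_of (proj d A z) t\<bar> \<le> (\<Sum>c\<in>Pow A. \<bar>y (ix c) - z (ix c)\<bar>)" .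
  qed
  show ?thesis
    unfolding continuous_on_def
  proof
    fix z :: "nat \<Rightarrow> real"
    have ev: "((\<lambda>y. y i) \<longlongrightarrow> z i) (at z)" for i
    proof -
      have "continuous_on UNIV (\<lambda>y :: nat \<Rightarrow> real. y i)" by (rule continuous_on_product_coordinates)
      then show ?thesis by (simp add: continuous_on_def)
    qed
    have "((\<lambda>y. \<Sum>c\<in>Pow A. \<bar>y (ix c) - z (ix c)\<bar>) \<longlongrightarrow> (\<Sum>c\<in>Pow A. \<bar>z (ix c) - z (ix c)\<bar>)) (at z)"
      by (intro tendsto_sum tendsto_rabs tendsto_diff ev tendsto_const)
    then have lim: "((\<lambda>y. \<Sum>c\<in>Pow A. \<bar>y (ix c) - z (ix c)\<bar>) \<longlongrightarrow> 0) (at z)" by simp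
    have "((\<lambda>y. dist (proj d A y) (proj d A z)) \<longlongrightarrow> 0) (at z)"
      by (rule tendsto_sandwich[OF _ _ tendsto_const lim]) (simp_all add: le)
    then show "(proj d A \<longlongrightarrow> proj d A z) (at z within UNIV)"
      unfolding tendsto_dist_iff[of "proj d A"] .
  qed
qed

end

text \<open>Each value of the projection is either a value of \<open>x\<close> from the same cell of
  the coarser \<open>A\<close>, or 0. The value 0 occurs on the unbounded intervals of
  \<open>B\<close>, which lie in those of \<open>A\<close>, where \<open>x\<close> itself is within
  \<epsilon> of 0.\<close>

lemma proj_in:
  assumes A: "finite B" "A \<subseteq> B" and x: "osc_le (\<lambda>t. t) A \<epsilon> x" "0 \<le> \<epsilon>"
  shows "osc_le (\<lambda>t. t) A \<epsilon> (path_of (proj (\<lambda>t. t) B x))"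
proof -
  let ?p = "path_of (proj (\<lambda>t. t) B x)"
  have c: "(cell A t = {} \<or> cell A t = A) \<and> ?p t = 0 \<or> (\<exists>k. cell A k = cell A t \<and> ?p t = x k)" for t
  proof (cases rule: proj_cases[OF A(1), of "\<lambda>t. t" t x])
    case 1
    then show ?thesis using cell_mono_extreme[OF A(2) 1(1)] by simp
  next
    case (2 k)
    then show ?thesis using cell_mono[OF A(2) 2(1)] by blast
  qed
  have o1: "\<bar>x s - x t\<bar> \<le> \<epsilon>" if "cell A s = cell A t" for s t
    using x(1) that unfolding osc_le_def by blast
  have o2: "\<bar>x t\<bar> \<le> \<epsilon>" if "cell A t = {} \<or> cell A t = A" for t
    using x(1) that unfolding osc_le_def by blast
  show ?thesis
    unfolding osc_le_def
  proof (intro conjI allI impI)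
    fix s t assume st: "cell A s = cell A t"
    have z: "\<bar>?p t\<bar> \<le> \<epsilon>" if "cell A t = {} \<or> cell A t = A" for t
      using c[of t]
    proof (elim disjE exE conjE)
      fix k assume k: "cell A k = cell A t" "?p t = x k"
      then have "cell A k = {} \<or> cell A k = A" using that by simp
      from o2[OF this] show ?thesis by (simp only: k)
    qed (use x(2) in simp_all)
    show "\<bar>?p s - ?p t\<bar> \<le> \<epsilon>"
    proof (cases "cell A s = {} \<or> cell A s = A")
      case True
      have "(\<exists>v. ?p s = x v \<and> cell A v = cell A s) \<or> ?p s = 0" "(\<exists>v. ?p t = x v \<and> cell A v = cell A s) \<or> ?p t = 0"
        using c[of s] c[of t] st by (metis (no_types))+
      then show ?thesis
      proof (elim disjE exE conjE)
        fix v w assume vw: "?p s = x v" "cell A v = cell A s" "?p t = x w" "cell A w = cell A s"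
        have "cell A v = cell A w" by (simp only: vw)
        from o1[OF this] show ?thesis by (simp only: vw)
      next
        fix v assume "?p t = 0"
        then show ?thesis using z[OF True] by simp
      next
        fix v assume "?p s = 0"
        moreover have "cell A t = {} \<or> cell A t = A" using True by (simp only: st)
        ultimately show ?thesis using z[of t] by simp
      next
        assume "?p s = 0" "?p t = 0"
        then show ?thesis using x(2) by simp
      qed
    next
      case False
      then have "\<not> (cell A t = {} \<or> cell A t = A)" by (simp only: st not_False_eq_True)
      then obtain v w where vw: "?p s = x v" "cell A v = cell A s" "?p t = x w" "cell A w = cell A t"
        using c[of s] c[of t] False by blast
      have "cell A v = cell A w" by (simp only: vw st)
      from o1[OF this] show ?thesis by (simp only: vw)
    qed
  next
    fix t assume t: "cell A t = {} \<or> cell A t = A"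
    show "\<bar>?p t\<bar> \<le> \<epsilon>"
      using c[of t]
    proof (elim disjE exE conjE)
      fix k assume k: "cell A k = cell A t" "?p t = x k"
      then have "cell A k = {} \<or> cell A k = A" using t by simp
      from o2[OF this] show ?thesis by (simp only: k)
    qed (use x(2) in simp_all)
  qed
qed

lemma proj_osc_0:
  assumes A: "finite B" "B \<subseteq> A" and "0 \<le> \<epsilon>"
  shows "osc_le (\<lambda>t. t) A \<epsilon> (path_of (proj (\<lambda>t. t) B x))"
  unfolding osc_le_def
proof (intro conjI allI impI)
  fix s t assume "cell A s = cell A t"
  from cell_mono[OF A(2) this]
  show "\<bar>path_of (proj (\<lambda>t. t) B x) s - path_of (proj (\<lambda>t. t) B x) t\<bar> \<le> \<epsilon>"
    using assms(1,3) by (simp add: proj_def path_step)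
next
  fix t assume "cell A t = {} \<or> cell A t = A"
  from cell_mono_extreme[OF A(2) this]
  show "\<bar>path_of (proj (\<lambda>t. t) B x) t\<bar> \<le> \<epsilon>"
    using assms(1,3) by (simp add: proj_def path_step)
qed

section \<open>Compact sets of paths, in the manner of Arzela and Ascoli\<close>

definition osc_set :: "(nat \<Rightarrow> real set) \<Rightarrow> (nat \<Rightarrow> real) \<Rightarrow> nat \<Rightarrow> real \<Rightarrow> cadlag0 set" where
  "osc_set A \<epsilon> j0 R =
     {x. (\<forall>j\<ge>j0. osc_le (\<lambda>t. t) (A j) (\<epsilon> j) (path_of x)) \<and> (\<forall>t. \<bar>path_of x t\<bar> \<le> R)}"

text \<open>The set is closed, being cut out by closed conditions on coordinates, in a complete
  space. It is totally bounded because at a scale \<open>j\<close> with small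
  \<open>\<epsilon> j\<close> each member is nearly constant on the finitely many cells of
  \<open>A j\<close>, with values in a bounded range.\<close>

lemma compact_osc_set:
  assumes A: "\<And>j. finite (A j)" and \<epsilon>: "\<epsilon> \<longlonglongrightarrow> 0"
  shows "compact (osc_set A \<epsilon> j0 R)"
  unfolding compact_eq_totally_bounded
proof
  let ?K = "osc_set A \<epsilon> j0 R"
  have cl: "closed {x. \<bar>path_of x s - path_of x t\<bar> \<le> c}" "closed {x. \<bar>path_of x t\<bar> \<le> c}" for s t c
    by (intro closed_Collect_le continuous_intros continuous_on_eval)+
  have "?K = (\<Inter>j\<in>{j0..}. (\<Inter>(s, t)\<in>{(s, t). cell (A j) s = cell (A j) t}. {x. \<bar>path_of x s - path_of x t\<bar> \<le> \<epsilon> j})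
      \<inter> (\<Inter>t\<in>{t. cell (A j) t = {} \<or> cell (A j) t = A j}. {x. \<bar>path_of x t\<bar> \<le> \<epsilon> j}))
      \<inter> (\<Inter>t. {x. \<bar>path_of x t\<bar> \<le> R})"
    by (auto simp: osc_set_def osc_le_def)
  also have "closed \<dots>" by (intro closed_Int closed_INT ballI) (auto intro: cl)
  finally show "Topological_Spaces.complete ?K" using complete_closed_subset[OF _ subset_UNIV complete_cadlag0] by blast
  show "\<forall>e>0. \<exists>k. finite k \<and> ?K \<subseteq> (\<Union>x\<in>k. ball x e)"
  proof (intro allI impI)
    fix e :: real assume e: "0 < e"
    have "\<forall>\<^sub>F j in sequentially. \<epsilon> j < e / 4 \<and> j0 \<le> j"
      using e by (intro eventually_conj order_tendstoD(2)[OF \<epsilon>] eventually_ge_at_top) simp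
    then obtain j where j: "\<epsilon> j < e / 4" "j0 \<le> j" by (auto simp: eventually_sequentially)
    define B where "B = A j"
    have B: "finite B" using A by (simp add: B_def)
    define M where "M = \<lceil>\<bar>R\<bar> / (e / 4)\<rceil> + 1"
    define grid where "grid = (\<lambda>m. (e / 4) * real_of_int m) ` {-M..M}"
    define k where "k = step B ` (PiE (Pow B) (\<lambda>_. grid))"
    have "finite k" unfolding k_def grid_def using B by (intro finite_imageI finite_PiE) auto
    moreover have "?K \<subseteq> (\<Union>x\<in>k. ball x e)"
    proof
      fix x assume x: "x \<in> ?K"
      \<comment> \<open>One value per cell, rounded down to a multiple of e / 4. Rounding costs at
        most e / 4, the oscillation less than e / 4, and only finitely many such \<phi>
        occur.\<close>
      define \<phi> where "\<phi> = (\<lambda>c\<in>Pow B. (e / 4) * real_of_int \<lfloor>path_of x (SOME i. cell B i = c) / (e / 4)\<rfloor>)"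
      have fl: "\<lfloor>path_of x s / (e / 4)\<rfloor> \<in> {-M..M}" for s
      proof -
        have "\<bar>path_of x s\<bar> \<le> \<bar>R\<bar>" using x by (auto simp: osc_set_def abs_le_iff) (meson abs_ge_self order_trans abs_le_D1)+
        then have "\<bar>path_of x s / (e / 4)\<bar> \<le> \<bar>R\<bar> / (e / 4)"
          using e by (simp add: abs_mult divide_right_mono)
        moreover have "\<lfloor>q\<rfloor> \<in> {- (\<lceil>r\<rceil> + 1)..\<lceil>r\<rceil> + 1}" if "\<bar>q\<bar> \<le> r" for q r :: real
          using floor_mono[of q r] floor_mono[of "- r" q] that floor_le_ceiling[of r]
          unfolding atLeastAtMost_iff abs_le_iff floor_minus by linarith
        ultimately show ?thesis unfolding M_def by blast
      qed
      have \<phi>: "\<phi> \<in> PiE (Pow B) (\<lambda>_. grid)" unfolding \<phi>_def grid_def using fl by auto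
      have "dist x (step B \<phi>) \<le> e / 4 + e / 4"
      proof (rule dist_cadlag0_le)
        fix t
        have osc: "osc_le (\<lambda>t. t) B (\<epsilon> j) (path_of x)" using x j by (auto simp: osc_set_def B_def)
        have 1: "\<bar>path_of (proj (\<lambda>t. t) B (path_of x)) t - path_of x t\<bar> \<le> \<epsilon> j"
          by (rule proj_close[OF B osc])
        have rnd: "\<bar>v - (e / 4) * real_of_int \<lfloor>v / (e / 4)\<rfloor>\<bar> \<le> e / 4" for v
        proof -
          have "real_of_int \<lfloor>v / (e / 4)\<rfloor> * (e / 4) \<le> v" "v < (real_of_int \<lfloor>v / (e / 4)\<rfloor> + 1) * (e / 4)"
            using e by (intro floor_divide_lower floor_divide_upper; simp)+
          then show ?thesis by (simp add: algebra_simps abs_le_iff)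
        qed
        have "cell B t \<in> Pow B" by (auto simp: cell_def)
        then have 2: "\<bar>path_of (proj (\<lambda>t. t) B (path_of x)) t - path_of (step B \<phi>) t\<bar> \<le> e / 4"
          using rnd e unfolding proj_def path_step[OF B] \<phi>_def by simp
        show "\<bar>path_of x t - path_of (step B \<phi>) t\<bar> \<le> e / 4 + e / 4" using 1 2 j by linarith
      qed
      then have "x \<in> ball (step B \<phi>) e" using e by (simp add: dist_commute)
      then show "x \<in> (\<Union>x\<in>k. ball x e)" using \<phi> by (auto simp: k_def)
    qed
    ultimately show "\<exists>k. finite k \<and> ?K \<subseteq> (\<Union>x\<in>k. ball x e)" by blast
  qed
qed

text \<open>For large \<open>n\<close> only finitely many scales of \<open>C_n\<close> are under
  control. Projecting at the last controlled scale \<open>m\<close> supplies the others: the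
  projection is constant on the cells of every finer partition. The price is a distance of at most
  \<open>\<epsilon> m\<close>.\<close>

lemma proj_in_osc_set:
  assumes A: "\<And>j. finite (A j)" "mono A" and \<epsilon>: "\<And>j. 0 \<le> \<epsilon> j" and m: "j0 \<le> m"
    and x: "\<And>j. j0 \<le> j \<Longrightarrow> j \<le> m \<Longrightarrow> osc_le (\<lambda>t. t) (A j) (\<epsilon> j) (path_of x)" "\<And>t. \<bar>path_of x t\<bar> \<le> R"
  shows "proj (\<lambda>t. t) (A m) (path_of x) \<in> osc_set A \<epsilon> j0 R"
    and "dist x (proj (\<lambda>t. t) (A m) (path_of x)) \<le> \<epsilon> m"
proof -
  have "osc_le (\<lambda>t. t) (A j) (\<epsilon> j) (path_of (proj (\<lambda>t. t) (A m) (path_of x)))" if "j0 \<le> j" for j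
  proof (cases "j \<le> m")
    case True
    show ?thesis by (rule proj_in[OF A(1) monoD[OF A(2) True] x(1)[OF that True] \<epsilon>])
  next
    case False
    then have "m \<le> j" by simp
    show ?thesis by (rule proj_osc_0[OF A(1) monoD[OF A(2) \<open>m \<le> j\<close>] \<epsilon>])
  qed
  moreover have "\<bar>path_of (proj (\<lambda>t. t) (A m) (path_of x)) t\<bar> \<le> R" for t
    using A(1)[of m] by (cases rule: proj_cases[of "A m" "\<lambda>t. t" t "path_of x"])
      (use x(2) in \<open>auto intro: order_trans[OF abs_ge_zero]\<close>)
  ultimately show "proj (\<lambda>t. t) (A m) (path_of x) \<in> osc_set A \<epsilon> j0 R" by (simp add: osc_set_def)
  show "dist x (proj (\<lambda>t. t) (A m) (path_of x)) \<le> \<epsilon> m"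
    by (rule dist_cadlag0_le, subst abs_minus_commute, rule proj_close) (use A x m in auto)
qed

text \<open>The \<open>j\<close>-th projection is within \<open>\<epsilon> j\<close> of
  \<open>y\<close> at all dense times. Two projections are therefore uniformly close, and
  completeness yields the path; no regularity of \<open>y\<close> beyond its oscillation bounds
  enters.\<close>

lemma (in dense_seq) proj_tendsto_extension:
  assumes A: "\<And>j. finite (A j)" and \<epsilon>: "\<epsilon> \<longlonglongrightarrow> 0"
    and y: "\<And>j. j0 \<le> j \<Longrightarrow> osc_le d (A j) (\<epsilon> j) y"
  obtains x where "(\<lambda>j. proj d (A j) y) \<longlonglongrightarrow> x" "\<And>i. path_of x (d i) = y i"
proof -
  let ?p = "\<lambda>j. proj d (A j) y"
  have close: "\<bar>path_of (?p j) (d i) - y i\<bar> \<le> \<epsilon> j" if "j0 \<le> j" for i j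
    by (rule proj_close[OF A y[OF that]])
  have "Cauchy ?p"
  proof (rule metric_CauchyI)
    fix e :: real assume e: "0 < e"
    obtain j1 where j1: "\<And>j. j1 \<le> j \<Longrightarrow> \<epsilon> j < e / 4"
      using order_tendstoD(2)[OF \<epsilon>, of "e/4"] e by (auto simp: eventually_sequentially)
    have "dist (?p m) (?p n) < e" if "max j0 j1 \<le> m" "max j0 j1 \<le> n" for m n
    proof -
      have "dist (?p m) (?p n) \<le> e / 2"
      proof (rule dist_le_dense)
        fix i
        show "\<bar>path_of (?p m) (d i) - path_of (?p n) (d i)\<bar> \<le> e / 2"
          using close[of m i] close[of n i] j1[of m] j1[of n] that by linarith
      qed
      with e show ?thesis by simp
    qed
    then show "\<exists>M. \<forall>m\<ge>M. \<forall>n\<ge>M. dist (?p m) (?p n) < e" by blast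
  qed
  then obtain x where x: "?p \<longlonglongrightarrow> x" using cadlag0_convergent by (auto simp: convergent_def)
  have "path_of x (d i) = y i" for i
  proof (rule LIMSEQ_unique)
    show "(\<lambda>j. path_of (?p j) (d i)) \<longlonglongrightarrow> path_of x (d i)"
      by (rule continuous_on_tendsto_compose[OF continuous_on_eval[of UNIV] x]) auto
    have "(\<lambda>j. path_of (?p j) (d i) - y i) \<longlonglongrightarrow> 0"
      by (rule Lim_null_comparison[OF _ \<epsilon>])
        (use close in \<open>auto simp: eventually_sequentially intro!: exI[of _ j0]\<close>)
    then show "(\<lambda>j. path_of (?p j) (d i)) \<longlonglongrightarrow> y i" by (simp add: LIM_zero_iff)
  qed
  with x show thesis by (rule that)
qed

section \<open>Tightness and existence of the limit\<close>

lemma (in prob_space) exhaust_small: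
  fixes B :: "nat \<Rightarrow> 'a set"
  assumes "\<And>n. B n \<in> events" "incseq B" "prob (\<Union>n. B n) = 1" "0 < (\<eta>::real)"
  shows "\<exists>n. prob (space M - B n) \<le> \<eta>"
proof -
  have "(\<lambda>n. prob (B n)) \<longlonglongrightarrow> 1"
    using finite_Lim_measure_incseq[of B] assms by auto
  then have "\<forall>\<^sub>F n in sequentially. 1 - \<eta> < prob (B n)"
    using assms(4) by (intro order_tendstoD) auto
  then obtain n where "1 - \<eta> < prob (B n)" by (auto simp: eventually_sequentially)
  then have "prob (space M - B n) \<le> \<eta>" using assms(1)[of n] by (simp add: prob_compl)
  then show ?thesis by blast
qed

lemma (in prob_space) tail_small:
  fixes f :: "'a \<Rightarrow> real"
  assumes [measurable]: "f \<in> borel_measurable M" and "0 < (\<eta>::real)"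
  shows "\<exists>R. prob {\<omega> \<in> space M. R < \<bar>f \<omega>\<bar>} \<le> \<eta>"
proof -
  let ?B = "\<lambda>n::nat. {\<omega> \<in> space M. \<bar>f \<omega>\<bar> \<le> real n}"
  have "(\<Union>n. ?B n) = space M" using real_arch_simple by auto
  then have "prob (\<Union>n. ?B n) = 1" by (simp add: prob_space)
  moreover have "incseq ?B" by (auto simp: incseq_def)
  ultimately obtain n where "prob (space M - ?B n) \<le> \<eta>"
    using exhaust_small[of ?B \<eta>] assms(2) by auto
  moreover have "space M - ?B n = {\<omega> \<in> space M. real n < \<bar>f \<omega>\<bar>}" by auto
  ultimately show ?thesis by auto
qed

lemma (in prob_space) prob_UN_le:
  fixes B :: "nat \<Rightarrow> 'a set"
  assumes "\<And>i. B i \<in> events" "\<And>i. prob (B i) \<le> \<eta> * (1 / 2) ^ Suc i"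
  shows "prob (\<Union>i. B i) \<le> \<eta>"
proof -
  have s: "(\<lambda>i. \<eta> * (1 / 2) ^ Suc i) sums (\<eta> * 1)" by (intro sums_mult power_half_series)
  have sm: "summable (\<lambda>i. prob (B i))"
    by (rule summable_comparison_test'[OF sums_summable[OF s], of 0]) (use assms(2) in auto)
  have "prob (\<Union>i. B i) \<le> (\<Sum>i. prob (B i))"
    using assms(1) sm by (intro finite_measure_subadditive_countably) auto
  also have "\<dots> \<le> (\<Sum>i. \<eta> * (1 / 2) ^ Suc i)"
    by (rule suminf_le[OF assms(2) sm sums_summable[OF s]])
  also have "\<dots> = \<eta>" using sums_unique[OF s] by simp
  finally show ?thesis .
qed

section \<open>Weak convergence in a countable product of real lines\<close>

lemma compact_box: "compact {y :: nat \<Rightarrow> real. \<forall>i. \<bar>y i\<bar> \<le> R i}"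
proof -
  have "compactin (product_topology (\<lambda>_::nat. euclidean :: real topology) UNIV) (PiE UNIV (\<lambda>i. {- R i..R i}))"
    by (auto simp: compactin_PiE compactin_euclidean_iff)
  moreover have "PiE UNIV (\<lambda>i. {- R i..R i}) = {y :: nat \<Rightarrow> real. \<forall>i. \<bar>y i\<bar> \<le> R i}"
  proof -
    have "x \<in> {- r..r} \<longleftrightarrow> \<bar>x\<bar> \<le> r" for x r :: real by (simp, linarith)
    then show ?thesis by (simp only: PiE_UNIV_domain Pi_def mem_Collect_eq simp_thms UNIV_I)
  qed
  ultimately show ?thesis by (simp add: euclidean_product_topology compactin_euclidean_iff)
qed

text \<open>Levy's continuity theorem in countably many coordinates. The compact sets are boxes;
  coordinate \<open>i\<close> may leave its interval with probability \<eta> / 2^(i+1), which sums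
  to \<eta>. Here \<open>Y n\<close> is Borel measurable, so the outer expectations are
  integrals.\<close>

theorem product_weak_convergence:
  fixes Y :: "nat \<Rightarrow> 'm \<Rightarrow> nat \<Rightarrow> real" and Z :: "'n \<Rightarrow> nat \<Rightarrow> real"
  assumes M: "prob_space M" and N: "prob_space N"
    and Y: "\<And>n i. (\<lambda>\<omega>. Y n \<omega> i) \<in> borel_measurable M"
    and Z: "\<And>i. (\<lambda>\<omega>. Z \<omega> i) \<in> borel_measurable N"
    and conv: "\<And>(r::nat) b c. (\<lambda>n. \<integral>\<omega>. cos ((\<Sum>i<r. b i * Y n \<omega> i) + c) \<partial>M)
                 \<longlonglongrightarrow> (\<integral>\<omega>. cos ((\<Sum>i<r. b i * Z \<omega> i) + c) \<partial>N)"
    and tight: "\<And>i \<eta>. \<eta> > 0 \<Longrightarrow> \<exists>R. \<forall>n. measure M {\<omega> \<in> space M. R < \<bar>Y n \<omega> i\<bar>} \<le> \<eta>"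
    and f: "continuous_on UNIV f" "\<And>x. \<bar>f x\<bar> \<le> (B::real)"
  shows "(\<lambda>n. \<integral>\<omega>. f (Y n \<omega>) \<partial>M) \<longlonglongrightarrow> (\<integral>\<omega>. f (Z \<omega>) \<partial>N)"
proof -
  interpret M: prob_space M by fact
  interpret N: prob_space N by fact
  note [measurable] = Y Z
  have mY [measurable]: "Y n \<in> borel_measurable M" for n
    by (rule measurable_coordinatewise_then_product) (rule Y)
  have mZ [measurable]: "Z \<in> borel_measurable N"
    by (rule measurable_coordinatewise_then_product) (rule Z)
  have fm: "f \<in> borel_measurable borel" by (rule borel_measurable_continuous_onI[OF f(1)])
  have "(\<lambda>n. outer_expectation M (\<lambda>\<omega>. f (Y n \<omega>))) \<longlonglongrightarrow> (\<integral>\<omega>. f (Z \<omega>) \<partial>N)"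
  proof (rule weak_convergence_from_trig[OF M N, where \<phi>="\<lambda>i x. x i" and B=B and f=f and Y=Y and Z=Z])
    show "continuous_on UNIV (\<lambda>x :: nat \<Rightarrow> real. x i)" for i by (rule continuous_on_product_coordinates)
    fix \<eta> :: real assume \<eta>: "0 < \<eta>"
    have "\<exists>R. (\<forall>n. M.prob {\<omega> \<in> space M. R < \<bar>Y n \<omega> i\<bar>} \<le> \<eta> * (1 / 2) ^ Suc i) \<and>
        N.prob {\<omega> \<in> space N. R < \<bar>Z \<omega> i\<bar>} \<le> \<eta> * (1 / 2) ^ Suc i" for i
    proof -
      have pos: "0 < \<eta> * (1 / 2) ^ Suc i" using \<eta> by simp
      obtain R1 where R1: "\<And>n. M.prob {\<omega> \<in> space M. R1 < \<bar>Y n \<omega> i\<bar>} \<le> \<eta> * (1 / 2) ^ Suc i"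
        using tight[OF pos] by blast
      obtain R2 where R2: "N.prob {\<omega> \<in> space N. R2 < \<bar>Z \<omega> i\<bar>} \<le> \<eta> * (1 / 2) ^ Suc i"
        using N.tail_small[OF Z pos] by blast
      show ?thesis
      proof (intro exI[of _ "max R1 R2"] conjI allI)
        show "M.prob {\<omega> \<in> space M. max R1 R2 < \<bar>Y n \<omega> i\<bar>} \<le> \<eta> * (1 / 2) ^ Suc i" for n
          by (rule order_trans[OF M.finite_measure_mono R1[of n]]) auto
        show "N.prob {\<omega> \<in> space N. max R1 R2 < \<bar>Z \<omega> i\<bar>} \<le> \<eta> * (1 / 2) ^ Suc i"
          by (rule order_trans[OF N.finite_measure_mono R2]) auto
      qed
    qed
    then have "\<forall>i. \<exists>R. (\<forall>n. M.prob {\<omega> \<in> space M. R < \<bar>Y n \<omega> i\<bar>} \<le> \<eta> * (1 / 2) ^ Suc i) \<and>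
        N.prob {\<omega> \<in> space N. R < \<bar>Z \<omega> i\<bar>} \<le> \<eta> * (1 / 2) ^ Suc i" by blast
    from choice[OF this] obtain R where
      "\<forall>i. (\<forall>n. M.prob {\<omega> \<in> space M. R i < \<bar>Y n \<omega> i\<bar>} \<le> \<eta> * (1 / 2) ^ Suc i) \<and>
        N.prob {\<omega> \<in> space N. R i < \<bar>Z \<omega> i\<bar>} \<le> \<eta> * (1 / 2) ^ Suc i" by blast
    then have R: "\<And>i n. M.prob {\<omega> \<in> space M. R i < \<bar>Y n \<omega> i\<bar>} \<le> \<eta> * (1 / 2) ^ Suc i"
      "\<And>i. N.prob {\<omega> \<in> space N. R i < \<bar>Z \<omega> i\<bar>} \<le> \<eta> * (1 / 2) ^ Suc i" by blast+
    let ?K = "{y :: nat \<Rightarrow> real. \<forall>i. \<bar>y i\<bar> \<le> R i}"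
    have "\<exists>E\<in>M.events. M.prob E \<le> \<eta> \<and> (\<forall>\<omega>\<in>space M - E. \<exists>z\<in>?K. dist (Y n \<omega>) z < \<delta>)" if "\<delta> > 0" for n \<delta>
    proof (intro bexI[of _ "\<Union>i. {\<omega> \<in> space M. R i < \<bar>Y n \<omega> i\<bar>}"] conjI ballI)
      show "M.prob (\<Union>i. {\<omega> \<in> space M. R i < \<bar>Y n \<omega> i\<bar>}) \<le> \<eta>"
        by (rule M.prob_UN_le[OF _ R(1)]) measurable
      fix \<omega> assume "\<omega> \<in> space M - (\<Union>i. {\<omega> \<in> space M. R i < \<bar>Y n \<omega> i\<bar>})"
      then have "Y n \<omega> \<in> ?K" by (auto simp: not_less)
      then show "\<exists>z\<in>?K. dist (Y n \<omega>) z < \<delta>" using that by (intro bexI[of _ "Y n \<omega>"]) auto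
    qed measurable
    moreover have "N.prob {\<omega> \<in> space N. Z \<omega> \<notin> ?K} \<le> \<eta>"
    proof -
      have "{\<omega> \<in> space N. Z \<omega> \<notin> ?K} = (\<Union>i. {\<omega> \<in> space N. R i < \<bar>Z \<omega> i\<bar>})" by (auto simp: not_le)
      moreover have "N.prob (\<Union>i. {\<omega> \<in> space N. R i < \<bar>Z \<omega> i\<bar>}) \<le> \<eta>"
        by (rule N.prob_UN_le[OF _ R(2)]) measurable
      ultimately show ?thesis by simp
    qed
    ultimately show "\<exists>K. compact K \<and> N.prob {\<omega> \<in> space N. Z \<omega> \<notin> K} \<le> \<eta> \<and>
      (\<forall>\<delta>>0. \<forall>\<^sub>F n in sequentially. \<exists>E\<in>M.events. M.prob E \<le> \<eta> \<and>
         (\<forall>\<omega>\<in>space M - E. \<exists>z\<in>K. dist (Y n \<omega>) z < \<delta>))"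
      using compact_box by (intro exI[of _ ?K]) simp
  qed (use f conv in \<open>auto simp: fun_eq_iff\<close>)
  moreover have "outer_expectation M (\<lambda>\<omega>. f (Y n \<omega>)) = (\<integral>\<omega>. f (Y n \<omega>) \<partial>M)" for n
    by (rule outer_expectation_integrable[OF M measurable_compose[OF mY fm] f(2)])
  ultimately show ?thesis by simp
qed

text \<open>One half of the portmanteau theorem: the indicator of an open set is the increasing
  limit of the continuous functions min 1 (k * distance to the complement).\<close>

lemma open_prob_le:
  fixes Y :: "nat \<Rightarrow> 'm \<Rightarrow> 'a::metric_space" and Z :: "'n \<Rightarrow> 'a"
  assumes M: "prob_space M" and N: "prob_space N"
    and Y: "\<And>n. Y n \<in> borel_measurable M" and Z: "Z \<in> borel_measurable N"
    and conv: "\<And>f B. continuous_on UNIV f \<Longrightarrow> (\<And>x. \<bar>f x\<bar> \<le> (B::real)) \<Longrightarrow>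
        (\<lambda>n. \<integral>\<omega>. f (Y n \<omega>) \<partial>M) \<longlonglongrightarrow> (\<integral>\<omega>. f (Z \<omega>) \<partial>N)"
    and O: "open S" and le: "\<forall>\<^sub>F n in sequentially. measure M {\<omega> \<in> space M. Y n \<omega> \<in> S} \<le> p"
  shows "measure N {\<omega> \<in> space N. Z \<omega> \<in> S} \<le> p"
proof -
  interpret M: prob_space M by fact
  interpret N: prob_space N by fact
  note [measurable] = Y Z
  have S [measurable]: "S \<in> sets borel" using O by simp
  show ?thesis
  \<comment> \<open>The distance \<open>infdist\<close> to the empty set is 0 by convention, so for
    \<open>S = UNIV\<close> the approximants used below would vanish.\<close>
  proof (cases "S = UNIV")
    case True
    then have "\<forall>\<^sub>F n::nat in sequentially. 1 \<le> p" using le by (simp add: M.prob_space)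
    then have "1 \<le> p" by simp
    then show ?thesis using N.prob_le_1 order_trans by blast
  next
    case False
    define f where "f = (\<lambda>(k::nat) x. min 1 (real k * infdist x (- S)))"
    have f: "continuous_on UNIV (f k)" "0 \<le> f k x" "f k x \<le> 1" for k x
      unfolding f_def by (auto intro!: continuous_intros simp: infdist_nonneg)
    have fS: "f k x \<le> indicator S x" for k x
      using f(3)[of k x] by (auto simp: indicator_def f_def)
    have mf [measurable]: "f k \<in> borel_measurable borel" for k
      by (rule borel_measurable_continuous_onI[OF f(1)])
    have "(\<integral>\<omega>. f k (Z \<omega>) \<partial>N) \<le> p" for k
    proof (rule tendsto_upperbound)
      show "(\<lambda>n. \<integral>\<omega>. f k (Y n \<omega>) \<partial>M) \<longlonglongrightarrow> (\<integral>\<omega>. f k (Z \<omega>) \<partial>N)"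
        by (rule conv[OF f(1), of _ 1]) (use f in simp)
      show "\<forall>\<^sub>F n in sequentially. (\<integral>\<omega>. f k (Y n \<omega>) \<partial>M) \<le> p"
        using le
      proof eventually_elim
        case (elim n)
        have "(\<integral>\<omega>. f k (Y n \<omega>) \<partial>M) \<le> (\<integral>\<omega>. indicator {\<omega> \<in> space M. Y n \<omega> \<in> S} \<omega> \<partial>M)"
        proof (rule integral_mono)
          show "integrable M (\<lambda>\<omega>. f k (Y n \<omega>))"
            by (rule M.integrable_boundedI[where B=1]) (use f in auto)
          show "f k (Y n \<omega>) \<le> indicator {\<omega> \<in> space M. Y n \<omega> \<in> S} \<omega>" if "\<omega> \<in> space M" for \<omega>
            using fS[of k "Y n \<omega>"] that by (simp add: indicator_def)
        qed (auto simp: M.emeasure_eq_measure)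
        also have "\<dots> \<le> p" using elim by simp
        finally show ?case .
      qed
    qed simp
    moreover have "(\<lambda>k. \<integral>\<omega>. f k (Z \<omega>) \<partial>N) \<longlonglongrightarrow> (\<integral>\<omega>. indicator S (Z \<omega>) \<partial>N)"
    proof (rule integral_dominated_convergence[where w="\<lambda>_. 1"])
      show "AE \<omega> in N. (\<lambda>k. f k (Z \<omega>)) \<longlonglongrightarrow> indicator S (Z \<omega>)"
      proof (rule AE_I2)
        fix \<omega>
        show "(\<lambda>k. f k (Z \<omega>)) \<longlonglongrightarrow> indicator S (Z \<omega>)"
        proof (cases "Z \<omega> \<in> S")
          case True
          have "closed (- S)" "- S \<noteq> {}" using O False by auto
          then have "0 < infdist (Z \<omega>) (- S)"
            using True by (metis ComplD infdist_nonneg in_closed_iff_infdist_zero order_le_imp_less_or_eq)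
          then obtain k0 :: nat where k0: "1 < real k0 * infdist (Z \<omega>) (- S)"
            using reals_Archimedean3 by blast
          have "f k (Z \<omega>) = 1" if "k0 \<le> k" for k
          proof -
            have "real k0 * infdist (Z \<omega>) (- S) \<le> real k * infdist (Z \<omega>) (- S)"
              using that by (intro mult_right_mono) (auto simp: infdist_nonneg)
            then show ?thesis using k0 by (simp add: f_def)
          qed
          then show ?thesis using True
            by (intro tendsto_eventually) (auto simp: eventually_sequentially)
        next
          case False
          then have "f k (Z \<omega>) = 0" for k by (simp add: f_def)
          then show ?thesis using False by simp
        qed
      qed
    qed (use f in auto)
    ultimately have "(\<integral>\<omega>. indicator S (Z \<omega>) \<partial>N) \<le> p"
      by (intro tendsto_upperbound[of "\<lambda>k. \<integral>\<omega>. f k (Z \<omega>) \<partial>N"]) auto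
    moreover have "(\<integral>\<omega>. indicator S (Z \<omega>) \<partial>N) = (\<integral>\<omega>. indicator {\<omega> \<in> space N. Z \<omega> \<in> S} \<omega> \<partial>N :: real)"
      by (intro Bochner_Integration.integral_cong) (auto simp: indicator_def)
    ultimately show ?thesis by simp
  qed
qed

lemma osc_le_superset:
  assumes "A \<subseteq> B" "osc_le d A \<epsilon> x"
  shows "osc_le d B \<epsilon> x"
  unfolding osc_le_def
proof (intro conjI allI impI)
  fix i j assume "cell B (d i) = cell B (d j)"
  from cell_mono[OF assms(1) this] show "\<bar>x i - x j\<bar> \<le> \<epsilon>" using assms(2) unfolding osc_le_def by blast
next
  fix i assume "cell B (d i) = {} \<or> cell B (d i) = B"
  from cell_mono_extreme[OF assms(1) this] show "\<bar>x i\<bar> \<le> \<epsilon>" using assms(2) unfolding osc_le_def by blast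
qed

lemma (in dense_seq) osc_le_path_iff:
  assumes "finite A"
  shows "osc_le (\<lambda>t. t) A \<epsilon> (path_of x) \<longleftrightarrow> osc_le d A \<epsilon> (\<lambda>i. path_of x (d i))"
proof
  assume *: "osc_le (\<lambda>t. t) A \<epsilon> (path_of x)"
  show "osc_le d A \<epsilon> (\<lambda>i. path_of x (d i))"
    unfolding osc_le_def
  proof (intro conjI allI impI)
    fix i j assume "cell A (d i) = cell A (d j)"
    then show "\<bar>path_of x (d i) - path_of x (d j)\<bar> \<le> \<epsilon>" using * unfolding osc_le_def by blast
  next
    fix i assume "cell A (d i) = {} \<or> cell A (d i) = A"
    then show "\<bar>path_of x (d i)\<bar> \<le> \<epsilon>" using * unfolding osc_le_def by blast
  qed
qed (rule osc_le_dense[OF assms])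

text \<open>A violated bound is a strict inequality between finitely many coordinates. Openness is
  what lets \<open>open_prob_le\<close> carry the oscillation bounds of \<open>C_n\<close> over to
  \<open>y\<close>.\<close>

lemma open_not_osc_le: "open {y :: nat \<Rightarrow> real. \<not> osc_le d A \<epsilon> y}"
proof -
  have "{y :: nat \<Rightarrow> real. \<not> osc_le d A \<epsilon> y} =
    (\<Union>(i, j)\<in>{(i, j). cell A (d i) = cell A (d j)}. {y. \<epsilon> < \<bar>y i - y j\<bar>}) \<union>
    (\<Union>i\<in>{i. cell A (d i) = {} \<or> cell A (d i) = A}. {y. \<epsilon> < \<bar>y i\<bar>})"
    unfolding osc_le_def not_le[symmetric] by blast
  moreover have "open {y :: nat \<Rightarrow> real. \<epsilon> < \<bar>y i - y j\<bar>}" "open {y :: nat \<Rightarrow> real. \<epsilon> < \<bar>y i\<bar>}" for i j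
    by (intro open_Collect_less continuous_intros continuous_on_product_coordinates)+
  ultimately show ?thesis by (simp only:) (intro open_Un open_UN ballI; auto)
qed

lemma osc_le_measurable [measurable]:
  fixes y :: "'w \<Rightarrow> nat \<Rightarrow> real"
  assumes [measurable]: "\<And>i. (\<lambda>\<omega>. y \<omega> i) \<in> borel_measurable N"
  shows "Measurable.pred N (\<lambda>\<omega>. osc_le d A \<epsilon> (y \<omega>))"
  unfolding osc_le_def by measurable

text \<open>\<open>y\<close> is a candidate for the limit, given at the dense times only and without
  path regularity. It is the time-changed bridge in (a) and a mixture of Gaussian sequences in (b);
  the passage to a random path is common to both.\<close>

locale empirical_limit = dense_seq d for d +
  fixes M :: "'m measure" and Y :: "nat \<Rightarrow> 'm \<Rightarrow> cadlag0" and N :: "'n measure" and y :: "'n \<Rightarrow> nat \<Rightarrow> real"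
  assumes M: "prob_space M" and N: "prob_space N"
    and Y: "\<And>n t. (\<lambda>\<omega>. path_of (Y n \<omega>) t) \<in> borel_measurable M"
    and osc: "\<And>\<epsilon> \<eta>. 0 < (\<epsilon>::real) \<Longrightarrow> 0 < (\<eta>::real) \<Longrightarrow> \<exists>A. finite A \<and>
        (\<forall>\<^sub>F n in sequentially. measure M {\<omega> \<in> space M. \<not> osc_le (\<lambda>t. t) A \<epsilon> (path_of (Y n \<omega>))} < \<eta>)"
    and tight: "\<And>t \<eta>. 0 < (\<eta>::real) \<Longrightarrow> \<exists>R. \<forall>n. measure M {\<omega> \<in> space M. R < \<bar>path_of (Y n \<omega>) t\<bar>} \<le> \<eta>"
    and y: "\<And>i. (\<lambda>\<omega>. y \<omega> i) \<in> borel_measurable N"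
    and conv: "\<And>(r::nat) b c. (\<lambda>n. \<integral>\<omega>. cos ((\<Sum>i<r. b i * path_of (Y n \<omega>) (d i)) + c) \<partial>M)
                 \<longlonglongrightarrow> (\<integral>\<omega>. cos ((\<Sum>i<r. b i * y \<omega> i) + c) \<partial>N)"
begin

sublocale M: prob_space M by (rule M)
sublocale N: prob_space N by (rule N)

declare Y [measurable] y [measurable]

lemma osc_events: "finite A \<Longrightarrow> {\<omega> \<in> space M. \<not> osc_le (\<lambda>t. t) A \<epsilon> (path_of (Y n \<omega>))} \<in> M.events"
  unfolding osc_le_path_iff by measurable

text \<open>Finite unions make the partitions nested, and adding cuts only shrinks the exceptional
  events. Both scales and probabilities are halved with each \<open>j\<close>, so that the
  exceptional probabilities are summable.\<close>

lemma osc_sequence: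
  obtains A :: "nat \<Rightarrow> real set" where "\<And>j. finite (A j)" "mono A"
    "\<And>j. \<forall>\<^sub>F n in sequentially.
        M.prob {\<omega> \<in> space M. \<not> osc_le (\<lambda>t. t) (A j) ((1 / 2) ^ j) (path_of (Y n \<omega>))} \<le> (1 / 2) ^ j"
proof -
  have "\<forall>j. \<exists>A. finite A \<and> (\<forall>\<^sub>F n in sequentially.
        M.prob {\<omega> \<in> space M. \<not> osc_le (\<lambda>t. t) A ((1 / 2) ^ j) (path_of (Y n \<omega>))} < (1 / 2) ^ j)"
    by (intro allI osc) auto
  from choice[OF this] obtain A0 where A0: "\<forall>j. finite (A0 j) \<and> (\<forall>\<^sub>F n in sequentially.
        M.prob {\<omega> \<in> space M. \<not> osc_le (\<lambda>t. t) (A0 j) ((1 / 2) ^ j) (path_of (Y n \<omega>))} < (1 / 2) ^ j)"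
    by blast
  define A where "A = (\<lambda>j::nat. \<Union>i\<le>j. A0 i)"
  have fin: "finite (A j)" for j using A0 by (auto simp: A_def)
  show thesis
  proof (rule that[of A])
    show "mono A" unfolding mono_def A_def by fastforce
    fix j
    have "\<forall>\<^sub>F n in sequentially.
        M.prob {\<omega> \<in> space M. \<not> osc_le (\<lambda>t. t) (A0 j) ((1 / 2) ^ j) (path_of (Y n \<omega>))} < (1 / 2) ^ j"
      using A0 by blast
    then show "\<forall>\<^sub>F n in sequentially.
        M.prob {\<omega> \<in> space M. \<not> osc_le (\<lambda>t. t) (A j) ((1 / 2) ^ j) (path_of (Y n \<omega>))} \<le> (1 / 2) ^ j"
    proof eventually_elim
      case (elim n)
      have "A0 j \<subseteq> A j" by (auto simp: A_def)
      then have "M.prob {\<omega> \<in> space M. \<not> osc_le (\<lambda>t. t) (A j) ((1 / 2) ^ j) (path_of (Y n \<omega>))}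
        \<le> M.prob {\<omega> \<in> space M. \<not> osc_le (\<lambda>t. t) (A0 j) ((1 / 2) ^ j) (path_of (Y n \<omega>))}"
        using A0 by (intro M.finite_measure_mono osc_events) (auto dest: osc_le_superset)
      with elim show ?case by simp
    qed
  qed (rule fin)
qed

lemma prob_limit_osc_le:
  assumes A: "finite A"
    and le: "\<forall>\<^sub>F n in sequentially. M.prob {\<omega> \<in> space M. \<not> osc_le (\<lambda>t. t) A \<epsilon> (path_of (Y n \<omega>))} \<le> p"
  shows "N.prob {\<omega> \<in> space N. \<not> osc_le d A \<epsilon> (y \<omega>)} \<le> p"
proof -
  let ?Y = "\<lambda>n \<omega> i. path_of (Y n \<omega>) (d i)"
  have "N.prob {\<omega> \<in> space N. y \<omega> \<in> {y. \<not> osc_le d A \<epsilon> y}} \<le> p"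
  proof (rule open_prob_le[OF M N, where Y="?Y"])
    show "?Y n \<in> borel_measurable M" for n
      by (rule measurable_coordinatewise_then_product) (rule Y)
    show "y \<in> borel_measurable N"
      by (rule measurable_coordinatewise_then_product) (rule y)
    show "\<forall>\<^sub>F n in sequentially. M.prob {\<omega> \<in> space M. ?Y n \<omega> \<in> {y. \<not> osc_le d A \<epsilon> y}} \<le> p"
      using le by (simp add: osc_le_path_iff[OF A])
    show "(\<lambda>n. \<integral>\<omega>. f (?Y n \<omega>) \<partial>M) \<longlonglongrightarrow> (\<integral>\<omega>. f (y \<omega>) \<partial>N)"
      if "continuous_on UNIV f" "\<And>x. \<bar>f x\<bar> \<le> B" for f :: "(nat \<Rightarrow> real) \<Rightarrow> real" and B
      by (rule product_weak_convergence[OF M N, where Y="?Y" and Z=y and f=f and B=B])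
        (use that conv Y y tight in auto)
  qed (rule open_not_osc_le)
  then show ?thesis by simp
qed

text \<open>On \<open>good j0\<close> all scales from \<open>j0\<close> on behave, and its
  complement has probability at most 2 (1/2)^j0. Thus almost every \<open>y\<close> extends to a
  path. The same sets \<open>osc_set\<close>, with the scales before \<open>j0\<close> dropped and a
  bound on the supremum, serve for the tightness of the limit and for the asymptotic tightness of
  \<open>Y\<close>.\<close>

theorem limit_exists:
  obtains Z where "Z \<in> N \<rightarrow>\<^sub>M borel" "AE \<omega> in N. \<forall>i. path_of (Z \<omega>) (d i) = y \<omega> i"
    "tight_law (distr N borel Z)"
    "\<And>f. continuous_on UNIV f \<Longrightarrow> bounded (range f) \<Longrightarrow>
       (\<lambda>n. outer_expectation M (\<lambda>\<omega>. f (Y n \<omega>))) \<longlonglongrightarrow> (\<integral>\<omega>. f (Z \<omega>) \<partial>N)"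
proof -
  obtain A where A: "\<And>j. finite (A j)" "mono A"
    "\<And>j. \<forall>\<^sub>F n in sequentially.
        M.prob {\<omega> \<in> space M. \<not> osc_le (\<lambda>t. t) (A j) ((1 / 2) ^ j) (path_of (Y n \<omega>))} \<le> (1 / 2) ^ j"
    by (rule osc_sequence) blast
  define \<epsilon> where "\<epsilon> = (\<lambda>j::nat. (1 / 2 :: real) ^ j)"
  have \<epsilon>0: "0 \<le> \<epsilon> j" for j by (simp add: \<epsilon>_def)
  have \<epsilon>lim: "\<epsilon> \<longlonglongrightarrow> 0" unfolding \<epsilon>_def by (rule LIMSEQ_realpow_zero) auto
  have small: "\<exists>j0. \<epsilon> j0 * 2 \<le> \<eta>" if "0 < \<eta>" for \<eta>
  proof -
    have "\<forall>\<^sub>F j in sequentially. \<epsilon> j < \<eta> / 2" using \<epsilon>lim that by (intro order_tendstoD) auto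
    then obtain j where "\<epsilon> j < \<eta> / 2" by (auto simp: eventually_sequentially)
    then show ?thesis by (intro exI[of _ j]) simp
  qed
  define good where "good = (\<lambda>j0. {\<omega> \<in> space N. \<forall>j\<ge>j0. osc_le d (A j) (\<epsilon> j) (y \<omega>)})"
  have good_m [measurable]: "good j0 \<in> N.events" for j0 unfolding good_def by measurable
  have good_prob: "N.prob (space N - good j0) \<le> \<epsilon> j0 * 2" for j0
  proof -
    have "N.prob (\<Union>i. {\<omega> \<in> space N. \<not> osc_le d (A (j0 + i)) (\<epsilon> (j0 + i)) (y \<omega>)}) \<le> \<epsilon> j0 * 2"
    proof (rule N.prob_UN_le)
      fix i
      show "N.prob {\<omega> \<in> space N. \<not> osc_le d (A (j0 + i)) (\<epsilon> (j0 + i)) (y \<omega>)} \<le> \<epsilon> j0 * 2 * (1 / 2) ^ Suc i"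
        using prob_limit_osc_le[OF A(1,3), of "j0 + i"] by (simp add: \<epsilon>_def power_add)
    qed measurable
    also have "(\<Union>i. {\<omega> \<in> space N. \<not> osc_le d (A (j0 + i)) (\<epsilon> (j0 + i)) (y \<omega>)}) = space N - good j0"
    proof (intro equalityI subsetI)
      fix \<omega> assume "\<omega> \<in> space N - good j0"
      then obtain j where "\<omega> \<in> space N" "j0 \<le> j" "\<not> osc_le d (A j) (\<epsilon> j) (y \<omega>)" by (auto simp: good_def)
      then show "\<omega> \<in> (\<Union>i. {\<omega> \<in> space N. \<not> osc_le d (A (j0 + i)) (\<epsilon> (j0 + i)) (y \<omega>)})"
        by (intro UN_I[of "j - j0"]) auto
    next
      fix \<omega> assume "\<omega> \<in> (\<Union>i. {\<omega> \<in> space N. \<not> osc_le d (A (j0 + i)) (\<epsilon> (j0 + i)) (y \<omega>)})"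
      then obtain i where "\<omega> \<in> space N" "\<not> osc_le d (A (j0 + i)) (\<epsilon> (j0 + i)) (y \<omega>)" by blast
      then show "\<omega> \<in> space N - good j0" unfolding good_def using le_add1[of j0 i] by blast
    qed
    finally show ?thesis .
  qed
  define reg where "reg = (\<Union>j. good j)"
  have reg_m [measurable]: "reg \<in> N.events" unfolding reg_def by measurable
  have reg_prob: "N.prob reg = 1"
  proof -
    have "1 - N.prob reg \<le> \<eta>" if \<eta>: "0 < \<eta>" for \<eta>
    proof -
      obtain j where j: "\<epsilon> j * 2 \<le> \<eta>" using small[OF \<eta>] by blast
      have "1 - N.prob (good j) \<le> \<epsilon> j * 2" using good_prob[of j] by (simp add: N.prob_compl)
      moreover have "N.prob (good j) \<le> N.prob reg" by (rule N.finite_measure_mono) (auto simp: reg_def)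
      ultimately show ?thesis using j by linarith
    qed
    then have "1 - N.prob reg \<le> 0" by (meson dense_ge)
    then show ?thesis using N.prob_le_1[of reg] by linarith
  qed
  have AE_reg: "AE \<omega> in N. \<omega> \<in> reg" using N.prob_eq_1[OF reg_m] reg_prob by simp
  have ext: "\<exists>x. (\<lambda>j. proj d (A j) (y \<omega>)) \<longlonglongrightarrow> x \<and> (\<forall>i. path_of x (d i) = y \<omega> i)" if \<omega>: "\<omega> \<in> reg" for \<omega>
  proof -
    obtain j0 where "\<omega> \<in> good j0" using \<omega> by (auto simp: reg_def)
    then have "\<And>j. j0 \<le> j \<Longrightarrow> osc_le d (A j) (\<epsilon> j) (y \<omega>)" by (simp add: good_def)
    from proj_tendsto_extension[OF A(1) \<epsilon>lim this] show ?thesis by blast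
  qed
  define Z where "Z = (\<lambda>\<omega>. if \<omega> \<in> reg then (SOME x. (\<lambda>j. proj d (A j) (y \<omega>)) \<longlonglongrightarrow> x \<and> (\<forall>i. path_of x (d i) = y \<omega> i))
    else undefined)"
  have Z: "(\<lambda>j. proj d (A j) (y \<omega>)) \<longlonglongrightarrow> Z \<omega>" "path_of (Z \<omega>) (d i) = y \<omega> i" if "\<omega> \<in> reg" for \<omega> i
    using someI_ex[OF ext[OF that]] that unfolding Z_def by auto
  have ym: "y \<in> borel_measurable N" by (rule measurable_coordinatewise_then_product) (rule y)
  \<comment> \<open>\<open>Z\<close> is the pointwise limit of the projections on \<open>reg\<close>
    and constant elsewhere. Each projection is a continuous function of \<open>y\<close>, so
    \<open>Z\<close> is Borel measurable and not merely measurable in each coordinate.\<close>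
  have Zm [measurable]: "Z \<in> borel_measurable N"
  proof (rule borel_measurable_LIMSEQ_metric)
    fix j
    have "proj d (A j) \<in> borel_measurable borel"
      by (rule borel_measurable_continuous_onI[OF continuous_proj[OF A(1)]])
    then have [measurable]: "(\<lambda>\<omega>. proj d (A j) (y \<omega>)) \<in> borel_measurable N"
      by (rule measurable_compose[OF ym])
    show "(\<lambda>\<omega>. if \<omega> \<in> reg then proj d (A j) (y \<omega>) else undefined) \<in> borel_measurable N"
      by measurable
  next
    fix \<omega>
    show "(\<lambda>j. if \<omega> \<in> reg then proj d (A j) (y \<omega>) else undefined) \<longlonglongrightarrow> Z \<omega>"
      using Z(1)[of \<omega>] by (cases "\<omega> \<in> reg") (simp_all add: Z_def)
  qed
  have Zosc: "osc_le (\<lambda>t. t) (A j) (\<epsilon> j) (path_of (Z \<omega>))" if "\<omega> \<in> good j0" "j0 \<le> j" for \<omega> j0 j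
  proof -
    have "\<omega> \<in> reg" using that by (auto simp: reg_def)
    then have "(\<lambda>i. path_of (Z \<omega>) (d i)) = y \<omega>" using Z(2) by auto
    moreover have "osc_le d (A j) (\<epsilon> j) (y \<omega>)" using that by (simp add: good_def)
    ultimately show ?thesis by (simp add: osc_le_path_iff[OF A(1)])
  qed
  have bdd: "\<exists>R\<ge>0. N.prob {\<omega> \<in> space N. \<exists>i. R < \<bar>path_of (Z \<omega>) (d i)\<bar>} \<le> \<eta>" if \<eta>: "0 < \<eta>" for \<eta>
  proof -
    let ?B = "\<lambda>n::nat. {\<omega> \<in> space N. \<forall>i. \<bar>path_of (Z \<omega>) (d i)\<bar> \<le> real n}"
    have "\<exists>n::nat. \<forall>i. \<bar>path_of x (d i)\<bar> \<le> real n" for x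
    proof -
      obtain b where "\<And>t. \<bar>path_of x t\<bar> \<le> b" using bounded_range_path_of[of x] by (auto simp: bounded_iff)
      moreover obtain n :: nat where "b \<le> real n" using real_arch_simple by blast
      ultimately show ?thesis by (meson order_trans)
    qed
    then have "(\<Union>n. ?B n) = space N" by blast
    then have "N.prob (\<Union>n. ?B n) = 1" by (simp add: N.prob_space)
    moreover have "incseq ?B" by (auto simp: incseq_def intro: order_trans)
    moreover have "?B n \<in> N.events" for n
      using measurable_compose[OF Zm measurable_eval] by measurable
    ultimately obtain n where "N.prob (space N - ?B n) \<le> \<eta>"
      using N.exhaust_small[of ?B \<eta>] \<eta> by auto
    moreover have "space N - ?B n = {\<omega> \<in> space N. \<exists>i. real n < \<bar>path_of (Z \<omega>) (d i)\<bar>}"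
      unfolding not_le[symmetric] by blast
    ultimately show ?thesis by (intro exI[of _ "real n"]) auto
  qed
  have Zset: "N.prob {\<omega> \<in> space N. Z \<omega> \<notin> osc_set A \<epsilon> j0 R} \<le> \<epsilon> j0 * 2 + \<eta>"
    if R: "N.prob {\<omega> \<in> space N. \<exists>i. R0 < \<bar>path_of (Z \<omega>) (d i)\<bar>} \<le> \<eta>" "R0 \<le> R" for j0 R R0 \<eta>
  proof -
    have [measurable]: "(\<lambda>\<omega>. path_of (Z \<omega>) (d i)) \<in> borel_measurable N" for i
      using measurable_compose[OF Zm measurable_eval] .
    have m: "{\<omega> \<in> space N. \<exists>i. R0 < \<bar>path_of (Z \<omega>) (d i)\<bar>} \<in> N.events" by measurable
    have "{\<omega> \<in> space N. Z \<omega> \<notin> osc_set A \<epsilon> j0 R} \<subseteq>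
        (space N - good j0) \<union> {\<omega> \<in> space N. \<exists>i. R0 < \<bar>path_of (Z \<omega>) (d i)\<bar>}"
    proof safe
      fix \<omega> assume \<omega>: "\<omega> \<in> space N" "Z \<omega> \<notin> osc_set A \<epsilon> j0 R" "\<omega> \<in> good j0"
      show "\<exists>i. R0 < \<bar>path_of (Z \<omega>) (d i)\<bar>"
      proof (rule ccontr)
        assume "\<not> ?thesis"
        then have "\<And>i. \<bar>path_of (Z \<omega>) (d i)\<bar> \<le> R" using R(2) by (meson not_le order_trans)
        from sup_le_dense[OF this] Zosc[OF \<omega>(3)] have "Z \<omega> \<in> osc_set A \<epsilon> j0 R" by (simp add: osc_set_def)
        with \<omega>(2) show False by simp
      qed
    qed
    then have "N.prob {\<omega> \<in> space N. Z \<omega> \<notin> osc_set A \<epsilon> j0 R} \<le>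
        N.prob ((space N - good j0) \<union> {\<omega> \<in> space N. \<exists>i. R0 < \<bar>path_of (Z \<omega>) (d i)\<bar>})"
      using m by (intro N.finite_measure_mono) auto
    also have "\<dots> \<le> N.prob (space N - good j0) + N.prob {\<omega> \<in> space N. \<exists>i. R0 < \<bar>path_of (Z \<omega>) (d i)\<bar>}"
      using m by (intro measure_Un_le) auto
    also have "\<dots> \<le> \<epsilon> j0 * 2 + \<eta>" using good_prob[of j0] R(1) by (rule add_mono)
    finally show ?thesis .
  qed
  have Kcomp: "compact (osc_set A \<epsilon> j0 R)" for j0 R by (rule compact_osc_set[OF A(1) \<epsilon>lim])
  show thesis
  proof (rule that[of Z])
    show "Z \<in> N \<rightarrow>\<^sub>M borel" by (rule Zm)
    show "AE \<omega> in N. \<forall>i. path_of (Z \<omega>) (d i) = y \<omega> i" using AE_reg by eventually_elim (simp add: Z)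
    show "tight_law (distr N borel Z)"
      unfolding tight_law_def
    proof (intro allI impI)
      fix \<eta> :: real assume \<eta>: "0 < \<eta>"
      obtain j0 where j0: "\<epsilon> j0 * 2 \<le> \<eta> / 2" using small[of "\<eta>/2"] \<eta> by auto
      obtain R where R: "N.prob {\<omega> \<in> space N. \<exists>i. R < \<bar>path_of (Z \<omega>) (d i)\<bar>} \<le> \<eta> / 2"
        using bdd[of "\<eta> / 2"] \<eta> by auto
      let ?K = "osc_set A \<epsilon> j0 R"
      have K [measurable]: "?K \<in> sets borel" using Kcomp by (simp add: borel_compact)
      have "N.prob {\<omega> \<in> space N. Z \<omega> \<notin> ?K} \<le> \<eta>" using Zset[OF R, of R j0] j0 by simp
      moreover have "{\<omega> \<in> space N. Z \<omega> \<notin> ?K} = space N - {\<omega> \<in> space N. Z \<omega> \<in> ?K}" by auto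
      moreover have "{\<omega> \<in> space N. Z \<omega> \<in> ?K} \<in> N.events" by measurable
      ultimately have "1 - N.prob {\<omega> \<in> space N. Z \<omega> \<in> ?K} \<le> \<eta>" by (simp add: N.prob_compl)
      moreover have "Z -` ?K \<inter> space N = {\<omega> \<in> space N. Z \<omega> \<in> ?K}" by auto
      ultimately have "1 - \<eta> \<le> measure (distr N borel Z) ?K" by (simp add: measure_distr[OF Zm K])
      then show "\<exists>K. compact K \<and> 1 - \<eta> \<le> measure (distr N borel Z) K" using Kcomp by blast
    qed
    fix f :: "cadlag0 \<Rightarrow> real" assume f: "continuous_on UNIV f" "bounded (range f)"
    obtain B where B: "\<And>x. \<bar>f x\<bar> \<le> B" using f(2) by (auto simp: bounded_iff)
    show "(\<lambda>n. outer_expectation M (\<lambda>\<omega>. f (Y n \<omega>))) \<longlonglongrightarrow> (\<integral>\<omega>. f (Z \<omega>) \<partial>N)"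
    proof (rule weak_convergence_from_trig[OF M N, where \<phi>="\<lambda>i x. path_of x (d i)" and f=f and Y=Y and Z=Z and B=B])
      show "continuous_on UNIV (\<lambda>x. path_of x (d i))" for i by (rule continuous_on_eval)
      show "\<exists>i. path_of x (d i) \<noteq> path_of x' (d i)" if "x \<noteq> x'" for x x' using that eq_if_dense by blast
      show "(\<lambda>n. \<integral>\<omega>. cos ((\<Sum>i<r. b i * path_of (Y n \<omega>) (d i)) + c) \<partial>M)
          \<longlonglongrightarrow> (\<integral>\<omega>. cos ((\<Sum>i<r. b i * path_of (Z \<omega>) (d i)) + c) \<partial>N)" for r :: nat and b c
      proof -
        have [measurable]: "(\<lambda>\<omega>. path_of (Z \<omega>) (d i)) \<in> borel_measurable N" for i
          using measurable_compose[OF Zm measurable_eval] .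
        have "(\<integral>\<omega>. cos ((\<Sum>i<r. b i * path_of (Z \<omega>) (d i)) + c) \<partial>N) = (\<integral>\<omega>. cos ((\<Sum>i<r. b i * y \<omega> i) + c) \<partial>N)"
        proof (rule integral_cong_AE)
          show "AE \<omega> in N. cos ((\<Sum>i<r. b i * path_of (Z \<omega>) (d i)) + c) = cos ((\<Sum>i<r. b i * y \<omega> i) + c)"
            using AE_reg by eventually_elim (simp add: Z)
        qed measurable
        then show ?thesis using conv by simp
      qed
      fix \<eta> :: real assume \<eta>: "0 < \<eta>"
      obtain j0 where j0: "\<epsilon> j0 * 2 \<le> \<eta> / 2" using small[of "\<eta>/2"] \<eta> by auto
      obtain R1 where R1: "N.prob {\<omega> \<in> space N. \<exists>i. R1 < \<bar>path_of (Z \<omega>) (d i)\<bar>} \<le> \<eta> / 2"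
        using bdd[of "\<eta> / 2"] \<eta> by auto
      \<comment> \<open>One representative time for each cell of \<open>A j0\<close>: a bound there
        extends to the whole cell at the cost of \<open>\<epsilon> j0\<close>. The at most
        \<open>k\<close> representatives share the probability \<eta> / 2; the other half pays for
        the scales.\<close>
      define rep where "rep = (\<lambda>c. SOME t. cell (A j0) t = c)"
      have rep: "cell (A j0) (rep (cell (A j0) t)) = cell (A j0) t" for t
        unfolding rep_def by (rule someI) simp
      define k where "k = real (card (Pow (A j0)))"
      have k: "0 < k" using A(1) by (simp add: k_def card_Pow)
      have "\<forall>c. \<exists>R. \<forall>n. M.prob {\<omega> \<in> space M. R < \<bar>path_of (Y n \<omega>) (rep c)\<bar>} \<le> \<eta> / (2 * k)"
        using \<eta> k by (intro allI tight) simp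
      from choice[OF this] obtain Rc where
        Rc: "\<And>c n. M.prob {\<omega> \<in> space M. Rc c < \<bar>path_of (Y n \<omega>) (rep c)\<bar>} \<le> \<eta> / (2 * k)" by blast
      define R where "R = max R1 ((\<Sum>c\<in>Pow (A j0). \<bar>Rc c\<bar>) + \<epsilon> j0)"
      let ?K = "osc_set A \<epsilon> j0 R"
      have "\<forall>\<^sub>F n in sequentially. \<exists>E\<in>M.events. M.prob E \<le> \<eta> \<and> (\<forall>\<omega>\<in>space M - E. \<exists>z\<in>?K. dist (Y n \<omega>) z < \<delta>)"
        if \<delta>: "0 < \<delta>" for \<delta>
      proof -
        \<comment> \<open>The scale \<open>m\<close> depends on \<delta>, while \<open>?K\<close>
          does not. For \<open>n\<close> large in terms of \<open>m\<close>, the finitely many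
          scales from \<open>j0\<close> to \<open>m\<close> hold at once outside an event whose
          probability is bounded independently of \<open>m\<close>.\<close>
        have "\<forall>\<^sub>F m in sequentially. \<epsilon> m < \<delta> \<and> j0 \<le> m"
          using \<delta> by (intro eventually_conj order_tendstoD(2)[OF \<epsilon>lim] eventually_ge_at_top)
        then obtain m where m: "\<epsilon> m < \<delta>" "j0 \<le> m" by (auto simp: eventually_sequentially)
        have "\<forall>\<^sub>F n in sequentially. \<forall>j\<in>{j0..m}. M.prob {\<omega> \<in> space M. \<not> osc_le (\<lambda>t. t) (A j) (\<epsilon> j) (path_of (Y n \<omega>))} \<le> \<epsilon> j"
          unfolding \<epsilon>_def by (intro eventually_ball_finite ballI A(3)) simp
        then show ?thesis
        proof eventually_elim
          case (elim n)
          let ?E1 = "\<lambda>j. {\<omega> \<in> space M. \<not> osc_le (\<lambda>t. t) (A j) (\<epsilon> j) (path_of (Y n \<omega>))}"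
          let ?E2 = "\<lambda>c. {\<omega> \<in> space M. Rc c < \<bar>path_of (Y n \<omega>) (rep c)\<bar>}"
          have E1: "?E1 j \<in> M.events" for j by (rule osc_events[OF A(1)])
          have E2: "?E2 c \<in> M.events" for c by measurable
          define E where "E = (\<Union>j\<in>{j0..m}. ?E1 j) \<union> (\<Union>c\<in>Pow (A j0). ?E2 c)"
          have U: "(\<Union>j\<in>{j0..m}. ?E1 j) \<in> M.events" "(\<Union>c\<in>Pow (A j0). ?E2 c) \<in> M.events"
            using A(1) by (intro sets.finite_UN E1 E2; simp)+
          have "M.prob E \<le> M.prob (\<Union>j\<in>{j0..m}. ?E1 j) + M.prob (\<Union>c\<in>Pow (A j0). ?E2 c)"
            unfolding E_def by (rule measure_Un_le[OF U])
          also have "M.prob (\<Union>j\<in>{j0..m}. ?E1 j) \<le> (\<Sum>j\<in>{j0..m}. \<epsilon> j)"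
            by (rule order_trans[OF measure_UNION_le]) (use E1 elim in \<open>auto intro!: sum_mono\<close>)
          also have "(\<Sum>j\<in>{j0..m}. \<epsilon> j) \<le> \<epsilon> j0 * 2"
          proof -
            have "(\<Sum>j\<in>{j0..m}. \<epsilon> j) = \<epsilon> j0 * 2 - \<epsilon> m" using m(2)
              by (induction m rule: dec_induct) (simp_all add: \<epsilon>_def)
            then show ?thesis using \<epsilon>0[of m] by simp
          qed
          also have "M.prob (\<Union>c\<in>Pow (A j0). ?E2 c) \<le> (\<Sum>c\<in>Pow (A j0). \<eta> / (2 * k))"
            by (rule order_trans[OF measure_UNION_le]; (rule E2 | rule sum_mono, rule Rc | simp add: A(1)))
          also have "(\<Sum>c\<in>Pow (A j0). \<eta> / (2 * k)) = \<eta> / 2" using k by (simp add: k_def)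
          finally have PE: "M.prob E \<le> \<eta>" using j0 by simp
          have "\<exists>z\<in>?K. dist (Y n \<omega>) z < \<delta>" if \<omega>: "\<omega> \<in> space M - E" for \<omega>
          proof -
            have o: "osc_le (\<lambda>t. t) (A j) (\<epsilon> j) (path_of (Y n \<omega>))" if "j0 \<le> j" "j \<le> m" for j
              using \<omega> that by (auto simp: E_def)
            have bd: "\<bar>path_of (Y n \<omega>) t\<bar> \<le> R" for t
            proof -
              let ?c = "cell (A j0) t"
              have c: "?c \<in> Pow (A j0)" by (auto simp: cell_def)
              have "\<omega> \<notin> ?E2 ?c" using \<omega> c unfolding E_def by blast
              then have "\<bar>path_of (Y n \<omega>) (rep ?c)\<bar> \<le> \<bar>Rc ?c\<bar>" using \<omega> by auto
              also have "\<dots> \<le> (\<Sum>c\<in>Pow (A j0). \<bar>Rc c\<bar>)" using c A(1) by (intro member_le_sum) auto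
              finally have "\<bar>path_of (Y n \<omega>) (rep ?c)\<bar> \<le> (\<Sum>c\<in>Pow (A j0). \<bar>Rc c\<bar>)" .
              moreover have "\<bar>path_of (Y n \<omega>) (rep ?c) - path_of (Y n \<omega>) t\<bar> \<le> \<epsilon> j0"
                using o[of j0] m(2) rep[of t] unfolding osc_le_def by blast
              ultimately show ?thesis unfolding R_def by linarith
            qed
            have "proj (\<lambda>t. t) (A m) (path_of (Y n \<omega>)) \<in> ?K"
              by (rule proj_in_osc_set(1)[OF A(1,2) \<epsilon>0 m(2)]) (rule o bd; assumption?)+
            moreover have "dist (Y n \<omega>) (proj (\<lambda>t. t) (A m) (path_of (Y n \<omega>))) \<le> \<epsilon> m"
              by (rule proj_in_osc_set(2)[where R=R, OF A(1,2) \<epsilon>0 m(2)]) (rule o bd; assumption?)+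
            ultimately show ?thesis using m(1) by (meson le_less_trans)
          qed
          moreover have "E \<in> M.events" unfolding E_def using U by auto
          ultimately show ?case using PE by blast
        qed
      qed
      moreover have "N.prob {\<omega> \<in> space N. Z \<omega> \<notin> ?K} \<le> \<eta>"
        using Zset[OF R1, of R j0] j0 by (simp add: R_def)
      ultimately show "\<exists>K. compact K \<and> N.prob {\<omega> \<in> space N. Z \<omega> \<notin> K} \<le> \<eta> \<and>
        (\<forall>\<delta>>0. \<forall>\<^sub>F n in sequentially. \<exists>E\<in>M.events. M.prob E \<le> \<eta> \<and>
           (\<forall>\<omega>\<in>space M - E. \<exists>z\<in>K. dist (Y n \<omega>) z < \<delta>))"
        using Kcomp by blast
    qed (use f B Y Zm in auto)
  qed
qed

end

section \<open>Gaussian laws and their mixtures\<close>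

definition psd :: "nat \<Rightarrow> (nat \<Rightarrow> nat \<Rightarrow> real) \<Rightarrow> bool" where
  "psd r S \<longleftrightarrow> (\<forall>a<r. \<forall>b<r. S a b = S b a) \<and> (\<forall>v. 0 \<le> (\<Sum>a<r. \<Sum>b<r. v a * v b * S a b))"

text \<open>Cholesky's algorithm: \<open>schur S k\<close> is what is left of \<open>S\<close> after \<open>k\<close> elimination steps. For
  a vanishing pivot of a positive semidefinite matrix the whole column vanishes, so division by
  zero does no harm.\<close>

fun schur :: "(nat \<Rightarrow> nat \<Rightarrow> real) \<Rightarrow> nat \<Rightarrow> nat \<Rightarrow> nat \<Rightarrow> real" where
  "schur S 0 = S"
| "schur S (Suc k) = (\<lambda>a b. schur S k a b - schur S k a k * schur S k b k / schur S k k k)"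

text \<open>An explicit factor depends measurably on the matrix. The factor chosen by
  \<open>SOME\<close> in \<open>centered_gaussian\<close> offers no such information, which matters
  for random covariances.\<close>

definition chol :: "(nat \<Rightarrow> nat \<Rightarrow> real) \<Rightarrow> nat \<Rightarrow> nat \<Rightarrow> real" where
  "chol S a k = schur S k a k / sqrt (schur S k k k)"

text \<open>The quadratic form evaluated at v + \<tau> e_k, with e_k the \<open>k\<close>-th unit
  vector. As a polynomial in \<tau> it controls both cases of an elimination step: minimised for a
  positive pivot, affine for a zero one.\<close>

lemma quadratic_shift:
  fixes S :: "nat \<Rightarrow> nat \<Rightarrow> real"
  assumes sym: "\<And>a b. a < r \<Longrightarrow> b < r \<Longrightarrow> S a b = S b a" and k: "k < r"
  shows "(\<Sum>a<r. \<Sum>b<r. (v a + (if a = k then \<tau> else 0)) * (v b + (if b = k then \<tau> else 0)) * S a b)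
    = (\<Sum>a<r. \<Sum>b<r. v a * v b * S a b) + 2 * \<tau> * (\<Sum>a<r. v a * S a k) + \<tau>\<^sup>2 * S k k"
proof -
  have inner: "(\<Sum>b<r. (v a + (if a = k then \<tau> else 0)) * (v b + (if b = k then \<tau> else 0)) * S a b)
    = (\<Sum>b<r. v a * v b * S a b) + \<tau> * v a * S a k
      + (if a = k then \<tau> * (\<Sum>b<r. v b * S k b) + \<tau>\<^sup>2 * S k k else 0)" for a
  proof -
    have "(\<Sum>b<r. (v a + (if a = k then \<tau> else 0)) * (v b + (if b = k then \<tau> else 0)) * S a b)
      = (\<Sum>b<r. v a * v b * S a b + (if b = k then v a * \<tau> * S a b else 0)
          + (if a = k then \<tau> * (v b * S k b) else 0) + (if b = k then (if a = k then \<tau>\<^sup>2 * S k b else 0) else 0))"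
      by (intro sum.cong) (auto simp: algebra_simps power2_eq_square)
    also have "\<dots> = (\<Sum>b<r. v a * v b * S a b) + v a * \<tau> * S a k
          + (if a = k then \<tau> * (\<Sum>b<r. v b * S k b) else 0) + (if a = k then \<tau>\<^sup>2 * S k k else 0)"
      using k by (simp add: sum.distrib sum_distrib_left)
    finally show ?thesis by simp
  qed
  have "(\<Sum>b<r. v b * S k b) = (\<Sum>a<r. v a * S a k)"
    using sym k by (intro sum.cong) auto
  then show ?thesis
    unfolding inner using k by (simp add: sum.distrib sum_distrib_left algebra_simps)
qed

lemma psd_diag_nonneg:
  assumes "psd r S" "k < r" shows "0 \<le> S k k"
proof -
  have "0 \<le> (\<Sum>a<r. \<Sum>b<r. (if a = k then 1 else 0) * (if b = k then 1 else 0) * S a b)"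
    using assms(1) by (auto simp: psd_def)
  also have "\<dots> = (\<Sum>a<r. if a = k then \<Sum>b<r. if b = k then S a b else 0 else 0)"
    by (intro sum.cong refl) (simp add: if_distrib[of "\<lambda>x. x * _"] cong: if_cong)
  also have "\<dots> = S k k" using assms(2) by simp
  finally show ?thesis .
qed

lemma psd_quadratic_nonneg:
  assumes "psd r S" "k < r"
  shows "0 \<le> (\<Sum>a<r. \<Sum>b<r. v a * v b * S a b) + 2 * \<tau> * (\<Sum>a<r. v a * S a k) + \<tau>\<^sup>2 * S k k"
proof -
  have "\<forall>v. 0 \<le> (\<Sum>a<r. \<Sum>b<r. v a * v b * S a b)" using assms(1) by (simp add: psd_def)
  from spec[OF this, of "\<lambda>a. v a + (if a = k then \<tau> else 0)"]
  show ?thesis using quadratic_shift[of r S k v \<tau>] assms by (simp add: psd_def)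
qed

lemma affine_nonneg_imp_slope_0:
  fixes p q :: real
  assumes "\<And>\<tau>. 0 \<le> p + 2 * \<tau> * q" shows "q = 0"
proof (rule ccontr)
  assume "q \<noteq> 0"
  then have "p + 2 * (- (p + 1) / (2 * q)) * q = - 1" by (simp add: field_simps)
  then show False using assms[of "- (p + 1) / (2 * q)"] by linarith
qed

lemma psd_zero_pivot:
  assumes "psd r S" "k < r" "S k k = 0"
  shows "(\<Sum>a<r. v a * S a k) = 0"
proof (rule affine_nonneg_imp_slope_0)
  fix \<tau>
  show "0 \<le> (\<Sum>a<r. \<Sum>b<r. v a * v b * S a b) + 2 * \<tau> * (\<Sum>a<r. v a * S a k)"
    using psd_quadratic_nonneg[OF assms(1,2), of v \<tau>] assms(3) by simp
qed

lemma psd_zero_pivot_column: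
  assumes "psd r S" "k < r" "S k k = 0" "a < r"
  shows "S a k = 0"
proof -
  have "S a k = (\<Sum>i<r. if i = a then S i k else 0)" using assms(4) by simp
  also have "\<dots> = (\<Sum>i<r. (if i = a then 1 else 0) * S i k)" by (intro sum.cong) auto
  also have "\<dots> = 0" by (rule psd_zero_pivot[OF assms(1-3)])
  finally show ?thesis .
qed

text \<open>The new form at \<open>v\<close> is the old one at v + \<tau> e_k with the minimising
  \<tau>, hence nonnegative. For a zero pivot the quotient is 0 by convention and the form is
  unchanged.\<close>

lemma psd_schur_step:
  assumes S: "psd r S" and k: "k < r"
  shows "psd r (\<lambda>a b. S a b - S a k * S b k / S k k)"
  unfolding psd_def
proof (intro conjI allI impI)
  show "S a b - S a k * S b k / S k k = S b a - S b k * S a k / S k k" if "a < r" "b < r" for a b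
    using S that by (simp add: psd_def mult.commute)
  fix v :: "nat \<Rightarrow> real"
  let ?L = "\<Sum>a<r. v a * S a k" and ?Q = "\<Sum>a<r. \<Sum>b<r. v a * v b * S a b"
  have "?L * ?L / S k k = (\<Sum>a<r. \<Sum>b<r. v a * v b * (S a k * S b k / S k k))"
    by (simp add: sum_product sum_divide_distrib mult_ac)
  then have eq: "(\<Sum>a<r. \<Sum>b<r. v a * v b * (S a b - S a k * S b k / S k k)) = ?Q - ?L * ?L / S k k"
    by (simp add: right_diff_distrib sum_subtractf)
  show "0 \<le> (\<Sum>a<r. \<Sum>b<r. v a * v b * (S a b - S a k * S b k / S k k))"
  proof (cases "S k k = 0")
    case True
    then show ?thesis unfolding eq using S by (simp add: psd_def)
  next
    case False
    have "?Q + 2 * (- ?L / S k k) * ?L + (- ?L / S k k)\<^sup>2 * S k k = ?Q - ?L * ?L / S k k"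
      using False by (simp add: power2_eq_square field_simps)
    then show ?thesis unfolding eq using psd_quadratic_nonneg[OF S k, of v "- ?L / S k k"] by simp
  qed
qed

text \<open>Eliminated columns stay zero: by symmetry the current pivot column vanishes in the rows
  eliminated before, so nothing is subtracted from the corresponding columns.\<close>

lemma schur_psd:
  assumes S: "psd r S" and "m \<le> r"
  shows "psd r (schur S m) \<and> (\<forall>j<m. \<forall>a<r. schur S m a j = 0)"
  using assms(2)
proof (induction m)
  case (Suc m)
  then have IH: "psd r (schur S m)" "\<And>j a. j < m \<Longrightarrow> a < r \<Longrightarrow> schur S m a j = 0" and m: "m < r" by auto
  have sym: "schur S m j m = schur S m m j" if "j < r" for j
    using IH(1) that m by (simp add: psd_def)
  have "schur S (Suc m) a j = 0" if j: "j < Suc m" and a: "a < r" for a j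
  proof (cases "j = m")
    case True
    show ?thesis
    proof (cases "schur S m m m = 0")
      case True
      from psd_zero_pivot_column[OF IH(1) m True a] show ?thesis using \<open>j = m\<close> by simp
    next
      case False
      then show ?thesis using \<open>j = m\<close> by simp
    qed
  next
    case False
    then have jm: "j < m" using j by simp
    then have "schur S m j m = 0" using sym[of j] IH(2)[OF jm m] m by linarith
    then show ?thesis using IH(2)[OF jm a] by simp
  qed
  moreover have "psd r (schur S (Suc m))" using psd_schur_step[OF IH(1) m] by (simp only: schur.simps)
  ultimately show ?case by blast
next
  case 0
  show ?case using S by simp
qed

text \<open>Elimination step \<open>k\<close> subtracts exactly
  \<open>chol S a k * chol S b k\<close>. The steps telescope, and after \<open>r\<close> of them
  nothing is left.\<close>

theorem chol_factorization:
  assumes S: "psd r S" and ab: "a < r" "b < r"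
  shows "(\<Sum>k<r. chol S a k * chol S b k) = S a b"
proof -
  have "(\<Sum>k<m. chol S a k * chol S b k) = S a b - schur S m a b" if "m \<le> r" for m
    using that
  proof (induction m)
    case (Suc m)
    have "0 \<le> schur S m m m" using schur_psd[OF S, of m] Suc.prems by (intro psd_diag_nonneg[of r]) auto
    then have "chol S a m * chol S b m = schur S m a m * schur S m b m / schur S m m m"
      by (simp add: chol_def)
    then show ?case using Suc by simp
  qed simp
  from this[of r] show ?thesis using schur_psd[OF S, of r] ab by simp
qed

lemma schur_measurable [measurable]:
  assumes [measurable]: "\<And>a b. (\<lambda>\<omega>. S \<omega> a b) \<in> borel_measurable M"
  shows "(\<lambda>\<omega>. schur (S \<omega>) k a b) \<in> borel_measurable M"
proof (induction k arbitrary: a b)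
  case (Suc k)
  note [measurable] = Suc
  show ?case unfolding schur.simps by measurable
qed simp

lemma chol_measurable [measurable]:
  assumes "\<And>a b. (\<lambda>\<omega>. S \<omega> a b) \<in> borel_measurable M"
  shows "(\<lambda>\<omega>. chol (S \<omega>) a k) \<in> borel_measurable M"
  using schur_measurable[OF assms] unfolding chol_def by measurable

section \<open>Products of standard Gaussian laws and their linear images\<close>

abbreviation gauss_product :: "nat set \<Rightarrow> (nat \<Rightarrow> real) measure" where
  "gauss_product I \<equiv> \<Pi>\<^sub>M i\<in>I. density lborel std_normal_density"

lemma prob_space_std_normal: "prob_space (density lborel std_normal_density)"
  by (rule prob_space_normal_density) simp

lemma prob_space_gauss_product: "prob_space (gauss_product I)"
  by (rule prob_space_PiM) (rule prob_space_std_normal)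

lemma gauss_product_coord [measurable]: "(\<lambda>z. z i) \<in> borel_measurable (gauss_product I)" if "i \<in> I"
  by (rule measurable_compose[OF measurable_component_singleton[OF that]]) simp

text \<open>\<open>I\<close> may be infinite, because (b) draws all coordinates of the limit from a
  single Gaussian sequence. The integrand depends on the finitely many coordinates in
  \<open>J\<close>, so the integral reduces to a finite product measure, where it
  factorises.\<close>

lemma gauss_product_char:
  assumes "finite J" "J \<subseteq> I"
  shows "(\<integral>z. iexp (\<Sum>k\<in>J. c k * z k) \<partial>gauss_product I) = exp (- (\<Sum>k\<in>J. (c k)\<^sup>2) / 2)"
proof -
  interpret P: product_prob_space "\<lambda>_. density lborel std_normal_density" I
    by (rule product_prob_spaceI) (rule prob_space_std_normal)
  have "(\<integral>z. iexp (\<Sum>k\<in>J. c k * z k) \<partial>gauss_product J)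
      = (\<integral>z. iexp (\<Sum>k\<in>J. c k * z k) \<partial>distr (gauss_product I) (gauss_product J) (\<lambda>z. restrict z J))"
    by (simp add: P.distr_PiM_restrict_finite[OF assms])
  also have "\<dots> = (\<integral>z. iexp (\<Sum>k\<in>J. c k * restrict z J k) \<partial>gauss_product I)"
  proof (rule integral_distr)
    show "(\<lambda>z. restrict z J) \<in> gauss_product I \<rightarrow>\<^sub>M gauss_product J"
      using assms(2) by (rule measurable_restrict_subset)
    have "(\<lambda>z. \<Sum>k\<in>J. c k * z k) \<in> borel_measurable (gauss_product J)"
      by (intro borel_measurable_sum borel_measurable_times borel_measurable_const gauss_product_coord)
    moreover have "(\<lambda>x :: real. iexp x) \<in> borel_measurable borel" by measurable
    ultimately show "(\<lambda>z. iexp (\<Sum>k\<in>J. c k * z k)) \<in> borel_measurable (gauss_product J)"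
      by (rule measurable_compose)
  qed
  also have "\<dots> = (\<integral>z. iexp (\<Sum>k\<in>J. c k * z k) \<partial>gauss_product I)" by simp
  finally have "(\<integral>z. iexp (\<Sum>k\<in>J. c k * z k) \<partial>gauss_product I)
      = (\<integral>z. (\<Prod>k\<in>J. iexp (c k * z k)) \<partial>gauss_product J)"
    by (simp add: sum_distrib_left exp_sum assms(1))
  also have "\<dots> = (\<Prod>k\<in>J. \<integral>x. iexp (c k * x) \<partial>density lborel std_normal_density)"
    by (rule P.product_integral_prod[OF assms(1)]) (rule prob_space.integrable_boundedI[OF prob_space_std_normal, where B=1], auto)
  also have "\<dots> = (\<Prod>k\<in>J. char (density lborel std_normal_density) (c k))"
    by (simp add: char_def)
  also have "\<dots> = exp (- (\<Sum>k\<in>J. (c k)\<^sup>2) / 2)"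
  proof -
    have "(\<Sum>k\<in>J. - (c k)\<^sup>2 / 2) = - (\<Sum>k\<in>J. (c k)\<^sup>2) / 2"
      by (simp add: sum_negf sum_divide_distrib)
    moreover have "(\<Prod>k\<in>J. exp (- (c k)\<^sup>2 / 2)) = exp (\<Sum>k\<in>J. - (c k)\<^sup>2 / 2)"
      by (rule exp_sum[OF assms(1), symmetric])
    ultimately show ?thesis unfolding char_std_normal_distribution of_real_prod[symmetric] by (simp only:)
  qed
  finally show ?thesis .
qed

lemma gauss_product_cos:
  assumes "finite J" "J \<subseteq> I"
  shows "(\<integral>z. cos ((\<Sum>k\<in>J. c k * z k) + c0) \<partial>gauss_product I) = exp (- (\<Sum>k\<in>J. (c k)\<^sup>2) / 2) * cos c0"
proof -
  interpret prob_space "gauss_product I" by (rule prob_space_gauss_product)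
  have m: "(\<lambda>z. \<Sum>k\<in>J. c k * z k) \<in> borel_measurable (gauss_product I)"
    using assms(2) by (intro borel_measurable_sum borel_measurable_times borel_measurable_const gauss_product_coord) auto
  have i: "integrable (gauss_product I) (\<lambda>z. iexp c0 * iexp (\<Sum>k\<in>J. c k * z k))"
    by (rule integrable_boundedI[where B=1]) (use m in \<open>auto simp: norm_mult simp del: of_real_sum of_real_mult\<close>)
  have "(\<integral>z. cos ((\<Sum>k\<in>J. c k * z k) + c0) \<partial>gauss_product I)
      = (\<integral>z. Re (iexp c0 * iexp (\<Sum>k\<in>J. c k * z k)) \<partial>gauss_product I)"
    by (intro Bochner_Integration.integral_cong)
      (auto simp: Re_exp add.commute distrib_left simp flip: exp_add of_real_add of_real_sum of_real_mult)
  also have "\<dots> = Re (\<integral>z. iexp c0 * iexp (\<Sum>k\<in>J. c k * z k) \<partial>gauss_product I)"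
    by (rule integral_Re[OF i])
  also have "\<dots> = Re (iexp c0 * exp (- (\<Sum>k\<in>J. (c k)\<^sup>2) / 2))"
    by (simp only: integral_mult_right_zero gauss_product_char[OF assms])
  also have "\<dots> = exp (- (\<Sum>k\<in>J. (c k)\<^sup>2) / 2) * cos c0" by (simp add: Re_exp)
  finally show ?thesis .
qed

lemma gram_quadratic:
  fixes L :: "nat \<Rightarrow> nat \<Rightarrow> real"
  assumes "\<And>i j. i < r \<Longrightarrow> j < r \<Longrightarrow> (\<Sum>k<m. L i k * L j k) = S i j"
  shows "(\<Sum>k<m. (\<Sum>i<r. b i * L i k)\<^sup>2) = (\<Sum>i<r. \<Sum>j<r. b i * b j * S i j)"
proof -
  have "(\<Sum>k<m. (\<Sum>i<r. b i * L i k)\<^sup>2) = (\<Sum>k<m. \<Sum>i<r. \<Sum>j<r. b i * b j * (L i k * L j k))"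
    by (simp add: power2_eq_square sum_product mult_ac)
  also have "\<dots> = (\<Sum>i<r. \<Sum>k<m. \<Sum>j<r. b i * b j * (L i k * L j k))" by (rule sum.swap)
  also have "\<dots> = (\<Sum>i<r. \<Sum>j<r. \<Sum>k<m. b i * b j * (L i k * L j k))"
    by (rule sum.cong[OF refl]) (rule sum.swap)
  also have "\<dots> = (\<Sum>i<r. \<Sum>j<r. b i * b j * S i j)"
    by (intro sum.cong refl) (simp add: assms flip: sum_distrib_left)
  finally show ?thesis .
qed

lemma linear_gauss_cos:
  fixes L :: "nat \<Rightarrow> nat \<Rightarrow> real"
  assumes LL: "\<And>i j. i < r \<Longrightarrow> j < r \<Longrightarrow> (\<Sum>k<m. L i k * L j k) = S i j" and I: "{..<m} \<subseteq> I"
  shows "(\<integral>z. cos ((\<Sum>i<r. b i * (\<Sum>k<m. L i k * z k)) + c) \<partial>gauss_product I)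
    = exp (- (\<Sum>i<r. \<Sum>j<r. b i * b j * S i j) / 2) * cos c"
proof -
  have "(\<Sum>i<r. b i * (\<Sum>k<m. L i k * z k)) = (\<Sum>k<m. (\<Sum>i<r. b i * L i k) * z k)" for z :: "nat \<Rightarrow> real"
    by (simp add: sum_distrib_left sum_distrib_right mult.assoc) (rule sum.swap)
  moreover have "(\<Sum>k<m. (\<Sum>i<r. b i * L i k)\<^sup>2) = (\<Sum>i<r. \<Sum>j<r. b i * b j * S i j)"
    by (rule gram_quadratic[OF LL])
  ultimately show ?thesis
    using gauss_product_cos[of "{..<m}" I "\<lambda>k. \<Sum>i<r. b i * L i k" c] I by simp
qed

lemma linear_gauss_measurable [measurable]:
  "(\<lambda>z. \<lambda>i\<in>{..<r}. \<Sum>k<r. L i k * z k) \<in> gauss_product {..<r} \<rightarrow>\<^sub>M (\<Pi>\<^sub>M i\<in>{..<r}. borel)"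
  by (intro measurable_restrict borel_measurable_sum borel_measurable_times borel_measurable_const gauss_product_coord)

lemma centered_gaussian_eq_distr:
  assumes "\<And>i j. i < r \<Longrightarrow> j < r \<Longrightarrow> (\<Sum>k<r. L0 i k * L0 j k) = S i j"
  obtains L where "\<And>i j. i < r \<Longrightarrow> j < r \<Longrightarrow> (\<Sum>k<r. L i k * L j k) = S i j"
    "centered_gaussian r S = distr (gauss_product {..<r}) (\<Pi>\<^sub>M i\<in>{..<r}. borel) (\<lambda>z. \<lambda>i\<in>{..<r}. \<Sum>k<r. L i k * z k)"
proof -
  define L where "L = (SOME L :: nat \<Rightarrow> nat \<Rightarrow> real. \<forall>i<r. \<forall>j<r. (\<Sum>k<r. L i k * L j k) = S i j)"
  have "\<forall>i<r. \<forall>j<r. (\<Sum>k<r. L i k * L j k) = S i j"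
    unfolding L_def by (rule someI[of _ L0]) (use assms in auto)
  then show thesis by (intro that[of L]) (auto simp: centered_gaussian_def L_def Let_def)
qed

lemma distr_linear_gauss_cos:
  assumes LL: "\<And>i j. i < r \<Longrightarrow> j < r \<Longrightarrow> (\<Sum>k<r. L i k * L j k) = S i j"
  shows "(\<integral>x. cos ((\<Sum>i<r. b i * x i) + c)
      \<partial>distr (gauss_product {..<r}) (\<Pi>\<^sub>M i\<in>{..<r}. borel) (\<lambda>z. \<lambda>i\<in>{..<r}. \<Sum>k<r. L i k * z k))
    = exp (- (\<Sum>i<r. \<Sum>j<r. b i * b j * S i j) / 2) * cos c"
proof -
  have m: "(\<lambda>x. cos ((\<Sum>i<r. b i * x i) + c)) \<in> borel_measurable (\<Pi>\<^sub>M i\<in>{..<r}. borel)" by measurable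
  have "(\<integral>x. cos ((\<Sum>i<r. b i * x i) + c)
      \<partial>distr (gauss_product {..<r}) (\<Pi>\<^sub>M i\<in>{..<r}. borel) (\<lambda>z. \<lambda>i\<in>{..<r}. \<Sum>k<r. L i k * z k))
    = (\<integral>z. cos ((\<Sum>i<r. b i * (\<lambda>i\<in>{..<r}. \<Sum>k<r. L i k * z k) i) + c) \<partial>gauss_product {..<r})"
    by (rule integral_distr[OF linear_gauss_measurable m])
  also have "\<dots> = (\<integral>z. cos ((\<Sum>i<r. b i * (\<Sum>k<r. L i k * z k)) + c) \<partial>gauss_product {..<r})"
    by simp
  also have "\<dots> = exp (- (\<Sum>i<r. \<Sum>j<r. b i * b j * S i j) / 2) * cos c"
    by (rule linear_gauss_cos[OF LL]) auto
  finally show ?thesis .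
qed

section \<open>Uniqueness of laws from their cosine transforms\<close>

lemma sets_eq_borel_if_open_eq:
  fixes \<mu>1 \<mu>2 :: "'a::topological_space measure"
  assumes "prob_space \<mu>1" "prob_space \<mu>2" "sets \<mu>1 = sets borel" "sets \<mu>2 = sets borel"
    and "\<And>S. open S \<Longrightarrow> measure \<mu>1 S = measure \<mu>2 S"
  shows "\<mu>1 = \<mu>2"
proof (rule measure_eqI_generator_eq[where E="{S. open S}" and \<Omega>=UNIV and A="\<lambda>_. UNIV"])
  interpret A: prob_space \<mu>1 by fact
  interpret B: prob_space \<mu>2 by fact
  show "Int_stable {S :: 'a set. open S}" by (auto simp: Int_stable_def)
  show "emeasure \<mu>1 S = emeasure \<mu>2 S" if "S \<in> {S. open S}" for S
    using assms(5) that by (simp add: A.emeasure_eq_measure B.emeasure_eq_measure)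
  show "sets \<mu>1 = sigma_sets UNIV {S. open S}" "sets \<mu>2 = sigma_sets UNIV {S. open S}"
    using assms(3,4) by (simp_all add: borel_def)
  show "emeasure \<mu>1 UNIV \<noteq> \<infinity>" by simp
qed auto

text \<open>Uniqueness is read off from weak convergence: the constant sequence \<open>X\<close>
  converges weakly to \<open>Y\<close>, which gives this inequality, and exchanging the roles gives
  the other.\<close>

lemma prob_eq_on_open_if_cos_eq:
  fixes X :: "'m \<Rightarrow> nat \<Rightarrow> real" and Y :: "'n \<Rightarrow> nat \<Rightarrow> real"
  assumes M: "prob_space M" and N: "prob_space N"
    and X: "\<And>i. (\<lambda>\<omega>. X \<omega> i) \<in> borel_measurable M" and Y: "\<And>i. (\<lambda>\<omega>. Y \<omega> i) \<in> borel_measurable N"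
    and cos: "\<And>(r::nat) b c. (\<integral>\<omega>. cos ((\<Sum>i<r. b i * X \<omega> i) + c) \<partial>M) = (\<integral>\<omega>. cos ((\<Sum>i<r. b i * Y \<omega> i) + c) \<partial>N)"
    and S: "open S"
  shows "measure N {\<omega> \<in> space N. Y \<omega> \<in> S} \<le> measure M {\<omega> \<in> space M. X \<omega> \<in> S}"
proof (rule open_prob_le[OF M N, where Y="\<lambda>_. X" and Z=Y])
  interpret M: prob_space M by fact
  show "X \<in> borel_measurable M" by (rule measurable_coordinatewise_then_product) (rule X)
  show "Y \<in> borel_measurable N" by (rule measurable_coordinatewise_then_product) (rule Y)
  show "(\<lambda>n. \<integral>\<omega>. f (X \<omega>) \<partial>M) \<longlonglongrightarrow> (\<integral>\<omega>. f (Y \<omega>) \<partial>N)"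
    if "continuous_on UNIV f" "\<And>x. \<bar>f x\<bar> \<le> B" for f :: "(nat \<Rightarrow> real) \<Rightarrow> real" and B
    by (rule product_weak_convergence[OF M N, where Y="\<lambda>_. X" and Z=Y and f=f and B=B])
      (use that cos X Y M.tail_small[OF X] in auto)
qed (use S in auto)

text \<open>Padding with zeros by \<open>ext\<close> moves both laws into the countable product,
  where the weak convergence results live; the restriction \<open>bk\<close> recovers them. Padding
  turns a combination of any length into one of length \<open>r\<close>.\<close>

theorem distr_eq_if_cos_eq:
  fixes \<mu>1 \<mu>2 :: "(nat \<Rightarrow> real) measure"
  assumes p: "prob_space \<mu>1" "prob_space \<mu>2"
    and s: "sets \<mu>1 = sets (\<Pi>\<^sub>M i\<in>{..<r}. borel)" "sets \<mu>2 = sets (\<Pi>\<^sub>M i\<in>{..<r}. borel)"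
    and cos: "\<And>b c. (\<integral>x. cos ((\<Sum>i<r. b i * x i) + c) \<partial>\<mu>1) = (\<integral>x. cos ((\<Sum>i<r. b i * x i) + c) \<partial>\<mu>2)"
  shows "\<mu>1 = \<mu>2"
proof -
  define ext where "ext = (\<lambda>x :: nat \<Rightarrow> real. \<lambda>i. if i < r then x i else 0)"
  have coord: "(\<lambda>x. ext x i) \<in> borel_measurable (\<Pi>\<^sub>M i\<in>{..<r}. borel)" for i
    by (cases "i < r") (auto simp: ext_def)
  then have m: "ext \<in> \<mu>1 \<rightarrow>\<^sub>M borel" "ext \<in> \<mu>2 \<rightarrow>\<^sub>M borel"
    using s by (auto intro!: measurable_coordinatewise_then_product cong: measurable_cong_sets)
  have coord': "(\<lambda>x. ext x i) \<in> borel_measurable \<mu>1" "(\<lambda>x. ext x i) \<in> borel_measurable \<mu>2" for i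
    using coord s by (simp_all cong: measurable_cong_sets)
  have red: "(\<Sum>i<r'. b i * ext x i) = (\<Sum>i<r. (if i < r' then b i else 0) * x i)" for r' b x
  proof -
    have "(\<Sum>i<r'. b i * ext x i) = (\<Sum>i\<in>{..<r'} \<inter> {..<r}. b i * x i)"
      by (rule sum.mono_neutral_cong_right) (auto simp: ext_def)
    also have "\<dots> = (\<Sum>i<r. (if i < r' then b i else 0) * x i)"
      by (rule sum.mono_neutral_cong_left) auto
    finally show ?thesis .
  qed
  have cosr: "(\<integral>x. cos ((\<Sum>i<r'. b i * ext x i) + c) \<partial>\<mu>1) = (\<integral>x. cos ((\<Sum>i<r'. b i * ext x i) + c) \<partial>\<mu>2)" for r' b c
    unfolding red by (rule cos)
  have eq: "distr \<mu>1 borel ext = distr \<mu>2 borel ext"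
  proof (rule sets_eq_borel_if_open_eq)
    fix S :: "(nat \<Rightarrow> real) set" assume S: "open S"
    have "measure \<mu>1 {\<omega> \<in> space \<mu>1. ext \<omega> \<in> S} = measure \<mu>2 {\<omega> \<in> space \<mu>2. ext \<omega> \<in> S}"
      by (rule antisym; rule prob_eq_on_open_if_cos_eq) (use p coord' cosr S in auto)
    then show "measure (distr \<mu>1 borel ext) S = measure (distr \<mu>2 borel ext) S"
      using m S by (simp add: measure_distr vimage_def Int_def conj_commute)
  qed (use p m in \<open>auto intro: prob_space.prob_space_distr\<close>)
  define bk where "bk = (\<lambda>x :: nat \<Rightarrow> real. restrict x {..<r})"
  have bk: "bk \<in> borel \<rightarrow>\<^sub>M (\<Pi>\<^sub>M i\<in>{..<r}. borel)"
    unfolding bk_def by (rule measurable_restrict) (rule measurable_product_coordinates)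
  have id: "bk (ext x) = x" if "x \<in> space (\<Pi>\<^sub>M i\<in>{..<r}. borel)" for x
    using that by (auto simp: bk_def ext_def space_PiM PiE_def extensional_def fun_eq_iff)
  have undo: "distr (distr \<mu> borel ext) (\<Pi>\<^sub>M i\<in>{..<r}. borel) bk = \<mu>"
    if "ext \<in> \<mu> \<rightarrow>\<^sub>M borel" "sets \<mu> = sets (\<Pi>\<^sub>M i\<in>{..<r}. borel)" for \<mu>
  proof -
    have "distr (distr \<mu> borel ext) (\<Pi>\<^sub>M i\<in>{..<r}. borel) bk = distr \<mu> (\<Pi>\<^sub>M i\<in>{..<r}. borel) (bk \<circ> ext)"
      by (rule distr_distr[OF bk that(1)])
    also have "\<dots> = distr \<mu> \<mu> (\<lambda>x. x)"
      by (rule distr_cong) (use id sets_eq_imp_space_eq[OF that(2)] that(2) in auto)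
    finally show ?thesis by simp
  qed
  have "\<mu>1 = distr (distr \<mu>1 borel ext) (\<Pi>\<^sub>M i\<in>{..<r}. borel) bk"
    by (rule undo[OF m(1) s(1), symmetric])
  also have "\<dots> = distr (distr \<mu>2 borel ext) (\<Pi>\<^sub>M i\<in>{..<r}. borel) bk" by (simp only: eq)
  also have "\<dots> = \<mu>2" by (rule undo[OF m(2) s(2)])
  finally show ?thesis .
qed

lemma gram_psd:
  fixes L :: "nat \<Rightarrow> nat \<Rightarrow> real"
  assumes "\<And>i j. i < r \<Longrightarrow> j < r \<Longrightarrow> (\<Sum>k<m. L i k * L j k) = S i j"
  shows "psd r S"
  unfolding psd_def
proof (intro conjI allI impI)
  show "S a b = S b a" if "a < r" "b < r" for a b
    using assms[OF that] assms[OF that(2,1)] by (simp add: mult.commute)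
  show "0 \<le> (\<Sum>a<r. \<Sum>b<r. v a * v b * S a b)" for v
    by (subst gram_quadratic[where L=L and m=m and S=S, OF assms, symmetric]) (auto intro: sum_nonneg)
qed

lemma chol_lower:
  assumes "psd r S" "a < k" "k < r" shows "chol S a k = 0"
proof -
  have "psd r (schur S k)" "schur S k k a = 0" using schur_psd[OF assms(1), of k] assms by auto
  then have "schur S k a k = 0" using assms by (simp add: psd_def)
  then show ?thesis by (simp add: chol_def)
qed

text \<open>A linear image of the Gaussian product has a cosine transform that involves its factor
  through \<open>S\<close> alone, so the factor chosen by \<open>SOME\<close> may be exchanged for
  \<open>chol\<close>.\<close>

lemma centered_gaussian_chol:
  assumes "psd r S"
  shows "centered_gaussian r S = distr (gauss_product {..<r}) (\<Pi>\<^sub>M i\<in>{..<r}. borel) (\<lambda>z. \<lambda>i\<in>{..<r}. \<Sum>k<r. chol S i k * z k)"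
proof -
  note ch = chol_factorization[OF assms]
  obtain L where L: "\<And>i j. i < r \<Longrightarrow> j < r \<Longrightarrow> (\<Sum>k<r. L i k * L j k) = S i j"
    "centered_gaussian r S = distr (gauss_product {..<r}) (\<Pi>\<^sub>M i\<in>{..<r}. borel) (\<lambda>z. \<lambda>i\<in>{..<r}. \<Sum>k<r. L i k * z k)"
    using centered_gaussian_eq_distr[of r "chol S" S] ch by blast
  show ?thesis unfolding L(2)
  proof (rule distr_eq_if_cos_eq)
    fix b c
    show "(\<integral>x. cos ((\<Sum>i<r. b i * x i) + c)
        \<partial>distr (gauss_product {..<r}) (\<Pi>\<^sub>M i\<in>{..<r}. borel) (\<lambda>z. \<lambda>i\<in>{..<r}. \<Sum>k<r. L i k * z k))
      = (\<integral>x. cos ((\<Sum>i<r. b i * x i) + c)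
        \<partial>distr (gauss_product {..<r}) (\<Pi>\<^sub>M i\<in>{..<r}. borel) (\<lambda>z. \<lambda>i\<in>{..<r}. \<Sum>k<r. chol S i k * z k))"
      by (simp only: distr_linear_gauss_cos[where S=S, OF L(1)] distr_linear_gauss_cos[where S=S, OF ch])
  qed (simp_all add: prob_space.prob_space_distr[OF prob_space_gauss_product linear_gauss_measurable])
qed

lemma centered_gaussian_cos:
  assumes "psd r S"
  shows "(\<integral>x. cos ((\<Sum>i<r. b i * x i) + c) \<partial>centered_gaussian r S)
    = exp (- (\<Sum>i<r. \<Sum>j<r. b i * b j * S i j) / 2) * cos c"
  unfolding centered_gaussian_chol[OF assms] by (rule distr_linear_gauss_cos[OF chol_factorization[OF assms]])

text \<open>Fubini with \<omega> frozen: the conditional law of the coordinates is Gaussian with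
  covariance \<open>S \<omega>\<close>.\<close>

lemma mixture_cos:
  fixes L :: "'a \<Rightarrow> nat \<Rightarrow> nat \<Rightarrow> real"
  assumes M: "prob_space M" and L [measurable]: "\<And>i k. (\<lambda>\<omega>. L \<omega> i k) \<in> borel_measurable M"
    and S: "\<And>i j. (\<lambda>\<omega>. S \<omega> i j) \<in> borel_measurable M"
    and LL: "AE \<omega> in M. \<forall>i<r. \<forall>j<r. (\<Sum>k<m. L \<omega> i k * L \<omega> j k) = S \<omega> i j" and I: "{..<m} \<subseteq> I"
  shows "(\<integral>p. cos ((\<Sum>i<r. b i * (\<Sum>k<m. L (fst p) i k * snd p k)) + c) \<partial>(M \<Otimes>\<^sub>M gauss_product I))
    = (\<integral>\<omega>. exp (- (\<Sum>i<r. \<Sum>j<r. b i * b j * S \<omega> i j) / 2) * cos c \<partial>M)"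
proof -
  interpret M: prob_space M by fact
  interpret G: prob_space "gauss_product I" by (rule prob_space_gauss_product)
  interpret P: pair_prob_space M "gauss_product I" ..
  let ?f = "\<lambda>p. cos ((\<Sum>i<r. b i * (\<Sum>k<m. L (fst p) i k * snd p k)) + c)"
  have "(\<lambda>p. snd p k) \<in> borel_measurable (M \<Otimes>\<^sub>M gauss_product I)" if "k \<in> {..<m}" for k
    using measurable_compose[OF measurable_snd gauss_product_coord[of k I]] I that by auto
  moreover have "(\<lambda>p. L (fst p) i k) \<in> borel_measurable (M \<Otimes>\<^sub>M gauss_product I)" for i k
    by (rule measurable_compose[OF measurable_fst L])
  ultimately have "(\<lambda>p. (\<Sum>i<r. b i * (\<Sum>k<m. L (fst p) i k * snd p k)) + c) \<in> borel_measurable (M \<Otimes>\<^sub>M gauss_product I)"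
    by (intro borel_measurable_add borel_measurable_sum borel_measurable_times borel_measurable_const)
  then have fm: "?f \<in> borel_measurable (M \<Otimes>\<^sub>M gauss_product I)" by measurable
  have "integrable (M \<Otimes>\<^sub>M gauss_product I) ?f"
    by (rule P.integrable_boundedI[OF fm, where B=1]) simp
  then have "(\<integral>p. ?f p \<partial>(M \<Otimes>\<^sub>M gauss_product I)) = (\<integral>\<omega>. \<integral>z. ?f (\<omega>, z) \<partial>gauss_product I \<partial>M)"
    by (rule P.integral_fst'[symmetric])
  also have "\<dots> = (\<integral>\<omega>. exp (- (\<Sum>i<r. \<Sum>j<r. b i * b j * S \<omega> i j) / 2) * cos c \<partial>M)"
  proof (rule integral_cong_AE)
    show "(\<lambda>\<omega>. \<integral>z. ?f (\<omega>, z) \<partial>gauss_product I) \<in> borel_measurable M"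
      by (rule G.borel_measurable_lebesgue_integral) (use fm in simp)
    show "(\<lambda>\<omega>. exp (- (\<Sum>i<r. \<Sum>j<r. b i * b j * S \<omega> i j) / 2) * cos c) \<in> borel_measurable M"
      using S by measurable
    show "AE \<omega> in M. (\<integral>z. ?f (\<omega>, z) \<partial>gauss_product I) = exp (- (\<Sum>i<r. \<Sum>j<r. b i * b j * S \<omega> i j) / 2) * cos c"
      using LL
    proof eventually_elim
      case (elim \<omega>)
      show ?case using linear_gauss_cos[where r=r and m=m and L="L \<omega>" and S="S \<omega>" and I=I and b=b and c=c] elim I by simp
    qed
  qed
  finally show ?thesis .
qed

text \<open>The mixture is realised as the law of \<open>chol (S \<omega>)\<close> applied to an
  independent standard Gaussian vector. This gives at once its cosine transform and, by integrating
  sections, its values as averages of Gaussian measures.\<close>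

theorem gaussian_mixture:
  fixes S :: "'a \<Rightarrow> nat \<Rightarrow> nat \<Rightarrow> real"
  assumes M: "prob_space M" and S [measurable]: "\<And>i j. (\<lambda>\<omega>. S \<omega> i j) \<in> borel_measurable M"
    and psd: "AE \<omega> in M. psd r (S \<omega>)"
  obtains \<mu> where "prob_space \<mu>" "sets \<mu> = sets (\<Pi>\<^sub>M i\<in>{..<r}. borel)"
    "\<And>A. A \<in> sets (\<Pi>\<^sub>M i\<in>{..<r}. borel) \<Longrightarrow> measure \<mu> A = (\<integral>\<omega>. measure (centered_gaussian r (S \<omega>)) A \<partial>M)"
    "\<And>b c. (\<integral>x. cos ((\<Sum>i<r. b i * x i) + c) \<partial>\<mu>) = (\<integral>\<omega>. exp (- (\<Sum>i<r. \<Sum>j<r. b i * b j * S \<omega> i j) / 2) * cos c \<partial>M)"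
proof -
  interpret M: prob_space M by fact
  let ?G = "gauss_product {..<r}" and ?B = "\<Pi>\<^sub>M i\<in>{..<r}. borel :: real measure"
  interpret G: prob_space ?G by (rule prob_space_gauss_product)
  interpret P: pair_prob_space M ?G ..
  define lin where "lin = (\<lambda>\<omega> z. \<lambda>i\<in>{..<r}. \<Sum>k<r. chol (S \<omega>) i k * z k)"
  have ch [measurable]: "(\<lambda>\<omega>. chol (S \<omega>) i k) \<in> borel_measurable M" for i k
    by (rule chol_measurable[OF S])
  have linm [measurable]: "(\<lambda>p. lin (fst p) (snd p)) \<in> M \<Otimes>\<^sub>M ?G \<rightarrow>\<^sub>M ?B"
    unfolding lin_def
  proof (intro measurable_restrict borel_measurable_sum borel_measurable_times)
    show "(\<lambda>p. chol (S (fst p)) i k) \<in> borel_measurable (M \<Otimes>\<^sub>M ?G)" for i k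
      by (rule measurable_compose[OF measurable_fst ch])
    show "(\<lambda>p. snd p k) \<in> borel_measurable (M \<Otimes>\<^sub>M ?G)" if "k \<in> {..<r}" for k
      by (rule measurable_compose[OF measurable_snd gauss_product_coord[OF that]])
  qed
  define \<mu> where "\<mu> = distr (M \<Otimes>\<^sub>M ?G) ?B (\<lambda>p. lin (fst p) (snd p))"
  \<comment> \<open>Positive semidefiniteness quantifies over uncountably many vectors. It is
    equivalent to these finitely many equations, which define a measurable set.\<close>
  define good where "good = (\<lambda>\<omega>. \<forall>i<r. \<forall>j<r. (\<Sum>k<r. chol (S \<omega>) i k * chol (S \<omega>) j k) = S \<omega> i j)"
  have good_m [measurable]: "Measurable.pred M good" unfolding good_def by measurable
  have good_psd: "good \<omega> \<longleftrightarrow> psd r (S \<omega>)" for \<omega>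
    using chol_factorization[of r "S \<omega>"] gram_psd[where L="chol (S \<omega>)" and S="S \<omega>" and r=r and m=r] by (auto simp: good_def)
  \<comment> \<open>For a matrix without factor the predicate under \<open>SOME\<close> is
    identically false, so the choice is one and the same \<open>L0\<close>. Hence
    \<open>centered_gaussian\<close> is constant off \<open>good\<close>, and the integrand is
    measurable on the exceptional null set too.\<close>
  define L0 where "L0 = (SOME L :: nat \<Rightarrow> nat \<Rightarrow> real. False)"
  define K where "K = distr ?G ?B (\<lambda>z. \<lambda>i\<in>{..<r}. \<Sum>k<r. L0 i k * z k)"
  have cg: "centered_gaussian r (S \<omega>) = (if good \<omega> then distr ?G ?B (lin \<omega>) else K)" for \<omega>
  proof (cases "good \<omega>")
    case True
    then show ?thesis unfolding good_psd by (simp add: centered_gaussian_chol lin_def good_psd)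
  next
    case False
    have "\<not> (\<forall>i<r. \<forall>j<r. (\<Sum>k<r. L i k * L j k) = S \<omega> i j)" for L :: "nat \<Rightarrow> nat \<Rightarrow> real"
      using False gram_psd[where L=L and S="S \<omega>" and r=r and m=r] good_psd by blast
    then have "(\<lambda>L :: nat \<Rightarrow> nat \<Rightarrow> real. \<forall>i<r. \<forall>j<r. (\<Sum>k<r. L i k * L j k) = S \<omega> i j) = (\<lambda>_. False)"
      by (intro HOL.ext) blast
    then have "(SOME L :: nat \<Rightarrow> nat \<Rightarrow> real. \<forall>i<r. \<forall>j<r. (\<Sum>k<r. L i k * L j k) = S \<omega> i j) = L0"
      unfolding L0_def by (rule arg_cong)
    then show ?thesis using False by (simp only: centered_gaussian_def Let_def K_def if_False)
  qed
  show thesis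
  proof (rule that[of \<mu>])
    show "prob_space \<mu>" unfolding \<mu>_def by (rule P.prob_space_distr[OF linm])
    show "sets \<mu> = sets ?B" by (simp add: \<mu>_def)
    show "(\<integral>x. cos ((\<Sum>i<r. b i * x i) + c) \<partial>\<mu>) = (\<integral>\<omega>. exp (- (\<Sum>i<r. \<Sum>j<r. b i * b j * S \<omega> i j) / 2) * cos c \<partial>M)" for b c
    proof -
      have "(\<integral>x. cos ((\<Sum>i<r. b i * x i) + c) \<partial>\<mu>) = (\<integral>p. cos ((\<Sum>i<r. b i * lin (fst p) (snd p) i) + c) \<partial>(M \<Otimes>\<^sub>M ?G))"
        unfolding \<mu>_def by (rule integral_distr[OF linm]) measurable
      also have "\<dots> = (\<integral>p. cos ((\<Sum>i<r. b i * (\<Sum>k<r. chol (S (fst p)) i k * snd p k)) + c) \<partial>(M \<Otimes>\<^sub>M ?G))"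
        by (simp add: lin_def)
      also have "\<dots> = (\<integral>\<omega>. exp (- (\<Sum>i<r. \<Sum>j<r. b i * b j * S \<omega> i j) / 2) * cos c \<partial>M)"
        by (rule mixture_cos[OF M ch S]) (use psd chol_factorization in auto)
      finally show ?thesis .
    qed
    fix A assume A [measurable]: "A \<in> sets ?B"
    define Q where "Q = (\<lambda>p. lin (fst p) (snd p)) -` A \<inter> space (M \<Otimes>\<^sub>M ?G)"
    have Q [measurable]: "Q \<in> sets (M \<Otimes>\<^sub>M ?G)" unfolding Q_def by (rule measurable_sets[OF linm A])
    have Qs: "Pair \<omega> -` Q = lin \<omega> -` A \<inter> space ?G" if "\<omega> \<in> space M" for \<omega>
      using that by (auto simp: Q_def space_pair_measure)
    have lm: "lin \<omega> \<in> ?G \<rightarrow>\<^sub>M ?B" for \<omega> unfolding lin_def by (rule linear_gauss_measurable)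
    have g: "measure (centered_gaussian r (S \<omega>)) A = (if good \<omega> then measure ?G (Pair \<omega> -` Q) else measure K A)"
      if "\<omega> \<in> space M" for \<omega>
      by (simp add: cg measure_distr[OF lm A] Qs[OF that])
    have em: "(\<lambda>\<omega>. emeasure ?G (Pair \<omega> -` Q)) \<in> borel_measurable M"
      by (rule G.measurable_emeasure_Pair[OF Q])
    then have mm [measurable]: "(\<lambda>\<omega>. measure ?G (Pair \<omega> -` Q)) \<in> borel_measurable M"
      unfolding measure_def by measurable
    have "(\<integral>\<omega>. measure (centered_gaussian r (S \<omega>)) A \<partial>M) = (\<integral>\<omega>. (if good \<omega> then measure ?G (Pair \<omega> -` Q) else measure K A) \<partial>M)"
      by (rule Bochner_Integration.integral_cong) (auto simp: g)
    also have "\<dots> = (\<integral>\<omega>. measure ?G (Pair \<omega> -` Q) \<partial>M)"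
    proof (rule integral_cong_AE)
      show "AE \<omega> in M. (if good \<omega> then measure ?G (Pair \<omega> -` Q) else measure K A) = measure ?G (Pair \<omega> -` Q)"
        using psd by eventually_elim (simp only: good_psd if_True)
    qed measurable
    also have "ennreal \<dots> = (\<integral>\<^sup>+\<omega>. ennreal (measure ?G (Pair \<omega> -` Q)) \<partial>M)"
    proof (rule nn_integral_eq_integral[symmetric])
      show "integrable M (\<lambda>\<omega>. measure ?G (Pair \<omega> -` Q))"
        by (rule M.integrable_boundedI[OF mm, where B=1]) simp
    qed simp
    also have "\<dots> = emeasure (M \<Otimes>\<^sub>M ?G) Q"
      by (simp add: G.emeasure_pair_measure_alt[OF Q] G.emeasure_eq_measure)
    also have "\<dots> = emeasure \<mu> A" unfolding \<mu>_def Q_def by (simp add: emeasure_distr[OF linm A])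
    finally have e: "ennreal (\<integral>\<omega>. measure (centered_gaussian r (S \<omega>)) A \<partial>M) = emeasure \<mu> A" .
    moreover have "0 \<le> (\<integral>\<omega>. measure (centered_gaussian r (S \<omega>)) A \<partial>M)" by (rule integral_nonneg_AE) simp
    moreover have "measure \<mu> A = enn2real (emeasure \<mu> A)" by (rule Sigma_Algebra.measure_def)
    ultimately show "measure \<mu> A = (\<integral>\<omega>. measure (centered_gaussian r (S \<omega>)) A \<partial>M)"
      unfolding e[symmetric] by (simp only: enn2real_ennreal)
  qed
qed

section \<open>Finite-dimensional limits of the empirical process\<close>

locale cid_setting = prob_space M for M :: "'a measure" +
  fixes G :: "nat \<Rightarrow> 'a measure" and X :: "nat \<Rightarrow> 'a \<Rightarrow> real" and \<kappa> :: "nat \<Rightarrow> 'a \<Rightarrow> real measure"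
  assumes filt: "filtration (space M) G" and sub: "\<And>n. subalgebra M (G n)"
    and cid: "cid M G X" and rcd: "\<And>n. regular_cond_distr M (G n) (X (n + 1)) (\<kappa> n)"
begin

lemma G_mono: "m \<le> n \<Longrightarrow> sets (G m) \<subseteq> sets (G n)"
  using filt by (simp add: filtration_def)

lemma space_G: "space (G n) = space M" using sub[of n] by (simp add: subalgebra_def)

lemma meas_G_mono:
  assumes "f \<in> borel_measurable (G m)" "m \<le> n" shows "f \<in> borel_measurable (G n)"
  by (rule measurable_from_subalg[OF _ assms(1)]) (use G_mono[OF assms(2)] in \<open>auto simp: subalgebra_def space_G\<close>)

lemma meas_G_M: assumes "f \<in> borel_measurable (G m)" shows "f \<in> borel_measurable M"
  by (rule measurable_from_subalg[OF sub assms])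

lemma X_adapted: "1 \<le> n \<Longrightarrow> X n \<in> borel_measurable (G n)"
  using cid by (simp add: cid_def)

lemma X_M [measurable]: "X (Suc n) \<in> borel_measurable M"
  by (rule meas_G_M[OF X_adapted]) simp

lemma sigma_finite_sub: "sigma_finite_subalgebra M (G n)"
  by (rule finite_measure_subalgebra_is_sigma_finite)
     (simp add: finite_measure_subalgebra_def finite_measure_subalgebra_axioms_def sub finite_measure_axioms)

definition V :: "nat \<Rightarrow> real \<Rightarrow> 'a \<Rightarrow> real" where "V n t \<omega> = measure (\<kappa> n \<omega>) {..t}"

definition ind :: "nat \<Rightarrow> real \<Rightarrow> 'a \<Rightarrow> real" where "ind n t \<omega> = indicator {..t} (X (Suc n) \<omega>)"

text \<open>Indices start at 0: \<open>q k\<close> agrees almost everywhere with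
  \<open>q_incr\<close> at \<open>Suc k\<close>. Built from the regular version \<open>V\<close>, it
  represents the paths of the empirical process at every point of the space.\<close>

definition q :: "nat \<Rightarrow> real \<Rightarrow> 'a \<Rightarrow> real" where
  "q k t \<omega> = ind k t \<omega> - real (Suc k) * V (Suc k) t \<omega> + real k * V k t \<omega>"

lemma kernel_meas: "\<kappa> n \<in> G n \<rightarrow>\<^sub>M prob_algebra borel"
  using rcd[of n] by (simp add: regular_cond_distr_def)

lemma kernel_space: "\<omega> \<in> space M \<Longrightarrow> \<kappa> n \<omega> \<in> space (prob_algebra borel)"
  using measurable_space[OF kernel_meas[of n]] by (simp add: space_G)

lemma V_meas: "V n t \<in> borel_measurable (G n)"
  unfolding V_def
  by (rule measurable_compose[OF measurable_prob_algebraD[OF kernel_meas] measurable_measure_subprob_algebra]) simp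

lemma V_M [measurable]: "V n t \<in> borel_measurable M" by (rule meas_G_M[OF V_meas])

lemma V_nonneg: "0 \<le> V n t \<omega>" by (simp add: V_def)

lemma V_le_1: assumes "\<omega> \<in> space M" shows "V n t \<omega> \<le> 1"
proof -
  interpret K: prob_space "\<kappa> n \<omega>" using kernel_space[OF assms, of n] by (simp add: space_prob_algebra)
  show ?thesis unfolding V_def by (rule K.prob_le_1)
qed

lemma ind_meas: "ind n t \<in> borel_measurable (G (Suc n))"
proof -
  have [measurable]: "X (Suc n) \<in> borel_measurable (G (Suc n))" by (rule X_adapted) simp
  show ?thesis unfolding ind_def by measurable
qed

lemma ind_M [measurable]: "ind n t \<in> borel_measurable M" by (rule meas_G_M[OF ind_meas])

lemma ind_range: "0 \<le> ind n t \<omega>" "ind n t \<omega> \<le> 1" by (auto simp: ind_def indicator_def)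

lemma V_eq_cond_cdf: "AE \<omega> in M. V n t \<omega> = cond_cdf M G X n t \<omega>"
proof -
  have "{..t} \<in> sets (borel :: real measure)" by simp
  then show ?thesis using rcd[of n] unfolding regular_cond_distr_def V_def cond_cdf_def by blast
qed

text \<open>In the sum of the \<open>q k\<close> the terms \<open>real k * V k\<close>
  telescope.\<close>

lemma path_empirical:
  assumes "\<omega> \<in> space M"
  shows "path_of (empirical_process X \<kappa> n \<omega>) t = (\<Sum>k<n. q k t \<omega>) / sqrt (real n)"
proof -
  have "(\<Sum>k<n. q k t \<omega>) = (\<Sum>k<n. ind k t \<omega>) - real n * V n t \<omega>"
    by (induction n) (simp_all add: q_def algebra_simps)
  also have "(\<Sum>k<n. ind k t \<omega>) = (\<Sum>k=1..n. indicator {..t} (X k \<omega>))"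
    by (simp add: ind_def sum.atLeast1_atMost_eq)
  finally show ?thesis
    using path_empirical_process[where n=n and X=X and \<kappa>=\<kappa> and \<omega>=\<omega>, OF kernel_space[OF assms], of t] by (simp add: V_def)
qed

lemma path_measurable: "(\<lambda>\<omega>. path_of (empirical_process X \<kappa> n \<omega>) t) \<in> borel_measurable M"
proof -
  have "(\<lambda>\<omega>. (\<Sum>k<n. q k t \<omega>) / sqrt (real n)) \<in> borel_measurable M" unfolding q_def by measurable
  then show ?thesis by (rule measurable_cong[THEN iffD2, rotated]) (simp add: path_empirical)
qed

lemma cond_exp_test:
  assumes f: "f \<in> borel_measurable borel" "\<And>x. \<bar>f x\<bar> \<le> (C::real)"
    and w: "w \<in> borel_measurable (G n)" "\<And>\<omega>. \<omega> \<in> space M \<Longrightarrow> \<bar>w \<omega>\<bar> \<le> (B::real)"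
  shows "(\<integral>\<omega>. w \<omega> * real_cond_exp M (G n) (\<lambda>\<omega>. f (X (Suc k) \<omega>)) \<omega> \<partial>M) = (\<integral>\<omega>. w \<omega> * f (X (Suc k) \<omega>) \<partial>M)"
proof -
  interpret S: sigma_finite_subalgebra M "G n" by (rule sigma_finite_sub)
  note [measurable] = f(1) meas_G_M[OF w(1)]
  have m: "(\<lambda>\<omega>. f (X (Suc k) \<omega>)) \<in> borel_measurable M" by measurable
  show ?thesis
  proof (rule S.real_cond_exp_intg(2)[OF _ w(1) m])
    show "integrable M (\<lambda>\<omega>. w \<omega> * f (X (Suc k) \<omega>))"
    proof (rule integrable_boundedI)
      fix \<omega> assume "\<omega> \<in> space M"
      then show "norm (w \<omega> * f (X (Suc k) \<omega>)) \<le> B * C"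
        using w(2) f(2)[of "X (Suc k) \<omega>"] by (auto simp: abs_mult intro!: mult_mono intro: order_trans[OF abs_ge_zero])
    qed measurable
  qed
qed

lemma cid_test:
  assumes f: "f \<in> borel_measurable borel" "\<And>x. \<bar>f x\<bar> \<le> (C::real)"
    and w: "w \<in> borel_measurable (G n)" "\<And>\<omega>. \<omega> \<in> space M \<Longrightarrow> \<bar>w \<omega>\<bar> \<le> (B::real)" and k: "n \<le> k"
  shows "(\<integral>\<omega>. w \<omega> * f (X (Suc k) \<omega>) \<partial>M) = (\<integral>\<omega>. w \<omega> * f (X (Suc n) \<omega>) \<partial>M)"
proof -
  interpret S: sigma_finite_subalgebra M "G n" by (rule sigma_finite_sub)
  have "bounded (range f)" using f(2) by (auto simp: bounded_iff)
  then have ae: "AE \<omega> in M. real_cond_exp M (G n) (\<lambda>\<omega>. f (X (Suc k) \<omega>)) \<omega> = real_cond_exp M (G n) (\<lambda>\<omega>. f (X (Suc n) \<omega>)) \<omega>"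
    using cid f(1) k unfolding cid_def by (metis Suc_eq_plus1 le_imp_less_Suc)
  note [measurable] = meas_G_M[OF w(1)]
  have "(\<integral>\<omega>. w \<omega> * real_cond_exp M (G n) (\<lambda>\<omega>. f (X (Suc k) \<omega>)) \<omega> \<partial>M)
    = (\<integral>\<omega>. w \<omega> * real_cond_exp M (G n) (\<lambda>\<omega>. f (X (Suc n) \<omega>)) \<omega> \<partial>M)"
  proof (rule integral_cong_AE)
    show "AE \<omega> in M. w \<omega> * real_cond_exp M (G n) (\<lambda>\<omega>. f (X (Suc k) \<omega>)) \<omega>
      = w \<omega> * real_cond_exp M (G n) (\<lambda>\<omega>. f (X (Suc n) \<omega>)) \<omega>"
      using ae by eventually_elim simp
  qed measurable
  then show ?thesis using cond_exp_test[OF f w] by simp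
qed

lemma V_test:
  assumes w: "w \<in> borel_measurable (G n)" "\<And>\<omega>. \<omega> \<in> space M \<Longrightarrow> \<bar>w \<omega>\<bar> \<le> (B::real)"
  shows "(\<integral>\<omega>. w \<omega> * V n t \<omega> \<partial>M) = (\<integral>\<omega>. w \<omega> * ind n t \<omega> \<partial>M)"
proof -
  note [measurable] = meas_G_M[OF w(1)]
  have "(\<integral>\<omega>. w \<omega> * V n t \<omega> \<partial>M) = (\<integral>\<omega>. w \<omega> * real_cond_exp M (G n) (\<lambda>\<omega>. indicator {..t} (X (Suc n) \<omega>)) \<omega> \<partial>M)"
  proof (rule integral_cong_AE)
    show "AE \<omega> in M. w \<omega> * V n t \<omega> = w \<omega> * real_cond_exp M (G n) (\<lambda>\<omega>. indicator {..t} (X (Suc n) \<omega>)) \<omega>"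
      using V_eq_cond_cdf[of n t] by eventually_elim (simp add: cond_cdf_def)
  qed measurable
  also have "\<dots> = (\<integral>\<omega>. w \<omega> * indicator {..t} (X (Suc n) \<omega>) \<partial>M)"
    by (rule cond_exp_test[where C=1 and B=B]) (use w in \<open>auto simp: indicator_def\<close>)
  finally show ?thesis by (simp add: ind_def)
qed

lemma ind_test:
  assumes w: "w \<in> borel_measurable (G n)" "\<And>\<omega>. \<omega> \<in> space M \<Longrightarrow> \<bar>w \<omega>\<bar> \<le> (B::real)" and "n \<le> k"
  shows "(\<integral>\<omega>. w \<omega> * ind k t \<omega> \<partial>M) = (\<integral>\<omega>. w \<omega> * ind n t \<omega> \<partial>M)"
  unfolding ind_def
  by (rule cid_test[where C=1 and B=B]) (use assms in \<open>auto simp: indicator_def\<close>)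

lemma q_bdd: assumes "\<omega> \<in> space M" shows "\<bar>q k t \<omega>\<bar> \<le> 2 * real k + 2"
proof -
  define p p' where "p = real (Suc k) * V (Suc k) t \<omega>" and "p' = real k * V k t \<omega>"
  have "p \<le> real (Suc k) * 1" "p' \<le> real k * 1"
    unfolding p_def p'_def using V_le_1[OF assms] by (intro mult_left_mono; simp)+
  then have "p \<le> real k + 1" "p' \<le> real k" by simp_all
  moreover have "0 \<le> p" "0 \<le> p'" using V_nonneg by (simp_all add: p_def p'_def)
  ultimately have "\<bar>ind k t \<omega> - p + p'\<bar> \<le> 2 * real k + 2"
    using ind_range[of k t \<omega>] unfolding abs_le_iff by linarith
  then show ?thesis by (simp only: q_def p_def p'_def)
qed

lemma q_meas: "q k t \<in> borel_measurable (G (Suc k))"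
proof -
  note [measurable] = ind_meas[of k t] V_meas[of "Suc k" t] meas_G_mono[OF V_meas[of k t], of "Suc k"]
  show ?thesis unfolding q_def by measurable
qed

lemma q_M [measurable]: "q k t \<in> borel_measurable M" by (rule meas_G_M[OF q_meas])

lemma mult_integrable:
  assumes "f \<in> borel_measurable M" "g \<in> borel_measurable M"
    "\<And>\<omega>. \<omega> \<in> space M \<Longrightarrow> \<bar>f \<omega>\<bar> \<le> (A::real)" "\<And>\<omega>. \<omega> \<in> space M \<Longrightarrow> \<bar>g \<omega>\<bar> \<le> (B::real)"
  shows "integrable M (\<lambda>\<omega>. f \<omega> * g \<omega>)"
proof (rule integrable_boundedI)
  fix \<omega> assume \<omega>: "\<omega> \<in> space M"
  show "norm (f \<omega> * g \<omega>) \<le> A * B"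
    using assms(3)[OF \<omega>] assms(4)[OF \<omega>] by (auto simp: abs_mult intro!: mult_mono intro: order_trans[OF abs_ge_zero])
qed (use assms in measurable)

text \<open>By the c.i.d. property \<open>ind k t\<close>, \<open>V (Suc k) t\<close> and
  \<open>V k t\<close> have the same integral against a \<open>G k\<close>-measurable weight, and 1
  - (k + 1) + k = 0.\<close>

lemma q_mart:
  assumes w: "w \<in> borel_measurable (G k)" "\<And>\<omega>. \<omega> \<in> space M \<Longrightarrow> \<bar>w \<omega>\<bar> \<le> (B::real)"
  shows "(\<integral>\<omega>. q k t \<omega> * w \<omega> \<partial>M) = 0"
proof -
  note [measurable] = meas_G_M[OF w(1)]
  have w': "w \<in> borel_measurable (G (Suc k))" by (rule meas_G_mono[OF w(1)]) simp
  have V1: "\<omega> \<in> space M \<Longrightarrow> \<bar>V n t \<omega>\<bar> \<le> 1" and I1: "\<bar>ind n t \<omega>\<bar> \<le> 1" for n \<omega>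
    using V_nonneg[of n t \<omega>] V_le_1[of \<omega> n t] ind_range[of n t \<omega>] by auto
  have i: "integrable M (\<lambda>\<omega>. w \<omega> * ind n t \<omega>)" "integrable M (\<lambda>\<omega>. w \<omega> * V n t \<omega>)" for n
    by (rule mult_integrable[where A=B and B=1]; use w V1 I1 in simp)+
  have "(\<integral>\<omega>. q k t \<omega> * w \<omega> \<partial>M)
      = (\<integral>\<omega>. w \<omega> * ind k t \<omega> - real (Suc k) * (w \<omega> * V (Suc k) t \<omega>) + real k * (w \<omega> * V k t \<omega>) \<partial>M)"
    by (intro Bochner_Integration.integral_cong) (auto simp: q_def algebra_simps)
  also have "\<dots> = (\<integral>\<omega>. w \<omega> * ind k t \<omega> \<partial>M) - real (Suc k) * (\<integral>\<omega>. w \<omega> * V (Suc k) t \<omega> \<partial>M) + real k * (\<integral>\<omega>. w \<omega> * V k t \<omega> \<partial>M)"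
    using i by simp
  also have "(\<integral>\<omega>. w \<omega> * V (Suc k) t \<omega> \<partial>M) = (\<integral>\<omega>. w \<omega> * ind k t \<omega> \<partial>M)"
    using V_test[OF w' w(2)] ind_test[OF w, of "Suc k" t] by simp
  also have "(\<integral>\<omega>. w \<omega> * V k t \<omega> \<partial>M) = (\<integral>\<omega>. w \<omega> * ind k t \<omega> \<partial>M)" by (rule V_test[OF w])
  finally show ?thesis by (simp add: algebra_simps)
qed

definition u :: "nat \<Rightarrow> (nat \<Rightarrow> real) \<Rightarrow> (nat \<Rightarrow> real) \<Rightarrow> nat \<Rightarrow> 'a \<Rightarrow> real" where
  "u r b t k \<omega> = (\<Sum>j<r. b j * q k (t j) \<omega>)"

lemma u_mart_diff: "bounded_mart_diff M G (u r b t) (\<lambda>k. \<Sum>j<r. \<bar>b j\<bar> * (2 * real k + 2))"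
proof (unfold_locales, rule sub, rule G_mono, assumption)
  fix k
  show "u r b t k \<in> borel_measurable (G (Suc k))"
    unfolding u_def by (intro borel_measurable_sum borel_measurable_times borel_measurable_const q_meas)
  show "\<bar>u r b t k \<omega>\<bar> \<le> (\<Sum>j<r. \<bar>b j\<bar> * (2 * real k + 2))" if "\<omega> \<in> space M" for \<omega>
    unfolding u_def
    by (rule order_trans[OF sum_abs]) (auto simp: abs_mult intro!: sum_mono mult_left_mono q_bdd[OF that])
  fix w and B :: real assume w: "w \<in> borel_measurable (G k)" "\<And>\<omega>. \<omega> \<in> space M \<Longrightarrow> \<bar>w \<omega>\<bar> \<le> B"
  have "(\<integral>\<omega>. u r b t k \<omega> * w \<omega> \<partial>M) = (\<integral>\<omega>. (\<Sum>j<r. b j * (q k (t j) \<omega> * w \<omega>)) \<partial>M)"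
    by (simp add: u_def sum_distrib_right mult.assoc)
  also have "\<dots> = (\<Sum>j<r. b j * (\<integral>\<omega>. q k (t j) \<omega> * w \<omega> \<partial>M))"
  proof -
    have "integrable M (\<lambda>\<omega>. q k (t j) \<omega> * w \<omega>)" for j
      by (rule mult_integrable[where A="2 * real k + 2" and B=B]) (use q_bdd w meas_G_M[OF w(1)] in auto)
    then show ?thesis by simp
  qed
  also have "\<dots> = 0" by (simp add: q_mart[OF w])
  finally show "(\<integral>\<omega>. u r b t k \<omega> * w \<omega> \<partial>M) = 0" .
qed

lemma path_combination:
  assumes "\<omega> \<in> space M"
  shows "(\<Sum>j<r. b j * path_of (empirical_process X \<kappa> n \<omega>) (t j)) = (\<Sum>k<n. u r b t k \<omega>) / sqrt (real n)"
proof -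
  have "(\<Sum>j<r. b j * path_of (empirical_process X \<kappa> n \<omega>) (t j)) = (\<Sum>j<r. \<Sum>k<n. b j * q k (t j) \<omega>) / sqrt (real n)"
    by (simp add: path_empirical[OF assms] sum_divide_distrib sum_distrib_left)
  also have "(\<Sum>j<r. \<Sum>k<n. b j * q k (t j) \<omega>) = (\<Sum>k<n. u r b t k \<omega>)"
    unfolding u_def by (rule sum.swap)
  finally show ?thesis .
qed

end

section \<open>Consequences of the second moment bound\<close>

locale cid_l2 = cid_setting M G X \<kappa> for M :: "'a measure" and G X \<kappa> +
  assumes l2: "\<And>t. (SUP n\<in>{1..}. \<integral>\<^sup>+ \<omega>. ennreal ((path_of (empirical_process X \<kappa> n \<omega>) t)\<^sup>2) \<partial>M) < \<infinity>"
begin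

lemma path_bdd:
  assumes "\<omega> \<in> space M"
  shows "\<bar>path_of (empirical_process X \<kappa> n \<omega>) t\<bar> \<le> (\<Sum>k<n. 2 * real k + 2) / sqrt (real n)"
  unfolding path_empirical[OF assms] abs_divide
  by (simp, intro divide_right_mono order_trans[OF sum_abs] sum_mono q_bdd[OF assms]) simp

lemma path_sq_integrable: "integrable M (\<lambda>\<omega>. (path_of (empirical_process X \<kappa> n \<omega>) t)\<^sup>2)"
proof (rule integrable_boundedI)
  show "(\<lambda>\<omega>. (path_of (empirical_process X \<kappa> n \<omega>) t)\<^sup>2) \<in> borel_measurable M"
    using path_measurable by measurable
  fix \<omega> assume "\<omega> \<in> space M"
  from path_bdd[OF this, of n t]
  show "norm ((path_of (empirical_process X \<kappa> n \<omega>) t)\<^sup>2) \<le> ((\<Sum>k<n. 2 * real k + 2) / sqrt (real n))\<^sup>2"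
    by (simp add: power2_le_iff_abs_le sum_nonneg)
qed

lemma l2_bound: obtains C where "0 \<le> C" "\<And>n. (\<integral>\<omega>. (path_of (empirical_process X \<kappa> n \<omega>) t)\<^sup>2 \<partial>M) \<le> C"
proof -
  let ?f = "\<lambda>n. \<integral>\<^sup>+ \<omega>. ennreal ((path_of (empirical_process X \<kappa> n \<omega>) t)\<^sup>2) \<partial>M"
  define c where "c = (SUP n\<in>{1..}. ?f n)"
  have c: "c < \<infinity>" unfolding c_def by (rule l2)
  have "(\<integral>\<omega>. (path_of (empirical_process X \<kappa> n \<omega>) t)\<^sup>2 \<partial>M) \<le> enn2real c" for n
  proof (cases "n = 0")
    case True
    have "(\<integral>\<omega>. (path_of (empirical_process X \<kappa> 0 \<omega>) t)\<^sup>2 \<partial>M) = (\<integral>\<omega>. 0 \<partial>M)"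
      by (rule Bochner_Integration.integral_cong) (auto simp: path_empirical)
    then show ?thesis using True by simp
  next
    case False
    have "?f n \<le> c" unfolding c_def using False by (intro SUP_upper) simp
    moreover have "ennreal (\<integral>\<omega>. (path_of (empirical_process X \<kappa> n \<omega>) t)\<^sup>2 \<partial>M) = ?f n"
      by (rule nn_integral_eq_integral[OF path_sq_integrable, symmetric]) simp
    ultimately have "ennreal (\<integral>\<omega>. (path_of (empirical_process X \<kappa> n \<omega>) t)\<^sup>2 \<partial>M) \<le> c" by simp
    then have "enn2real (ennreal (\<integral>\<omega>. (path_of (empirical_process X \<kappa> n \<omega>) t)\<^sup>2 \<partial>M)) \<le> enn2real c"
      using c by (intro enn2real_mono) auto
    then show ?thesis by simp
  qed
  then show thesis by (rule that[rotated]) simp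
qed

lemma path_tight:
  assumes \<eta>: "0 < (\<eta>::real)"
  shows "\<exists>R. \<forall>n. prob {\<omega> \<in> space M. R < \<bar>path_of (empirical_process X \<kappa> n \<omega>) t\<bar>} \<le> \<eta>"
proof -
  obtain C where C: "0 \<le> C" "\<And>n. (\<integral>\<omega>. (path_of (empirical_process X \<kappa> n \<omega>) t)\<^sup>2 \<partial>M) \<le> C" by (rule l2_bound) blast
  \<comment> \<open>Chebyshev's inequality asks for R^2 \<ge> C / \<eta>; the summand 1 keeps
    \<open>R\<close> positive when C = 0.\<close>
  define R where "R = sqrt (C / \<eta>) + 1"
  have sq: "0 \<le> sqrt (C / \<eta>)" "(sqrt (C / \<eta>))\<^sup>2 = C / \<eta>" using C(1) \<eta> by simp_all
  have R: "0 < R" using sq(1) unfolding R_def by linarith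
  have "C / \<eta> \<le> R\<^sup>2" using power_mono[of "sqrt (C / \<eta>)" R 2] sq by (simp add: R_def)
  then have CR: "C / R\<^sup>2 \<le> \<eta>" using R \<eta> by (simp add: field_simps)
  have "prob {\<omega> \<in> space M. R < \<bar>path_of (empirical_process X \<kappa> n \<omega>) t\<bar>} \<le> \<eta>" for n
  proof -
    note [measurable] = path_measurable
    have "prob {\<omega> \<in> space M. R < \<bar>path_of (empirical_process X \<kappa> n \<omega>) t\<bar>}
        \<le> prob {\<omega> \<in> space M. R\<^sup>2 \<le> (path_of (empirical_process X \<kappa> n \<omega>) t)\<^sup>2}"
    proof (rule finite_measure_mono)
      have "R\<^sup>2 \<le> x\<^sup>2" if "R < \<bar>x\<bar>" for x
        using power_mono[of R "\<bar>x\<bar>" 2] R that by simp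
      then show "{\<omega> \<in> space M. R < \<bar>path_of (empirical_process X \<kappa> n \<omega>) t\<bar>}
        \<subseteq> {\<omega> \<in> space M. R\<^sup>2 \<le> (path_of (empirical_process X \<kappa> n \<omega>) t)\<^sup>2}" by blast
    qed measurable
    also have "\<dots> \<le> (\<integral>\<omega>. (path_of (empirical_process X \<kappa> n \<omega>) t)\<^sup>2 \<partial>M) / R\<^sup>2"
      using integral_Markov_inequality_measure[OF path_sq_integrable[of n t], of "space M" "R\<^sup>2"] R by simp
    also have "\<dots> \<le> C / R\<^sup>2" using C(2) by (intro divide_right_mono) auto
    finally show ?thesis using CR by simp
  qed
  then show ?thesis by blast
qed

text \<open>By orthogonality the mean of the averaged squares is the second moment of a linear
  combination of coordinates of the empirical process, and those moments are bounded by assumption.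
  The factor \<open>r\<close> comes from the squared sum of \<open>r\<close> terms.\<close>

lemma u_l2_bound:
  obtains C where "\<And>n. 1 \<le> n \<Longrightarrow> (\<integral>\<omega>. (\<Sum>k<n. (u r b t k \<omega>)\<^sup>2) / real n \<partial>M) \<le> C"
proof -
  interpret B: bounded_mart_diff M G "u r b t" "\<lambda>k. \<Sum>j<r. \<bar>b j\<bar> * (2 * real k + 2)" by (rule u_mart_diff)
  have "\<forall>s. \<exists>C. \<forall>n. (\<integral>\<omega>. (path_of (empirical_process X \<kappa> n \<omega>) s)\<^sup>2 \<partial>M) \<le> C" using l2_bound by metis
  from choice[OF this] obtain C where C: "\<And>s n. (\<integral>\<omega>. (path_of (empirical_process X \<kappa> n \<omega>) s)\<^sup>2 \<partial>M) \<le> C s" by blast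
  have "(\<integral>\<omega>. (\<Sum>k<n. (u r b t k \<omega>)\<^sup>2) / real n \<partial>M) \<le> (\<Sum>j<r. (b j)\<^sup>2 * C (t j)) * real r" if "1 \<le> n" for n
  proof -
    let ?p = "\<lambda>\<omega> j. path_of (empirical_process X \<kappa> n \<omega>) (t j)"
    have "(\<integral>\<omega>. (\<Sum>k<n. (u r b t k \<omega>)\<^sup>2) / real n \<partial>M) = (\<integral>\<omega>. (\<Sum>k<n. u r b t k \<omega>)\<^sup>2 / real n \<partial>M)"
      using B.expectation_sum_squared[of n] by simp
    also have "\<dots> = (\<integral>\<omega>. (\<Sum>j<r. b j * ?p \<omega> j)\<^sup>2 \<partial>M)"
      by (intro Bochner_Integration.integral_cong) (auto simp: path_combination power_divide)
    also have "\<dots> \<le> (\<integral>\<omega>. (\<Sum>j<r. (b j)\<^sup>2 * (?p \<omega> j)\<^sup>2) * real r \<partial>M)"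
    proof (rule integral_mono)
      show "integrable M (\<lambda>\<omega>. (\<Sum>j<r. b j * ?p \<omega> j)\<^sup>2)"
      proof (rule integrable_boundedI)
        show "(\<lambda>\<omega>. (\<Sum>j<r. b j * ?p \<omega> j)\<^sup>2) \<in> borel_measurable M" using path_measurable by measurable
        fix \<omega> assume \<omega>: "\<omega> \<in> space M"
        have "\<bar>\<Sum>j<r. b j * ?p \<omega> j\<bar> \<le> (\<Sum>j<r. \<bar>b j\<bar> * ((\<Sum>k<n. 2 * real k + 2) / sqrt (real n)))"
          by (rule order_trans[OF sum_abs], rule sum_mono, unfold abs_mult, intro mult_left_mono path_bdd[OF \<omega>]) simp
        then show "norm ((\<Sum>j<r. b j * ?p \<omega> j)\<^sup>2) \<le> (\<Sum>j<r. \<bar>b j\<bar> * ((\<Sum>k<n. 2 * real k + 2) / sqrt (real n)))\<^sup>2"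
          by (subst real_norm_def, subst abs_power2, subst power2_abs[symmetric]) (rule power_mono, auto)
      qed
      show "integrable M (\<lambda>\<omega>. (\<Sum>j<r. (b j)\<^sup>2 * (?p \<omega> j)\<^sup>2) * real r)" using path_sq_integrable by simp
      show "(\<Sum>j<r. b j * ?p \<omega> j)\<^sup>2 \<le> (\<Sum>j<r. (b j)\<^sup>2 * (?p \<omega> j)\<^sup>2) * real r" for \<omega>
        using sum_squared_le_sum_of_squares[of "\<lambda>j. b j * ?p \<omega> j" "{..<r}"] by (simp add: power_mult_distrib)
    qed
    also have "\<dots> = (\<Sum>j<r. (b j)\<^sup>2 * (\<integral>\<omega>. (?p \<omega> j)\<^sup>2 \<partial>M)) * real r" using path_sq_integrable by simp
    also have "\<dots> \<le> (\<Sum>j<r. (b j)\<^sup>2 * C (t j)) * real r"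
      by (intro mult_right_mono sum_mono mult_left_mono C) auto
    finally show ?thesis .
  qed
  then show thesis by (rule that)
qed

text \<open>The real part of \<open>iexp c\<close> times the characteristic function; the limit
  being real, only cos c survives. In (a) the sequence \<rho> is a subsequence along which the
  hypotheses hold almost surely.\<close>

theorem fidi_cos_tendsto:
  assumes \<rho>: "filterlim \<rho> at_top sequentially" and s2 [measurable]: "s2 \<in> borel_measurable M"
    and lim: "AE \<omega> in M. (\<lambda>n. (\<Sum>k<\<rho> n. (u r b t k \<omega>)\<^sup>2) / real (\<rho> n)) \<longlonglongrightarrow> s2 \<omega>"
    and mx: "AE \<omega> in M. \<forall>\<epsilon>>0. \<forall>\<^sub>F n in sequentially. \<forall>k<\<rho> n. (u r b t k \<omega>)\<^sup>2 \<le> \<epsilon> * real (\<rho> n)"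
  shows "(\<lambda>n. \<integral>\<omega>. cos ((\<Sum>j<r. b j * path_of (empirical_process X \<kappa> (\<rho> n) \<omega>) (t j)) + c) \<partial>M)
      \<longlonglongrightarrow> (\<integral>\<omega>. exp (- s2 \<omega> / 2) * cos c \<partial>M)"
proof -
  interpret B: bounded_mart_diff M G "u r b t" "\<lambda>k. \<Sum>j<r. \<bar>b j\<bar> * (2 * real k + 2)" by (rule u_mart_diff)
  obtain C where C: "\<And>n. 1 \<le> n \<Longrightarrow> (\<integral>\<omega>. (\<Sum>k<n. (u r b t k \<omega>)\<^sup>2) / real n \<partial>M) \<le> C" by (rule u_l2_bound) blast
  let ?S = "\<lambda>n \<omega>. (\<Sum>k<\<rho> n. u r b t k \<omega>) / sqrt (real (\<rho> n))"
  have "(\<lambda>n. Re (iexp c * (\<integral>\<omega>. iexp (?S n \<omega>) \<partial>M))) \<longlonglongrightarrow> Re (iexp c * complex_of_real (\<integral>\<omega>. exp (- s2 \<omega> / 2) \<partial>M))"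
    by (intro tendsto_Re tendsto_mult tendsto_const B.martingale_char_tendsto[OF \<rho> C s2 lim mx])
  moreover have "Re (iexp c * (\<integral>\<omega>. iexp (?S n \<omega>) \<partial>M))
      = (\<integral>\<omega>. cos ((\<Sum>j<r. b j * path_of (empirical_process X \<kappa> (\<rho> n) \<omega>) (t j)) + c) \<partial>M)" for n
  proof -
    have i: "integrable M (\<lambda>\<omega>. iexp c * iexp (?S n \<omega>))"
    proof (rule integrable_boundedI)
      have "?S n \<in> borel_measurable M" by measurable
      moreover have "(\<lambda>x :: real. iexp c * iexp x) \<in> borel_measurable borel" by measurable
      ultimately show "(\<lambda>\<omega>. iexp c * iexp (?S n \<omega>)) \<in> borel_measurable M" by (rule measurable_compose)
      show "cmod (iexp c * iexp (?S n \<omega>)) \<le> 1" for \<omega> by (simp only: norm_mult norm_exp_i_times)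
    qed
    have "Re (iexp c * (\<integral>\<omega>. iexp (?S n \<omega>) \<partial>M)) = Re (\<integral>\<omega>. iexp c * iexp (?S n \<omega>) \<partial>M)"
      by (simp only: integral_mult_right_zero)
    also have "\<dots> = (\<integral>\<omega>. Re (iexp c * iexp (?S n \<omega>)) \<partial>M)" by (rule integral_Re[OF i, symmetric])
    also have "\<dots> = (\<integral>\<omega>. cos ((\<Sum>j<r. b j * path_of (empirical_process X \<kappa> (\<rho> n) \<omega>) (t j)) + c) \<partial>M)"
    proof (rule Bochner_Integration.integral_cong[OF refl])
      fix \<omega> assume "\<omega> \<in> space M"
      have "iexp c * iexp (?S n \<omega>) = iexp (?S n \<omega> + c)"
        by (simp only: exp_add[symmetric] of_real_add distrib_left add.commute)
      then have "Re (iexp c * iexp (?S n \<omega>)) = cos (?S n \<omega> + c)" by (simp only: Re_exp) simp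
      then show "Re (iexp c * iexp (?S n \<omega>)) = cos ((\<Sum>j<r. b j * path_of (empirical_process X \<kappa> (\<rho> n) \<omega>) (t j)) + c)"
        by (simp only: path_combination[OF \<open>\<omega> \<in> space M\<close>])
    qed
    finally show ?thesis .
  qed
  moreover have "Re (iexp c * complex_of_real (\<integral>\<omega>. exp (- s2 \<omega> / 2) \<partial>M)) = (\<integral>\<omega>. exp (- s2 \<omega> / 2) * cos c \<partial>M)"
    by (simp add: Re_exp)
  ultimately show ?thesis by (simp only:)
qed

end

text \<open>a n / (n + 1) is the difference of consecutive means, up to a factor tending to 1, and
  so tends to 0. This handles late indices, while finitely many early terms are outgrown by
  \<epsilon> n. In (b) it makes the largest increment negligible without a further
  hypothesis.\<close>

lemma mean_convergent_imp_max_small: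
  fixes a :: "nat \<Rightarrow> real"
  assumes a: "\<And>k. 0 \<le> a k" and lim: "(\<lambda>n. (\<Sum>k<n. a k) / real n) \<longlonglongrightarrow> L" and \<epsilon>: "0 < \<epsilon>"
  shows "\<forall>\<^sub>F n in sequentially. \<forall>k<n. a k \<le> \<epsilon> * real n"
proof -
  have "(\<lambda>n. (\<Sum>k<Suc n. a k) / real (Suc n) - (\<Sum>k<n. a k) / real n * (real n / real (Suc n))) \<longlonglongrightarrow> L - L * 1"
    by (intro tendsto_diff tendsto_mult lim LIMSEQ_Suc[OF lim] LIMSEQ_n_over_Suc_n)
  moreover have "(\<Sum>k<Suc n. a k) / real (Suc n) - (\<Sum>k<n. a k) / real n * (real n / real (Suc n)) = a n / real (Suc n)" for n
  proof (cases "n = 0")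
    case False
    then have "(\<Sum>k<n. a k) / real n * (real n / real (Suc n)) = (\<Sum>k<n. a k) / real (Suc n)" by simp
    then show ?thesis by (simp add: add_divide_distrib)
  qed simp
  ultimately have "(\<lambda>n. a n / real (Suc n)) \<longlonglongrightarrow> 0" by simp
  then have "\<forall>\<^sub>F n in sequentially. a n / real (Suc n) < \<epsilon>" using \<epsilon> by (intro order_tendstoD)
  then obtain K where K: "\<And>k. K \<le> k \<Longrightarrow> a k / real (Suc k) < \<epsilon>" by (auto simp: eventually_sequentially)
  have "\<forall>\<^sub>F n in sequentially. (\<Sum>j<K. a j) / \<epsilon> \<le> real n"
    using filterlim_real_sequentially by (simp add: filterlim_at_top)
  then show ?thesis
  proof eventually_elim
    case (elim n)
    show ?case
    proof (intro allI impI)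
      fix k assume "k < n"
      show "a k \<le> \<epsilon> * real n"
      proof (cases "K \<le> k")
        case True
        have "a k \<le> \<epsilon> * real (Suc k)" using K[OF True] by (simp add: divide_less_eq)
        also have "\<dots> \<le> \<epsilon> * real n" using \<open>k < n\<close> \<epsilon> by (intro mult_left_mono) auto
        finally show ?thesis .
      next
        case False
        then have "a k \<le> (\<Sum>j<K. a j)" using a by (intro member_le_sum) auto
        also have "\<dots> \<le> \<epsilon> * real n" using elim \<epsilon> by (simp add: divide_le_eq mult.commute)
        finally show ?thesis .
      qed
    qed
  qed
qed

lemma cesaro_null:
  fixes a :: "nat \<Rightarrow> real"
  assumes a: "\<And>k. 0 \<le> a k" and lim: "a \<longlonglongrightarrow> 0"
  shows "(\<lambda>n. (\<Sum>k<n. a k) / real n) \<longlonglongrightarrow> 0"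
proof (rule tendstoI)
  fix e :: real assume e: "0 < e"
  have "\<forall>\<^sub>F n in sequentially. a n < e / 2" using lim e by (intro order_tendstoD) auto
  then obtain K where K: "\<And>k. K \<le> k \<Longrightarrow> a k < e / 2" by (auto simp: eventually_sequentially)
  have "\<forall>\<^sub>F n in sequentially. 2 * (\<Sum>j<K. a j) / e + 1 \<le> real n"
    using filterlim_real_sequentially by (simp add: filterlim_at_top)
  then show "\<forall>\<^sub>F n in sequentially. dist ((\<Sum>k<n. a k) / real n) 0 < e"
  proof eventually_elim
    case (elim n)
    have s0: "0 \<le> (\<Sum>j<K. a j)" by (simp add: sum_nonneg a)
    then have "0 \<le> 2 * (\<Sum>j<K. a j) / e" using e by simp
    with elim have n: "0 < real n" by linarith
    have "2 * (\<Sum>j<K. a j) / e < real n" using elim by linarith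
    then have 1: "(\<Sum>j<K. a j) < real n * (e / 2)" using e by (simp add: divide_less_eq)
    have "(\<Sum>k<n. a k) \<le> (\<Sum>k<n. (if k < K then a k else 0) + e / 2)"
    proof (rule sum_mono)
      fix k
      show "a k \<le> (if k < K then a k else 0) + e / 2" using K[of k] e by (cases "k < K") auto
    qed
    also have "\<dots> = (\<Sum>k<n. if k < K then a k else 0) + real n * (e / 2)" by (simp add: sum.distrib)
    also have "(\<Sum>k<n. if k < K then a k else 0) = (\<Sum>k\<in>{..<n} \<inter> {..<K}. a k)"
      by (rule sum.mono_neutral_cong_right) auto
    also have "\<dots> \<le> (\<Sum>j<K. a j)" by (rule sum_mono2) (auto simp: a)
    finally have "(\<Sum>k<n. a k) < real n * e" using 1 by (simp add: algebra_simps)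
    then have "(\<Sum>k<n. a k) / real n < e" using n by (simp add: divide_less_eq mult.commute)
    moreover have "0 \<le> (\<Sum>k<n. a k) / real n" by (simp add: sum_nonneg a)
    ultimately show ?case by simp
  qed
qed

text \<open>By Cauchy--Schwarz the square of the mixed mean is at most the product of the two
  quadratic means, one convergent and the other null.\<close>

lemma quadratic_mean_perturbation:
  fixes v w :: "nat \<Rightarrow> real"
  assumes N: "filterlim N at_top sequentially"
    and v: "(\<lambda>n. (\<Sum>k<N n. (v k)\<^sup>2) / real (N n)) \<longlonglongrightarrow> L"
    and w: "(\<lambda>n. (\<Sum>k<N n. (w k)\<^sup>2) / real (N n)) \<longlonglongrightarrow> 0"
  shows "(\<lambda>n. (\<Sum>k<N n. (v k - w k)\<^sup>2) / real (N n)) \<longlonglongrightarrow> L"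
proof -
  let ?v = "\<lambda>n. (\<Sum>k<N n. (v k)\<^sup>2) / real (N n)" and ?w = "\<lambda>n. (\<Sum>k<N n. (w k)\<^sup>2) / real (N n)"
  let ?T = "\<lambda>n. (\<Sum>k<N n. v k * w k) / real (N n)"
  have "(\<lambda>n. ?v n * ?w n) \<longlonglongrightarrow> L * 0" by (intro tendsto_mult v w)
  then have vw: "(\<lambda>n. ?v n * ?w n) \<longlonglongrightarrow> 0" by (simp only: mult_zero_right)
  have le: "(?T n)\<^sup>2 \<le> ?v n * ?w n" for n
  proof -
    have "(?T n)\<^sup>2 = (\<Sum>k<N n. v k * w k)\<^sup>2 / (real (N n) * real (N n))"
      by (simp only: power_divide power2_eq_square[of "real (N n)"])
    also have "\<dots> \<le> ((\<Sum>k<N n. (v k)\<^sup>2) * (\<Sum>k<N n. (w k)\<^sup>2)) / (real (N n) * real (N n))"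
      by (intro divide_right_mono Cauchy_Schwarz_ineq_sum) simp
    finally show ?thesis by (simp only: times_divide_times_eq)
  qed
  have "(\<lambda>n. (?T n)\<^sup>2) \<longlonglongrightarrow> 0"
    by (rule tendsto_sandwich[OF _ _ tendsto_const vw])
      (intro always_eventually allI zero_le_power2, intro always_eventually allI le)
  from tendsto_real_sqrt[OF this] have "(\<lambda>n. \<bar>?T n\<bar>) \<longlonglongrightarrow> 0" by (simp only: real_sqrt_abs real_sqrt_zero)
  then have T: "?T \<longlonglongrightarrow> 0" by (rule tendsto_rabs_zero_cancel)
  have "(\<lambda>n. ?v n - 2 * ?T n + ?w n) \<longlonglongrightarrow> L - 2 * 0 + 0"
    by (intro tendsto_add tendsto_diff tendsto_mult tendsto_const v w T)
  moreover have "?v n - 2 * ?T n + ?w n = (\<Sum>k<N n. (v k - w k)\<^sup>2) / real (N n)" for n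
  proof -
    have "(\<Sum>k<N n. (v k - w k)\<^sup>2) = (\<Sum>k<N n. (v k)\<^sup>2 - 2 * (v k * w k) + (w k)\<^sup>2)"
      by (intro sum.cong refl) (simp add: power2_diff)
    also have "\<dots> = (\<Sum>k<N n. (v k)\<^sup>2) - 2 * (\<Sum>k<N n. v k * w k) + (\<Sum>k<N n. (w k)\<^sup>2)"
      by (simp only: sum.distrib sum_subtractf sum_distrib_left)
    finally show ?thesis by (simp only: add_divide_distrib diff_divide_distrib times_divide_eq_right)
  qed
  ultimately show ?thesis by simp
qed

lemma sum_combination_squared:
  fixes f :: "nat \<Rightarrow> real"
  shows "(\<Sum>j<(r::nat). b j * f j)\<^sup>2 = (\<Sum>i<r. \<Sum>j<r. b i * b j * (f i * f j))"
  unfolding power2_eq_square sum_product by (intro sum.cong refl) (simp only: mult_ac)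

lemma mean_combination_squared:
  fixes f :: "nat \<Rightarrow> nat \<Rightarrow> real"
  shows "(\<Sum>k<n. (\<Sum>j<(r::nat). b j * f k j)\<^sup>2) / real n = (\<Sum>i<r. \<Sum>j<r. b i * b j * ((\<Sum>k<n. f k i * f k j) / real n))"
proof -
  have "(\<Sum>k<n. (\<Sum>j<r. b j * f k j)\<^sup>2) = (\<Sum>k<n. \<Sum>i<r. \<Sum>j<r. b i * b j * (f k i * f k j))"
    by (simp only: sum_combination_squared)
  also have "\<dots> = (\<Sum>i<r. \<Sum>k<n. \<Sum>j<r. b i * b j * (f k i * f k j))" by (rule sum.swap)
  also have "\<dots> = (\<Sum>i<r. \<Sum>j<r. \<Sum>k<n. b i * b j * (f k i * f k j))"
    by (rule sum.cong[OF refl]) (rule sum.swap)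
  also have "\<dots> = (\<Sum>i<r. \<Sum>j<r. b i * b j * (\<Sum>k<n. f k i * f k j))"
    by (simp only: sum_distrib_left)
  finally show ?thesis
    by (simp only: sum_divide_distrib[where A="{..<r}"] times_divide_eq_right)
qed

context cid_l2
begin

lemma q_eq_q_incr: "AE \<omega> in M. \<forall>k. q k t \<omega> = q_incr M G X (Suc k) t \<omega>"
proof -
  have "AE \<omega> in M. \<forall>n. V n t \<omega> = cond_cdf M G X n t \<omega>"
    unfolding AE_all_countable using V_eq_cond_cdf by blast
  then show ?thesis by eventually_elim (simp add: q_def q_incr_def ind_def)
qed

text \<open>The quadratic form of \<open>S\<close> is the limit of the averaged squares of the
  increments \<open>u\<close>. This one convergence gives positive semidefiniteness, the limiting
  variance and, through the maximum lemma, negligible increments.\<close>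

theorem fidi_limit_covariation:
  assumes S [measurable]: "\<And>i j. S i j \<in> borel_measurable M"
    and lim: "\<And>i j. i < r \<Longrightarrow> j < r \<Longrightarrow>
       AE \<omega> in M. (\<lambda>n. 1 / real n * (\<Sum>k=1..n. q_incr M G X k (t i) \<omega> * q_incr M G X k (t j) \<omega>)) \<longlonglongrightarrow> S i j \<omega>"
  shows "AE \<omega> in M. psd r (\<lambda>i j. S i j \<omega>)"
    and "(\<lambda>n. \<integral>\<omega>. cos ((\<Sum>j<r. b j * path_of (empirical_process X \<kappa> n \<omega>) (t j)) + c) \<partial>M)
      \<longlonglongrightarrow> (\<integral>\<omega>. exp (- (\<Sum>i<r. \<Sum>j<r. b i * b j * S i j \<omega>) / 2) * cos c \<partial>M)"
proof -
  have "AE \<omega> in M. \<forall>i j. i < r \<longrightarrow> j < r \<longrightarrow>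
      (\<lambda>n. 1 / real n * (\<Sum>k=1..n. q_incr M G X k (t i) \<omega> * q_incr M G X k (t j) \<omega>)) \<longlonglongrightarrow> S i j \<omega>"
    unfolding AE_all_countable using lim by auto
  moreover have "AE \<omega> in M. \<forall>i k. q k (t i) \<omega> = q_incr M G X (Suc k) (t i) \<omega>"
    unfolding AE_all_countable[where P="\<lambda>i \<omega>. \<forall>k. q k (t i) \<omega> = q_incr M G X (Suc k) (t i) \<omega>"]
    using q_eq_q_incr by blast
  ultimately have qlim: "AE \<omega> in M. \<forall>i j. i < r \<longrightarrow> j < r \<longrightarrow> (\<lambda>n. (\<Sum>k<n. q k (t i) \<omega> * q k (t j) \<omega>) / real n) \<longlonglongrightarrow> S i j \<omega>"
    by eventually_elim (simp add: sum.atLeast1_atMost_eq)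
  have ulim: "(\<lambda>n. (\<Sum>k<n. (u r v t k \<omega>)\<^sup>2) / real n) \<longlonglongrightarrow> (\<Sum>i<r. \<Sum>j<r. v i * v j * S i j \<omega>)"
    if "\<forall>i j. i < r \<longrightarrow> j < r \<longrightarrow> (\<lambda>n. (\<Sum>k<n. q k (t i) \<omega> * q k (t j) \<omega>) / real n) \<longlonglongrightarrow> S i j \<omega>" for \<omega> v
    unfolding u_def mean_combination_squared
    using that by (intro tendsto_sum tendsto_mult tendsto_const) auto
  show "AE \<omega> in M. psd r (\<lambda>i j. S i j \<omega>)"
    using qlim
  proof eventually_elim
    case (elim \<omega>)
    show ?case unfolding psd_def
    proof (intro conjI allI impI)
      fix i j assume ij: "i < r" "j < r"
      have "(\<lambda>n. (\<Sum>k<n. q k (t j) \<omega> * q k (t i) \<omega>) / real n) \<longlonglongrightarrow> S i j \<omega>"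
        using elim[rule_format, OF ij] by (simp add: mult.commute)
      then show "S i j \<omega> = S j i \<omega>" by (rule LIMSEQ_unique[OF _ elim[rule_format, OF ij(2,1)]])
    next
      fix v
      show "0 \<le> (\<Sum>i<r. \<Sum>j<r. v i * v j * S i j \<omega>)"
        by (rule tendsto_lowerbound[OF ulim[OF elim]]) (auto simp: sum_nonneg)
    qed
  qed
  show "(\<lambda>n. \<integral>\<omega>. cos ((\<Sum>j<r. b j * path_of (empirical_process X \<kappa> n \<omega>) (t j)) + c) \<partial>M)
      \<longlonglongrightarrow> (\<integral>\<omega>. exp (- (\<Sum>i<r. \<Sum>j<r. b i * b j * S i j \<omega>) / 2) * cos c \<partial>M)"
  proof (rule fidi_cos_tendsto[where \<rho>="\<lambda>n. n" and ?s2.0="\<lambda>\<omega>. \<Sum>i<r. \<Sum>j<r. b i * b j * S i j \<omega>"])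
    show "AE \<omega> in M. (\<lambda>n. (\<Sum>k<n. (u r b t k \<omega>)\<^sup>2) / real n) \<longlonglongrightarrow> (\<Sum>i<r. \<Sum>j<r. b i * b j * S i j \<omega>)"
      using qlim by eventually_elim (rule ulim)
    show "AE \<omega> in M. \<forall>\<epsilon>>0. \<forall>\<^sub>F n in sequentially. \<forall>k<n. (u r b t k \<omega>)\<^sup>2 \<le> \<epsilon> * real n"
      using qlim
    proof eventually_elim
      case (elim \<omega>)
      show ?case
        using mean_convergent_imp_max_small[OF _ ulim[OF elim, of b]] by simp
    qed
  qed (auto intro: filterlim_ident)
qed

end

section \<open>The directing measure\<close>

text \<open>Integrability is part of the notion because the integral of a non-integrable function is
  0 by convention.\<close>

definition L1_null :: "'a measure \<Rightarrow> (nat \<Rightarrow> 'a \<Rightarrow> real) \<Rightarrow> bool" where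
  "L1_null M Y \<longleftrightarrow> (\<forall>n. integrable M (Y n)) \<and> (\<lambda>n. \<integral>\<omega>. \<bar>Y n \<omega>\<bar> \<partial>M) \<longlonglongrightarrow> 0"

lemma L1_null_dominated:
  assumes Z: "L1_null M Z" and Y: "\<And>n. Y n \<in> borel_measurable M"
    and le: "\<And>n \<omega>. \<omega> \<in> space M \<Longrightarrow> \<bar>Y n \<omega>\<bar> \<le> \<bar>Z n \<omega>\<bar>"
  shows "L1_null M Y"
proof -
  have iZ: "integrable M (Z n)" for n using Z by (simp add: L1_null_def)
  have iY: "integrable M (Y n)" for n
    by (rule Bochner_Integration.integrable_bound[OF iZ Y]) (use le in auto)
  have "(\<lambda>n. \<integral>\<omega>. \<bar>Y n \<omega>\<bar> \<partial>M) \<longlonglongrightarrow> 0"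
  proof (rule tendsto_sandwich[OF _ _ tendsto_const])
    show "(\<lambda>n. \<integral>\<omega>. \<bar>Z n \<omega>\<bar> \<partial>M) \<longlonglongrightarrow> 0" using Z by (simp add: L1_null_def)
    show "\<forall>\<^sub>F n in sequentially. (\<integral>\<omega>. \<bar>Y n \<omega>\<bar> \<partial>M) \<le> (\<integral>\<omega>. \<bar>Z n \<omega>\<bar> \<partial>M)"
      by (intro always_eventually allI integral_mono le) (use iY iZ in auto)
  qed simp
  with iY show ?thesis by (simp add: L1_null_def)
qed

lemma L1_null_add:
  assumes "L1_null M Y" "L1_null M Z"
  shows "L1_null M (\<lambda>n \<omega>. Y n \<omega> + Z n \<omega>)"
proof -
  have i: "integrable M (Y n)" "integrable M (Z n)" for n using assms by (simp_all add: L1_null_def)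
  have "(\<lambda>n. \<integral>\<omega>. \<bar>Y n \<omega> + Z n \<omega>\<bar> \<partial>M) \<longlonglongrightarrow> 0"
  proof (rule tendsto_sandwich[OF _ _ tendsto_const])
    have "(\<lambda>n. (\<integral>\<omega>. \<bar>Y n \<omega>\<bar> \<partial>M) + (\<integral>\<omega>. \<bar>Z n \<omega>\<bar> \<partial>M)) \<longlonglongrightarrow> 0 + 0"
      using assms unfolding L1_null_def by (intro tendsto_add) auto
    then show "(\<lambda>n. (\<integral>\<omega>. \<bar>Y n \<omega>\<bar> \<partial>M) + (\<integral>\<omega>. \<bar>Z n \<omega>\<bar> \<partial>M)) \<longlonglongrightarrow> 0" by simp
    have "(\<integral>\<omega>. \<bar>Y n \<omega> + Z n \<omega>\<bar> \<partial>M) \<le> (\<integral>\<omega>. \<bar>Y n \<omega>\<bar> + \<bar>Z n \<omega>\<bar> \<partial>M)" for n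
      by (intro integral_mono) (use i in auto)
    then show "\<forall>\<^sub>F n in sequentially. (\<integral>\<omega>. \<bar>Y n \<omega> + Z n \<omega>\<bar> \<partial>M) \<le> (\<integral>\<omega>. \<bar>Y n \<omega>\<bar> \<partial>M) + (\<integral>\<omega>. \<bar>Z n \<omega>\<bar> \<partial>M)"
      using i by simp
  qed simp
  with i show ?thesis by (simp add: L1_null_def)
qed

lemma L1_null_uminus: "L1_null M Y \<Longrightarrow> L1_null M (\<lambda>n \<omega>. - Y n \<omega>)"
  by (simp add: L1_null_def)

lemma L1_null_diff: "L1_null M Y \<Longrightarrow> L1_null M Z \<Longrightarrow> L1_null M (\<lambda>n \<omega>. Y n \<omega> - Z n \<omega>)"
  using L1_null_add[OF _ L1_null_uminus] by fastforce

lemma L1_null_sum: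
  fixes r :: nat
  assumes "\<And>j. j < r \<Longrightarrow> L1_null M (Y j)"
  shows "L1_null M (\<lambda>n \<omega>. \<Sum>j<r. \<bar>Y j n \<omega>\<bar>)"
  using assms
proof (induction r)
  case (Suc r)
  have "L1_null M (\<lambda>n \<omega>. \<bar>Y r n \<omega>\<bar>)" using Suc.prems[of r] by (simp add: L1_null_def)
  from L1_null_add[OF Suc.IH this] Suc.prems show ?case by simp
qed (simp add: L1_null_def)

lemma L1_null_subseq:
  assumes "L1_null M Y" "filterlim \<rho> at_top sequentially"
  shows "L1_null M (\<lambda>n. Y (\<rho> n))"
  using assms filterlim_compose[of "\<lambda>n. \<integral>\<omega>. \<bar>Y n \<omega>\<bar> \<partial>M" "nhds 0" sequentially \<rho> sequentially]
  by (simp add: L1_null_def)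

lemma L1_null_AE_subseq:
  assumes "L1_null M Y"
  obtains \<rho> :: "nat \<Rightarrow> nat" where "strict_mono \<rho>" "AE \<omega> in M. (\<lambda>n. Y (\<rho> n) \<omega>) \<longlonglongrightarrow> 0"
  using tendsto_L1_AE_subseq[of M Y] assms by (auto simp: L1_null_def)

lemma L1_null_mean:
  assumes g: "L1_null M g"
  shows "L1_null M (\<lambda>n \<omega>. (\<Sum>k<n. g k \<omega>) / real n)"
proof -
  have i: "integrable M (g n)" for n using g by (simp add: L1_null_def)
  have "(\<lambda>n. \<integral>\<omega>. \<bar>(\<Sum>k<n. g k \<omega>) / real n\<bar> \<partial>M) \<longlonglongrightarrow> 0"
  proof (rule tendsto_sandwich[OF _ _ tendsto_const])
    show "(\<lambda>n. (\<Sum>k<n. \<integral>\<omega>. \<bar>g k \<omega>\<bar> \<partial>M) / real n) \<longlonglongrightarrow> 0"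
      by (rule cesaro_null) (use g in \<open>auto simp: L1_null_def\<close>)
    have "(\<integral>\<omega>. \<bar>(\<Sum>k<n. g k \<omega>) / real n\<bar> \<partial>M) \<le> (\<integral>\<omega>. (\<Sum>k<n. \<bar>g k \<omega>\<bar>) / real n \<partial>M)" for n
      by (intro integral_mono) (use i in \<open>auto intro!: divide_right_mono\<close>)
    then show "\<forall>\<^sub>F n in sequentially. (\<integral>\<omega>. \<bar>(\<Sum>k<n. g k \<omega>) / real n\<bar> \<partial>M) \<le> (\<Sum>k<n. \<integral>\<omega>. \<bar>g k \<omega>\<bar> \<partial>M) / real n"
      using i by simp
  qed simp
  with i show ?thesis by (simp add: L1_null_def)
qed

text \<open>Orthogonality bounds the second moment of the sum by \<open>n\<close>. With s = sqrt n
  the pointwise bound |y| / n \<le> 1 / s + y^2 / (n s) turns this into a first moment of at most 2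
  / s for the mean.\<close>

lemma (in bounded_mart_diff) L1_null_mean_mart_diff:
  assumes "\<And>k. b k = 1"
  shows "L1_null M (\<lambda>n \<omega>. (\<Sum>k<n. u k \<omega>) / real n)"
proof -
  let ?Y = "\<lambda>n \<omega>. (\<Sum>k<n. u k \<omega>) / real n"
  have i: "integrable M (u k)" for k
    by (rule integrable_boundedI[where B="b k"]) (use bdd in auto)
  have i2: "integrable M (\<lambda>\<omega>. (\<Sum>k<n. u k \<omega>)\<^sup>2)" for n
    by (rule integrable_boundedI[where B="(\<Sum>k<n. b k)\<^sup>2"])
      (use sum_bdd in \<open>auto simp: power2_le_iff_abs_le sum_nonneg b_nonneg\<close>)
  have u2: "integrable M (\<lambda>\<omega>. (u k \<omega>)\<^sup>2)" for k
    by (rule integrable_boundedI[where B="(b k)\<^sup>2"]) (use bdd in \<open>auto simp: power2_le_iff_abs_le b_nonneg\<close>)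
  have le: "(\<integral>\<omega>. (\<Sum>k<n. u k \<omega>)\<^sup>2 \<partial>M) \<le> real n" for n
  proof -
    have "(\<integral>\<omega>. (u k \<omega>)\<^sup>2 \<partial>M) \<le> (\<integral>\<omega>. 1 \<partial>M)" for k
      by (rule integral_mono[OF u2]) (use bdd[of _ k] assms[of k] in \<open>auto simp: abs_square_le_1\<close>)
    then have "(\<Sum>k<n. \<integral>\<omega>. (u k \<omega>)\<^sup>2 \<partial>M) \<le> (\<Sum>k<n. 1)" by (intro sum_mono) (simp add: prob_space)
    then show ?thesis unfolding expectation_sum_squared using u2 by simp
  qed
  have "(\<integral>\<omega>. \<bar>?Y n \<omega>\<bar> \<partial>M) \<le> 2 / sqrt (real n)" for n
  proof (cases "n = 0")
    case False
    define s where "s = sqrt (real n)"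
    have s: "0 < s" "s * s = real n" using False by (simp_all add: s_def)
    have "(\<integral>\<omega>. \<bar>?Y n \<omega>\<bar> \<partial>M) \<le> (\<integral>\<omega>. 1 / s + (\<Sum>k<n. u k \<omega>)\<^sup>2 / (real n * s) \<partial>M)"
    proof (rule integral_mono)
      show "integrable M (\<lambda>\<omega>. \<bar>?Y n \<omega>\<bar>)" using i by simp
      show "integrable M (\<lambda>\<omega>. 1 / s + (\<Sum>k<n. u k \<omega>)\<^sup>2 / (real n * s))" using i2 by simp
      fix \<omega>
      define y where "y = \<bar>\<Sum>k<n. u k \<omega>\<bar>"
      have "2 * (y * s) \<le> y\<^sup>2 + s\<^sup>2" using sum_squares_bound[of y s] by (simp add: mult.assoc)
      moreover have "0 \<le> y * s" using s by (simp add: y_def)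
      ultimately have "y * s \<le> s * s + y\<^sup>2" by (simp add: power2_eq_square)
      then have "y * s / (real n * s) \<le> (s * s + y\<^sup>2) / (real n * s)"
        using s by (intro divide_right_mono) auto
      moreover have "y * s / (real n * s) = y / real n" using s by simp
      moreover have "(s * s + y\<^sup>2) / (real n * s) = 1 / s + y\<^sup>2 / (real n * s)"
        using s False by (simp add: add_divide_distrib)
      ultimately show "\<bar>?Y n \<omega>\<bar> \<le> 1 / s + (\<Sum>k<n. u k \<omega>)\<^sup>2 / (real n * s)"
        by (simp add: y_def)
    qed
    also have "\<dots> = 1 / s + (\<integral>\<omega>. (\<Sum>k<n. u k \<omega>)\<^sup>2 \<partial>M) / (real n * s)"
      using i2 by (simp add: prob_space)
    also have "\<dots> \<le> 1 / s + real n / (real n * s)"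
      using le[of n] s by (intro add_left_mono divide_right_mono) auto
    also have "\<dots> = 2 / s" using False by simp
    finally show ?thesis by (simp only: s_def)
  qed simp
  then have le2: "\<forall>\<^sub>F n in sequentially. (\<integral>\<omega>. \<bar>?Y n \<omega>\<bar> \<partial>M) \<le> 2 / sqrt (real n)" by (intro always_eventually allI)
  have lim: "(\<lambda>n. 2 / sqrt (real n)) \<longlonglongrightarrow> 0"
    by (rule tendsto_divide_0[OF tendsto_const filterlim_at_top_imp_at_infinity[OF
        filterlim_compose[OF sqrt_at_top filterlim_real_sequentially]]])
  have "(\<lambda>n. \<integral>\<omega>. \<bar>?Y n \<omega>\<bar> \<partial>M) \<longlonglongrightarrow> 0"
    by (rule tendsto_sandwich[OF _ le2 tendsto_const lim]) simp
  with i show ?thesis by (simp add: L1_null_def)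
qed

text \<open>Continuous majorants of the indicator of the half-line up to \<open>t\<close>, with
  slope -j beyond \<open>t\<close>. The directing measure is characterised by continuous functions
  only, so distribution functions are reached through these.\<close>

definition ramp :: "real \<Rightarrow> nat \<Rightarrow> real \<Rightarrow> real" where
  "ramp t j x = max 0 (min 1 (1 - real j * (x - t)))"

lemma ramp_continuous: "continuous_on S (ramp t j)"
  unfolding ramp_def by (intro continuous_intros)

lemma ramp_measurable [measurable]: "ramp t j \<in> borel_measurable borel"
  by (rule borel_measurable_continuous_onI[OF ramp_continuous])

lemma ramp_bdd: "\<bar>ramp t j x\<bar> \<le> 1" by (simp add: ramp_def)

lemma ramp_tendsto: "(\<lambda>j. ramp t j x) \<longlonglongrightarrow> indicator {..t} x"
proof (cases "x \<le> t")
  case True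
  then have "real j * (x - t) \<le> 0" for j by (simp add: mult_nonneg_nonpos)
  then have "ramp t j x = 1" for j unfolding ramp_def using True by (simp add: min_absorb1)
  then show ?thesis using True by simp
next
  case False
  obtain j0 :: nat where j0: "1 < real j0 * (x - t)" using False reals_Archimedean3[of "x - t"] by auto
  have "ramp t j x = 0" if "j0 \<le> j" for j
  proof -
    have "real j0 * (x - t) \<le> real j * (x - t)" using that False by (intro mult_right_mono) auto
    then show ?thesis using j0 by (simp add: ramp_def)
  qed
  then have "\<forall>\<^sub>F j in sequentially. ramp t j x = 0" by (auto simp: eventually_sequentially)
  then show ?thesis using False by (simp add: tendsto_eventually)
qed

locale cid_directed = cid_setting M G X \<kappa> for M :: "'a measure" and G X \<kappa> +
  fixes \<alpha> :: "'a \<Rightarrow> real measure"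
  assumes dir: "directing_measure M G X \<alpha>"
begin

definition F :: "real \<Rightarrow> 'a \<Rightarrow> real" where "F t \<omega> = measure (\<alpha> \<omega>) {..t}"

lemma alpha_meas: "\<alpha> \<in> M \<rightarrow>\<^sub>M prob_algebra borel"
  using dir by (simp add: directing_measure_def)

lemma F_M [measurable]: "F t \<in> borel_measurable M"
  unfolding F_def
  by (rule measurable_compose[OF measurable_prob_algebraD[OF alpha_meas] measurable_measure_subprob_algebra]) simp

lemma alpha_space:
  assumes "\<omega> \<in> space M" shows "prob_space (\<alpha> \<omega>)" "sets (\<alpha> \<omega>) = sets borel"
  using measurable_space[OF alpha_meas assms] by (auto simp: space_prob_algebra)

lemma F_range: assumes "\<omega> \<in> space M" shows "0 \<le> F t \<omega>" "F t \<omega> \<le> 1"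
  using prob_space.prob_le_1[OF alpha_space(1)[OF assms]] by (auto simp: F_def)

lemma integral_alpha_M: "f \<in> borel_measurable borel \<Longrightarrow> (\<lambda>\<omega>. \<integral>x. (f x :: real) \<partial>\<alpha> \<omega>) \<in> borel_measurable M"
  by (rule measurable_compose[OF measurable_prob_algebraD[OF alpha_meas] integral_measurable_subprob_algebra])

lemma integral_alpha_bdd:
  assumes "\<omega> \<in> space M" "\<And>x. \<bar>f x\<bar> \<le> (1::real)" shows "\<bar>\<integral>x. f x \<partial>\<alpha> \<omega>\<bar> \<le> 1"
proof -
  interpret A: prob_space "\<alpha> \<omega>" by (rule alpha_space(1)[OF assms(1)])
  show ?thesis
  proof (cases "integrable (\<alpha> \<omega>) f")
    case True
    have "\<bar>\<integral>x. f x \<partial>\<alpha> \<omega>\<bar> \<le> (\<integral>x. \<bar>f x\<bar> \<partial>\<alpha> \<omega>)" by (rule integral_abs_bound)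
    also have "\<dots> \<le> (\<integral>x. 1 \<partial>\<alpha> \<omega>)" by (rule integral_mono) (use True assms(2) in auto)
    finally show ?thesis by (simp add: A.prob_space)
  qed (simp add: not_integrable_integral_eq)
qed

lemma integral_ramp_bdd: "\<omega> \<in> space M \<Longrightarrow> \<bar>\<integral>x. ramp t j x \<partial>\<alpha> \<omega>\<bar> \<le> 1"
  by (rule integral_alpha_bdd[where f="ramp t j"]) (auto intro: ramp_bdd)

lemma cond_exp_bdd:
  assumes f: "f \<in> borel_measurable borel" "\<And>x. \<bar>f x\<bar> \<le> (1::real)"
  shows "AE \<omega> in M. \<bar>real_cond_exp M (G k) (\<lambda>\<omega>. f (X (Suc k) \<omega>)) \<omega>\<bar> \<le> 1"
proof -
  interpret S: sigma_finite_subalgebra M "G k" by (rule sigma_finite_sub)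
  note [measurable] = f(1)
  have i: "integrable M (\<lambda>\<omega>. f (X (Suc k) \<omega>))" by (rule integrable_boundedI[where B=1]) (use f(2) in auto)
  have "AE \<omega> in M. real_cond_exp M (G k) (\<lambda>\<omega>. f (X (Suc k) \<omega>)) \<omega> \<le> 1"
    by (rule S.real_cond_exp_le_c[OF i]) (use f(2) in \<open>auto simp: abs_le_iff\<close>)
  moreover have "AE \<omega> in M. real_cond_exp M (G k) (\<lambda>\<omega>. f (X (Suc k) \<omega>)) \<omega> \<ge> -1"
    by (rule S.real_cond_exp_ge_c[OF i]) (use f(2) in \<open>auto simp: abs_le_iff minus_le_iff\<close>)
  ultimately show ?thesis by eventually_elim auto
qed

lemma cond_exp_tendsto:
  assumes f: "continuous_on UNIV f" "\<And>x. \<bar>f x\<bar> \<le> (1::real)"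
  shows "AE \<omega> in M. (\<lambda>k. real_cond_exp M (G k) (\<lambda>\<omega>. f (X (Suc k) \<omega>)) \<omega>) \<longlonglongrightarrow> (\<integral>x. f x \<partial>\<alpha> \<omega>)"
proof -
  have "bounded (range f)" using f(2) by (auto simp: bounded_iff)
  then show ?thesis using dir f(1) by (simp add: directing_measure_def)
qed

text \<open>From time \<open>n\<close> on, the integrals of the conditional expectations against
  \<open>w\<close> are constant by the c.i.d. property. Dominated convergence identifies their limit
  with the integral for the directing measure.\<close>

lemma integral_alpha_test:
  assumes f: "continuous_on UNIV f" "\<And>x. \<bar>f x\<bar> \<le> (1::real)"
    and w: "w \<in> borel_measurable (G n)" "\<And>\<omega>. \<omega> \<in> space M \<Longrightarrow> \<bar>w \<omega>\<bar> \<le> (B::real)"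
  shows "(\<integral>\<omega>. w \<omega> * (\<integral>x. f x \<partial>\<alpha> \<omega>) \<partial>M) = (\<integral>\<omega>. w \<omega> * f (X (Suc n) \<omega>) \<partial>M)"
proof -
  have fm: "f \<in> borel_measurable borel" by (rule borel_measurable_continuous_onI[OF f(1)])
  let ?\<Phi> = "\<lambda>k. real_cond_exp M (G k) (\<lambda>\<omega>. f (X (Suc k) \<omega>))"
  note [measurable] = meas_G_M[OF w(1)] integral_alpha_M[OF fm]
  have "(\<lambda>k. \<integral>\<omega>. w \<omega> * ?\<Phi> k \<omega> \<partial>M) \<longlonglongrightarrow> (\<integral>\<omega>. w \<omega> * (\<integral>x. f x \<partial>\<alpha> \<omega>) \<partial>M)"
  proof (rule integral_dominated_convergence[where w="\<lambda>_. B"])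
    show "AE \<omega> in M. (\<lambda>k. w \<omega> * ?\<Phi> k \<omega>) \<longlonglongrightarrow> w \<omega> * (\<integral>x. f x \<partial>\<alpha> \<omega>)"
      using cond_exp_tendsto[OF f] by eventually_elim (intro tendsto_mult tendsto_const)
    show "AE \<omega> in M. norm (w \<omega> * ?\<Phi> k \<omega>) \<le> B" for k
      using cond_exp_bdd[OF fm f(2), of k] AE_space
    proof eventually_elim
      case (elim \<omega>)
      have "\<bar>w \<omega>\<bar> * \<bar>?\<Phi> k \<omega>\<bar> \<le> B * 1"
        using elim(1) w(2)[OF elim(2)] by (intro mult_mono) auto
      then show ?case by (simp add: abs_mult)
    qed
  qed auto
  moreover have "\<forall>\<^sub>F k in sequentially. (\<integral>\<omega>. w \<omega> * ?\<Phi> k \<omega> \<partial>M) = (\<integral>\<omega>. w \<omega> * f (X (Suc n) \<omega>) \<partial>M)"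
    using eventually_ge_at_top[of n]
  proof eventually_elim
    case (elim k)
    have "(\<integral>\<omega>. w \<omega> * ?\<Phi> k \<omega> \<partial>M) = (\<integral>\<omega>. w \<omega> * f (X (Suc k) \<omega>) \<partial>M)"
      by (rule cond_exp_test[OF fm f(2) meas_G_mono[OF w(1) elim] w(2)])
    also have "\<dots> = (\<integral>\<omega>. w \<omega> * f (X (Suc n) \<omega>) \<partial>M)" by (rule cid_test[OF fm f(2) w elim])
    finally show ?case .
  qed
  then have "(\<lambda>k. \<integral>\<omega>. w \<omega> * ?\<Phi> k \<omega> \<partial>M) \<longlonglongrightarrow> (\<integral>\<omega>. w \<omega> * f (X (Suc n) \<omega>) \<partial>M)" by (rule tendsto_eventually)
  ultimately show ?thesis by (rule LIMSEQ_unique)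
qed

lemma ramp_alpha_tendsto:
  assumes "\<omega> \<in> space M" shows "(\<lambda>j. \<integral>x. ramp t j x \<partial>\<alpha> \<omega>) \<longlonglongrightarrow> F t \<omega>"
proof -
  interpret A: prob_space "\<alpha> \<omega>" by (rule alpha_space(1)[OF assms])
  note s = alpha_space(2)[OF assms]
  have "(\<lambda>j. \<integral>x. ramp t j x \<partial>\<alpha> \<omega>) \<longlonglongrightarrow> (\<integral>x. indicator {..t} x \<partial>\<alpha> \<omega>)"
  proof (rule integral_dominated_convergence[where w="\<lambda>_. 1"])
    show "ramp t j \<in> borel_measurable (\<alpha> \<omega>)" for j
      using ramp_measurable s by (simp cong: measurable_cong_sets)
    show "(indicator {..t} :: real \<Rightarrow> real) \<in> borel_measurable (\<alpha> \<omega>)"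
      by (intro borel_measurable_indicator) (simp add: s)
  qed (use ramp_tendsto ramp_bdd in auto)
  moreover have "(\<integral>x. indicator {..t} x \<partial>\<alpha> \<omega>) = F t \<omega>"
    by (simp add: F_def s)
  ultimately show ?thesis by simp
qed

text \<open>\<open>V n t\<close> acts as the conditional expectation of \<open>F t\<close> given
  \<open>G n\<close>. For ramps this is \<open>integral_alpha_test\<close>, and both sides pass to
  the indicator by dominated convergence.\<close>

lemma F_test:
  assumes w: "w \<in> borel_measurable (G n)" "\<And>\<omega>. \<omega> \<in> space M \<Longrightarrow> \<bar>w \<omega>\<bar> \<le> (B::real)"
  shows "(\<integral>\<omega>. w \<omega> * F t \<omega> \<partial>M) = (\<integral>\<omega>. w \<omega> * V n t \<omega> \<partial>M)"
proof -
  note [measurable] = meas_G_M[OF w(1)] integral_alpha_M[OF ramp_measurable]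
  have wb: "\<bar>w \<omega> * y\<bar> \<le> B" if "\<omega> \<in> space M" "\<bar>y\<bar> \<le> 1" for \<omega> y
  proof -
    have "\<bar>w \<omega>\<bar> * \<bar>y\<bar> \<le> B * 1" using w(2)[OF that(1)] that(2) by (intro mult_mono) auto
    then show ?thesis by (simp add: abs_mult)
  qed
  have "(\<lambda>j. \<integral>\<omega>. w \<omega> * (\<integral>x. ramp t j x \<partial>\<alpha> \<omega>) \<partial>M) \<longlonglongrightarrow> (\<integral>\<omega>. w \<omega> * F t \<omega> \<partial>M)"
  proof (rule integral_dominated_convergence[where w="\<lambda>_. B"])
    show "AE \<omega> in M. (\<lambda>j. w \<omega> * (\<integral>x. ramp t j x \<partial>\<alpha> \<omega>)) \<longlonglongrightarrow> w \<omega> * F t \<omega>"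
      by (intro AE_I2 tendsto_mult tendsto_const ramp_alpha_tendsto)
    show "AE \<omega> in M. norm (w \<omega> * (\<integral>x. ramp t j x \<partial>\<alpha> \<omega>)) \<le> B" for j
      by (intro AE_I2) (simp add: wb integral_ramp_bdd)
  qed auto
  moreover have "(\<lambda>j. \<integral>\<omega>. w \<omega> * ramp t j (X (Suc n) \<omega>) \<partial>M) \<longlonglongrightarrow> (\<integral>\<omega>. w \<omega> * ind n t \<omega> \<partial>M)"
  proof (rule integral_dominated_convergence[where w="\<lambda>_. B"])
    show "AE \<omega> in M. (\<lambda>j. w \<omega> * ramp t j (X (Suc n) \<omega>)) \<longlonglongrightarrow> w \<omega> * ind n t \<omega>"
      unfolding ind_def by (intro AE_I2 tendsto_mult tendsto_const ramp_tendsto)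
    show "AE \<omega> in M. norm (w \<omega> * ramp t j (X (Suc n) \<omega>)) \<le> B" for j
      by (intro AE_I2) (simp add: wb ramp_bdd)
  qed auto
  moreover have "(\<integral>\<omega>. w \<omega> * (\<integral>x. ramp t j x \<partial>\<alpha> \<omega>) \<partial>M) = (\<integral>\<omega>. w \<omega> * ramp t j (X (Suc n) \<omega>) \<partial>M)" for j
    by (rule integral_alpha_test[OF ramp_continuous ramp_bdd w])
  ultimately have "(\<integral>\<omega>. w \<omega> * F t \<omega> \<partial>M) = (\<integral>\<omega>. w \<omega> * ind n t \<omega> \<partial>M)"
    using LIMSEQ_unique by (simp only:)
  then show ?thesis using V_test[OF w] by simp
qed

text \<open>Two approximations in the mean: the indicator by a ramp, and the integral of that ramp
  by its conditional expectation at a late time, which is measurable at that time.\<close>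

lemma F_approx:
  assumes \<epsilon>: "0 < (\<epsilon>::real)"
  obtains m Y where "Y \<in> borel_measurable (G m)" "integrable M Y" "(\<integral>\<omega>. \<bar>F t \<omega> - Y \<omega>\<bar> \<partial>M) < \<epsilon>"
proof -
  note [measurable] = integral_alpha_M[OF ramp_measurable]
  have iF: "integrable M (F t)" by (rule integrable_boundedI[where B=1]) (use F_range in auto)
  have iR: "integrable M (\<lambda>\<omega>. \<integral>x. ramp t j x \<partial>\<alpha> \<omega>)" for j
    by (rule integrable_boundedI[where B=1]) (use integral_ramp_bdd in auto)
  have "(\<lambda>j. \<integral>\<omega>. \<bar>F t \<omega> - (\<integral>x. ramp t j x \<partial>\<alpha> \<omega>)\<bar> \<partial>M) \<longlonglongrightarrow> (\<integral>\<omega>. 0 \<partial>M)"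
  proof (rule integral_dominated_convergence[where w="\<lambda>_. 2"])
    show "AE \<omega> in M. (\<lambda>j. \<bar>F t \<omega> - (\<integral>x. ramp t j x \<partial>\<alpha> \<omega>)\<bar>) \<longlonglongrightarrow> 0"
    proof (rule AE_I2)
      fix \<omega> assume "\<omega> \<in> space M"
      have "(\<lambda>j. \<bar>F t \<omega> - (\<integral>x. ramp t j x \<partial>\<alpha> \<omega>)\<bar>) \<longlonglongrightarrow> \<bar>F t \<omega> - F t \<omega>\<bar>"
        by (intro tendsto_rabs tendsto_diff tendsto_const ramp_alpha_tendsto[OF \<open>\<omega> \<in> space M\<close>])
      then show "(\<lambda>j. \<bar>F t \<omega> - (\<integral>x. ramp t j x \<partial>\<alpha> \<omega>)\<bar>) \<longlonglongrightarrow> 0" by simp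
    qed
    show "AE \<omega> in M. norm \<bar>F t \<omega> - (\<integral>x. ramp t j x \<partial>\<alpha> \<omega>)\<bar> \<le> 2" for j
    proof (rule AE_I2)
      fix \<omega> assume "\<omega> \<in> space M"
      then show "norm \<bar>F t \<omega> - (\<integral>x. ramp t j x \<partial>\<alpha> \<omega>)\<bar> \<le> 2"
        using F_range[OF \<open>\<omega> \<in> space M\<close>, of t] integral_ramp_bdd[OF \<open>\<omega> \<in> space M\<close>, of t j] unfolding real_norm_def by linarith
    qed
  qed auto
  then have "\<forall>\<^sub>F j in sequentially. (\<integral>\<omega>. \<bar>F t \<omega> - (\<integral>x. ramp t j x \<partial>\<alpha> \<omega>)\<bar> \<partial>M) < \<epsilon> / 2"
    using \<epsilon> by (intro order_tendstoD(2)) auto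
  then obtain j where j: "(\<integral>\<omega>. \<bar>F t \<omega> - (\<integral>x. ramp t j x \<partial>\<alpha> \<omega>)\<bar> \<partial>M) < \<epsilon> / 2"
    by (auto simp: eventually_sequentially)
  let ?\<Phi> = "\<lambda>k. real_cond_exp M (G k) (\<lambda>\<omega>. ramp t j (X (Suc k) \<omega>))"
  have "(\<lambda>k. \<integral>\<omega>. \<bar>(\<integral>x. ramp t j x \<partial>\<alpha> \<omega>) - ?\<Phi> k \<omega>\<bar> \<partial>M) \<longlonglongrightarrow> (\<integral>\<omega>. 0 \<partial>M)"
  proof (rule integral_dominated_convergence[where w="\<lambda>_. 2"])
    show "AE \<omega> in M. (\<lambda>k. \<bar>(\<integral>x. ramp t j x \<partial>\<alpha> \<omega>) - ?\<Phi> k \<omega>\<bar>) \<longlonglongrightarrow> 0"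
      using cond_exp_tendsto[OF ramp_continuous[of _ t j] ramp_bdd[of t j]]
    proof eventually_elim
      case (elim \<omega>)
      have "(\<lambda>k. \<bar>(\<integral>x. ramp t j x \<partial>\<alpha> \<omega>) - ?\<Phi> k \<omega>\<bar>) \<longlonglongrightarrow> \<bar>(\<integral>x. ramp t j x \<partial>\<alpha> \<omega>) - (\<integral>x. ramp t j x \<partial>\<alpha> \<omega>)\<bar>"
        by (intro tendsto_rabs tendsto_diff tendsto_const elim)
      then show ?case by simp
    qed
    show "AE \<omega> in M. norm \<bar>(\<integral>x. ramp t j x \<partial>\<alpha> \<omega>) - ?\<Phi> k \<omega>\<bar> \<le> 2" for k
      using cond_exp_bdd[OF ramp_measurable[of t j] ramp_bdd[of t j], of k] AE_space
    proof eventually_elim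
      case (elim \<omega>)
      then show ?case
        using integral_ramp_bdd[OF elim(2), of t j] unfolding real_norm_def by linarith
    qed
  qed auto
  then have "\<forall>\<^sub>F k in sequentially. (\<integral>\<omega>. \<bar>(\<integral>x. ramp t j x \<partial>\<alpha> \<omega>) - ?\<Phi> k \<omega>\<bar> \<partial>M) < \<epsilon> / 2"
    using \<epsilon> by (intro order_tendstoD(2)) auto
  then obtain k where k: "(\<integral>\<omega>. \<bar>(\<integral>x. ramp t j x \<partial>\<alpha> \<omega>) - ?\<Phi> k \<omega>\<bar> \<partial>M) < \<epsilon> / 2"
    by (auto simp: eventually_sequentially)
  have i\<Phi>: "integrable M (?\<Phi> k)"
    by (rule integrable_const_bound[where B=1]) (use cond_exp_bdd[OF ramp_measurable[of t j] ramp_bdd[of t j], of k] in auto)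
  show thesis
  proof (rule that[of "?\<Phi> k" k])
    show "?\<Phi> k \<in> borel_measurable (G k)" by (rule borel_measurable_cond_exp)
    have "(\<integral>\<omega>. \<bar>F t \<omega> - ?\<Phi> k \<omega>\<bar> \<partial>M)
      \<le> (\<integral>\<omega>. \<bar>F t \<omega> - (\<integral>x. ramp t j x \<partial>\<alpha> \<omega>)\<bar> + \<bar>(\<integral>x. ramp t j x \<partial>\<alpha> \<omega>) - ?\<Phi> k \<omega>\<bar> \<partial>M)"
      by (rule integral_mono) (use iF iR i\<Phi> in auto)
    also have "\<dots> = (\<integral>\<omega>. \<bar>F t \<omega> - (\<integral>x. ramp t j x \<partial>\<alpha> \<omega>)\<bar> \<partial>M) + (\<integral>\<omega>. \<bar>(\<integral>x. ramp t j x \<partial>\<alpha> \<omega>) - ?\<Phi> k \<omega>\<bar> \<partial>M)"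
      using iF iR i\<Phi> by simp
    finally show "(\<integral>\<omega>. \<bar>F t \<omega> - ?\<Phi> k \<omega>\<bar> \<partial>M) < \<epsilon>" using j k by linarith
  qed (rule i\<Phi>)
qed

text \<open>Since \<open>V n t\<close> is the conditional expectation of \<open>F t\<close>, testing against the sign of
  \<open>V n t - Y\<close> bounds \<open>V n t - F t\<close> by twice the distance from \<open>F t\<close> to a variable \<open>Y\<close> measurable at
  a finite time; no martingale convergence theorem is needed.\<close>

lemma V_L1: "L1_null M (\<lambda>n \<omega>. V n t \<omega> - F t \<omega>)"
proof -
  have iF: "integrable M (F t)" by (rule integrable_boundedI[where B=1]) (use F_range in auto)
  have iV: "integrable M (V n t)" for n by (rule integrable_boundedI[where B=1]) (use V_nonneg V_le_1 in auto)
  have "(\<lambda>n. \<integral>\<omega>. \<bar>V n t \<omega> - F t \<omega>\<bar> \<partial>M) \<longlonglongrightarrow> 0"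
  proof (rule tendstoI)
    fix e :: real assume e: "0 < e"
    obtain m Y where Y: "Y \<in> borel_measurable (G m)" "integrable M Y" "(\<integral>\<omega>. \<bar>F t \<omega> - Y \<omega>\<bar> \<partial>M) < e / 2"
      by (rule F_approx[of "e / 2" t]) (use e in simp, blast)
    show "\<forall>\<^sub>F n in sequentially. dist (\<integral>\<omega>. \<bar>V n t \<omega> - F t \<omega>\<bar> \<partial>M) 0 < e"
      using eventually_ge_at_top[of m]
    proof eventually_elim
      case (elim n)
      define w where "w = (\<lambda>\<omega>. sgn (V n t \<omega> - Y \<omega>))"
      have w: "w \<in> borel_measurable (G n)" "\<bar>w \<omega>\<bar> \<le> 1" for \<omega>
        using V_meas[of n t] meas_G_mono[OF Y(1) elim] unfolding w_def by (auto simp: sgn_real_def)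
      note [measurable] = meas_G_M[OF w(1)] meas_G_M[OF Y(1)]
      have iw: "integrable M (\<lambda>\<omega>. w \<omega> * g \<omega>)" if "integrable M g" for g
      proof (rule Bochner_Integration.integrable_bound[OF that])
        show "(\<lambda>\<omega>. w \<omega> * g \<omega>) \<in> borel_measurable M" using that by simp
        show "AE \<omega> in M. norm (w \<omega> * g \<omega>) \<le> norm (g \<omega>)"
          using w(2) by (auto simp: abs_mult intro!: mult_left_le_one_le)
      qed
      have "(\<integral>\<omega>. \<bar>V n t \<omega> - Y \<omega>\<bar> \<partial>M) = (\<integral>\<omega>. w \<omega> * V n t \<omega> - w \<omega> * Y \<omega> \<partial>M)"
        by (intro Bochner_Integration.integral_cong) (auto simp: w_def abs_sgn algebra_simps)
      also have "\<dots> = (\<integral>\<omega>. w \<omega> * F t \<omega> \<partial>M) - (\<integral>\<omega>. w \<omega> * Y \<omega> \<partial>M)"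
        using iw[OF iV] iw[OF Y(2)] F_test[OF w] by simp
      also have "\<dots> = (\<integral>\<omega>. w \<omega> * (F t \<omega> - Y \<omega>) \<partial>M)"
        using iw[OF iF] iw[OF Y(2)] by (simp add: right_diff_distrib)
      also have "\<dots> \<le> (\<integral>\<omega>. \<bar>F t \<omega> - Y \<omega>\<bar> \<partial>M)"
      proof (rule integral_mono)
        show "w \<omega> * (F t \<omega> - Y \<omega>) \<le> \<bar>F t \<omega> - Y \<omega>\<bar>" for \<omega>
          by (rule order_trans[OF abs_ge_self]) (use w(2)[of \<omega>] in \<open>simp add: abs_mult mult_left_le_one_le\<close>)
      qed (use iw iF Y(2) in auto)
      finally have 1: "(\<integral>\<omega>. \<bar>V n t \<omega> - Y \<omega>\<bar> \<partial>M) < e / 2" using Y(3) by simp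
      have "(\<integral>\<omega>. \<bar>V n t \<omega> - F t \<omega>\<bar> \<partial>M) \<le> (\<integral>\<omega>. \<bar>V n t \<omega> - Y \<omega>\<bar> + \<bar>F t \<omega> - Y \<omega>\<bar> \<partial>M)"
        by (rule integral_mono) (use iV iF Y(2) in auto)
      also have "\<dots> = (\<integral>\<omega>. \<bar>V n t \<omega> - Y \<omega>\<bar> \<partial>M) + (\<integral>\<omega>. \<bar>F t \<omega> - Y \<omega>\<bar> \<partial>M)" using iV iF Y(2) by simp
      finally have "(\<integral>\<omega>. \<bar>V n t \<omega> - F t \<omega>\<bar> \<partial>M) < e" using 1 Y(3) by linarith
      moreover have "0 \<le> (\<integral>\<omega>. \<bar>V n t \<omega> - F t \<omega>\<bar> \<partial>M)" by (rule integral_nonneg_AE) simp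
      ultimately show ?case by simp
    qed
  qed
  with iV iF show ?thesis by (simp add: L1_null_def)
qed

text \<open>The innovation of the indicator, a martingale difference bounded by 1, whereas the bound
  on \<open>q k\<close> grows with \<open>k\<close>.\<close>

definition D :: "nat \<Rightarrow> real \<Rightarrow> 'a \<Rightarrow> real" where "D k t \<omega> = ind k t \<omega> - V k t \<omega>"

lemma D_M [measurable]: "D k t \<in> borel_measurable M" unfolding D_def by measurable

lemma D_bdd: "\<omega> \<in> space M \<Longrightarrow> \<bar>D k t \<omega>\<bar> \<le> 1"
  using ind_range[of k t \<omega>] V_nonneg[of k t \<omega>] V_le_1[of \<omega> k t] by (simp add: D_def abs_le_iff)

text \<open>A weight known at time \<open>k\<close> keeps \<open>D k t\<close> a martingale
  difference bounded by 1, so the law of large numbers above applies.\<close>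

lemma D_mean_L1:
  assumes W: "\<And>k. W k \<in> borel_measurable (G k)" "\<And>k \<omega>. \<omega> \<in> space M \<Longrightarrow> \<bar>W k \<omega>\<bar> \<le> (1::real)"
  shows "L1_null M (\<lambda>n \<omega>. (\<Sum>k<n. D k t \<omega> * W k \<omega>) / real n)"
proof -
  interpret B: bounded_mart_diff M G "\<lambda>k \<omega>. D k t \<omega> * W k \<omega>" "\<lambda>_. 1"
  proof (unfold_locales, rule sub, rule G_mono, assumption)
    fix k
    note [measurable] = ind_meas[of k t] meas_G_mono[OF V_meas[of k t], of "Suc k"] meas_G_mono[OF W(1)[of k], of "Suc k"]
    show "(\<lambda>\<omega>. D k t \<omega> * W k \<omega>) \<in> borel_measurable (G (Suc k))" unfolding D_def by measurable
    show b: "\<bar>D k t \<omega> * W k \<omega>\<bar> \<le> 1" if "\<omega> \<in> space M" for \<omega>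
      unfolding abs_mult using D_bdd[OF that, of k t] W(2)[OF that, of k] by (intro mult_le_one) auto
    fix w and B :: real assume w: "w \<in> borel_measurable (G k)" "\<And>\<omega>. \<omega> \<in> space M \<Longrightarrow> \<bar>w \<omega>\<bar> \<le> B"
    let ?w = "\<lambda>\<omega>. W k \<omega> * w \<omega>"
    have wm: "?w \<in> borel_measurable (G k)" using W(1) w(1) by measurable
    have wb: "\<bar>?w \<omega>\<bar> \<le> B" if "\<omega> \<in> space M" for \<omega>
    proof -
      have "\<bar>W k \<omega>\<bar> * \<bar>w \<omega>\<bar> \<le> 1 * B" using W(2)[OF that] w(2)[OF that] by (intro mult_mono) auto
      then show ?thesis by (simp add: abs_mult)
    qed
    have i: "integrable M (\<lambda>\<omega>. ?w \<omega> * ind k t \<omega>)" "integrable M (\<lambda>\<omega>. ?w \<omega> * V k t \<omega>)"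
      by (rule mult_integrable[OF meas_G_M[OF wm] _ wb, where B=1]; use ind_range V_nonneg V_le_1 in auto)+
    have "(\<integral>\<omega>. D k t \<omega> * W k \<omega> * w \<omega> \<partial>M) = (\<integral>\<omega>. ?w \<omega> * ind k t \<omega> - ?w \<omega> * V k t \<omega> \<partial>M)"
      by (intro Bochner_Integration.integral_cong) (auto simp: D_def algebra_simps)
    also have "\<dots> = 0" using i V_test[OF wm wb] by simp
    finally show "(\<integral>\<omega>. D k t \<omega> * W k \<omega> * w \<omega> \<partial>M) = 0" .
  qed
  show ?thesis by (rule B.L1_null_mean_mart_diff) simp
qed

text \<open>Since \<open>ind k s * ind k t = ind k (min s t)\<close>, the product
  \<open>D k s * D k t\<close> is a sum of three weighted innovations plus
  \<open>V k (min s t) - V k s * V k t\<close>. The former have null means; the latter converges in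
  the mean to the covariance. At n = 0 the mean is 0 by convention, so the limit is removed
  there.\<close>

lemma covariation_L1:
  "L1_null M (\<lambda>n \<omega>. (\<Sum>k<n. D k s \<omega> * D k t \<omega>) / real n - (if n = 0 then 0 else F (min s t) \<omega> - F s \<omega> * F t \<omega>))"
proof -
  let ?m = "min s t"
  have VV: "L1_null M (\<lambda>n \<omega>. V n s \<omega> * V n t \<omega> - F s \<omega> * F t \<omega>)"
  proof (rule L1_null_dominated)
    have a: "L1_null M (\<lambda>n \<omega>. \<bar>V n s \<omega> - F s \<omega>\<bar>)" "L1_null M (\<lambda>n \<omega>. \<bar>V n t \<omega> - F t \<omega>\<bar>)"
      using V_L1[of s] V_L1[of t] by (simp_all add: L1_null_def)
    show "L1_null M (\<lambda>n \<omega>. \<bar>V n s \<omega> - F s \<omega>\<bar> + \<bar>V n t \<omega> - F t \<omega>\<bar>)" by (rule L1_null_add[OF a])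
    fix n \<omega> assume \<omega>: "\<omega> \<in> space M"
    have "V n s \<omega> * V n t \<omega> - F s \<omega> * F t \<omega> = (V n s \<omega> - F s \<omega>) * V n t \<omega> + F s \<omega> * (V n t \<omega> - F t \<omega>)"
      by (simp add: algebra_simps)
    then have "\<bar>V n s \<omega> * V n t \<omega> - F s \<omega> * F t \<omega>\<bar>
      \<le> \<bar>V n s \<omega> - F s \<omega>\<bar> * \<bar>V n t \<omega>\<bar> + \<bar>F s \<omega>\<bar> * \<bar>V n t \<omega> - F t \<omega>\<bar>"
      by (metis abs_mult abs_triangle_ineq)
    also have "\<dots> \<le> \<bar>V n s \<omega> - F s \<omega>\<bar> * 1 + 1 * \<bar>V n t \<omega> - F t \<omega>\<bar>"
      using V_nonneg[of n t \<omega>] V_le_1[OF \<omega>, of n t] F_range[OF \<omega>, of s]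
      by (intro add_mono mult_left_mono mult_right_mono) auto
    finally show "\<bar>V n s \<omega> * V n t \<omega> - F s \<omega> * F t \<omega>\<bar> \<le> \<bar>\<bar>V n s \<omega> - F s \<omega>\<bar> + \<bar>V n t \<omega> - F t \<omega>\<bar>\<bar>" by simp
  qed measurable
  have Vb: "\<bar>V k x \<omega>\<bar> \<le> 1" if "\<omega> \<in> space M" for k x \<omega> using V_nonneg[of k x \<omega>] V_le_1[OF that, of k x] by simp
  note Z1 = D_mean_L1[where t="?m" and W="\<lambda>_ _. 1"]
  note Z2 = D_mean_L1[where t=s and W="\<lambda>k. V k t", OF V_meas Vb]
  note Z3 = D_mean_L1[where t=t and W="\<lambda>k. V k s", OF V_meas Vb]
  have all: "L1_null M (\<lambda>n \<omega>. ((\<Sum>k<n. D k ?m \<omega> * 1) / real n - (\<Sum>k<n. D k s \<omega> * V k t \<omega>) / real n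
      - (\<Sum>k<n. D k t \<omega> * V k s \<omega>) / real n) + ((\<Sum>k<n. V k ?m \<omega> - F ?m \<omega>) / real n
      - (\<Sum>k<n. V k s \<omega> * V k t \<omega> - F s \<omega> * F t \<omega>) / real n))"
    by (intro L1_null_add L1_null_diff Z1 Z2 Z3 L1_null_mean V_L1 VV) auto
  have ii: "ind k s \<omega> * ind k t \<omega> = ind k ?m \<omega>" for k \<omega> by (auto simp: ind_def indicator_def)
  have eq: "(\<Sum>k<n. D k s \<omega> * D k t \<omega>) = (\<Sum>k<n. D k ?m \<omega> * 1) - (\<Sum>k<n. D k s \<omega> * V k t \<omega>)
      - (\<Sum>k<n. D k t \<omega> * V k s \<omega>) + ((\<Sum>k<n. V k ?m \<omega> - F ?m \<omega>)
      - (\<Sum>k<n. V k s \<omega> * V k t \<omega> - F s \<omega> * F t \<omega>)) + real n * (F ?m \<omega> - F s \<omega> * F t \<omega>)" for n \<omega>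
  proof (induction n)
    case (Suc n)
    have "D n s \<omega> * D n t \<omega> = D n ?m \<omega> * 1 - D n s \<omega> * V n t \<omega> - D n t \<omega> * V n s \<omega> + V n ?m \<omega> - V n s \<omega> * V n t \<omega>"
      by (simp add: D_def ii[symmetric] algebra_simps)
    then show ?case using Suc by (simp add: algebra_simps)
  qed simp
  show ?thesis
  proof (rule L1_null_dominated[OF all])
    fix n \<omega>
    show "\<bar>(\<Sum>k<n. D k s \<omega> * D k t \<omega>) / real n - (if n = 0 then 0 else F ?m \<omega> - F s \<omega> * F t \<omega>)\<bar>
      \<le> \<bar>((\<Sum>k<n. D k ?m \<omega> * 1) / real n - (\<Sum>k<n. D k s \<omega> * V k t \<omega>) / real n
      - (\<Sum>k<n. D k t \<omega> * V k s \<omega>) / real n) + ((\<Sum>k<n. V k ?m \<omega> - F ?m \<omega>) / real n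
      - (\<Sum>k<n. V k s \<omega> * V k t \<omega> - F s \<omega> * F t \<omega>) / real n)\<bar>"
      by (cases "n = 0") (simp_all add: eq add_divide_distrib diff_divide_distrib)
  qed measurable
qed

end

section \<open>Passing to almost surely convergent subsequences\<close>

lemma tendsto_if_subseq:
  fixes a :: "nat \<Rightarrow> 'b::metric_space"
  assumes "\<And>\<rho> :: nat \<Rightarrow> nat. strict_mono \<rho> \<Longrightarrow> \<exists>\<rho>'. strict_mono \<rho>' \<and> (\<lambda>n. a (\<rho> (\<rho>' n))) \<longlonglongrightarrow> l"
  shows "a \<longlonglongrightarrow> l"
proof (rule ccontr)
  assume "\<not> a \<longlonglongrightarrow> l"
  then obtain e where e: "0 < e" "\<not> (\<forall>\<^sub>F n in sequentially. dist (a n) l < e)"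
    unfolding tendsto_iff by blast
  then have "infinite {n. e \<le> dist (a n) l}"
    by (simp add: not_eventually frequently_cofinite not_less flip: cofinite_eq_sequentially)
  then obtain \<rho> :: "nat \<Rightarrow> nat" where \<rho>: "strict_mono \<rho>" "\<And>n. \<rho> n \<in> {n. e \<le> dist (a n) l}"
    using infinite_enumerate by blast
  obtain \<rho>' where "(\<lambda>n. a (\<rho> (\<rho>' n))) \<longlonglongrightarrow> l" using assms[OF \<rho>(1)] by blast
  then have "\<forall>\<^sub>F n in sequentially. dist (a (\<rho> (\<rho>' n))) l < e" using e(1) by (rule tendstoD)
  then obtain n where "dist (a (\<rho> (\<rho>' n))) l < e" by (auto simp: eventually_sequentially)
  then show False using \<rho>(2)[of "\<rho>' n"] by simp
qed

text \<open>Truncation at 1 turns convergence in probability into convergence in the mean, so that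
  it joins the other error terms and shares a subsequence with them.\<close>

lemma (in prob_space) converges_in_prob_imp_L1_null:
  assumes Y: "converges_in_prob_to_0 M Y" and m [measurable]: "\<And>n. Y n \<in> borel_measurable M"
  shows "L1_null M (\<lambda>n \<omega>. min 1 \<bar>Y n \<omega>\<bar>)"
proof -
  have i: "integrable M (\<lambda>\<omega>. min 1 \<bar>Y n \<omega>\<bar>)" for n
    by (rule integrable_boundedI[where B=1]) auto
  have "(\<lambda>n. \<integral>\<omega>. \<bar>min 1 \<bar>Y n \<omega>\<bar>\<bar> \<partial>M) \<longlonglongrightarrow> 0"
  proof (rule tendstoI)
    fix e :: real assume e: "0 < e"
    have "0 < e / 2" using e by simp
    then have "(\<lambda>n. prob {\<omega> \<in> space M. \<bar>Y n \<omega>\<bar> > e / 2}) \<longlonglongrightarrow> 0"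
      using Y unfolding converges_in_prob_to_0_def by blast
    then have "\<forall>\<^sub>F n in sequentially. prob {\<omega> \<in> space M. \<bar>Y n \<omega>\<bar> > e / 2} < e / 2"
      using e by (intro order_tendstoD) auto
    then show "\<forall>\<^sub>F n in sequentially. dist (\<integral>\<omega>. \<bar>min 1 \<bar>Y n \<omega>\<bar>\<bar> \<partial>M) 0 < e"
    proof eventually_elim
      case (elim n)
      let ?A = "{\<omega> \<in> space M. \<bar>Y n \<omega>\<bar> > e / 2}"
      have "(\<integral>\<omega>. \<bar>min 1 \<bar>Y n \<omega>\<bar>\<bar> \<partial>M) \<le> (\<integral>\<omega>. e / 2 + indicator ?A \<omega> \<partial>M)"
      proof (rule integral_mono)
        show "\<bar>min 1 \<bar>Y n \<omega>\<bar>\<bar> \<le> e / 2 + indicator ?A \<omega>" if "\<omega> \<in> space M" for \<omega>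
          using e that by (auto simp: indicator_def)
      qed (use i in \<open>auto simp: emeasure_eq_measure\<close>)
      also have "\<dots> = e / 2 + prob ?A" by (simp add: emeasure_eq_measure prob_space)
      finally have "(\<integral>\<omega>. \<bar>min 1 \<bar>Y n \<omega>\<bar>\<bar> \<partial>M) < e" using elim by linarith
      moreover have "0 \<le> (\<integral>\<omega>. \<bar>min 1 \<bar>Y n \<omega>\<bar>\<bar> \<partial>M)" by (rule integral_nonneg_AE) simp
      ultimately show ?case by simp
    qed
  qed
  with i show ?thesis by (simp add: L1_null_def)
qed

locale cid_l2_directed = cid_l2 M G X \<kappa> + cid_directed M G X \<kappa> \<alpha> for M :: "'a measure" and G X \<kappa> \<alpha>
begin

definition bridge_cov :: "real \<Rightarrow> real \<Rightarrow> 'a \<Rightarrow> real" where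
  "bridge_cov s t \<omega> = F (min s t) \<omega> - F s \<omega> * F t \<omega>"

lemma bridge_cov_M [measurable]: "bridge_cov s t \<in> borel_measurable M"
  unfolding bridge_cov_def by measurable

text \<open>The part of \<open>q\<close> that is not an innovation:
  \<open>q k = D k - incr k\<close>. Almost everywhere, the hypothesis of (a) concerns the average
  of the squares of \<open>incr\<close>.\<close>

definition incr :: "nat \<Rightarrow> real \<Rightarrow> 'a \<Rightarrow> real" where
  "incr k t \<omega> = real (Suc k) * (V (Suc k) t \<omega> - V k t \<omega>)"

lemma u_eq: "u r b t k \<omega> = (\<Sum>j<r. b j * D k (t j) \<omega>) - (\<Sum>j<r. b j * incr k (t j) \<omega>)"
proof -
  have "q k s \<omega> = D k s \<omega> - incr k s \<omega>" for s by (simp add: q_def D_def incr_def algebra_simps)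
  then show ?thesis by (simp add: u_def right_diff_distrib sum_subtractf)
qed

text \<open>\<open>v\<close> collects the innovations and \<open>w\<close> the remaining parts. The
  quadratic mean of \<open>w\<close> vanishes, so the limit is that of \<open>v\<close>. For the
  maximum, \<open>v\<close> is bounded outright and each (w k)^2 is at most the whole sum of
  squares.\<close>

lemma u_path_limits:
  assumes \<omega>: "\<omega> \<in> space M" and N: "filterlim N at_top sequentially"
    and A: "\<And>j. j < r \<Longrightarrow> (\<lambda>n. (\<Sum>k<N n. (incr k (t j) \<omega>)\<^sup>2) / real (N n)) \<longlonglongrightarrow> 0"
    and B: "\<And>i j. i < r \<Longrightarrow> j < r \<Longrightarrow> (\<lambda>n. (\<Sum>k<N n. D k (t i) \<omega> * D k (t j) \<omega>) / real (N n)) \<longlonglongrightarrow> bridge_cov (t i) (t j) \<omega>"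
  shows "(\<lambda>n. (\<Sum>k<N n. (u r b t k \<omega>)\<^sup>2) / real (N n)) \<longlonglongrightarrow> (\<Sum>i<r. \<Sum>j<r. b i * b j * bridge_cov (t i) (t j) \<omega>)"
    and "0 < \<epsilon> \<Longrightarrow> \<forall>\<^sub>F n in sequentially. \<forall>k<N n. (u r b t k \<omega>)\<^sup>2 \<le> \<epsilon> * real (N n)"
proof -
  define v where "v = (\<lambda>k. \<Sum>j<r. b j * D k (t j) \<omega>)"
  define w where "w = (\<lambda>k. \<Sum>j<r. b j * incr k (t j) \<omega>)"
  have u: "u r b t k \<omega> = v k - w k" for k by (simp add: u_eq v_def w_def)
  have vlim: "(\<lambda>n. (\<Sum>k<N n. (v k)\<^sup>2) / real (N n)) \<longlonglongrightarrow> (\<Sum>i<r. \<Sum>j<r. b i * b j * bridge_cov (t i) (t j) \<omega>)"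
    unfolding v_def mean_combination_squared by (intro tendsto_sum tendsto_mult tendsto_const B) auto
  have wle: "(w k)\<^sup>2 \<le> real r * (\<Sum>j<r. (b j)\<^sup>2 * (incr k (t j) \<omega>)\<^sup>2)" for k
    using sum_squared_le_sum_of_squares[of "\<lambda>j. b j * incr k (t j) \<omega>" "{..<r}"]
    by (simp add: w_def power_mult_distrib mult.commute)
  have w2: "(\<Sum>k<n. (w k)\<^sup>2) / real n \<le> real r * (\<Sum>j<r. (b j)\<^sup>2 * ((\<Sum>k<n. (incr k (t j) \<omega>)\<^sup>2) / real n))" for n
  proof -
    have "(\<Sum>k<n. (w k)\<^sup>2) \<le> (\<Sum>k<n. real r * (\<Sum>j<r. (b j)\<^sup>2 * (incr k (t j) \<omega>)\<^sup>2))" by (intro sum_mono wle)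
    also have "\<dots> = real r * (\<Sum>k<n. \<Sum>j<r. (b j)\<^sup>2 * (incr k (t j) \<omega>)\<^sup>2)" by (simp only: sum_distrib_left)
    also have "(\<Sum>k<n. \<Sum>j<r. (b j)\<^sup>2 * (incr k (t j) \<omega>)\<^sup>2) = (\<Sum>j<r. (b j)\<^sup>2 * (\<Sum>k<n. (incr k (t j) \<omega>)\<^sup>2))"
      by (subst sum.swap) (simp only: sum_distrib_left)
    finally have "(\<Sum>k<n. (w k)\<^sup>2) / real n \<le> real r * (\<Sum>j<r. (b j)\<^sup>2 * (\<Sum>k<n. (incr k (t j) \<omega>)\<^sup>2)) / real n"
      by (rule divide_right_mono) simp
    also have "\<dots> = real r * (\<Sum>j<r. (b j)\<^sup>2 * ((\<Sum>k<n. (incr k (t j) \<omega>)\<^sup>2) / real n))"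
      by (simp only: sum_divide_distrib[where A="{..<r}"] times_divide_eq_right[symmetric])
    finally show ?thesis .
  qed
  have wlim: "(\<lambda>n. (\<Sum>k<N n. (w k)\<^sup>2) / real (N n)) \<longlonglongrightarrow> 0"
  proof (rule tendsto_sandwich[OF _ always_eventually[OF allI[OF w2]] tendsto_const])
    have "(\<lambda>n. real r * (\<Sum>j<r. (b j)\<^sup>2 * ((\<Sum>k<N n. (incr k (t j) \<omega>)\<^sup>2) / real (N n)))) \<longlonglongrightarrow> real r * (\<Sum>j<r. (b j)\<^sup>2 * 0)"
      by (intro tendsto_mult tendsto_const tendsto_sum A) simp
    then show "(\<lambda>n. real r * (\<Sum>j<r. (b j)\<^sup>2 * ((\<Sum>k<N n. (incr k (t j) \<omega>)\<^sup>2) / real (N n)))) \<longlonglongrightarrow> 0" by simp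
  qed (simp add: sum_nonneg)
  show "(\<lambda>n. (\<Sum>k<N n. (u r b t k \<omega>)\<^sup>2) / real (N n)) \<longlonglongrightarrow> (\<Sum>i<r. \<Sum>j<r. b i * b j * bridge_cov (t i) (t j) \<omega>)"
    unfolding u by (rule quadratic_mean_perturbation[OF N vlim wlim])
  assume \<epsilon>: "0 < \<epsilon>"
  define c where "c = (\<Sum>j<r. \<bar>b j\<bar>)\<^sup>2"
  have vle: "(v k)\<^sup>2 \<le> c" for k
  proof -
    have "\<bar>v k\<bar> \<le> (\<Sum>j<r. \<bar>b j * D k (t j) \<omega>\<bar>)" unfolding v_def by (rule sum_abs)
    also have "\<dots> \<le> (\<Sum>j<r. \<bar>b j\<bar>)"
      using D_bdd[OF \<omega>] by (intro sum_mono) (simp add: abs_mult mult_left_le)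
    finally have "\<bar>v k\<bar> \<le> (\<Sum>j<r. \<bar>b j\<bar>)" .
    from power_mono[OF this abs_ge_zero, of 2] show ?thesis by (simp add: c_def)
  qed
  \<comment> \<open>The constants fit (v - w)^2 \<le> 2 v^2 + 2 w^2, each term receiving half of
    \<epsilon> N. The summand 1 in the next bound keeps \<open>N n\<close> positive when c =
    0.\<close>
  have "\<forall>\<^sub>F n in sequentially. (\<Sum>k<N n. (w k)\<^sup>2) / real (N n) < \<epsilon> / 4"
    using wlim \<epsilon> by (intro order_tendstoD(2)) auto
  moreover have "\<forall>\<^sub>F n in sequentially. 4 * c / \<epsilon> + 1 \<le> real (N n)"
    using filterlim_compose[OF filterlim_real_sequentially N] by (simp add: filterlim_at_top)
  ultimately show "\<forall>\<^sub>F n in sequentially. \<forall>k<N n. (u r b t k \<omega>)\<^sup>2 \<le> \<epsilon> * real (N n)"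
  proof eventually_elim
    case (elim n)
    have c0: "0 \<le> 4 * c / \<epsilon>" using \<epsilon> by (simp add: c_def)
    with elim(2) have N1: "0 < real (N n)" by linarith
    have "4 * c / \<epsilon> \<le> real (N n)" using elim(2) by linarith
    then have cN: "4 * c \<le> \<epsilon> * real (N n)" using \<epsilon> by (simp add: divide_le_eq mult.commute)
    show ?case
    proof (intro allI impI)
      fix k assume k: "k < N n"
      have "(w k)\<^sup>2 \<le> (\<Sum>k<N n. (w k)\<^sup>2)" using k by (intro member_le_sum) auto
      also have "\<dots> \<le> \<epsilon> / 4 * real (N n)" using elim(1) N1 by (simp add: divide_less_eq)
      finally have w4: "4 * (w k)\<^sup>2 \<le> \<epsilon> * real (N n)" by simp
      have "(v k - w k)\<^sup>2 \<le> 2 * (v k)\<^sup>2 + 2 * (w k)\<^sup>2"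
        using zero_le_power2[of "v k + w k"] by (simp add: power2_sum power2_diff)
      then show "(u r b t k \<omega>)\<^sup>2 \<le> \<epsilon> * real (N n)" unfolding u using vle[of k] cN w4 by linarith
    qed
  qed
qed

text \<open>The limit does not depend on the subsequence, so it suffices to find, inside any
  subsequence, a further one along which all averages converge almost surely.\<close>

theorem fidi_limit_bridge:
  fixes t :: "nat \<Rightarrow> real"
  assumes hyp: "\<And>s. converges_in_prob_to_0 M (\<lambda>n \<omega>. 1 / real n * (\<Sum>k=1..n. (real k)\<^sup>2 *
              (cond_cdf M G X k s \<omega> - cond_cdf M G X (k - 1) s \<omega>)\<^sup>2))"
  shows "(\<lambda>n. \<integral>\<omega>. cos ((\<Sum>j<r. b j * path_of (empirical_process X \<kappa> n \<omega>) (t j)) + c) \<partial>M)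
      \<longlonglongrightarrow> (\<integral>\<omega>. exp (- (\<Sum>i<r. \<Sum>j<r. b i * b j * bridge_cov (t i) (t j) \<omega>) / 2) * cos c \<partial>M)"
proof (rule tendsto_if_subseq)
  fix \<rho> :: "nat \<Rightarrow> nat" assume \<rho>: "strict_mono \<rho>"
  define Y where "Y = (\<lambda>s n \<omega>. 1 / real n * (\<Sum>k=1..n. (real k)\<^sup>2 *
              (cond_cdf M G X k s \<omega> - cond_cdf M G X (k - 1) s \<omega>)\<^sup>2))"
  define C where "C = (\<lambda>s s' n \<omega>. (\<Sum>k<n. D k s \<omega> * D k s' \<omega>) / real n - (if n = 0 then 0 else bridge_cov s s' \<omega>))"
  have Ym: "Y s n \<in> borel_measurable M" for s n unfolding Y_def cond_cdf_def by measurable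
  \<comment> \<open>One sum of finitely many error terms, so that a single subsequence makes all of
    them vanish.\<close>
  define H where "H = (\<lambda>n \<omega>. (\<Sum>j<r. \<bar>min 1 \<bar>Y (t j) n \<omega>\<bar>\<bar>) + (\<Sum>i<r. \<bar>\<Sum>j<r. \<bar>C (t i) (t j) n \<omega>\<bar>\<bar>))"
  have l1: "L1_null M (\<lambda>n \<omega>. min 1 \<bar>Y (t j) n \<omega>\<bar>)" for j
    by (rule converges_in_prob_imp_L1_null[OF _ Ym]) (use hyp[of "t j"] in \<open>simp add: Y_def\<close>)
  have l2: "L1_null M (C (t i) (t j))" for i j
    using covariation_L1[of "t i" "t j"] by (simp add: C_def bridge_cov_def cong: if_cong)
  have "L1_null M H"
    unfolding H_def
    by (rule L1_null_add[OF L1_null_sum L1_null_sum[OF L1_null_sum]]) (rule l1 l2)+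
  from L1_null_subseq[OF this filterlim_subseq[OF \<rho>]]
  obtain \<rho>' :: "nat \<Rightarrow> nat" where \<rho>': "strict_mono \<rho>'" "AE \<omega> in M. (\<lambda>n. H (\<rho> (\<rho>' n)) \<omega>) \<longlonglongrightarrow> 0"
    by (rule L1_null_AE_subseq)
  define N where "N = (\<lambda>n. \<rho> (\<rho>' n))"
  have N: "filterlim N at_top sequentially"
    unfolding N_def by (rule filterlim_compose[OF filterlim_subseq[OF \<rho>] filterlim_subseq[OF \<rho>'(1)]])
  have "AE \<omega> in M. \<forall>j n. V n (t j) \<omega> = cond_cdf M G X n (t j) \<omega>"
    unfolding AE_all_countable using V_eq_cond_cdf by blast
  then have main: "AE \<omega> in M. (\<lambda>n. (\<Sum>k<N n. (u r b t k \<omega>)\<^sup>2) / real (N n)) \<longlonglongrightarrow> (\<Sum>i<r. \<Sum>j<r. b i * b j * bridge_cov (t i) (t j) \<omega>) \<and>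
      (\<forall>\<epsilon>>0. \<forall>\<^sub>F n in sequentially. \<forall>k<N n. (u r b t k \<omega>)\<^sup>2 \<le> \<epsilon> * real (N n))"
    using \<rho>'(2) AE_space
  proof eventually_elim
    case (elim \<omega>)
    have H0: "(\<lambda>n. H (N n) \<omega>) \<longlonglongrightarrow> 0" using elim(2) by (simp add: N_def)
    have YH: "\<bar>min 1 \<bar>Y (t j) n \<omega>\<bar>\<bar> \<le> H n \<omega>" if "j < r" for j n
    proof -
      have "\<bar>min 1 \<bar>Y (t j) n \<omega>\<bar>\<bar> \<le> (\<Sum>j<r. \<bar>min 1 \<bar>Y (t j) n \<omega>\<bar>\<bar>)"
        using that by (intro member_le_sum) auto
      also have "\<dots> \<le> H n \<omega>" unfolding H_def by (simp add: sum_nonneg)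
      finally show ?thesis .
    qed
    have CH: "\<bar>C (t i) (t j) n \<omega>\<bar> \<le> H n \<omega>" if "i < r" "j < r" for i j n
    proof -
      have "\<bar>C (t i) (t j) n \<omega>\<bar> \<le> (\<Sum>j<r. \<bar>C (t i) (t j) n \<omega>\<bar>)" using that by (intro member_le_sum) auto
      also have "\<dots> = \<bar>\<Sum>j<r. \<bar>C (t i) (t j) n \<omega>\<bar>\<bar>" by (simp add: sum_nonneg)
      also have "\<dots> \<le> (\<Sum>i<r. \<bar>\<Sum>j<r. \<bar>C (t i) (t j) n \<omega>\<bar>\<bar>)" using that by (intro member_le_sum) auto
      also have "\<dots> \<le> H n \<omega>" unfolding H_def by (simp add: sum_nonneg)
      finally show ?thesis .
    qed
    have A: "(\<lambda>n. (\<Sum>k<N n. (incr k (t j) \<omega>)\<^sup>2) / real (N n)) \<longlonglongrightarrow> 0" if j: "j < r" for j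
    proof -
      have Yeq: "Y (t j) n \<omega> = (\<Sum>k<n. (incr k (t j) \<omega>)\<^sup>2) / real n" for n
        using elim(1) by (simp add: Y_def incr_def sum.atLeast1_atMost_eq power_mult_distrib)
      \<comment> \<open>Once \<open>H\<close> is below 1 the truncation of \<open>Y\<close> is
        inactive, and \<open>H\<close> bounds \<open>Y\<close> itself.\<close>
      have "\<forall>\<^sub>F n in sequentially. H (N n) \<omega> < 1" using H0 by (intro order_tendstoD) auto
      then have ev: "\<forall>\<^sub>F n in sequentially. norm (Y (t j) (N n) \<omega>) \<le> H (N n) \<omega>"
      proof eventually_elim
        case (elim n)
        then show ?case using YH[OF j, of "N n"] by (auto simp: min_def split: if_splits)
      qed
      have "(\<lambda>n. Y (t j) (N n) \<omega>) \<longlonglongrightarrow> 0" by (rule Lim_null_comparison[OF ev H0])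
      then show ?thesis by (simp add: Yeq)
    qed
    have B: "(\<lambda>n. (\<Sum>k<N n. D k (t i) \<omega> * D k (t j) \<omega>) / real (N n)) \<longlonglongrightarrow> bridge_cov (t i) (t j) \<omega>"
      if "i < r" "j < r" for i j
    proof -
      have "(\<lambda>n. C (t i) (t j) (N n) \<omega>) \<longlonglongrightarrow> 0"
        by (rule Lim_null_comparison[OF _ H0]) (use CH[OF that] in \<open>auto intro!: always_eventually\<close>)
      moreover have "\<forall>\<^sub>F n in sequentially. C (t i) (t j) (N n) \<omega> =
          (\<Sum>k<N n. D k (t i) \<omega> * D k (t j) \<omega>) / real (N n) - bridge_cov (t i) (t j) \<omega>"
      proof -
        have "\<forall>\<^sub>F n in sequentially. 1 \<le> N n" using N by (simp add: filterlim_at_top)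
        then show ?thesis by eventually_elim (simp add: C_def)
      qed
      ultimately have "(\<lambda>n. (\<Sum>k<N n. D k (t i) \<omega> * D k (t j) \<omega>) / real (N n) - bridge_cov (t i) (t j) \<omega>) \<longlonglongrightarrow> 0"
        by (simp cong: tendsto_cong)
      then show ?thesis by (simp add: LIM_zero_iff)
    qed
    show ?case
    proof (intro conjI allI impI)
      show "(\<lambda>n. (\<Sum>k<N n. (u r b t k \<omega>)\<^sup>2) / real (N n)) \<longlonglongrightarrow> (\<Sum>i<r. \<Sum>j<r. b i * b j * bridge_cov (t i) (t j) \<omega>)"
        by (rule u_path_limits(1)[OF elim(3) N]) (simp_all add: A B)
      show "\<forall>\<^sub>F n in sequentially. \<forall>k<N n. (u r b t k \<omega>)\<^sup>2 \<le> \<epsilon> * real (N n)" if "0 < \<epsilon>" for \<epsilon>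
        by (rule u_path_limits(2)[OF elim(3) N]) (simp_all add: A B that)
    qed
  qed
  have "(\<lambda>n. \<integral>\<omega>. cos ((\<Sum>j<r. b j * path_of (empirical_process X \<kappa> (N n) \<omega>) (t j)) + c) \<partial>M)
      \<longlonglongrightarrow> (\<integral>\<omega>. exp (- (\<Sum>i<r. \<Sum>j<r. b i * b j * bridge_cov (t i) (t j) \<omega>) / 2) * cos c \<partial>M)"
  proof (rule fidi_cos_tendsto[OF N])
    show "AE \<omega> in M. (\<lambda>n. (\<Sum>k<N n. (u r b t k \<omega>)\<^sup>2) / real (N n)) \<longlonglongrightarrow> (\<Sum>i<r. \<Sum>j<r. b i * b j * bridge_cov (t i) (t j) \<omega>)"
      using main by eventually_elim blast
    show "AE \<omega> in M. \<forall>\<epsilon>>0. \<forall>\<^sub>F n in sequentially. \<forall>k<N n. (u r b t k \<omega>)\<^sup>2 \<le> \<epsilon> * real (N n)"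
      using main by eventually_elim blast
  qed measurable
  with \<rho>'(1) show "\<exists>\<rho>'. strict_mono \<rho>' \<and> (\<lambda>n. \<integral>\<omega>. cos ((\<Sum>j<r. b j * path_of (empirical_process X \<kappa> (\<rho> (\<rho>' n)) \<omega>) (t j)) + c) \<partial>M)
      \<longlonglongrightarrow> (\<integral>\<omega>. exp (- (\<Sum>i<r. \<Sum>j<r. b i * b j * bridge_cov (t i) (t j) \<omega>) / 2) * cos c \<partial>M)"
    unfolding N_def by blast
qed

end

section \<open>The Brownian bridge at an independent random time\<close>

lemma prob_space_uniform01: "prob_space (uniform_measure lborel {0..1::real})"
  by (rule prob_space_uniform_measure) auto

lemma uniform01_atMost:
  assumes "0 \<le> u" "u \<le> 1"
  shows "(\<integral>x. indicator {..u} x \<partial>uniform_measure lborel {0..1::real}) = u"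
proof -
  have "{0..1} \<inter> {..u} = {0..u}" using assms by auto
  then have "measure (uniform_measure lborel {0..1}) {..u} = u"
    using assms by simp
  then show ?thesis by simp
qed

text \<open>The covariance of the Brownian bridge is that of the indicators \<open>x \<le> u\<close> under the
  uniform distribution, hence positive semidefinite.\<close>

lemma psd_bridge:
  assumes u: "\<And>i. i < r \<Longrightarrow> 0 \<le> u i \<and> u i \<le> 1"
  shows "psd r (\<lambda>i j. min (u i) (u j) - u i * u j)"
  unfolding psd_def
proof (intro conjI allI impI)
  show "min (u i) (u j) - u i * u j = min (u j) (u i) - u j * u i" for i j by (simp add: min.commute mult.commute)
  fix v :: "nat \<Rightarrow> real"
  let ?U = "uniform_measure lborel {0..1::real}"
  interpret U: prob_space ?U by (rule prob_space_uniform01)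
  let ?I = "\<lambda>i x. indicator {..u i} x :: real"
  have i1: "integrable ?U (\<lambda>x. indicator {..a} x :: real)" for a
    by (rule U.integrable_boundedI[where B=1]) (auto simp: indicator_def)
  have ii: "?I i x * ?I j x = indicator {..min (u i) (u j)} x" for i j x by (auto simp: indicator_def)
  have cov: "(\<integral>x. (?I i x - u i) * (?I j x - u j) \<partial>?U) = min (u i) (u j) - u i * u j" if ij: "i < r" "j < r" for i j
  proof -
    have "(\<integral>x. (?I i x - u i) * (?I j x - u j) \<partial>?U)
        = (\<integral>x. indicator {..min (u i) (u j)} x - u j * ?I i x - u i * ?I j x + u i * u j \<partial>?U)"
      by (intro Bochner_Integration.integral_cong refl) (simp add: ii[symmetric] algebra_simps)
    also have "\<dots> = (\<integral>x. indicator {..min (u i) (u j)} x \<partial>?U) - u j * (\<integral>x. ?I i x \<partial>?U)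
        - u i * (\<integral>x. ?I j x \<partial>?U) + u i * u j"
      using i1 by (simp add: U.prob_space)
    also have "\<dots> = min (u i) (u j) - u j * u i - u i * u j + u i * u j"
    proof -
      have "0 \<le> min (u i) (u j)" "min (u i) (u j) \<le> 1" using u[OF ij(1)] u[OF ij(2)] by auto
      from uniform01_atMost[OF this] uniform01_atMost[of "u i"] uniform01_atMost[of "u j"]
      show ?thesis using u[OF ij(1)] u[OF ij(2)] by (simp only:)
    qed
    finally show ?thesis by simp
  qed
  have ci: "integrable ?U (\<lambda>x. (?I i x - u i) * (?I j x - u j))" if ij: "i < r" "j < r" for i j
  proof (rule U.integrable_boundedI[where B=1])
    show "norm ((?I i x - u i) * (?I j x - u j)) \<le> 1" for x
      unfolding real_norm_def abs_mult using u[OF ij(1)] u[OF ij(2)]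
      by (intro mult_le_one) (auto simp: indicator_def)
  qed (intro borel_measurable_times borel_measurable_diff borel_measurable_const borel_measurable_indicator; simp)
  have "0 \<le> (\<integral>x. (\<Sum>i<r. v i * (?I i x - u i))\<^sup>2 \<partial>?U)" by (rule integral_nonneg_AE) simp
  also have "\<dots> = (\<integral>x. (\<Sum>i<r. \<Sum>j<r. v i * v j * ((?I i x - u i) * (?I j x - u j))) \<partial>?U)"
    by (intro Bochner_Integration.integral_cong refl, unfold power2_eq_square sum_product, intro sum.cong refl)
      (simp only: mult_ac)
  also have "\<dots> = (\<Sum>i<r. \<Sum>j<r. v i * v j * (\<integral>x. (?I i x - u i) * (?I j x - u j) \<partial>?U))"
  proof -
    have cv: "integrable ?U (\<lambda>x. v i * v j * ((?I i x - u i) * (?I j x - u j)))" if "i \<in> {..<r}" "j \<in> {..<r}" for i j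
      using that by (intro integrable_mult_right ci) auto
    have "(\<integral>x. (\<Sum>i<r. \<Sum>j<r. v i * v j * ((?I i x - u i) * (?I j x - u j))) \<partial>?U)
        = (\<Sum>i<r. \<integral>x. (\<Sum>j<r. v i * v j * ((?I i x - u i) * (?I j x - u j))) \<partial>?U)"
      by (rule Bochner_Integration.integral_sum, rule Bochner_Integration.integrable_sum, rule cv)
    also have "\<dots> = (\<Sum>i<r. \<Sum>j<r. \<integral>x. v i * v j * ((?I i x - u i) * (?I j x - u j)) \<partial>?U)"
      by (rule sum.cong[OF refl], rule Bochner_Integration.integral_sum, rule cv)
    finally show ?thesis by (simp only: integral_mult_right_zero)
  qed
  also have "\<dots> = (\<Sum>i<r. \<Sum>j<r. v i * v j * (min (u i) (u j) - u i * u j))"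
    by (intro sum.cong refl) (simp add: cov)
  finally show "0 \<le> (\<Sum>i<r. \<Sum>j<r. v i * v j * (min (u i) (u j) - u i * u j))" .
qed

lemma distribution_function_range:
  assumes "distribution_function H" shows "0 \<le> H t" "H t \<le> 1"
proof -
  have H: "mono H" "(H \<longlongrightarrow> 0) at_bot" "(H \<longlongrightarrow> 1) at_top"
    using assms by (auto simp: distribution_function_def)
  show "0 \<le> H t"
  proof (rule tendsto_upperbound[OF H(2)])
    show "\<forall>\<^sub>F i in at_bot. H i \<le> H t"
      using eventually_le_at_bot[of t] by eventually_elim (rule monoD[OF H(1)])
  qed simp
  show "H t \<le> 1"
  proof (rule tendsto_lowerbound[OF H(3)])
    show "\<forall>\<^sub>F i in at_top. H t \<le> H i"
      using eventually_ge_at_top[of t] by eventually_elim (rule monoD[OF H(1)])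
  qed simp
qed

text \<open>The bridge law and the independence are known for finitely many fixed times only, so a random time
  is approximated by its value on a grid and the paths' continuity gives the limit.\<close>

definition grid_pt :: "nat \<Rightarrow> nat \<Rightarrow> real" where "grid_pt m k = real (min (Suc m) k) / real (Suc m)"

definition grid_ix :: "nat \<Rightarrow> real \<Rightarrow> nat" where "grid_ix m x = nat \<lfloor>x * real (Suc m)\<rfloor>"

lemma grid_pt_range: "grid_pt m k \<in> {0..1}"
  by (simp add: grid_pt_def divide_le_eq_1)

lemma grid_ix_measurable: "grid_ix m \<in> borel \<rightarrow>\<^sub>M count_space UNIV"
  unfolding grid_ix_def by measurable

lemma grid_tendsto:
  assumes "0 \<le> x" "x \<le> 1"
  shows "(\<lambda>m. grid_pt m (grid_ix m x)) \<longlonglongrightarrow> x"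
proof (rule tendsto_sandwich)
  have b: "x - 1 / real (Suc m) \<le> grid_pt m (grid_ix m x) \<and> grid_pt m (grid_ix m x) \<le> x" for m
  proof -
    define s where "s = real (Suc m)"
    have s: "0 < s" by (simp add: s_def)
    define n where "n = \<lfloor>x * s\<rfloor>"
    have xs: "0 \<le> x * s" "x * s \<le> s" using assms s by (simp_all add: mult_left_le_one_le)
    have n0: "0 \<le> n" unfolding n_def using xs by simp
    have nr: "real_of_int n \<le> x * s" "x * s < real_of_int n + 1" unfolding n_def by linarith+
    have "real (nat n) \<le> s" using nr xs n0 by simp
    then have "nat n \<le> Suc m" by (simp add: s_def)
    then have g: "grid_pt m (grid_ix m x) = real_of_int n / s"
      using n0 by (simp add: grid_pt_def grid_ix_def n_def s_def min_absorb2)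
    have "real_of_int n / s \<le> x" using nr s by (simp add: divide_le_eq)
    moreover have "x - 1 / s \<le> real_of_int n / s"
    proof -
      have "x * s - 1 \<le> real_of_int n" using nr by simp
      then have "(x * s - 1) / s \<le> real_of_int n / s" using s by (intro divide_right_mono) auto
      then show ?thesis using s by (simp add: diff_divide_distrib)
    qed
    ultimately show ?thesis unfolding g s_def by simp
  qed
  show "\<forall>\<^sub>F m in sequentially. x - 1 / real (Suc m) \<le> grid_pt m (grid_ix m x)"
    "\<forall>\<^sub>F m in sequentially. grid_pt m (grid_ix m x) \<le> x"
    using b by (auto intro: always_eventually)
  have "(\<lambda>m. x - inverse (real (Suc m))) \<longlonglongrightarrow> x - 0"
    by (intro tendsto_diff tendsto_const LIMSEQ_inverse_real_of_nat)
  then show "(\<lambda>m. x - 1 / real (Suc m)) \<longlonglongrightarrow> x" by (simp add: inverse_eq_divide)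
qed (rule tendsto_const)

locale bridge = prob_space N for N :: "'w measure" +
  fixes M :: "'a measure" and \<alpha> :: "'a \<Rightarrow> real measure" and W :: "real \<Rightarrow> 'w \<Rightarrow> real" and F :: "'w \<Rightarrow> real \<Rightarrow> real"
  assumes setting: "bridge_setting M \<alpha> N W F"
begin

lemma W_M: "u \<in> {0..1} \<Longrightarrow> W u \<in> borel_measurable N"
  using setting by (simp add: bridge_setting_def standard_brownian_bridge_def)

lemma F_M [measurable]: "(\<lambda>\<omega>. F \<omega> t) \<in> borel_measurable N"
  using setting by (simp add: bridge_setting_def)

lemma F_range: "\<omega> \<in> space N \<Longrightarrow> 0 \<le> F \<omega> t \<and> F \<omega> t \<le> 1"
  using setting distribution_function_range[of "F \<omega>" t] by (simp add: bridge_setting_def)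

lemma W_continuous: "\<omega> \<in> space N \<Longrightarrow> continuous_on {0..1} (\<lambda>u. W u \<omega>)"
  using setting by (simp add: bridge_setting_def standard_brownian_bridge_def)

lemma F_ix_M [measurable]: "(\<lambda>\<omega>. grid_ix m (F \<omega> t)) \<in> N \<rightarrow>\<^sub>M count_space UNIV"
  by (rule measurable_compose[OF F_M grid_ix_measurable])

lemma W_grid_M: "(\<lambda>\<omega>. W (grid_pt m (grid_ix m (F \<omega> t))) \<omega>) \<in> borel_measurable N"
  by (rule measurable_compose_countable[where f="\<lambda>k. W (grid_pt m k)", OF W_M[OF grid_pt_range] F_ix_M])

lemma W_grid_tendsto:
  assumes "\<omega> \<in> space N"
  shows "(\<lambda>m. W (grid_pt m (grid_ix m (F \<omega> t))) \<omega>) \<longlonglongrightarrow> W (F \<omega> t) \<omega>"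
  by (rule continuous_on_tendsto_compose[OF W_continuous[OF assms] grid_tendsto])
    (use F_range[OF assms] grid_pt_range in \<open>auto intro: always_eventually\<close>)

lemma W_F_M: "(\<lambda>\<omega>. W (F \<omega> t) \<omega>) \<in> borel_measurable N"
  by (rule borel_measurable_LIMSEQ_real[OF W_grid_tendsto W_grid_M])

text \<open>The mean of the cosine for the bridge at the fixed times \<open>u\<close>. By symmetry
  of a centred law the sine part vanishes, which leaves the factor cos c.\<close>

definition gauss_cos :: "nat \<Rightarrow> (nat \<Rightarrow> real) \<Rightarrow> real \<Rightarrow> (nat \<Rightarrow> real) \<Rightarrow> real" where
  "gauss_cos r b c u = exp (- (\<Sum>i<r. \<Sum>j<r. b i * b j * (min (u i) (u j) - u i * u j)) / 2) * cos c"

lemma W_cos: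
  assumes u: "\<And>i. u i \<in> {0..1}"
  shows "(\<integral>\<omega>. cos ((\<Sum>i<r. b i * W (u i) \<omega>) + c) \<partial>N) = gauss_cos r b c u"
proof -
  let ?B = "\<Pi>\<^sub>M i\<in>{..<r}. borel :: real measure"
  have m: "(\<lambda>\<omega>. \<lambda>i\<in>{..<r}. W (u i) \<omega>) \<in> N \<rightarrow>\<^sub>M ?B" by (intro measurable_restrict W_M u)
  have d: "distr N ?B (\<lambda>\<omega>. \<lambda>i\<in>{..<r}. W (u i) \<omega>) = centered_gaussian r (\<lambda>i j. min (u i) (u j) - u i * u j)"
    using setting u unfolding bridge_setting_def standard_brownian_bridge_def by blast
  have "(\<integral>\<omega>. cos ((\<Sum>i<r. b i * W (u i) \<omega>) + c) \<partial>N)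
      = (\<integral>\<omega>. cos ((\<Sum>i<r. b i * (\<lambda>i\<in>{..<r}. W (u i) \<omega>) i) + c) \<partial>N)" by simp
  also have "\<dots> = (\<integral>x. cos ((\<Sum>i<r. b i * x i) + c) \<partial>distr N ?B (\<lambda>\<omega>. \<lambda>i\<in>{..<r}. W (u i) \<omega>))"
    by (rule integral_distr[OF m, symmetric]) measurable
  also have "\<dots> = gauss_cos r b c u"
    unfolding d gauss_cos_def by (rule centered_gaussian_cos[OF psd_bridge]) (use u in auto)
  finally show ?thesis .
qed

text \<open>Evaluating a path at a random time need not be measurable for an uncountable product
  sigma-field; at a time with values in a countable grid it is. Independence then gives a product
  law, and Fubini integrates over the bridge first, with the times frozen.\<close>

lemma W_grid_cos:
  "(\<integral>\<omega>. cos ((\<Sum>i<r. b i * W (grid_pt m (grid_ix m (F \<omega> (t i)))) \<omega>) + c) \<partial>N)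
    = (\<integral>\<omega>. gauss_cos r b c (\<lambda>i. grid_pt m (grid_ix m (F \<omega> (t i)))) \<partial>N)"
proof -
  let ?S = "\<Pi>\<^sub>M u\<in>{0..1::real}. borel :: real measure" and ?T = "\<Pi>\<^sub>M t\<in>(UNIV :: real set). borel :: real measure"
  let ?W = "\<lambda>\<omega>. \<lambda>u\<in>{0..1}. W u \<omega>"
  have ind: "indep_var ?S ?W ?T F" using setting by (simp add: bridge_setting_def)
  then have Wm: "?W \<in> N \<rightarrow>\<^sub>M ?S" and Fm: "F \<in> N \<rightarrow>\<^sub>M ?T"
    and dist: "distr N ?S ?W \<Otimes>\<^sub>M distr N ?T F = distr N (?S \<Otimes>\<^sub>M ?T) (\<lambda>\<omega>. (?W \<omega>, F \<omega>))"
    unfolding indep_var_distribution_eq by auto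
  interpret PW: prob_space "distr N ?S ?W" by (rule prob_space_distr[OF Wm])
  interpret PF: prob_space "distr N ?T F" by (rule prob_space_distr[OF Fm])
  interpret PP: pair_prob_space "distr N ?S ?W" "distr N ?T F" ..
  define g where "g = (\<lambda>p :: (real \<Rightarrow> real) \<times> (real \<Rightarrow> real). cos ((\<Sum>i<r. b i * fst p (grid_pt m (grid_ix m (snd p (t i))))) + c))"
  have gm: "g \<in> borel_measurable (?S \<Otimes>\<^sub>M ?T)"
  proof -
    have "(\<lambda>p. fst p (grid_pt m (grid_ix m (snd p (t i))))) \<in> borel_measurable (?S \<Otimes>\<^sub>M ?T)" for i
    proof (rule measurable_compose_countable[where f="\<lambda>k p. fst p (grid_pt m k)"])
      show "(\<lambda>p. fst p (grid_pt m k)) \<in> borel_measurable (?S \<Otimes>\<^sub>M ?T)" for k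
        by (rule measurable_compose[OF measurable_fst measurable_component_singleton[OF grid_pt_range]])
      have "(\<lambda>p. snd p (t i)) \<in> borel_measurable (?S \<Otimes>\<^sub>M ?T)"
        by (rule measurable_compose[OF measurable_snd measurable_component_singleton]) simp
      then show "(\<lambda>p. grid_ix m (snd p (t i))) \<in> ?S \<Otimes>\<^sub>M ?T \<rightarrow>\<^sub>M count_space UNIV"
        by (rule measurable_compose[OF _ grid_ix_measurable])
    qed
    then have "(\<lambda>p. (\<Sum>i<r. b i * fst p (grid_pt m (grid_ix m (snd p (t i))))) + c) \<in> borel_measurable (?S \<Otimes>\<^sub>M ?T)"
      by (intro borel_measurable_add borel_measurable_sum borel_measurable_times borel_measurable_const)
    then show ?thesis unfolding g_def by measurable
  qed
  have gm': "g \<in> borel_measurable (distr N ?S ?W \<Otimes>\<^sub>M distr N ?T F)"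
    using gm by (simp cong: measurable_cong_sets)
  have WF: "(\<lambda>\<omega>. (?W \<omega>, F \<omega>)) \<in> N \<rightarrow>\<^sub>M ?S \<Otimes>\<^sub>M ?T" using Wm Fm by (rule measurable_Pair)
  have "(\<integral>\<omega>. cos ((\<Sum>i<r. b i * W (grid_pt m (grid_ix m (F \<omega> (t i)))) \<omega>) + c) \<partial>N) = (\<integral>\<omega>. g (?W \<omega>, F \<omega>) \<partial>N)"
    by (simp add: g_def grid_pt_range[unfolded atLeastAtMost_iff])
  also have "\<dots> = (\<integral>p. g p \<partial>distr N (?S \<Otimes>\<^sub>M ?T) (\<lambda>\<omega>. (?W \<omega>, F \<omega>)))"
    by (rule integral_distr[OF WF gm, symmetric])
  also have "\<dots> = (\<integral>p. g p \<partial>(distr N ?S ?W \<Otimes>\<^sub>M distr N ?T F))" by (simp only: dist)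
  also have "\<dots> = (\<integral>f. \<integral>w. g (w, f) \<partial>distr N ?S ?W \<partial>distr N ?T F)"
  proof -
    have "integrable (distr N ?S ?W \<Otimes>\<^sub>M distr N ?T F) g"
      by (rule PP.integrable_boundedI[OF gm', where B=1]) (simp add: g_def)
    then show ?thesis using PP.integral_snd[of "\<lambda>w f. g (w, f)"] by simp
  qed
  also have "\<dots> = (\<integral>f. gauss_cos r b c (\<lambda>i. grid_pt m (grid_ix m (f (t i)))) \<partial>distr N ?T F)"
  proof (rule Bochner_Integration.integral_cong[OF refl])
    fix f
    have "(\<integral>w. g (w, f) \<partial>distr N ?S ?W) = (\<integral>\<omega>. g (?W \<omega>, f) \<partial>N)"
    proof (rule integral_distr[OF Wm])
      have "(\<lambda>w. w (grid_pt m (grid_ix m (f (t i))))) \<in> borel_measurable ?S" for i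
        by (rule measurable_component_singleton[OF grid_pt_range])
      then have "(\<lambda>w. (\<Sum>i<r. b i * w (grid_pt m (grid_ix m (f (t i))))) + c) \<in> borel_measurable ?S"
        by (intro borel_measurable_add borel_measurable_sum borel_measurable_times borel_measurable_const)
      then show "(\<lambda>w. g (w, f)) \<in> borel_measurable ?S" unfolding g_def fst_conv snd_conv by measurable
    qed
    also have "\<dots> = (\<integral>\<omega>. cos ((\<Sum>i<r. b i * W (grid_pt m (grid_ix m (f (t i)))) \<omega>) + c) \<partial>N)"
      by (simp add: g_def grid_pt_range[unfolded atLeastAtMost_iff])
    also have "\<dots> = gauss_cos r b c (\<lambda>i. grid_pt m (grid_ix m (f (t i))))" by (rule W_cos[OF grid_pt_range])
    finally show "(\<integral>w. g (w, f) \<partial>distr N ?S ?W) = gauss_cos r b c (\<lambda>i. grid_pt m (grid_ix m (f (t i))))" .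
  qed
  also have "\<dots> = (\<integral>\<omega>. gauss_cos r b c (\<lambda>i. grid_pt m (grid_ix m (F \<omega> (t i)))) \<partial>N)"
  proof (rule integral_distr[OF Fm])
    have [measurable]: "(\<lambda>f. grid_pt m (grid_ix m (f (t i)))) \<in> borel_measurable ?T" for i
    proof -
      have "(\<lambda>f. f (t i)) \<in> borel_measurable ?T" by (rule measurable_component_singleton) simp
      from measurable_compose[OF this grid_ix_measurable]
      have "(\<lambda>f. grid_ix m (f (t i))) \<in> ?T \<rightarrow>\<^sub>M count_space UNIV" .
      then show ?thesis by (rule measurable_compose) simp
    qed
    show "(\<lambda>f. gauss_cos r b c (\<lambda>i. grid_pt m (grid_ix m (f (t i))))) \<in> borel_measurable ?T"
      unfolding gauss_cos_def by measurable
  qed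
  finally show ?thesis .
qed

text \<open>The quantity is the mean of a cosine; this avoids a sign discussion of the quadratic
  form.\<close>

lemma gauss_cos_bdd: assumes "\<And>i. u i \<in> {0..1}" shows "\<bar>gauss_cos r b c u\<bar> \<le> 1"
  unfolding W_cos[OF assms, symmetric]
proof -
  let ?f = "\<lambda>\<omega>. cos ((\<Sum>i<r. b i * W (u i) \<omega>) + c)"
  have "(\<lambda>\<omega>. (\<Sum>i<r. b i * W (u i) \<omega>) + c) \<in> borel_measurable N"
    by (intro borel_measurable_add borel_measurable_sum borel_measurable_times borel_measurable_const W_M assms)
  then have m: "?f \<in> borel_measurable N" by measurable
  have i: "integrable N ?f" by (rule integrable_boundedI[OF m, where B=1]) simp
  have "\<bar>\<integral>\<omega>. ?f \<omega> \<partial>N\<bar> \<le> (\<integral>\<omega>. \<bar>?f \<omega>\<bar> \<partial>N)" by (rule integral_abs_bound)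
  also have "\<dots> \<le> (\<integral>\<omega>. 1 \<partial>N)" by (rule integral_mono) (use i in auto)
  finally show "\<bar>\<integral>\<omega>. ?f \<omega> \<partial>N\<bar> \<le> 1" by (simp add: prob_space)
qed

lemma W_F_cos: "(\<integral>\<omega>. cos ((\<Sum>i<r. b i * W (F \<omega> (t i)) \<omega>) + c) \<partial>N) = (\<integral>\<omega>. gauss_cos r b c (\<lambda>i. F \<omega> (t i)) \<partial>N)"
proof (rule LIMSEQ_unique)
  show "(\<lambda>m. \<integral>\<omega>. cos ((\<Sum>i<r. b i * W (grid_pt m (grid_ix m (F \<omega> (t i)))) \<omega>) + c) \<partial>N)
      \<longlonglongrightarrow> (\<integral>\<omega>. cos ((\<Sum>i<r. b i * W (F \<omega> (t i)) \<omega>) + c) \<partial>N)"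
  proof (rule integral_dominated_convergence[where w="\<lambda>_. 1"])
    note [measurable] = W_F_M W_grid_M
    show "(\<lambda>\<omega>. cos ((\<Sum>i<r. b i * W (F \<omega> (t i)) \<omega>) + c)) \<in> borel_measurable N" by measurable
    show "(\<lambda>\<omega>. cos ((\<Sum>i<r. b i * W (grid_pt m (grid_ix m (F \<omega> (t i)))) \<omega>) + c)) \<in> borel_measurable N" for m by measurable
    show "AE \<omega> in N. (\<lambda>m. cos ((\<Sum>i<r. b i * W (grid_pt m (grid_ix m (F \<omega> (t i)))) \<omega>) + c))
        \<longlonglongrightarrow> cos ((\<Sum>i<r. b i * W (F \<omega> (t i)) \<omega>) + c)"
      by (intro AE_I2 tendsto_cos tendsto_add tendsto_sum tendsto_mult tendsto_const W_grid_tendsto)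
  qed auto
  show "(\<lambda>m. \<integral>\<omega>. cos ((\<Sum>i<r. b i * W (grid_pt m (grid_ix m (F \<omega> (t i)))) \<omega>) + c) \<partial>N)
      \<longlonglongrightarrow> (\<integral>\<omega>. gauss_cos r b c (\<lambda>i. F \<omega> (t i)) \<partial>N)"
    unfolding W_grid_cos
  proof (rule integral_dominated_convergence[where w="\<lambda>_. 1"])
    show "(\<lambda>\<omega>. gauss_cos r b c (\<lambda>i. F \<omega> (t i))) \<in> borel_measurable N"
      unfolding gauss_cos_def by measurable
    have [measurable]: "(\<lambda>\<omega>. grid_pt m (grid_ix m (F \<omega> (t i)))) \<in> borel_measurable N" for m i
      by (rule measurable_compose[OF F_ix_M]) simp
    show "(\<lambda>\<omega>. gauss_cos r b c (\<lambda>i. grid_pt m (grid_ix m (F \<omega> (t i))))) \<in> borel_measurable N" for m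
      unfolding gauss_cos_def by measurable
    show "AE \<omega> in N. (\<lambda>m. gauss_cos r b c (\<lambda>i. grid_pt m (grid_ix m (F \<omega> (t i))))) \<longlonglongrightarrow> gauss_cos r b c (\<lambda>i. F \<omega> (t i))"
    proof (rule AE_I2)
      fix \<omega> assume "\<omega> \<in> space N"
      have "(\<lambda>m. grid_pt m (grid_ix m (F \<omega> (t i)))) \<longlonglongrightarrow> F \<omega> (t i)" for i
        by (rule grid_tendsto) (use F_range[OF \<open>\<omega> \<in> space N\<close>] in auto)
      then show "(\<lambda>m. gauss_cos r b c (\<lambda>i. grid_pt m (grid_ix m (F \<omega> (t i))))) \<longlonglongrightarrow> gauss_cos r b c (\<lambda>i. F \<omega> (t i))"
        unfolding gauss_cos_def
        by (intro tendsto_mult tendsto_const tendsto_exp tendsto_divide tendsto_minus tendsto_sum tendsto_diff tendsto_min) auto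
    qed
    show "AE \<omega> in N. norm (gauss_cos r b c (\<lambda>i. grid_pt m (grid_ix m (F \<omega> (t i))))) \<le> 1" for m
      by (intro AE_I2) (simp only: real_norm_def gauss_cos_bdd[OF grid_pt_range])
  qed auto
qed

text \<open>\<open>gauss_cos\<close> depends on its first \<open>r\<close> arguments only, so the
  prescribed finite-dimensional laws of \<open>F\<close> suffice to pass from \<open>N\<close> to
  \<open>M\<close>.\<close>

theorem bridge_cos:
  assumes M: "\<alpha> \<in> M \<rightarrow>\<^sub>M prob_algebra borel"
  shows "(\<integral>\<omega>. cos ((\<Sum>i<r. b i * W (F \<omega> (t i)) \<omega>) + c) \<partial>N)
    = (\<integral>\<omega>. gauss_cos r b c (\<lambda>i. measure (\<alpha> \<omega>) {..t i}) \<partial>M)"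
proof -
  let ?B = "\<Pi>\<^sub>M i\<in>{..<r}. borel :: real measure"
  have d: "distr N ?B (\<lambda>\<omega>. \<lambda>i\<in>{..<r}. F \<omega> (t i)) = distr M ?B (\<lambda>\<omega>. \<lambda>i\<in>{..<r}. measure (\<alpha> \<omega>) {..t i})"
    using setting by (simp add: bridge_setting_def)
  have mN: "(\<lambda>\<omega>. \<lambda>i\<in>{..<r}. F \<omega> (t i)) \<in> N \<rightarrow>\<^sub>M ?B" by (intro measurable_restrict F_M)
  have "(\<lambda>\<omega>. measure (\<alpha> \<omega>) {..t i}) \<in> borel_measurable M" for i
    by (rule measurable_compose[OF measurable_prob_algebraD[OF M] measurable_measure_subprob_algebra]) simp
  then have mM: "(\<lambda>\<omega>. \<lambda>i\<in>{..<r}. measure (\<alpha> \<omega>) {..t i}) \<in> M \<rightarrow>\<^sub>M ?B" by (intro measurable_restrict)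
  have gm: "gauss_cos r b c \<in> borel_measurable ?B" unfolding gauss_cos_def by measurable
  have res: "gauss_cos r b c (\<lambda>i\<in>{..<r}. h i) = gauss_cos r b c h" for h by (simp add: gauss_cos_def)
  have "(\<integral>\<omega>. gauss_cos r b c (\<lambda>i. F \<omega> (t i)) \<partial>N) = (\<integral>x. gauss_cos r b c x \<partial>distr N ?B (\<lambda>\<omega>. \<lambda>i\<in>{..<r}. F \<omega> (t i)))"
    by (simp only: integral_distr[OF mN gm] res)
  also have "\<dots> = (\<integral>\<omega>. gauss_cos r b c (\<lambda>i. measure (\<alpha> \<omega>) {..t i}) \<partial>M)"
    by (simp only: d integral_distr[OF mM gm] res)
  finally show ?thesis by (simp only: W_F_cos)
qed

end

section \<open>Convergence of the empirical process\<close>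

text \<open>If \<open>t\<close> lay beyond \<open>I\<close>, the right end \<beta> of
  \<open>I\<close> would be a real number in (s, t]. The interval containing \<beta> must begin
  there, as otherwise it would meet \<open>I\<close> just to the left of \<beta>. So \<beta> is a
  minimum of an interval, hence a cut that separates \<open>s\<close> from \<open>t\<close>.\<close>

lemma right_open_same_interval:
  assumes part: "partition_on UNIV \<I>" and ro: "\<And>I. I \<in> \<I> \<Longrightarrow> right_open_interval I"
    and A: "{x. \<exists>I\<in>\<I>. x \<in> I \<and> (\<forall>y\<in>I. x \<le> y)} \<subseteq> A"
    and cell: "cell A s = cell A t" and st: "s \<le> t" and I: "I \<in> \<I>" "s \<in> I"
  shows "t \<in> I"
proof (rule ccontr)
  assume tI: "t \<notin> I"
  obtain a b :: ereal where ab: "I = {t. a \<le> ereal t \<and> ereal t < b}"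
    using ro[OF I(1)] by (auto simp: right_open_interval_def)
  have as: "a \<le> ereal s" "ereal s < b" using I(2) ab by auto
  have "a \<le> ereal t" using as(1) st by (meson ereal_less_eq(3) order_trans)
  then have bt: "b \<le> ereal t" using tI ab by (auto simp: not_less)
  then obtain \<beta> where \<beta>: "b = ereal \<beta>" using as(2) by (cases b) auto
  have s\<beta>: "s < \<beta>" and \<beta>t: "\<beta> \<le> t" using as(2) bt \<beta> by auto
  obtain J where J: "J \<in> \<I>" "\<beta> \<in> J" using part by (auto simp: partition_on_def)
  obtain c d :: ereal where cd: "J = {t. c \<le> ereal t \<and> ereal t < d}"
    using ro[OF J(1)] by (auto simp: right_open_interval_def)
  have \<beta>I: "\<beta> \<notin> I" using ab \<beta> by auto
  have "c = ereal \<beta>"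
  proof (rule ccontr)
    assume "c \<noteq> ereal \<beta>"
    then have "c < ereal \<beta>" using J(2) cd by auto
    then have "max c (ereal s) < ereal \<beta>" using s\<beta> by simp
    then obtain z where z: "max c (ereal s) < ereal z" "ereal z < ereal \<beta>" by (rule ereal_dense3[THEN exE]) (auto elim: exE dest: ereal_dense2)
    have zI: "z \<in> I"
    proof -
      have "ereal s < ereal z" using z(1) by simp
      then have "a \<le> ereal z" using as(1) by (meson less_imp_le order_trans)
      then show ?thesis using z(2) \<beta> ab by simp
    qed
    have zJ: "z \<in> J"
    proof -
      have "c \<le> ereal z" using z(1) by (simp add: less_imp_le)
      moreover have "ereal z < d" using z(2) J(2) cd by (metis (mono_tags, lifting) less_trans mem_Collect_eq)
      ultimately show ?thesis using cd by simp
    qed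
    have "I = J" using part I(1) J(1) zI zJ unfolding partition_on_def disjoint_def by blast
    then show False using J(2) \<beta>I by simp
  qed
  then have "\<forall>y\<in>J. \<beta> \<le> y" using cd by auto
  then have "\<beta> \<in> A" using A J by blast
  then have "\<beta> \<in> cell A t" "\<beta> \<notin> cell A s" using \<beta>t s\<beta> by (auto simp: cell_def)
  then show False using cell by simp
qed

lemma right_open_eventually:
  assumes "right_open_interval I" "s \<in> I"
  shows "\<forall>\<^sub>F u in at_right s. u \<in> I"
proof -
  obtain a b :: ereal where ab: "I = {t. a \<le> ereal t \<and> ereal t < b}"
    using assms(1) by (auto simp: right_open_interval_def)
  have s: "a \<le> ereal s" "ereal s < b" using assms(2) ab by auto
  obtain z where z: "s < z" "ereal z \<le> b"
  proof (cases b)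
    case (real r)
    then show ?thesis using s(2) by (intro that[of r]) auto
  next
    case PInf
    then show ?thesis by (intro that[of "s + 1"]) auto
  next
    case MInf
    then show ?thesis using s(2) by simp
  qed
  have "\<forall>\<^sub>F u in at_right s. u \<in> {s<..<z}" by (rule eventually_at_right_real[OF z(1)])
  then show ?thesis
  proof eventually_elim
    case (elim u)
    have "a \<le> ereal u" using s(1) elim by (meson greaterThanLessThan_iff ereal_less_eq(3) less_imp_le order_trans)
    moreover have "ereal u < b" using elim z(2) by (metis greaterThanLessThan_iff less_ereal.simps(1) order_less_le_trans)
    ultimately show ?case using ab by simp
  qed
qed

lemma bdd_above_osc: "bdd_above ((\<lambda>(s, t). \<bar>path_of x s - path_of x t\<bar>) ` S)"
proof -
  obtain B where B: "\<And>t. \<bar>path_of x t\<bar> \<le> B" using bounded_range_path_of[of x] by (auto simp: bounded_iff)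
  have "\<bar>path_of x s - path_of x t\<bar> \<le> 2 * B" for s t using B[of s] B[of t] by linarith
  then show ?thesis by (intro bdd_aboveI2[where M="2 * B"]) auto
qed

text \<open>A strict inequality survives a small move to the right, and right-open intervals contain
  such moves. Dense times therefore detect it, and the event depends on countably many
  coordinates.\<close>

lemma (in dense_seq) osc_gt_iff:
  assumes fin: "finite \<I>" "\<I> \<noteq> {}" and ro: "\<And>I. I \<in> \<I> \<Longrightarrow> right_open_interval I" and ne: "\<And>I. I \<in> \<I> \<Longrightarrow> I \<noteq> {}"
  shows "(MAX I\<in>\<I>. SUP (s, t)\<in>I \<times> I. \<bar>path_of x s - path_of x t\<bar>) > \<epsilon> \<longleftrightarrow>
    (\<exists>I\<in>\<I>. \<exists>i j. d i \<in> I \<and> d j \<in> I \<and> \<bar>path_of x (d i) - path_of x (d j)\<bar> > \<epsilon>)"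
    and "(MAX I\<in>\<I>. SUP (s, t)\<in>I \<times> I. \<bar>path_of x s - path_of x t\<bar>) > \<epsilon> \<longleftrightarrow>
    (\<exists>I\<in>\<I>. \<exists>s\<in>I. \<exists>t\<in>I. \<bar>path_of x s - path_of x t\<bar> > \<epsilon>)"
proof -
  have "(MAX I\<in>\<I>. SUP (s, t)\<in>I \<times> I. \<bar>path_of x s - path_of x t\<bar>) > \<epsilon> \<longleftrightarrow>
      (\<exists>I\<in>\<I>. (SUP (s, t)\<in>I \<times> I. \<bar>path_of x s - path_of x t\<bar>) > \<epsilon>)"
    using fin by (subst Max_gr_iff) auto
  also have "\<dots> \<longleftrightarrow> (\<exists>I\<in>\<I>. \<exists>s\<in>I. \<exists>t\<in>I. \<bar>path_of x s - path_of x t\<bar> > \<epsilon>)"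
  proof (rule bex_cong[OF refl])
    fix I assume "I \<in> \<I>"
    then have "I \<times> I \<noteq> {}" using ne by auto
    then show "(SUP (s, t)\<in>I \<times> I. \<bar>path_of x s - path_of x t\<bar>) > \<epsilon> \<longleftrightarrow> (\<exists>s\<in>I. \<exists>t\<in>I. \<bar>path_of x s - path_of x t\<bar> > \<epsilon>)"
      by (subst less_cSUP_iff[OF _ bdd_above_osc]) auto
  qed
  finally show 2: "(MAX I\<in>\<I>. SUP (s, t)\<in>I \<times> I. \<bar>path_of x s - path_of x t\<bar>) > \<epsilon> \<longleftrightarrow>
    (\<exists>I\<in>\<I>. \<exists>s\<in>I. \<exists>t\<in>I. \<bar>path_of x s - path_of x t\<bar> > \<epsilon>)" .
  show "(MAX I\<in>\<I>. SUP (s, t)\<in>I \<times> I. \<bar>path_of x s - path_of x t\<bar>) > \<epsilon> \<longleftrightarrow>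
    (\<exists>I\<in>\<I>. \<exists>i j. d i \<in> I \<and> d j \<in> I \<and> \<bar>path_of x (d i) - path_of x (d j)\<bar> > \<epsilon>)"
    unfolding 2
  proof
    assume "\<exists>I\<in>\<I>. \<exists>s\<in>I. \<exists>t\<in>I. \<bar>path_of x s - path_of x t\<bar> > \<epsilon>"
    then obtain I s t where I: "I \<in> \<I>" "s \<in> I" "t \<in> I" "\<epsilon> < \<bar>path_of x s - path_of x t\<bar>" by blast
    obtain f where f: "filterlim (\<lambda>n. d (f n)) (at_right s) sequentially" by (rule seq_to_right)
    obtain g where g: "filterlim (\<lambda>n. d (g n)) (at_right t) sequentially" by (rule seq_to_right)
    have "(\<lambda>n. \<bar>path_of x (d (f n)) - path_of x (d (g n))\<bar>) \<longlonglongrightarrow> \<bar>path_of x s - path_of x t\<bar>"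
      by (rule tendsto_rabs[OF tendsto_diff[OF path_seq_to_right[OF f] path_seq_to_right[OF g]]])
    then have "\<forall>\<^sub>F n in sequentially. \<epsilon> < \<bar>path_of x (d (f n)) - path_of x (d (g n))\<bar>"
      using I(4) by (rule order_tendstoD(1))
    moreover have "\<forall>\<^sub>F n in sequentially. d (f n) \<in> I"
      by (rule eventually_compose_filterlim[OF right_open_eventually[OF ro[OF I(1)] I(2)] f])
    moreover have "\<forall>\<^sub>F n in sequentially. d (g n) \<in> I"
      by (rule eventually_compose_filterlim[OF right_open_eventually[OF ro[OF I(1)] I(3)] g])
    ultimately have "\<forall>\<^sub>F n in sequentially. d (f n) \<in> I \<and> d (g n) \<in> I \<and> \<epsilon> < \<bar>path_of x (d (f n)) - path_of x (d (g n))\<bar>"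
      by eventually_elim blast
    then obtain n where "d (f n) \<in> I \<and> d (g n) \<in> I \<and> \<epsilon> < \<bar>path_of x (d (f n)) - path_of x (d (g n))\<bar>"
      by (auto simp: eventually_sequentially)
    then show "\<exists>I\<in>\<I>. \<exists>i j. d i \<in> I \<and> d j \<in> I \<and> \<bar>path_of x (d i) - path_of x (d j)\<bar> > \<epsilon>"
      using I(1) by blast
  qed blast
qed

lemma (in dense_seq) partition_osc:
  fixes Y :: "nat \<Rightarrow> 'm \<Rightarrow> cadlag0"
  assumes M: "prob_space M" and Y: "\<And>n t. (\<lambda>\<omega>. path_of (Y n \<omega>) t) \<in> borel_measurable M"
    and fin: "finite \<I>" and part: "partition_on UNIV \<I>" and ro: "\<And>I. I \<in> \<I> \<Longrightarrow> right_open_interval I"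
    and lim: "limsup (\<lambda>n. emeasure M {\<omega> \<in> space M.
               (MAX I\<in>\<I>. SUP (s, t)\<in>I \<times> I. \<bar>path_of (Y n \<omega>) s - path_of (Y n \<omega>) t\<bar>) > \<epsilon>}) < ennreal \<eta>"
  shows "\<exists>A. finite A \<and> (\<forall>\<^sub>F n in sequentially. measure M {\<omega> \<in> space M. \<not> osc_le (\<lambda>t. t) A \<epsilon> (path_of (Y n \<omega>))} < \<eta>)"
proof -
  interpret M: prob_space M by fact
  note [measurable] = Y
  have ne: "\<I> \<noteq> {}" and neI: "\<And>I. I \<in> \<I> \<Longrightarrow> I \<noteq> {}"
    using part unfolding partition_on_def by blast+
  \<comment> \<open>The attained left endpoints of the intervals; each is the infimum of its
    interval, which makes the set finite.\<close>
  define A where "A = {x. \<exists>I\<in>\<I>. x \<in> I \<and> (\<forall>y\<in>I. x \<le> y)}"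
  have "A \<subseteq> Inf ` \<I>"
  proof
    fix x assume "x \<in> A"
    then obtain I where I: "I \<in> \<I>" "x \<in> I" "\<forall>y\<in>I. x \<le> y" by (auto simp: A_def)
    then have "Inf I = x" by (intro cInf_eq_minimum) auto
    then show "x \<in> Inf ` \<I>" using I(1) by blast
  qed
  then have A: "finite A" using fin by (meson finite_imageI finite_subset)
  let ?S = "\<lambda>n. {\<omega> \<in> space M. (MAX I\<in>\<I>. SUP (s, t)\<in>I \<times> I. \<bar>path_of (Y n \<omega>) s - path_of (Y n \<omega>) t\<bar>) > \<epsilon>}"
  \<comment> \<open>Indispensable: \<open>emeasure\<close> is 0 on non-measurable sets, so without
    this the limsup bound would carry no information about subsets of \<open>?S n\<close>.\<close>
  have S: "?S n \<in> M.events" for n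
  proof -
    have "?S n = (\<Union>I\<in>\<I>. \<Union>p\<in>{p. d (fst p) \<in> I \<and> d (snd p) \<in> I}. {\<omega> \<in> space M. \<epsilon> < \<bar>path_of (Y n \<omega>) (d (fst p)) - path_of (Y n \<omega>) (d (snd p))\<bar>})"
      by (rule set_eqI) (simp only: osc_gt_iff(1)[OF fin ne ro neI] UN_iff mem_Collect_eq split_paired_Ex fst_conv snd_conv Bex_def, blast)
    also have "\<dots> \<in> M.events"
    proof (rule sets.finite_UN[OF fin], rule sets.countable_UN'[OF countableI_type], rule image_subsetI)
      fix I and p :: "nat \<times> nat"
      show "{\<omega> \<in> space M. \<epsilon> < \<bar>path_of (Y n \<omega>) (d (fst p)) - path_of (Y n \<omega>) (d (snd p))\<bar>} \<in> M.events"
        by measurable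
    qed
    finally show ?thesis .
  qed
  have sub: "{\<omega> \<in> space M. \<not> osc_le (\<lambda>t. t) A \<epsilon> (path_of (Y n \<omega>))} \<subseteq> ?S n" for n
  proof
    fix \<omega> assume \<omega>: "\<omega> \<in> {\<omega> \<in> space M. \<not> osc_le (\<lambda>t. t) A \<epsilon> (path_of (Y n \<omega>))}"
    have "\<exists>I\<in>\<I>. \<exists>s\<in>I. \<exists>t\<in>I. \<bar>path_of (Y n \<omega>) s - path_of (Y n \<omega>) t\<bar> > \<epsilon>"
    proof (rule ccontr)
      assume no: "\<not> ?thesis"
      have "osc_le (\<lambda>t. t) A \<epsilon> (path_of (Y n \<omega>))"
      proof (rule osc_le_path[OF A])
        have le: "\<bar>path_of (Y n \<omega>) s - path_of (Y n \<omega>) t\<bar> \<le> \<epsilon>" if c: "cell A s = cell A t" "s \<le> t" for s t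
        proof -
          obtain I where I: "I \<in> \<I>" "s \<in> I" using part unfolding partition_on_def by blast
          have "t \<in> I" by (rule right_open_same_interval[OF part ro _ c I]) (auto simp: A_def)
          then show ?thesis using no I by (meson not_le)
        qed
        fix s t assume c: "cell A s = cell A t"
        show "\<bar>path_of (Y n \<omega>) s - path_of (Y n \<omega>) t\<bar> \<le> \<epsilon>"
        proof (cases "s \<le> t")
          case True then show ?thesis by (rule le[OF c])
        next
          case False
          then have "t \<le> s" by simp
          from le[OF c[symmetric] this] show ?thesis by (simp add: abs_minus_commute)
        qed
      qed
      with \<omega> show False by simp
    qed
    with \<omega> show "\<omega> \<in> ?S n"
      by (intro CollectI conjI iffD2[OF osc_gt_iff(2)[OF fin ne ro neI]]) simp_all
  qed
  have "\<forall>\<^sub>F n in sequentially. emeasure M (?S n) < ennreal \<eta>" using lim by (rule Limsup_lessD)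
  then have "\<forall>\<^sub>F n in sequentially. measure M {\<omega> \<in> space M. \<not> osc_le (\<lambda>t. t) A \<epsilon> (path_of (Y n \<omega>))} < \<eta>"
  proof eventually_elim
    case (elim n)
    then have "measure M (?S n) < \<eta>" by (simp add: M.emeasure_eq_measure ennreal_less_iff)
    then show ?case using M.finite_measure_mono[OF sub S, of n] by simp
  qed
  with A show ?thesis by blast
qed

lemma rational_dense_seq: "dense_seq (from_nat_into \<rat>)"
proof
  fix a b :: real assume "a < b"
  then obtain x where x: "x \<in> \<rat>" "a < x" "x < b" using Rats_dense_in_real by blast
  moreover have "range (from_nat_into \<rat>) = (\<rat> :: real set)"
    using range_from_nat_into[of "\<rat> :: real set"] Rats_0 countable_rat by (metis empty_iff)
  ultimately obtain i where "x = from_nat_into \<rat> i" by (metis imageE)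
  with x show "\<exists>i. a < from_nat_into \<rat> i \<and> from_nat_into \<rat> i < b" by blast
qed

locale cid_limit = cid_l2 M G X \<kappa> + dense_seq d for M :: "'a measure" and G X \<kappa> d +
  assumes equicont: "\<And>\<epsilon> \<eta> :: real. \<epsilon> > 0 \<Longrightarrow> \<eta> > 0 \<Longrightarrow>
           \<exists>\<I>. finite \<I> \<and> partition_on UNIV \<I> \<and> (\<forall>I\<in>\<I>. right_open_interval I) \<and>
             limsup (\<lambda>n. emeasure M {\<omega> \<in> space M.
               (MAX I\<in>\<I>. SUP (s, t)\<in>I \<times> I.
                  \<bar>path_of (empirical_process X \<kappa> n \<omega>) s - path_of (empirical_process X \<kappa> n \<omega>) t\<bar>) > \<epsilon>})
             < ennreal \<eta>"
begin

lemma empirical_limitI: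
  fixes N :: "'n measure"
  assumes N: "prob_space N" and y: "\<And>i. (\<lambda>\<omega>. y \<omega> i) \<in> borel_measurable N"
    and conv: "\<And>(r::nat) b c. (\<lambda>n. \<integral>\<omega>. cos ((\<Sum>i<r. b i * path_of (empirical_process X \<kappa> n \<omega>) (d i)) + c) \<partial>M)
                 \<longlonglongrightarrow> (\<integral>\<omega>. cos ((\<Sum>i<r. b i * y \<omega> i) + c) \<partial>N)"
  shows "empirical_limit d M (empirical_process X \<kappa>) N y"
proof (intro empirical_limit.intro empirical_limit_axioms.intro)
  show "dense_seq d" by (rule dense_seq_axioms)
  show "prob_space M" by (rule prob_space_axioms)
  show "\<exists>A. finite A \<and> (\<forall>\<^sub>F n in sequentially. prob {\<omega> \<in> space M. \<not> osc_le (\<lambda>t. t) A \<epsilon> (path_of (empirical_process X \<kappa> n \<omega>))} < \<eta>)"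
    if pos: "0 < \<epsilon>" "0 < \<eta>" for \<epsilon> \<eta>
  proof -
    obtain \<I> where I: "finite \<I>" "partition_on UNIV \<I>" "\<forall>I\<in>\<I>. right_open_interval I"
      "limsup (\<lambda>n. emeasure M {\<omega> \<in> space M.
        (MAX I\<in>\<I>. SUP (s, t)\<in>I \<times> I.
          \<bar>path_of (empirical_process X \<kappa> n \<omega>) s - path_of (empirical_process X \<kappa> n \<omega>) t\<bar>) > \<epsilon>}) < ennreal \<eta>"
      using equicont[OF pos] by (elim exE conjE)
    show ?thesis
      by (rule partition_osc[OF prob_space_axioms path_measurable I(1,2) _ I(4)]) (rule bspec[OF I(3)])
  qed
  show "\<exists>R. \<forall>n. prob {\<omega> \<in> space M. R < \<bar>path_of (empirical_process X \<kappa> n \<omega>) t\<bar>} \<le> \<eta>" if "0 < \<eta>" for \<eta> t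
    by (rule path_tight[OF that])
qed (fact N path_measurable y conv)+

text \<open>The candidate \<open>y\<close> is the bridge process itself at the dense times, on its
  own space \<open>N\<close>. The random path obtained from it therefore agrees with the bridge
  process almost everywhere, which gives convergence and tightness together.\<close>

theorem bridge_limit:
  fixes N :: "'n measure"
  assumes hyp: "\<And>s. converges_in_prob_to_0 M (\<lambda>n \<omega>. 1 / real n * (\<Sum>k=1..n. (real k)\<^sup>2 *
              (cond_cdf M G X k s \<omega> - cond_cdf M G X (k - 1) s \<omega>)\<^sup>2))"
    and dir: "directing_measure M G X \<alpha>" and setting: "bridge_setting M \<alpha> N W F"
  shows "converges_in_dist M (empirical_process X \<kappa>) N (bridge_process W F) \<and> tight_element N (bridge_process W F)"
proof -
  interpret D: cid_l2_directed M G X \<kappa> \<alpha>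
    by (intro cid_l2_directed.intro cid_directed.intro cid_directed_axioms.intro dir)
       (rule cid_l2_axioms cid_setting_axioms)+
  have N: "prob_space N" using setting by (simp add: bridge_setting_def)
  interpret B: bridge N M \<alpha> W F
    by (intro bridge.intro bridge_axioms.intro N setting)
  have cov: "(\<integral>\<omega>. exp (- (\<Sum>i<r. \<Sum>j<r. b i * b j * D.bridge_cov (d i) (d j) \<omega>) / 2) * cos c \<partial>M)
      = (\<integral>\<omega>. cos ((\<Sum>i<r. b i * W (F \<omega> (d i)) \<omega>) + c) \<partial>N)" for r :: nat and b c
    unfolding B.bridge_cos[OF D.alpha_meas]
  proof (rule Bochner_Integration.integral_cong[OF refl])
    fix \<omega> assume \<omega>: "\<omega> \<in> space M"
    interpret A: prob_space "\<alpha> \<omega>" by (rule D.alpha_space(1)[OF \<omega>])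
    have mono: "measure (\<alpha> \<omega>) {..s} \<le> measure (\<alpha> \<omega>) {..t}" if "s \<le> t" for s t
      by (rule A.finite_measure_mono) (use that D.alpha_space(2)[OF \<omega>] in auto)
    \<comment> \<open>Monotonicity turns F(min s t) - F(s) F(t) into the bridge covariance at the
      times F(s) and F(t).\<close>
    have "D.F (min s t) \<omega> = min (D.F s \<omega>) (D.F t \<omega>)" for s t
      unfolding D.F_def using mono[of s t] mono[of t s] by (cases "s \<le> t") (auto simp: min_def)
    then show "exp (- (\<Sum>i<r. \<Sum>j<r. b i * b j * D.bridge_cov (d i) (d j) \<omega>) / 2) * cos c
        = B.gauss_cos r b c (\<lambda>i. measure (\<alpha> \<omega>) {..d i})"
      by (simp only: B.gauss_cos_def D.bridge_cov_def D.F_def)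
  qed
  interpret E: empirical_limit d M "empirical_process X \<kappa>" N "\<lambda>\<omega> i. W (F \<omega> (d i)) \<omega>"
  proof (rule empirical_limitI[OF N])
    show "(\<lambda>\<omega>. W (F \<omega> (d i)) \<omega>) \<in> borel_measurable N" for i by (rule B.W_F_M)
    show "(\<lambda>n. \<integral>\<omega>. cos ((\<Sum>i<r. b i * path_of (empirical_process X \<kappa> n \<omega>) (d i)) + c) \<partial>M)
        \<longlonglongrightarrow> (\<integral>\<omega>. cos ((\<Sum>i<r. b i * W (F \<omega> (d i)) \<omega>) + c) \<partial>N)" for r :: nat and b c
      unfolding cov[symmetric] by (rule D.fidi_limit_bridge[OF hyp])
  qed
  obtain Z where Z: "Z \<in> N \<rightarrow>\<^sub>M borel" "AE \<omega> in N. \<forall>i. path_of (Z \<omega>) (d i) = W (F \<omega> (d i)) \<omega>"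
    "tight_law (distr N borel Z)"
    "\<And>f. continuous_on UNIV f \<Longrightarrow> bounded (range f) \<Longrightarrow>
       (\<lambda>n. outer_expectation M (\<lambda>\<omega>. f (empirical_process X \<kappa> n \<omega>))) \<longlonglongrightarrow> (\<integral>\<omega>. f (Z \<omega>) \<partial>N)"
    by (rule E.limit_exists) blast
  have ind: "indistinguishable N (bridge_process W F) Z"
    unfolding indistinguishable_def using Z(2) AE_space
  proof eventually_elim
    case (elim \<omega>)
    show ?case
      by (rule eq_if_dense) (use elim path_bridge_process[OF setting] in simp)
  qed
  show ?thesis unfolding converges_in_dist_def tight_element_def using Z ind by blast
qed

text \<open>No limit process is given here. Its values at the dense times are built on the product
  of \<open>M\<close> with one Gaussian sequence: given \<omega>, a Gaussian sequence with
  covariance \<sigma> at those times.\<close>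

theorem covariation_limit:
  fixes \<sigma> :: "real \<Rightarrow> real \<Rightarrow> 'a \<Rightarrow> real"
  assumes \<sigma>: "\<And>s t. \<sigma> s t \<in> borel_measurable M"
    and lim: "\<And>s t. AE \<omega> in M. (\<lambda>n. 1 / real n * (\<Sum>k=1..n. q_incr M G X k s \<omega> * q_incr M G X k t \<omega>)) \<longlonglongrightarrow> \<sigma> s t \<omega>"
  shows "\<exists>(N :: cadlag0 measure) (Z :: cadlag0 \<Rightarrow> cadlag0).
               prob_space N \<and> Z \<in> N \<rightarrow>\<^sub>M borel \<and> tight_element N Z \<and>
               (\<forall>(r :: nat) (t :: nat \<Rightarrow> real). \<forall>A\<in>sets (\<Pi>\<^sub>M i\<in>{..<r}. borel).
                  measure (distr N borel Z) {x. (\<lambda>i\<in>{..<r}. path_of x (t i)) \<in> A}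
                    = (\<integral>\<omega>. measure (centered_gaussian r (\<lambda>i j. \<sigma> (t i) (t j) \<omega>)) A \<partial>M)) \<and>
               converges_in_dist M (empirical_process X \<kappa>) N Z"
proof -
  let ?E = "empirical_process X \<kappa>"
  have psd: "AE \<omega> in M. psd r (\<lambda>i j. \<sigma> (t i) (t j) \<omega>)" for r and t :: "nat \<Rightarrow> real"
    by (rule fidi_limit_covariation(1)[where S="\<lambda>i j. \<sigma> (t i) (t j)" and t=t, OF \<sigma> lim])
  have fidi: "(\<lambda>n. \<integral>\<omega>. cos ((\<Sum>j<r. b j * path_of (?E n \<omega>) (t j)) + c) \<partial>M)
      \<longlonglongrightarrow> (\<integral>\<omega>. exp (- (\<Sum>i<r. \<Sum>j<r. b i * b j * \<sigma> (t i) (t j) \<omega>) / 2) * cos c \<partial>M)" for r b c and t :: "nat \<Rightarrow> real"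
    by (rule fidi_limit_covariation(2)[where S="\<lambda>i j. \<sigma> (t i) (t j)" and t=t, OF \<sigma> lim])
  define S where "S = (\<lambda>\<omega> i j. \<sigma> (d i) (d j) \<omega>)"
  have Sm: "(\<lambda>\<omega>. S \<omega> i j) \<in> borel_measurable M" for i j unfolding S_def by (rule \<sigma>)
  have Spsd: "AE \<omega> in M. psd r (S \<omega>)" for r unfolding S_def by (rule psd)
  \<comment> \<open>Lower triangularity makes the construction consistent: row \<open>a\<close> uses
    the first a + 1 variables only, and the same rows factor every leading block of the
    covariance.\<close>
  define L where "L = (\<lambda>\<omega> a k. if k \<le> a then chol (S \<omega>) a k else 0)"
  have Lm [measurable]: "(\<lambda>\<omega>. L \<omega> a k) \<in> borel_measurable M" for a k
    using chol_measurable[of S M, OF Sm] unfolding L_def by (cases "k \<le> a") simp_all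
  let ?N = "M \<Otimes>\<^sub>M gauss_product UNIV"
  interpret GP: prob_space "gauss_product UNIV" by (rule prob_space_gauss_product)
  interpret P: pair_prob_space M "gauss_product UNIV" ..
  define y where "y = (\<lambda>p a. \<Sum>k<Suc a. L (fst p) a k * snd p k)"
  have yr: "y p a = (\<Sum>k<r. L (fst p) a k * snd p k)" if "a < r" for p a r
    unfolding y_def by (rule sum.mono_neutral_left) (use that in \<open>auto simp: L_def\<close>)
  have ym: "(\<lambda>p. y p a) \<in> borel_measurable ?N" for a
    unfolding y_def
  proof (intro borel_measurable_sum borel_measurable_times)
    show "(\<lambda>p. L (fst p) a k) \<in> borel_measurable ?N" for k by (rule measurable_compose[OF measurable_fst Lm])
    show "(\<lambda>p. snd p k) \<in> borel_measurable ?N" for k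
      by (rule measurable_compose[OF measurable_snd gauss_product_coord]) simp
  qed
  have LL: "AE \<omega> in M. \<forall>i<r. \<forall>j<r. (\<Sum>k<r. L \<omega> i k * L \<omega> j k) = S \<omega> i j" for r
    using Spsd[of r]
  proof eventually_elim
    case (elim \<omega>)
    have "L \<omega> a k = chol (S \<omega>) a k" if "a < r" "k < r" for a k
      using chol_lower[OF elim, of a k] that by (auto simp: L_def)
    then show ?case using chol_factorization[OF elim] by simp
  qed
  interpret E: empirical_limit d M ?E ?N y
  proof (rule empirical_limitI[OF P.prob_space_axioms ym])
    fix r :: nat and b c
    have "(\<integral>p. cos ((\<Sum>i<r. b i * y p i) + c) \<partial>?N)
        = (\<integral>p. cos ((\<Sum>i<r. b i * (\<Sum>k<r. L (fst p) i k * snd p k)) + c) \<partial>?N)"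
      by (simp add: yr)
    also have "\<dots> = (\<integral>\<omega>. exp (- (\<Sum>i<r. \<Sum>j<r. b i * b j * S \<omega> i j) / 2) * cos c \<partial>M)"
      by (rule mixture_cos[OF prob_space_axioms Lm Sm LL]) simp
    finally have eq: "(\<integral>p. cos ((\<Sum>i<r. b i * y p i) + c) \<partial>?N)
        = (\<integral>\<omega>. exp (- (\<Sum>i<r. \<Sum>j<r. b i * b j * \<sigma> (d i) (d j) \<omega>) / 2) * cos c \<partial>M)"
      by (simp only: S_def)
    show "(\<lambda>n. \<integral>\<omega>. cos ((\<Sum>i<r. b i * path_of (?E n \<omega>) (d i)) + c) \<partial>M)
        \<longlonglongrightarrow> (\<integral>p. cos ((\<Sum>i<r. b i * y p i) + c) \<partial>?N)"
      unfolding eq by (rule fidi)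
  qed
  obtain Z where Z: "Z \<in> ?N \<rightarrow>\<^sub>M borel" "tight_law (distr ?N borel Z)"
    "\<And>f. continuous_on UNIV f \<Longrightarrow> bounded (range f) \<Longrightarrow>
       (\<lambda>n. outer_expectation M (\<lambda>\<omega>. f (?E n \<omega>))) \<longlonglongrightarrow> (\<integral>\<omega>. f (Z \<omega>) \<partial>?N)"
    by (rule E.limit_exists) blast
  \<comment> \<open>The conclusion asks for a probability space on paths, so the random path is
    replaced by its law, with the identity as random element.\<close>
  define \<nu> where "\<nu> = distr ?N borel Z"
  have \<nu>: "prob_space \<nu>" unfolding \<nu>_def by (rule P.prob_space_distr[OF Z(1)])
  interpret V: prob_space \<nu> by (rule \<nu>)
  have s\<nu>: "sets \<nu> = sets borel" by (simp add: \<nu>_def)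
  have idm: "(\<lambda>x. x) \<in> \<nu> \<rightarrow>\<^sub>M borel" using s\<nu> by (simp cong: measurable_cong_sets)
  have id: "distr \<nu> borel (\<lambda>x. x) = \<nu>" by (rule distr_id2) (simp add: s\<nu>)
  have conv: "(\<lambda>n. outer_expectation M (\<lambda>\<omega>. f (?E n \<omega>))) \<longlonglongrightarrow> (\<integral>x. f x \<partial>\<nu>)"
    if f: "continuous_on UNIV f" "bounded (range f)" for f :: "cadlag0 \<Rightarrow> real"
  proof -
    have "(\<integral>x. f x \<partial>\<nu>) = (\<integral>p. f (Z p) \<partial>?N)"
      unfolding \<nu>_def by (rule integral_distr[OF Z(1) borel_measurable_continuous_onI[OF f(1)]])
    then show ?thesis using Z(3)[OF f] by simp
  qed
  \<comment> \<open>Here the times are arbitrary and need not belong to the dense sequence. Cosines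
    of coordinates at any times are bounded continuous functions of the path, so the convergence
    already proved determines these laws too.\<close>
  have law: "measure \<nu> {x. (\<lambda>i\<in>{..<r}. path_of x (t i)) \<in> A}
      = (\<integral>\<omega>. measure (centered_gaussian r (\<lambda>i j. \<sigma> (t i) (t j) \<omega>)) A \<partial>M)"
    if A: "A \<in> sets (\<Pi>\<^sub>M i\<in>{..<r}. borel)" for r and t :: "nat \<Rightarrow> real" and A
  proof -
    let ?B = "\<Pi>\<^sub>M i\<in>{..<r}. borel :: real measure"
    let ?\<pi> = "\<lambda>x. \<lambda>i\<in>{..<r}. path_of x (t i)"
    obtain \<mu> where \<mu>: "prob_space \<mu>" "sets \<mu> = sets ?B"
      "\<And>A. A \<in> sets ?B \<Longrightarrow> measure \<mu> A = (\<integral>\<omega>. measure (centered_gaussian r (\<lambda>i j. \<sigma> (t i) (t j) \<omega>)) A \<partial>M)"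
      "\<And>b c. (\<integral>x. cos ((\<Sum>i<r. b i * x i) + c) \<partial>\<mu>)
        = (\<integral>\<omega>. exp (- (\<Sum>i<r. \<Sum>j<r. b i * b j * \<sigma> (t i) (t j) \<omega>) / 2) * cos c \<partial>M)"
      by (rule gaussian_mixture[where S="\<lambda>\<omega> i j. \<sigma> (t i) (t j) \<omega>" and r=r, OF prob_space_axioms \<sigma> psd], erule (1) that) (assumption | simp only:)+
    have \<pi>: "?\<pi> \<in> \<nu> \<rightarrow>\<^sub>M ?B"
      by (intro measurable_restrict) (use measurable_eval s\<nu> in \<open>simp cong: measurable_cong_sets\<close>)
    have "distr \<nu> ?B ?\<pi> = \<mu>"
    proof (rule distr_eq_if_cos_eq[OF V.prob_space_distr[OF \<pi>] \<mu>(1) _ \<mu>(2)])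
      fix b c
      let ?f = "\<lambda>x. cos ((\<Sum>i<r. b i * path_of x (t i)) + c)"
      have fc: "continuous_on UNIV ?f"
        by (intro continuous_on_cos continuous_on_add continuous_on_sum continuous_on_mult continuous_on_const continuous_on_eval)
      have fb: "bounded (range ?f)" by (auto simp: bounded_iff intro!: exI[of _ 1])
      have "(\<integral>x. cos ((\<Sum>i<r. b i * x i) + c) \<partial>distr \<nu> ?B ?\<pi>) = (\<integral>x. cos ((\<Sum>i<r. b i * ?\<pi> x i) + c) \<partial>\<nu>)"
        by (rule integral_distr[OF \<pi>]) measurable
      also have "\<dots> = (\<integral>x. ?f x \<partial>\<nu>)" by simp
      also have "\<dots> = (\<integral>\<omega>. exp (- (\<Sum>i<r. \<Sum>j<r. b i * b j * \<sigma> (t i) (t j) \<omega>) / 2) * cos c \<partial>M)"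
      proof (rule LIMSEQ_unique[OF conv[OF fc fb]])
        have outer: "outer_expectation M (\<lambda>\<omega>. ?f (?E n \<omega>)) = (\<integral>\<omega>. ?f (?E n \<omega>) \<partial>M)" for n
        proof (rule outer_expectation_integrable[OF prob_space_axioms, where B=1])
          have "(\<lambda>\<omega>. (\<Sum>i<r. b i * path_of (?E n \<omega>) (t i)) + c) \<in> borel_measurable M"
            by (intro borel_measurable_add borel_measurable_sum borel_measurable_times borel_measurable_const path_measurable)
          then show "(\<lambda>\<omega>. ?f (?E n \<omega>)) \<in> borel_measurable M" by measurable
        qed simp
        show "(\<lambda>n. outer_expectation M (\<lambda>\<omega>. ?f (?E n \<omega>)))
            \<longlonglongrightarrow> (\<integral>\<omega>. exp (- (\<Sum>i<r. \<Sum>j<r. b i * b j * \<sigma> (t i) (t j) \<omega>) / 2) * cos c \<partial>M)"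
          unfolding outer by (rule fidi)
      qed
      finally show "(\<integral>x. cos ((\<Sum>i<r. b i * x i) + c) \<partial>distr \<nu> ?B ?\<pi>) = (\<integral>x. cos ((\<Sum>i<r. b i * x i) + c) \<partial>\<mu>)"
        by (simp only: \<mu>(4))
    qed simp
    moreover have "measure (distr \<nu> ?B ?\<pi>) A = measure \<nu> {x. ?\<pi> x \<in> A}"
    proof -
      have "space \<nu> = UNIV" by (simp add: \<nu>_def)
      then show ?thesis by (simp add: measure_distr[OF \<pi> A] vimage_def)
    qed
    ultimately show ?thesis using \<mu>(3)[OF A] by simp
  qed
  have tight: "tight_element \<nu> (\<lambda>x. x)"
    unfolding tight_element_def indistinguishable_def
    by (intro exI[of _ "\<lambda>x. x"]) (use idm id Z(2) in \<open>auto simp: \<nu>_def\<close>)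
  have "converges_in_dist M ?E \<nu> (\<lambda>x. x)"
    unfolding converges_in_dist_def indistinguishable_def
    by (intro exI[of _ "\<lambda>x. x"]) (use idm conv in auto)
  then show ?thesis using \<nu> idm tight law id by (intro exI[of _ \<nu>] exI[of _ "\<lambda>x. x"]) simp
qed

end

theorem theorem4p3:
  fixes M :: "'a measure" and G :: "nat \<Rightarrow> 'a measure" and X :: "nat \<Rightarrow> 'a \<Rightarrow> real"
    and \<kappa> :: "nat \<Rightarrow> 'a \<Rightarrow> real measure"
  assumes "prob_space M"
    and "filtration (space M) G" and "\<And>n. subalgebra M (G n)"
    and "cid M G X"
    and "\<And>n. regular_cond_distr M (G n) (X (n + 1)) (\<kappa> n)"
    and "\<And>t. (SUP n\<in>{1..}. \<integral>\<^sup>+ \<omega>. ennreal ((path_of (empirical_process X \<kappa> n \<omega>) t)\<^sup>2) \<partial>M) < \<infinity>"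
    and "\<And>\<epsilon> \<eta> :: real. \<epsilon> > 0 \<Longrightarrow> \<eta> > 0 \<Longrightarrow>
           \<exists>\<I>. finite \<I> \<and> partition_on UNIV \<I> \<and> (\<forall>I\<in>\<I>. right_open_interval I) \<and>
             limsup (\<lambda>n. emeasure M {\<omega> \<in> space M.
               (MAX I\<in>\<I>. SUP (s, t)\<in>I \<times> I.
                  \<bar>path_of (empirical_process X \<kappa> n \<omega>) s - path_of (empirical_process X \<kappa> n \<omega>) t\<bar>) > \<epsilon>})
             < ennreal \<eta>"
  shows "((\<forall>t. converges_in_prob_to_0 M (\<lambda>n \<omega>. 1 / real n * (\<Sum>k=1..n. (real k)\<^sup>2 *
              (cond_cdf M G X k t \<omega> - cond_cdf M G X (k - 1) t \<omega>)\<^sup>2))) \<longrightarrow>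
          (\<forall>\<alpha> (N :: 'b measure) W F.
             directing_measure M G X \<alpha> \<and> bridge_setting M \<alpha> N W F \<longrightarrow>
             converges_in_dist M (empirical_process X \<kappa>) N (bridge_process W F) \<and>
             tight_element N (bridge_process W F)))
       \<and> (\<forall>\<sigma> :: real \<Rightarrow> real \<Rightarrow> 'a \<Rightarrow> real.
            (\<forall>s t. \<sigma> s t \<in> borel_measurable M) \<and>
            (\<forall>s t. AE \<omega> in M. (\<lambda>n. 1 / real n * (\<Sum>k=1..n. q_incr M G X k s \<omega> * q_incr M G X k t \<omega>))
                                 \<longlonglongrightarrow> \<sigma> s t \<omega>) \<longrightarrow>
            (\<exists>(N :: cadlag0 measure) (Z :: cadlag0 \<Rightarrow> cadlag0).
               prob_space N \<and> Z \<in> N \<rightarrow>\<^sub>M borel \<and> tight_element N Z \<and>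
               (\<forall>(r :: nat) (t :: nat \<Rightarrow> real). \<forall>A\<in>sets (\<Pi>\<^sub>M i\<in>{..<r}. borel).
                  measure (distr N borel Z) {x. (\<lambda>i\<in>{..<r}. path_of x (t i)) \<in> A}
                    = (\<integral>\<omega>. measure (centered_gaussian r (\<lambda>i j. \<sigma> (t i) (t j) \<omega>)) A \<partial>M)) \<and>
               converges_in_dist M (empirical_process X \<kappa>) N Z))"
proof -
  interpret C: cid_limit M G X \<kappa> "from_nat_into \<rat>"
    by (intro cid_limit.intro cid_l2.intro cid_setting.intro cid_setting_axioms.intro cid_l2_axioms.intro
        cid_limit_axioms.intro rational_dense_seq assms)
  show ?thesis
  proof (intro conjI allI impI; (elim conjE)?)
    fix \<alpha> :: "'a \<Rightarrow> real measure" and N :: "'b measure" and W F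
    assume "\<forall>t. converges_in_prob_to_0 M (\<lambda>n \<omega>. 1 / real n * (\<Sum>k=1..n. (real k)\<^sup>2 *
              (cond_cdf M G X k t \<omega> - cond_cdf M G X (k - 1) t \<omega>)\<^sup>2))"
      and "directing_measure M G X \<alpha>" "bridge_setting M \<alpha> N W F"
    then have "converges_in_dist M (empirical_process X \<kappa>) N (bridge_process W F) \<and> tight_element N (bridge_process W F)"
      by (intro C.bridge_limit) blast+
    then show "converges_in_dist M (empirical_process X \<kappa>) N (bridge_process W F)"
      and "tight_element N (bridge_process W F)" by blast+
  qed (rule C.covariation_limit; blast)
qed

end
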